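(* Let $\mathbb K$ be an algebraically closed field of characteristic zero. Let $f\in R:=\mathbb K[x,y]$ be a squarefree, non-homogeneous (in the standard grading), weighted homogeneous polynomial of standard degree $d\geq 3$ with rational weights $a,b>0$, so that $f=axf_x+byf_y$. Let $F\in S:=R[z]$ be the homogenization of $f$ with respect to a new variable $z$, and let $J_F=\langle F_x,F_y,F_z\rangle\subset S$. Then: (1) If $a\neq\frac{1}{d}$ and $b\neq\frac{1}{d}$, then $J_F$ is perfect of linear type with graded minimal free resolution $$0\rightarrow S(-(2d-3))\oplus S(-d)\rightarrow S(-(d-1))^3\rightarrow J_F\rightarrow 0.$$ (2) If $a=\frac{1}{d}$ or $b=\frac{1}{d}$, then $J_F$ is an ideal of linear type, but it is not perfect. In this case, $J_F$ has a graded minimal free resolution $$0\rightarrow S(-(2d-1))\rightarrow S(-d)\oplus S(-2(d-1))^2\rightarrow S(-(d-1))^3\rightarrow J_F\rightarrow 0.$$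
   Context: A polynomial $f\in\mathbb K[x_1,\ldots,x_n]$ is weighted homogeneous with rational weights $a_1,\dots,a_n$ ($0<a_i\le\frac12$) if $f(s^{a_1}x_1,\ldots,s^{a_n}x_n)=s\,f(x_1,\ldots,x_n)$; equivalently $f=\sum_i a_ix_if_{x_i}$. The homogenization of $f$ of degree $d$ with respect to $z$ is $F=z^d f(x/z,y/z)$. Subscripts denote partial derivatives. A homogeneous ideal $J$ in a polynomial ring $S$ is perfect if $S/J$ is Cohen–Macaulay. An ideal is of linear type if the canonical surjection from its symmetric algebra to its Rees algebra is an isomorphism. *)

theory Defs
  imports
    "HOL-Library.Poly_Mapping"
    "HOL-Library.Extended_Nat"
    "HOL-Computational_Algebra.Squarefree"
    "HOL-Algebra.Ring_Divisibility"
    "HOL-Algebra.Ideal_Product"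
    "Jordan_Normal_Form.Matrix_Kernel"
begin

hide_const (open) UnivPoly.monom UnivPoly.coeff Poly_Mapping.degree

section \<open>The polynomial rings\<close>

text \<open>
  The ring \<open>R = K[x,y]\<close> is \<open>K[x][y]\<close>, the type \<open>'k poly poly\<close>, and \<open>S = R[z]\<close> is the type
  \<open>'k poly poly poly\<close>: the innermost variable is \<open>x\<close>, the outermost one is the last one adjoined.
\<close>

definition coeff2 :: "'k::zero poly poly \<Rightarrow> nat \<Rightarrow> nat \<Rightarrow> 'k" where
  "coeff2 f i j = coeff (coeff f j) i"

definition coeff3 :: "'k::zero poly poly poly \<Rightarrow> nat \<Rightarrow> nat \<Rightarrow> nat \<Rightarrow> 'k" where
  "coeff3 g i j k = coeff (coeff (coeff g k) j) i"

definition X2 :: "'k::comm_ring_1 poly poly" where "X2 = [:[:0, 1:]:]"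
definition Y2 :: "'k::comm_ring_1 poly poly" where "Y2 = [:0, 1:]"

definition X3 :: "'k::comm_ring_1 poly poly poly" where "X3 = [:[:[:0, 1:]:]:]"
definition Y3 :: "'k::comm_ring_1 poly poly poly" where "Y3 = [:[:0, 1:]:]"
definition Z3 :: "'k::comm_ring_1 poly poly poly" where "Z3 = [:0, 1:]"

definition total_degree :: "'k::zero poly poly \<Rightarrow> nat" where
  "total_degree f = Max (insert 0 {i + j | i j. coeff2 f i j \<noteq> 0})"

text \<open>
  Degrees are integers, so that for negative \<open>n\<close> only \<open>0\<close> is homogeneous of degree \<open>n\<close>.
\<close>

definition homogeneous2 :: "int \<Rightarrow> 'k::zero poly poly \<Rightarrow> bool" where
  "homogeneous2 n f \<longleftrightarrow> (\<forall>i j. coeff2 f i j \<noteq> 0 \<longrightarrow> int (i + j) = n)"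

definition homogeneous3 :: "int \<Rightarrow> 'k::zero poly poly poly \<Rightarrow> bool" where
  "homogeneous3 n g \<longleftrightarrow> (\<forall>i j k. coeff3 g i j k \<noteq> 0 \<longrightarrow> int (i + j + k) = n)"

text \<open>\<open>z^d f(x/z, y/z)\<close>, for \<open>d\<close> at least the total degree of \<open>f\<close>.\<close>

definition homogenization :: "nat \<Rightarrow> 'k::comm_ring_1 poly poly \<Rightarrow> 'k poly poly poly" where
  "homogenization d f =
     (\<Sum>j\<le>degree f. \<Sum>i\<le>degree (coeff f j).
        [:[:[:coeff2 f i j:]:]:] * X3 ^ i * Y3 ^ j * Z3 ^ (d - i - j))"

definition jacobian_ideal :: "'k::field poly poly poly \<Rightarrow> 'k poly poly poly set" where
  "jacobian_ideal F =
     Idl\<^bsub>class_ring\<^esub> {map_poly (map_poly pderiv) F, map_poly pderiv F, pderiv F}"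


section \<open>Weighted homogeneous polynomials\<close>

text \<open>
  The identity \<open>f(s^a x, s^b y) = s f(x, y)\<close> contains rational powers of the formal parameter \<open>s\<close>.
  It is read in the algebra over \<open>K[x,y]\<close> of finite formal sums of rational powers of \<open>s\<close>, which
  is the type \<open>rat \<Rightarrow>\<^sub>0 'k poly poly\<close>; the term \<open>Poly_Mapping.single q c\<close> is \<open>c s^q\<close>.
\<close>

definition weighted_homogeneous :: "rat \<Rightarrow> rat \<Rightarrow> 'k::field poly poly \<Rightarrow> bool" where
  "weighted_homogeneous a b f \<longleftrightarrow>
     (\<Sum>j\<le>degree f. \<Sum>i\<le>degree (coeff f j).
        Poly_Mapping.single 0 [:[:coeff2 f i j:]:]
          * Poly_Mapping.single a X2 ^ i * Poly_Mapping.single b Y2 ^ j)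
     = Poly_Mapping.single 1 1 * Poly_Mapping.single 0 f"

lemma coeff2_sum:
  "coeff2 (sum g A) i j = (\<Sum>x\<in>A. coeff2 (g x) i j)"
  by (simp add: coeff2_def coeff_sum)

lemma monom_term:
  "[:[:c:]:] * X2 ^ i * Y2 ^ j = Polynomial.monom (Polynomial.monom (c::'k::field) i) j"
proof -
  have x: "[:0, 1::'k:] ^ i = Polynomial.monom 1 i" by (simp add: monom_altdef)
  have "(X2 :: 'k poly poly) ^ i = [:[:0, 1:] ^ i:]" by (induction i) (simp_all add: X2_def one_pCons)
  moreover have "(Y2 :: 'k poly poly) ^ j = Polynomial.monom 1 j" by (simp add: Y2_def monom_altdef)
  ultimately show ?thesis by (simp add: x smult_monom)
qed

lemma coeff2_monom:
  "coeff2 (Polynomial.monom (Polynomial.monom (c::'k::field) i) j) i' j' = (if i = i' \<and> j = j' then c else 0)"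
  by (auto simp: coeff2_def)

lemma poly2_eq_iff: "f = g \<longleftrightarrow> (\<forall>i j. coeff2 f i j = coeff2 g i j)"
  by (auto simp: coeff2_def poly_eq_iff)

lemma single_power: "Poly_Mapping.single (a::rat) (c::'b::comm_ring_1) ^ n = Poly_Mapping.single (of_nat n * a) (c ^ n)"
  by (induction n) (simp_all add: mult_single algebra_simps)

lemma lookup_wh:
  "coeff2 (Poly_Mapping.lookup (\<Sum>j\<le>degree f. \<Sum>i\<le>degree (coeff f j).
        Poly_Mapping.single 0 [:[:coeff2 f i j:]:]
          * Poly_Mapping.single a X2 ^ i * Poly_Mapping.single b Y2 ^ j) q) i' j'
   = (if of_nat i' * (a::rat) + of_nat j' * b = q then coeff2 (f::'k::field poly poly) i' j' else 0)" (is "?L = ?R")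
proof -
  have t: "coeff2 (Poly_Mapping.lookup (Poly_Mapping.single 0 [:[:coeff2 f i j:]:]
          * Poly_Mapping.single a X2 ^ i * Poly_Mapping.single b Y2 ^ j) q) i' j'
     = (if i = i' then if j = j' then ?R else 0 else 0)" for i j
  proof -
    have "Poly_Mapping.single 0 [:[:coeff2 f i j:]:] * Poly_Mapping.single a X2 ^ i * Poly_Mapping.single b Y2 ^ j
      = Poly_Mapping.single (of_nat i * a + of_nat j * b) ([:[:coeff2 f i j:]:] * X2 ^ i * Y2 ^ j)"
      unfolding single_power mult_single by simp
    then show ?thesis
      unfolding monom_term by (auto simp: lookup_single when_def coeff2_monom coeff2_def)
  qed
  have "?L = (\<Sum>j\<le>degree f. \<Sum>i\<le>degree (coeff f j). (if i = i' then if j = j' then ?R else 0 else 0))"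
    by (simp add: lookup_sum coeff2_sum t)
  also have "\<dots> = (\<Sum>j\<le>degree f. if j = j' then (if i' \<le> degree (coeff f j') then ?R else 0) else 0)"
    by (intro sum.cong refl) (auto simp: sum.delta)
  also have "\<dots> = (if j' \<le> degree f \<and> i' \<le> degree (coeff f j') then ?R else 0)"
    by (auto simp: sum.delta)
  also have "\<dots> = ?R"
    by (auto simp: coeff2_def coeff_eq_0 not_le)
  finally show ?thesis .
qed

lemma weighted_homogeneous_iff_support:
  fixes f :: "'k::field poly poly"
  shows "weighted_homogeneous a b f \<longleftrightarrow>
    (\<forall>i j. coeff2 f i j \<noteq> 0 \<longrightarrow> of_nat i * a + of_nat j * b = 1)"
proof -
  have r: "Poly_Mapping.single 1 1 * Poly_Mapping.single 0 f = Poly_Mapping.single (1::rat) f"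
    by (simp add: mult_single)
  have l: "coeff2 (Poly_Mapping.lookup (Poly_Mapping.single (1::rat) f) q) i j
      = (if q = 1 then coeff2 f i j else 0)" for q i j
    by (auto simp: lookup_single when_def coeff2_def)
  have "weighted_homogeneous a b f \<longleftrightarrow> (\<forall>q i j.
      (if of_nat i * a + of_nat j * b = q then coeff2 f i j else 0) = (if q = 1 then coeff2 f i j else 0))"
    unfolding weighted_homogeneous_def r poly_mapping_eq_iff fun_eq_iff poly2_eq_iff lookup_wh l ..
  also have "\<dots> \<longleftrightarrow> (\<forall>i j. coeff2 f i j \<noteq> 0 \<longrightarrow> of_nat i * a + of_nat j * b = 1)"
    by (auto split: if_splits)
  finally show ?thesis .
qed

lemma weighted_homogeneous_iff_euler:
  fixes f :: "'k::field_char_0 poly poly"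
  shows "weighted_homogeneous a b f \<longleftrightarrow>
    f = [:[:of_rat a:]:] * X2 * map_poly pderiv f + [:[:of_rat b:]:] * Y2 * pderiv f"
proof -
  have x: "coeff2 ([:[:of_rat a:]:] * X2 * map_poly pderiv f) i j = of_rat (of_nat i * a) * coeff2 f i j" for i j
    by (cases i) (simp_all add: X2_def coeff2_def coeff_map_poly coeff_pderiv of_rat_mult of_rat_add)
  have y: "coeff2 ([:[:of_rat b:]:] * Y2 * pderiv f) i j = of_rat (of_nat j * b) * coeff2 f i j" for i j
  proof -
    have "coeff (of_nat n * p) i = of_nat n * coeff p i" for n and p :: "'k poly"
      by (simp add: of_nat_poly)
    from this[of "Suc n" for n] show ?thesis
      by (cases j) (simp_all add: Y2_def coeff2_def coeff_pderiv of_rat_mult of_rat_add)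
  qed
  have c: "coeff2 (g + h) i j = coeff2 g i j + coeff2 h i j" for g h :: "'k poly poly" and i j
    by (simp add: coeff2_def)
  have "f = [:[:of_rat a:]:] * X2 * map_poly pderiv f + [:[:of_rat b:]:] * Y2 * pderiv f
     \<longleftrightarrow> (\<forall>i j. coeff2 f i j = of_rat (of_nat i * a + of_nat j * b) * coeff2 f i j)"
    unfolding poly2_eq_iff c x y by (simp only: of_rat_add distrib_right)
  also have "\<dots> \<longleftrightarrow> weighted_homogeneous a b f"
    unfolding weighted_homogeneous_iff_support by (auto simp: of_rat_eq_1_iff)
  finally show ?thesis by simp
qed


section \<open>Cohen--Macaulay rings\<close>

text \<open>
  The localization of \<open>R\<close> at a multiplicative subset \<open>M\<close>: the fractions \<open>r / s\<close> with \<open>s \<in> M\<close> are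
  classes of pairs \<open>(r, s)\<close>.
\<close>

definition loc_rel :: "('a, 'm) ring_scheme \<Rightarrow> 'a set \<Rightarrow> (('a \<times> 'a) \<times> ('a \<times> 'a)) set" where
  "loc_rel R M = {((r, s), (r', s')). r \<in> carrier R \<and> r' \<in> carrier R \<and> s \<in> M \<and> s' \<in> M \<and>
     (\<exists>u\<in>M. u \<otimes>\<^bsub>R\<^esub> (r \<otimes>\<^bsub>R\<^esub> s' \<ominus>\<^bsub>R\<^esub> r' \<otimes>\<^bsub>R\<^esub> s) = \<zero>\<^bsub>R\<^esub>)}"

definition localization :: "('a, 'm) ring_scheme \<Rightarrow> 'a set \<Rightarrow> ('a \<times> 'a) set ring" where
  "localization R M =
     \<lparr>carrier = (carrier R \<times> M) // loc_rel R M,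
      mult = (\<lambda>A B. \<Union>(r, s)\<in>A. \<Union>(r', s')\<in>B.
                loc_rel R M `` {(r \<otimes>\<^bsub>R\<^esub> r', s \<otimes>\<^bsub>R\<^esub> s')}),
      one = loc_rel R M `` {(\<one>\<^bsub>R\<^esub>, \<one>\<^bsub>R\<^esub>)},
      zero = loc_rel R M `` {(\<zero>\<^bsub>R\<^esub>, \<one>\<^bsub>R\<^esub>)},
      add = (\<lambda>A B. \<Union>(r, s)\<in>A. \<Union>(r', s')\<in>B.
                loc_rel R M `` {(r \<otimes>\<^bsub>R\<^esub> s' \<oplus>\<^bsub>R\<^esub> r' \<otimes>\<^bsub>R\<^esub> s, s \<otimes>\<^bsub>R\<^esub> s')})\<rparr>"

definition krull_dim :: "('a, 'm) ring_scheme \<Rightarrow> enat" where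
  "krull_dim R = Sup {enat n | n. \<exists>P :: nat \<Rightarrow> 'a set.
     (\<forall>i\<le>n. primeideal (P i) R) \<and> (\<forall>i<n. P i \<subset> P (Suc i))}"

definition regular_sequence :: "('a, 'm) ring_scheme \<Rightarrow> 'a list \<Rightarrow> bool" where
  "regular_sequence R xs \<longleftrightarrow>
     set xs \<subseteq> carrier R \<and>
     (\<forall>i<length xs. \<forall>r\<in>carrier R.
        xs ! i \<otimes>\<^bsub>R\<^esub> r \<in> Idl\<^bsub>R\<^esub> (set (take i xs)) \<longrightarrow> r \<in> Idl\<^bsub>R\<^esub> (set (take i xs))) \<and>
     Idl\<^bsub>R\<^esub> (set xs) \<noteq> carrier R"

text \<open>For a local ring, whose maximal ideal consists of the non-units.\<close>

definition local_depth :: "('a, 'm) ring_scheme \<Rightarrow> enat" where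
  "local_depth R = Sup {enat (length xs) | xs.
     set xs \<subseteq> carrier R - Units R \<and> regular_sequence R xs}"

definition cohen_macaulay :: "('a, 'm) ring_scheme \<Rightarrow> bool" where
  "cohen_macaulay R \<longleftrightarrow> cring R \<and> noetherian_ring R \<and>
     (\<forall>m. maximalideal m R \<longrightarrow>
        local_depth (localization R (carrier R - m)) = krull_dim (localization R (carrier R - m)))"

definition perfect_ideal :: "'s::comm_ring_1 set \<Rightarrow> bool" where
  "perfect_ideal J \<longleftrightarrow> cohen_macaulay (class_ring Quot J)"


section \<open>Ideals of linear type\<close>

text \<open>
  The symmetric algebra of the module \<open>J\<close> is the commutative polynomial algebra over the base ring
  with one variable for each element of \<open>J\<close>, modulo the relations that make the map from \<open>J\<close> to
  the variables linear. Polynomials in variables indexed by elements of \<open>'s\<close> form the type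
  \<open>('s \<Rightarrow>\<^sub>0 nat) \<Rightarrow>\<^sub>0 's\<close>.
\<close>

definition gvar :: "'s \<Rightarrow> ('s \<Rightarrow>\<^sub>0 nat) \<Rightarrow>\<^sub>0 's::comm_ring_1" where
  "gvar g = Poly_Mapping.single (Poly_Mapping.single g 1) 1"

definition free_algebra :: "'s::comm_ring_1 set \<Rightarrow> (('s \<Rightarrow>\<^sub>0 nat) \<Rightarrow>\<^sub>0 's) ring" where
  "free_algebra J = class_ring\<lparr>carrier := {p. \<forall>m\<in>Poly_Mapping.keys p. Poly_Mapping.keys m \<subseteq> J}\<rparr>"

definition sym_relations :: "'s::comm_ring_1 set \<Rightarrow> (('s \<Rightarrow>\<^sub>0 nat) \<Rightarrow>\<^sub>0 's) set" where
  "sym_relations J =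
     {gvar (g + h) - gvar g - gvar h | g h. g \<in> J \<and> h \<in> J} \<union>
     {gvar (c * g) - Poly_Mapping.single 0 c * gvar g | c g. g \<in> J}"

definition sym_algebra :: "'s::comm_ring_1 set \<Rightarrow> (('s \<Rightarrow>\<^sub>0 nat) \<Rightarrow>\<^sub>0 's) set ring" where
  "sym_algebra J = free_algebra J Quot (Idl\<^bsub>free_algebra J\<^esub> (sym_relations J))"

text \<open>The Rees algebra is the subring of the polynomials \<open>\<Sum>i. c\<^sub>i t^i\<close> with \<open>c\<^sub>i \<in> J^i\<close>.\<close>

definition rees_algebra :: "'s::comm_ring_1 set \<Rightarrow> 's poly ring" where
  "rees_algebra J =
     class_ring\<lparr>carrier := {p. \<forall>i. coeff p i \<in> J [^]\<^bsub>ideals_set class_ring\<^esub> i}\<rparr>"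

text \<open>The algebra homomorphism that sends the variable of \<open>g \<in> J\<close> to \<open>g t\<close>.\<close>

definition rees_eval :: "(('s \<Rightarrow>\<^sub>0 nat) \<Rightarrow>\<^sub>0 's::comm_ring_1) \<Rightarrow> 's poly" where
  "rees_eval p = (\<Sum>m\<in>Poly_Mapping.keys p. Polynomial.smult (Poly_Mapping.lookup p m)
     (\<Prod>g\<in>Poly_Mapping.keys m. Polynomial.monom g 1 ^ Poly_Mapping.lookup m g))"

definition sym_to_rees :: "(('s \<Rightarrow>\<^sub>0 nat) \<Rightarrow>\<^sub>0 's::comm_ring_1) set \<Rightarrow> 's poly" where
  "sym_to_rees C = the_elem (rees_eval ` C)"

definition linear_type :: "'s::comm_ring_1 set \<Rightarrow> bool" where
  "linear_type J \<longleftrightarrow> sym_to_rees \<in> ring_iso (sym_algebra J) (rees_algebra J)"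


section \<open>Graded minimal free resolutions\<close>

text \<open>
  A list \<open>es = [e\<^sub>1, \<dots>, e\<^sub>n]\<close> of integers stands for the graded free module
  \<open>S(-e\<^sub>1) \<oplus> \<dots> \<oplus> S(-e\<^sub>n)\<close>, whose \<open>i\<close>-th basis vector has degree \<open>e\<^sub>i\<close>. A homogeneous linear map of
  degree \<open>0\<close> from the module of \<open>us\<close> to that of \<open>vs\<close> is given by a matrix acting on column vectors.
\<close>

definition graded_map ::
    "int list \<Rightarrow> int list \<Rightarrow> 'k::comm_ring_1 poly poly poly mat \<Rightarrow> bool" where
  "graded_map us vs A \<longleftrightarrow> A \<in> carrier_mat (length vs) (length us) \<and>
     (\<forall>i<length vs. \<forall>j<length us. homogeneous3 (us ! j - vs ! i) (A $$ (i, j)))"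

definition mat_image :: "'s::comm_ring_1 mat \<Rightarrow> 's vec set" where
  "mat_image A = {A *\<^sub>v v | v. v \<in> carrier_vec (dim_col A)}"

definition irrelevant_ideal :: "'k::comm_ring_1 poly poly poly set" where
  "irrelevant_ideal = Idl\<^bsub>class_ring\<^esub> {X3, Y3, Z3}"

text \<open>
  \<open>min_graded_free_resolution J [es\<^sub>0, \<dots>, es\<^sub>n]\<close>: there is a graded minimal free resolution
  \<open>0 \<rightarrow> F\<^sub>n \<rightarrow> \<dots> \<rightarrow> F\<^sub>0 \<rightarrow> J \<rightarrow> 0\<close> where \<open>F\<^sub>i\<close> is the free module of \<open>es\<^sub>i\<close>.
  The matrix \<open>A 0\<close> has one row and is the augmentation \<open>F\<^sub>0 \<rightarrow> J \<subseteq> S\<close>; for \<open>i \<ge> 1\<close>, \<open>A i\<close> is the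
  map \<open>F\<^sub>i \<rightarrow> F\<^sub>i\<^sub>-\<^sub>1\<close>. The modules \<open>F\<^sub>i\<close> with \<open>i > n\<close> are \<open>0\<close>, so that exactness at
  \<open>F\<^sub>n\<close> is injectivity of \<open>A n\<close>. Minimality says that the image of each \<open>A i\<close> with \<open>i \<ge> 1\<close> lies in
  \<open>\<mm> F\<^sub>i\<^sub>-\<^sub>1\<close>, where \<open>\<mm> = \<langle>x, y, z\<rangle>\<close>.
\<close>

definition min_graded_free_resolution ::
    "'k::comm_ring_1 poly poly poly set \<Rightarrow> int list list \<Rightarrow> bool" where
  "min_graded_free_resolution J es \<longleftrightarrow>
     (let F = (\<lambda>i. if i < length es then es ! i else []) in
      \<exists>A :: nat \<Rightarrow> 'k poly poly poly mat.
        graded_map (F 0) [0] (A 0) \<and>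
        (\<lambda>v. v $ 0) ` mat_image (A 0) = J \<and>
        (\<forall>i. graded_map (F (Suc i)) (F i) (A (Suc i)) \<and>
             mat_kernel (A i) = mat_image (A (Suc i)) \<and>
             elements_mat (A (Suc i)) \<subseteq> irrelevant_ideal))"

end

theory Submission imports Defs "Jordan_Normal_Form.Char_Poly" begin

text \<open>
  Exchange the variables if necessary so that \<open>x\<close> has the larger weight. The support of \<open>f\<close> lies on
  a line, so \<open>f = x^\<epsilon> y^\<delta> \<Sum>k\<le>m. c\<^sub>k x^(p k) y^(q (m - k))\<close> with \<open>0 < p < q\<close>. As \<open>f\<close> is squarefree,
  \<open>\<epsilon>\<close> and \<open>\<delta>\<close> are at most \<open>1\<close> and the polynomial \<open>\<Sum>k\<le>m. c\<^sub>k t^k\<close> has simple nonzero roots, from which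
  every prime ideal containing \<open>J\<^sub>F\<close> contains \<open>y\<close> and one of \<open>x\<close>, \<open>z\<close>.

  Neither weight is \<open>1/d\<close> exactly if \<open>\<epsilon> = 1\<close>. Then \<open>F\<^sub>y = x P\<close> and \<open>F\<^sub>z = x Q\<close> up to constants, and the
  relation between \<open>F\<^sub>x\<close>, \<open>F\<^sub>y\<close>, \<open>F\<^sub>z\<close> given by the weights turns \<open>F\<^sub>x\<close> into \<open>y P + z Q\<close>. So \<open>J\<^sub>F\<close> is generated
  by the minors of a matrix with two columns, which form its Hilbert--Burch resolution, and
  \<open>x + z - c\<close> is regular modulo \<open>J\<^sub>F\<close> for all \<open>c\<close>.

  If \<open>\<epsilon> = 0\<close>, then \<open>J\<^sub>F\<close> is generated by \<open>x G\<close>, \<open>z G\<close> and \<open>H\<close> for a regular sequence \<open>G\<close>, \<open>H\<close>. The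
  ideal \<open>\<langle>x, y, z\<rangle>\<close> is the annihilator of \<open>y^(d - 2) G\<close> modulo \<open>J\<^sub>F\<close>, so the quotient has depth \<open>0\<close> there,
  but its dimension is positive since \<open>J\<^sub>F\<close> vanishes on a coordinate axis.

  In both cases \<open>J\<^sub>F\<close> contains a power of \<open>y\<close> and \<open>y\<close> is regular modulo the ideal of the linear relations
  of the generators. Since the Rees map becomes injective when \<open>y\<close> is inverted, \<open>J\<^sub>F\<close> is of linear type.
\<close>

section \<open>Prime ideals and regular sequences\<close>

text \<open>Let a > b be the weights of x and y. From F = a x F_x + b y F_y and d F = x F_x + y F_y
  + z F_z, eliminating F leaves z F_z = (d a - 1) x F_x + (d b - 1) y F_y, and this relation decides
  the shape of the ideal. If b = 1/d, the y term disappears, so that F_x and F_z are constant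
  multiples of z G and x G for a common G. Otherwise all three coefficients are nonzero and x
  divides F_y and F_z, so that dividing by x expresses F_x through the other two.

  All regularity statements rest on one pair. The knowledge about primes puts y^K and (x z)^K into
  J_F, or into the ideal of G and H in the second case, and these two powers form a regular sequence
  in S. In the perfect case the pair stays regular modulo x + z - c. Syzygies are therefore found by
  dividing out y^K, and regularity of an element modulo an ideal follows by lifting syzygies from
  the quotient of the ring by that single element.\<close>

lemma class_ideal_iff:
  fixes I :: "'a::comm_ring_1 set"
  shows "ideal I class_ring \<longleftrightarrow> 0 \<in> I \<and> (\<forall>a\<in>I. \<forall>b\<in>I. a + b \<in> I) \<and> (\<forall>a\<in>I. \<forall>r. r * a \<in> I)"
proof
  assume "ideal I class_ring"
  note I = this
  have "0 \<in> I" using additive_subgroup.zero_closed[OF ideal.axioms(1)[OF I]] by (simp only: ring.simps)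
  moreover have "a + b \<in> I" if "a \<in> I" "b \<in> I" for a b
    using additive_subgroup.a_closed[OF ideal.axioms(1)[OF I] that] by (simp only: ring.simps)
  moreover have "r * a \<in> I" if "a \<in> I" for a r
    using ideal.I_l_closed[OF I that, of r] by (simp only: monoid.simps partial_object.simps UNIV_I)
  ultimately show "0 \<in> I \<and> (\<forall>a\<in>I. \<forall>b\<in>I. a + b \<in> I) \<and> (\<forall>a\<in>I. \<forall>r. r * a \<in> I)" by fast
next
  assume *: "0 \<in> I \<and> (\<forall>a\<in>I. \<forall>b\<in>I. a + b \<in> I) \<and> (\<forall>a\<in>I. \<forall>r. r * a \<in> I)"
  have neg: "- a \<in> I" if "a \<in> I" for a
    using *[THEN conjunct2, THEN conjunct2, rule_format, OF that, of "-1"] by simp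
  show "ideal I class_ring"
  proof (rule idealI)
    show "ring (class_ring :: 'a ring)" by (rule class_ring.ring_axioms)
    show "subgroup I (add_monoid class_ring)"
    proof (rule group.subgroupI)
      show "group (add_monoid (class_ring :: 'a ring))" by (rule abelian_group.a_group) (rule class_ring.is_abelian_group)
      show "inv\<^bsub>add_monoid class_ring\<^esub> a \<in> I" if "a \<in> I" for a
        using neg[OF that] unfolding a_inv_def[symmetric] by (simp add: class_ring_simps)
    qed (use * in auto)
  qed (use * in \<open>auto simp: mult.commute\<close>)
qed

lemma class_prime_iff:
  fixes Q :: "'a::comm_ring_1 set"
  shows "primeideal Q class_ring \<longleftrightarrow>
    ideal Q class_ring \<and> 1 \<notin> Q \<and> (\<forall>a b. a * b \<in> Q \<longrightarrow> a \<in> Q \<or> b \<in> Q)"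
proof
  assume "primeideal Q class_ring"
  note Q = this
  have "ideal Q class_ring" by (rule primeideal.axioms(1)[OF Q])
  moreover have "1 \<notin> Q"
    using primeideal.I_notcarr[OF Q] ideal.one_imp_carrier[OF calculation]
    by (metis monoid.simps(2) partial_object.simps(1))
  moreover have "a \<in> Q \<or> b \<in> Q" if "a * b \<in> Q" for a b
    using primeideal.I_prime[OF Q, of a b] that by (simp only: monoid.simps partial_object.simps UNIV_I)
  ultimately show "ideal Q class_ring \<and> 1 \<notin> Q \<and> (\<forall>a b. a * b \<in> Q \<longrightarrow> a \<in> Q \<or> b \<in> Q)" by fast
next
  assume *: "ideal Q class_ring \<and> 1 \<notin> Q \<and> (\<forall>a b. a * b \<in> Q \<longrightarrow> a \<in> Q \<or> b \<in> Q)"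
  show "primeideal Q class_ring"
    by (rule primeidealI) (use * class_cring.is_cring in auto)
qed

lemma class_ideal_minus:
  fixes I :: "'a::comm_ring_1 set"
  assumes "ideal I class_ring" "a \<in> I" "b \<in> I"
  shows "a - b \<in> I"
proof -
  have "a + (-1) * b \<in> I" using assms unfolding class_ideal_iff by blast
  then show ?thesis by simp
qed

lemma class_Idl_triple:
  fixes a b c :: "'a::comm_ring_1"
  shows "Idl\<^bsub>class_ring\<^esub> {a, b, c} = {u * a + v * b + w * c | u v w. True}" (is "_ = ?I")
proof
  have "ideal ?I class_ring"
    unfolding class_ideal_iff
  proof (intro conjI ballI allI)
    show "0 \<in> ?I" by (rule CollectI, rule exI[of _ 0], rule exI[of _ 0], rule exI[of _ 0]) simp
    fix s t assume "s \<in> ?I"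
    then obtain u v w where s: "s = u * a + v * b + w * c" by auto
    { fix r show "r * s \<in> ?I" by (rule CollectI, rule exI[of _ "r*u"], rule exI[of _ "r*v"], rule exI[of _ "r*w"])
        (simp add: s algebra_simps) }
    assume "t \<in> ?I"
    then obtain u' v' w' where t: "t = u' * a + v' * b + w' * c" by auto
    show "s + t \<in> ?I" by (rule CollectI, rule exI[of _ "u+u'"], rule exI[of _ "v+v'"], rule exI[of _ "w+w'"])
        (simp add: s t algebra_simps)
  qed
  moreover have "\<exists>u v w. a = u * a + v * b + w * c" by (rule exI[of _ 1], rule exI[of _ 0], rule exI[of _ 0]) simp
  moreover have "\<exists>u v w. b = u * a + v * b + w * c" by (rule exI[of _ 0], rule exI[of _ 1], rule exI[of _ 0]) simp
  moreover have "\<exists>u v w. c = u * a + v * b + w * c" by (rule exI[of _ 0], rule exI[of _ 0], rule exI[of _ 1]) simp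
  ultimately show "Idl\<^bsub>class_ring\<^esub> {a, b, c} \<subseteq> ?I"
    by (intro ring.genideal_minimal[OF class_ring.ring_axioms]) auto
next
  have "ideal (Idl\<^bsub>class_ring\<^esub> {a, b, c}) class_ring" by (rule ring.genideal_ideal[OF class_ring.ring_axioms]) simp
  moreover have "{a, b, c} \<subseteq> Idl\<^bsub>class_ring\<^esub> {a, b, c}" by (rule ring.genideal_self[OF class_ring.ring_axioms]) simp
  ultimately show "?I \<subseteq> Idl\<^bsub>class_ring\<^esub> {a, b, c}" unfolding class_ideal_iff by blast
qed

lemma (in cring) add_PIdl:
  assumes Q: "ideal Q R" and a: "a \<in> carrier R"
  shows "ideal (Q <+> PIdl a) R" and "Q \<subseteq> Q <+> PIdl a" and "a \<in> Q <+> PIdl a"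
    and "t \<in> Q <+> PIdl a \<Longrightarrow> \<exists>q\<in>Q. \<exists>r\<in>carrier R. t = q \<oplus> r \<otimes> a"
proof -
  show "ideal (Q <+> PIdl a) R" by (rule add_ideals[OF Q cgenideal_ideal[OF a]])
  have sub: "Q \<subseteq> carrier R" using ideal.Icarr[OF Q] by blast
  have z: "\<zero> \<in> Q" "\<zero> \<in> PIdl a"
    using Q cgenideal_ideal[OF a] by (simp_all add: additive_subgroup.zero_closed ideal.axioms(1))
  have mem: "t \<in> Q <+> PIdl a \<longleftrightarrow> (\<exists>q\<in>Q. \<exists>p\<in>PIdl a. t = q \<oplus> p)" for t
    unfolding set_add_def' by blast
  show "Q \<subseteq> Q <+> PIdl a"
  proof
    fix q assume "q \<in> Q"
    then show "q \<in> Q <+> PIdl a" unfolding mem using sub z by (intro bexI[of _ q] bexI[of _ \<zero>]) auto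
  qed
  show "a \<in> Q <+> PIdl a"
    unfolding mem using z a cgenideal_self[OF a] by (intro bexI[of _ \<zero>] bexI[of _ a]) auto
  show "t \<in> Q <+> PIdl a \<Longrightarrow> \<exists>q\<in>Q. \<exists>r\<in>carrier R. t = q \<oplus> r \<otimes> a"
    unfolding mem unfolding cgenideal_def by blast
qed

text \<open>Krull's argument: an ideal Q maximal among those that contain I and miss T is prime. If
  a and b lie outside Q, then Q + (a) and Q + (b) both meet T; multiplying the two elements found
  gives an element of T, which would lie in Q if a b did.\<close>

lemma (in cring) prime_ideal_avoiding:
  assumes I: "ideal I R" and T: "T \<subseteq> carrier R" "\<one> \<in> T"
    and mult: "\<And>s t. s \<in> T \<Longrightarrow> t \<in> T \<Longrightarrow> s \<otimes> t \<in> T" and disj: "I \<inter> T = {}"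
  obtains Q where "primeideal Q R" "I \<subseteq> Q" "Q \<inter> T = {}"
proof -
  define \<A> where "\<A> = {K. ideal K R \<and> I \<subseteq> K \<and> K \<inter> T = {}}"
  have "\<exists>M\<in>\<A>. \<forall>X\<in>\<A>. M \<subseteq> X \<longrightarrow> X = M"
  proof (rule subset_Zorn_nonempty)
    show "\<A> \<noteq> {}" using I disj unfolding \<A>_def by blast
    fix \<C> assume \<C>: "\<C> \<noteq> {}" "subset.chain \<A> \<C>"
    have "subset.chain {I. ideal I R} \<C>" using \<C>(2) unfolding subset_chain_def \<A>_def by blast
    then have "ideal (\<Union>\<C>) R" using chain_Union_is_ideal[of \<C>] \<C>(1) by simp
    then show "\<Union>\<C> \<in> \<A>" using \<C> unfolding \<A>_def subset_chain_def by blast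
  qed
  then obtain Q where Q: "ideal Q R" "I \<subseteq> Q" "Q \<inter> T = {}"
    and max: "\<forall>X. ideal X R \<and> I \<subseteq> X \<and> X \<inter> T = {} \<longrightarrow> Q \<subseteq> X \<longrightarrow> X = Q"
    unfolding \<A>_def mem_Collect_eq Ball_def Bex_def by (elim exE conjE)
  interpret Q: ideal Q R by (rule Q(1))
  have meet: "\<exists>q\<in>Q. \<exists>r\<in>carrier R. q \<oplus> r \<otimes> a \<in> T" if a: "a \<in> carrier R" "a \<notin> Q" for a
  proof (rule ccontr)
    assume no: "\<not> ?thesis"
    let ?X = "Q <+>\<^bsub>R\<^esub> PIdl a"
    note X = add_PIdl[OF Q(1) a(1)]
    have "t \<notin> T" if "t \<in> ?X" for t using X(4)[OF that] no by auto
    then have "?X \<inter> T = {}" by auto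
    moreover have "I \<subseteq> ?X" using Q(2) X(2) by (rule subset_trans)
    ultimately have "?X = Q" using max X(1,2) by simp
    then show False using a X(3) by simp
  qed
  have "primeideal Q R"
  proof (rule primeidealI[OF Q(1) is_cring])
    show "carrier R \<noteq> Q" using T Q(3) by blast
    fix a b assume ab: "a \<in> carrier R" "b \<in> carrier R" "a \<otimes> b \<in> Q"
    show "a \<in> Q \<or> b \<in> Q"
    proof (rule ccontr)
      assume "\<not> ?thesis"
      then obtain q r q' r' where *: "q \<in> Q" "r \<in> carrier R" "q \<oplus> r \<otimes> a \<in> T"
          "q' \<in> Q" "r' \<in> carrier R" "q' \<oplus> r' \<otimes> b \<in> T"
        using meet ab(1,2) by meson
      have c: "q \<in> carrier R" "q' \<in> carrier R" using * Q.Icarr by auto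
      have "(q \<oplus> r \<otimes> a) \<otimes> (q' \<oplus> r' \<otimes> b) = q \<otimes> (q' \<oplus> r' \<otimes> b) \<oplus> ((r \<otimes> a) \<otimes> q' \<oplus> (r \<otimes> r') \<otimes> (a \<otimes> b))"
        using * ab(1,2) c by algebra
      also have "\<dots> \<in> Q" using * ab c by (simp add: Q.I_l_closed Q.I_r_closed Q.a_closed)
      finally show False using mult[OF *(3,6)] Q(3) by blast
    qed
  qed
  then show ?thesis using that Q by blast
qed

lemma (in cring) prime_ideal_containing:
  assumes "ideal I R" "I \<noteq> carrier R"
  obtains Q where "primeideal Q R" "I \<subseteq> Q"
proof (rule prime_ideal_avoiding[OF assms(1), of "{\<one>}"])
  show "I \<inter> {\<one>} = {}" using ideal.one_imp_carrier[OF assms(1)] assms(2) by auto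
qed (use that in auto)

text \<open>The set to avoid consists of the products x^n s with s outside P. It misses I: as x is
  regular modulo I, a product in I would put s into I and hence into P. A prime that avoids it is
  contained in P and does not contain x.\<close>

lemma (in cring) prime_ideal_below_nonzerodivisor:
  assumes P: "primeideal P R" and I: "ideal I R" "I \<subseteq> P" and x: "x \<in> P"
    and nzd: "\<And>r. r \<in> carrier R \<Longrightarrow> x \<otimes> r \<in> I \<Longrightarrow> r \<in> I"
  obtains Q where "primeideal Q R" "I \<subseteq> Q" "Q \<subset> P"
proof -
  interpret P: primeideal P R by (rule P)
  have xc: "x \<in> carrier R" using x P.Icarr by blast
  let ?T = "{x [^] (n::nat) \<otimes> s | n s. s \<in> carrier R - P}"
  have pow: "s \<in> I" if "s \<in> carrier R" "x [^] n \<otimes> s \<in> I" for n :: nat and s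
    using that
  proof (induction n)
    case (Suc n)
    have "x \<otimes> (x [^] n \<otimes> s) \<in> I" using Suc.prems xc by (simp add: m_assoc m_comm m_lcomm)
    then have "x [^] n \<otimes> s \<in> I" by (rule nzd[rotated]) (use Suc.prems xc in simp_all)
    then show ?case by (rule Suc.IH[OF Suc.prems(1)])
  qed simp
  have P1: "\<one> \<notin> P" using P.one_imp_carrier P.I_notcarr by blast
  have T: "?T \<subseteq> carrier R" using xc by auto
  moreover have "\<one> \<in> ?T" using P1 by (intro CollectI exI[of _ "0::nat"] exI[of _ \<one>]) simp
  moreover have "s \<otimes> t \<in> ?T" if st: "s \<in> ?T" "t \<in> ?T" for s t
  proof -
    obtain n m :: nat and u v where *: "s = x [^] n \<otimes> u" "t = x [^] m \<otimes> v" "u \<in> carrier R - P" "v \<in> carrier R - P"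
      using st by blast
    have "s \<otimes> t = x [^] (n + m) \<otimes> (u \<otimes> v)" unfolding * nat_pow_mult[symmetric, OF xc]
      using * xc by (simp add: m_assoc m_lcomm)
    moreover have "u \<otimes> v \<in> carrier R - P" using * P.I_prime[of u v] by auto
    ultimately show ?thesis by (intro CollectI exI[of _ "n + m"] exI[of _ "u \<otimes> v"] conjI)
  qed
  moreover have "I \<inter> ?T = {}"
  proof (rule equals0I)
    fix t assume "t \<in> I \<inter> ?T"
    then obtain n s where "s \<in> carrier R - P" "x [^] (n::nat) \<otimes> s \<in> I" by auto
    then show False using pow[of s n] I(2) by auto
  qed
  ultimately obtain Q where Q: "primeideal Q R" "I \<subseteq> Q" "Q \<inter> ?T = {}"
    by (rule prime_ideal_avoiding[OF I(1)])
  have "Q \<subseteq> P"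
  proof
    fix q assume q: "q \<in> Q"
    have qc: "q \<in> carrier R" using q Q(1) by (meson ideal.Icarr primeideal.axioms(1))
    show "q \<in> P"
    proof (rule ccontr)
      assume "q \<notin> P"
      then have "q \<in> ?T" using qc by (intro CollectI exI[of _ "0::nat"] exI[of _ q]) simp
      then show False using q Q(3) by auto
    qed
  qed
  moreover have "x \<in> ?T" using xc P1 by (intro CollectI exI[of _ "1::nat"] exI[of _ \<one>]) simp
  then have "x \<notin> Q" using Q(3) by blast
  ultimately show ?thesis using that Q x by blast
qed

text \<open>Each step removes the last element of the sequence. It is regular modulo the ideal of
  its predecessors and lies in the prime at hand, so there is a strictly smaller prime over the
  predecessors. A regular sequence of length n thus yields n strict inclusions of primes.\<close>

lemma (in cring) regular_sequence_prime_chain: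
  assumes xs: "regular_sequence R xs" and "i \<le> length xs"
    and P: "primeideal P R" "Idl (set (take i xs)) \<subseteq> P"
  shows "\<exists>C :: nat \<Rightarrow> 'a set. (\<forall>j\<le>i. primeideal (C j) R) \<and> C i = P \<and> (\<forall>j<i. C j \<subset> C (Suc j))"
  using assms(2) P
proof (induction i arbitrary: P)
  case 0
  then show ?case by (intro exI[of _ "\<lambda>_. P"]) simp
next
  case (Suc i)
  have c: "set (take j xs) \<subseteq> carrier R" for j using xs set_take_subset unfolding regular_sequence_def by fastforce
  have sub: "set (take i xs) \<subseteq> set (take (Suc i) xs)" by (simp add: set_take_subset_set_take)
  have "Idl (set (take i xs)) \<subseteq> Idl (set (take (Suc i) xs))"
    using subset_Idl_subset[OF c sub] .
  then have "Idl (set (take i xs)) \<subseteq> P" using Suc.prems(3) by blast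
  moreover have "xs ! i \<in> set (take (Suc i) xs)" using Suc.prems(1) by (simp add: take_Suc_conv_app_nth)
  then have "xs ! i \<in> P" using genideal_self[OF c] Suc.prems(3) by blast
  moreover have "r \<in> Idl (set (take i xs))" if "r \<in> carrier R" "xs ! i \<otimes> r \<in> Idl (set (take i xs))" for r
    using xs that Suc.prems(1) unfolding regular_sequence_def by auto
  ultimately obtain Q where Q: "primeideal Q R" "Idl (set (take i xs)) \<subseteq> Q" "Q \<subset> P"
    by (rule prime_ideal_below_nonzerodivisor[OF Suc.prems(2) genideal_ideal[OF c]])
  obtain C where C: "\<forall>j\<le>i. primeideal (C j) R" "C i = Q" "\<forall>j<i. C j \<subset> C (Suc j)"
    using Suc.IH[OF _ Q(1,2)] Suc.prems(1) by auto
  show ?case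
    using C Q Suc.prems(2) by (intro exI[of _ "C(Suc i := P)"]) (auto simp: le_Suc_eq less_Suc_eq)
qed

text \<open>This general inequality closes the gap in the perfect case, where only depth at least 1
  and dimension at most 1 are shown directly.\<close>

lemma local_depth_le_krull_dim:
  assumes "cring R"
  shows "local_depth R \<le> krull_dim R"
  unfolding local_depth_def
proof (rule Sup_least, clarify)
  interpret cring R by (rule assms)
  fix xs assume xs: "set xs \<subseteq> carrier R - Units R" "regular_sequence R xs"
  have "set xs \<subseteq> carrier R" "Idl\<^bsub>R\<^esub> (set xs) \<noteq> carrier R" using xs unfolding regular_sequence_def by auto
  then obtain P where "primeideal P R" "Idl\<^bsub>R\<^esub> (set xs) \<subseteq> P"
    using prime_ideal_containing[OF genideal_ideal] by metis
  then obtain C :: "nat \<Rightarrow> 'a set" where "\<forall>j\<le>length xs. primeideal (C j) R" "\<forall>j<length xs. C j \<subset> C (Suc j)"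
    using regular_sequence_prime_chain[OF xs(2) order_refl, of P] by auto
  then show "enat (length xs) \<le> krull_dim R"
    unfolding krull_dim_def by (intro Sup_upper) auto
qed

text \<open>Hypothesis \<open>unit\<close> places w in the Jacobson radical. A prime P that avoids
  the powers of w is not maximal: P + (w) is proper, since 1 = p + b w would make p = 1 - w b a unit
  inside P.\<close>

lemma (in cring) krull_dim_ge_1:
  assumes w: "w \<in> carrier R" and nil: "\<And>n::nat. w [^] n \<noteq> \<zero>"
    and unit: "\<And>b. b \<in> carrier R \<Longrightarrow> \<one> \<ominus> w \<otimes> b \<in> Units R"
  shows "krull_dim R \<ge> 1"
proof -
  let ?T = "range (\<lambda>n::nat. w [^] n)"
  obtain P where P: "primeideal P R" "P \<inter> ?T = {}"
  proof (rule prime_ideal_avoiding[OF zeroideal])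
    show "?T \<subseteq> carrier R" using w by auto
    show "\<one> \<in> ?T" by (force intro!: image_eqI[of _ _ 0])
    show "s \<otimes> t \<in> ?T" if "s \<in> ?T" "t \<in> ?T" for s t
      using that w by (auto simp: nat_pow_mult)
    show "{\<zero>} \<inter> ?T = {}" using nil by (metis Int_emptyI imageE singletonD)
  qed auto
  interpret P: primeideal P R by (rule P(1))
  let ?I = "P <+>\<^bsub>R\<^esub> PIdl w"
  note I = add_PIdl[OF P.is_ideal w]
  have "\<one> \<notin> ?I"
  proof
    assume "\<one> \<in> ?I"
    then obtain p b where pb: "p \<in> P" "b \<in> carrier R" "\<one> = p \<oplus> b \<otimes> w"
      using I(4) by blast
    have pc: "p \<in> carrier R" using pb P.Icarr by blast
    have "\<one> \<ominus> w \<otimes> b = (p \<oplus> b \<otimes> w) \<ominus> w \<otimes> b" using pb by simp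
    also have "\<dots> = p" using pb pc w by algebra
    finally have "p \<in> Units R" using unit[OF pb(2)] by metis
    then obtain q where "q \<in> carrier R" "q \<otimes> p = \<one>" unfolding Units_def by blast
    then have "\<one> \<in> P" using P.I_l_closed[OF pb(1), of q] by simp
    then show False using P.one_imp_carrier P.I_notcarr by blast
  qed
  then obtain M where M: "primeideal M R" "?I \<subseteq> M"
    using prime_ideal_containing[OF I(1)] by (metis one_closed)
  have "w \<notin> P" using P(2) w by (metis disjoint_iff nat_pow_eone rangeI)
  then have "P \<subset> M" using M(2) I(2,3) by blast
  then have "enat 1 \<le> krull_dim R"
    unfolding krull_dim_def using P(1) M(1)
    by (intro Sup_upper) (auto intro!: exI[of _ "\<lambda>i. if i = 0 then P else M"])
  then show ?thesis by (simp add: one_enat_def)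
qed

section \<open>Localization and Cohen--Macaulay quotients\<close>

locale mult_submonoid = cring R for R (structure) +
  fixes M
  assumes M_sub: "M \<subseteq> carrier R" and M_one: "\<one> \<in> M"
    and M_mult: "\<lbrakk>s \<in> M; t \<in> M\<rbrakk> \<Longrightarrow> s \<otimes> t \<in> M"
begin

abbreviation frac where "frac r s \<equiv> loc_rel R M `` {(r, s)}"
abbreviation Loc where "Loc \<equiv> localization R M"

lemma M_carr[simp]: "s \<in> M \<Longrightarrow> s \<in> carrier R" using M_sub by blast

lemma loc_rel_iff:
  "((r, s), (r', s')) \<in> loc_rel R M \<longleftrightarrow> r \<in> carrier R \<and> r' \<in> carrier R \<and> s \<in> M \<and> s' \<in> M \<and>
    (\<exists>u\<in>M. u \<otimes> (r \<otimes> s' \<ominus> r' \<otimes> s) = \<zero>)"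
  by (auto simp: loc_rel_def)

lemma equiv_loc_rel: "equiv (carrier R \<times> M) (loc_rel R M)"
proof (rule equivI)
  show "loc_rel R M \<subseteq> (carrier R \<times> M) \<times> (carrier R \<times> M)" by (auto simp: loc_rel_def)
  show "refl_on (carrier R \<times> M) (loc_rel R M)"
    by (rule refl_onI) (auto simp: loc_rel_def r_right_minus_eq intro!: bexI[OF _ M_one])
  show "sym (loc_rel R M)"
  proof (rule symI, clarify)
    fix r s r' s' assume "((r, s), (r', s')) \<in> loc_rel R M"
    then obtain u where *: "r \<in> carrier R" "r' \<in> carrier R" "s \<in> M" "s' \<in> M" "u \<in> M"
      "u \<otimes> (r \<otimes> s' \<ominus> r' \<otimes> s) = \<zero>" unfolding loc_rel_iff by auto
    have "u \<otimes> (r' \<otimes> s \<ominus> r \<otimes> s') = \<ominus> (u \<otimes> (r \<otimes> s' \<ominus> r' \<otimes> s))"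
      using *(1,2) M_carr[OF *(3)] M_carr[OF *(4)] M_carr[OF *(5)] by algebra
    then show "((r', s'), (r, s)) \<in> loc_rel R M" unfolding loc_rel_iff using * by auto
  qed
  show "trans (loc_rel R M)"
  proof (rule transI, clarify)
    fix r s r' s' r'' s''
    assume "((r, s), (r', s')) \<in> loc_rel R M" "((r', s'), (r'', s'')) \<in> loc_rel R M"
    then obtain u v where *: "r \<in> carrier R" "r' \<in> carrier R" "r'' \<in> carrier R" "s \<in> M" "s' \<in> M" "s'' \<in> M" "u \<in> M" "v \<in> M"
      and z: "u \<otimes> (r \<otimes> s' \<ominus> r' \<otimes> s) = \<zero>" "v \<otimes> (r' \<otimes> s'' \<ominus> r'' \<otimes> s') = \<zero>" unfolding loc_rel_iff by auto
    have c: "s \<in> carrier R" "s' \<in> carrier R" "s'' \<in> carrier R" "u \<in> carrier R" "v \<in> carrier R" using * by auto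
    \<comment> \<open>Transitivity costs the middle denominator: the multipliers u and v of the two
      given relations combine to u v s', which is again in M.\<close>
    have "(u \<otimes> v \<otimes> s') \<otimes> (r \<otimes> s'' \<ominus> r'' \<otimes> s)
        = (v \<otimes> s'') \<otimes> (u \<otimes> (r \<otimes> s' \<ominus> r' \<otimes> s)) \<oplus> (u \<otimes> s) \<otimes> (v \<otimes> (r' \<otimes> s'' \<ominus> r'' \<otimes> s'))"
      using *(1-3) c by algebra
    also have "\<dots> = \<zero>" unfolding z using c by simp
    finally show "((r, s), (r'', s'')) \<in> loc_rel R M"
      unfolding loc_rel_iff using * by (intro conjI bexI[of _ "u \<otimes> v \<otimes> s'"]) (auto intro: M_mult)
  qed
qed

lemma frac_eq_iff:
  assumes "r \<in> carrier R" "s \<in> M" "r' \<in> carrier R" "s' \<in> M"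
  shows "frac r s = frac r' s' \<longleftrightarrow> (\<exists>u\<in>M. u \<otimes> (r \<otimes> s' \<ominus> r' \<otimes> s) = \<zero>)"
  using eq_equiv_class_iff[OF equiv_loc_rel, of "(r, s)" "(r', s')"] assms by (auto simp: loc_rel_iff)

lemma frac_eqI:
  assumes "r \<in> carrier R" "s \<in> M" "r' \<in> carrier R" "s' \<in> M" "r \<otimes> s' = r' \<otimes> s"
  shows "frac r s = frac r' s'"
  using assms by (subst frac_eq_iff) (auto simp: r_right_minus_eq intro!: bexI[OF _ M_one])

lemma carrier_Loc: "carrier Loc = {frac r s | r s. r \<in> carrier R \<and> s \<in> M}"
  by (auto simp: localization_def quotient_def)

lemma frac_closed: "r \<in> carrier R \<Longrightarrow> s \<in> M \<Longrightarrow> frac r s \<in> carrier Loc"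
  unfolding carrier_Loc by blast

lemma frac_memD: "(a, b) \<in> frac r s \<Longrightarrow> a \<in> carrier R \<and> b \<in> M \<and> r \<in> carrier R \<and> s \<in> M \<and>
    (\<exists>u\<in>M. u \<otimes> (r \<otimes> b \<ominus> a \<otimes> s) = \<zero>)"
  unfolding Image_singleton_iff loc_rel_iff by blast

lemma frac_self: "r \<in> carrier R \<Longrightarrow> s \<in> M \<Longrightarrow> (r, s) \<in> frac r s"
  using equiv_class_self[OF equiv_loc_rel] by blast

text \<open>Sums and products of classes are defined as unions over all pairs of representatives.
  Such a union is a single class as soon as every pair yields the same class.\<close>

lemma UN_pair_const:
  assumes "A \<noteq> {}" "B \<noteq> {}" "\<And>r s r' s'. (r, s) \<in> A \<Longrightarrow> (r', s') \<in> B \<Longrightarrow> g r s r' s' = c"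
  shows "(\<Union>(r, s)\<in>A. \<Union>(r', s')\<in>B. g r s r' s') = c"
  using assms by fast

lemma mult_Loc:
  assumes *: "r \<in> carrier R" "s \<in> M" "r' \<in> carrier R" "s' \<in> M"
  shows "frac r s \<otimes>\<^bsub>Loc\<^esub> frac r' s' = frac (r \<otimes> r') (s \<otimes> s')"
proof -
  have "(\<Union>(a, b)\<in>frac r s. \<Union>(a', b')\<in>frac r' s'. frac (a \<otimes> a') (b \<otimes> b')) = frac (r \<otimes> r') (s \<otimes> s')"
  proof (rule UN_pair_const)
    fix a b a' b' assume "(a, b) \<in> frac r s" "(a', b') \<in> frac r' s'"
    then obtain u v where **: "a \<in> carrier R" "b \<in> M" "a' \<in> carrier R" "b' \<in> M" "u \<in> M" "v \<in> M"
      and z: "u \<otimes> (r \<otimes> b \<ominus> a \<otimes> s) = \<zero>" "v \<otimes> (r' \<otimes> b' \<ominus> a' \<otimes> s') = \<zero>"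
      using frac_memD by meson
    have c: "s \<in> carrier R" "s' \<in> carrier R" "b \<in> carrier R" "b' \<in> carrier R" "u \<in> carrier R" "v \<in> carrier R"
      using * ** by auto
    have "(u \<otimes> v) \<otimes> ((r \<otimes> r') \<otimes> (b \<otimes> b') \<ominus> (a \<otimes> a') \<otimes> (s \<otimes> s'))
       = (v \<otimes> r' \<otimes> b') \<otimes> (u \<otimes> (r \<otimes> b \<ominus> a \<otimes> s)) \<oplus> (u \<otimes> a \<otimes> s) \<otimes> (v \<otimes> (r' \<otimes> b' \<ominus> a' \<otimes> s'))"
      using *(1,3) **(1,3) c by algebra
    also have "\<dots> = \<zero>" unfolding z using * ** c by simp
    finally have "frac (r \<otimes> r') (s \<otimes> s') = frac (a \<otimes> a') (b \<otimes> b')"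
      using * ** c by (intro iffD2[OF frac_eq_iff] bexI[of _ "u \<otimes> v"]) (simp_all add: M_mult)
    then show "frac (a \<otimes> a') (b \<otimes> b') = frac (r \<otimes> r') (s \<otimes> s')" by (rule sym)
  qed (use frac_self * in blast)+
  then show ?thesis by (simp add: localization_def)
qed

lemma add_Loc:
  assumes *: "r \<in> carrier R" "s \<in> M" "r' \<in> carrier R" "s' \<in> M"
  shows "frac r s \<oplus>\<^bsub>Loc\<^esub> frac r' s' = frac (r \<otimes> s' \<oplus> r' \<otimes> s) (s \<otimes> s')"
proof -
  have "(\<Union>(a, b)\<in>frac r s. \<Union>(a', b')\<in>frac r' s'. frac (a \<otimes> b' \<oplus> a' \<otimes> b) (b \<otimes> b'))
      = frac (r \<otimes> s' \<oplus> r' \<otimes> s) (s \<otimes> s')"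
  proof (rule UN_pair_const)
    fix a b a' b' assume "(a, b) \<in> frac r s" "(a', b') \<in> frac r' s'"
    then obtain u v where **: "a \<in> carrier R" "b \<in> M" "a' \<in> carrier R" "b' \<in> M" "u \<in> M" "v \<in> M"
      and z: "u \<otimes> (r \<otimes> b \<ominus> a \<otimes> s) = \<zero>" "v \<otimes> (r' \<otimes> b' \<ominus> a' \<otimes> s') = \<zero>"
      using frac_memD by meson
    have c: "s \<in> carrier R" "s' \<in> carrier R" "b \<in> carrier R" "b' \<in> carrier R" "u \<in> carrier R" "v \<in> carrier R"
      using * ** by auto
    have "(u \<otimes> v) \<otimes> ((r \<otimes> s' \<oplus> r' \<otimes> s) \<otimes> (b \<otimes> b') \<ominus> (a \<otimes> b' \<oplus> a' \<otimes> b) \<otimes> (s \<otimes> s'))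
       = (v \<otimes> b' \<otimes> s') \<otimes> (u \<otimes> (r \<otimes> b \<ominus> a \<otimes> s)) \<oplus> (u \<otimes> b \<otimes> s) \<otimes> (v \<otimes> (r' \<otimes> b' \<ominus> a' \<otimes> s'))"
      using *(1,3) **(1,3) c by algebra
    also have "\<dots> = \<zero>" unfolding z using * ** c by simp
    finally have "frac (r \<otimes> s' \<oplus> r' \<otimes> s) (s \<otimes> s') = frac (a \<otimes> b' \<oplus> a' \<otimes> b) (b \<otimes> b')"
      using * ** c by (intro iffD2[OF frac_eq_iff] bexI[of _ "u \<otimes> v"]) (simp_all add: M_mult)
    then show "frac (a \<otimes> b' \<oplus> a' \<otimes> b) (b \<otimes> b') = frac (r \<otimes> s' \<oplus> r' \<otimes> s) (s \<otimes> s')" by (rule sym)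
  qed (use frac_self * in blast)+
  then show ?thesis by (simp add: localization_def)
qed

lemma one_Loc: "\<one>\<^bsub>Loc\<^esub> = frac \<one> \<one>" and zero_Loc: "\<zero>\<^bsub>Loc\<^esub> = frac \<zero> \<one>"
  by (simp_all add: localization_def)

lemma cring_Loc: "cring Loc"
proof (rule cringI)
  show "abelian_group Loc"
  proof (rule abelian_groupI)
    fix X Y assume "X \<in> carrier Loc" "Y \<in> carrier Loc"
    then obtain r s r' s' where *: "X = frac r s" "Y = frac r' s'" "r \<in> carrier R" "s \<in> M" "r' \<in> carrier R" "s' \<in> M"
      unfolding carrier_Loc by blast
    then have c: "s \<in> carrier R" "s' \<in> carrier R" by auto
    show "X \<oplus>\<^bsub>Loc\<^esub> Y \<in> carrier Loc" unfolding *(1,2) using * by (simp add: add_Loc frac_closed M_mult)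
    have "r \<otimes> s' \<oplus> r' \<otimes> s = r' \<otimes> s \<oplus> r \<otimes> s'" "s \<otimes> s' = s' \<otimes> s"
      using *(3,5) c by (simp_all add: a_comm m_comm)
    then show "X \<oplus>\<^bsub>Loc\<^esub> Y = Y \<oplus>\<^bsub>Loc\<^esub> X" unfolding *(1,2) add_Loc[OF *(3-6)] add_Loc[OF *(5,6,3,4)] by simp
    fix Z assume "Z \<in> carrier Loc"
    then obtain r'' s'' where **: "Z = frac r'' s''" "r'' \<in> carrier R" "s'' \<in> M"
      unfolding carrier_Loc by blast
    then have c': "s'' \<in> carrier R" by auto
    have "(r \<otimes> s' \<oplus> r' \<otimes> s) \<otimes> s'' \<oplus> r'' \<otimes> (s \<otimes> s') = r \<otimes> (s' \<otimes> s'') \<oplus> (r' \<otimes> s'' \<oplus> r'' \<otimes> s') \<otimes> s"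
      using *(3,5) **(2) c c' by algebra
    then show "X \<oplus>\<^bsub>Loc\<^esub> Y \<oplus>\<^bsub>Loc\<^esub> Z = X \<oplus>\<^bsub>Loc\<^esub> (Y \<oplus>\<^bsub>Loc\<^esub> Z)"
      unfolding *(1,2) **(1) using *(3-6) **(2,3) c c' by (simp add: add_Loc M_mult m_assoc)
  next
    show "\<zero>\<^bsub>Loc\<^esub> \<in> carrier Loc" unfolding zero_Loc by (simp add: frac_closed M_one)
    fix X assume "X \<in> carrier Loc"
    then obtain r s where *: "X = frac r s" "r \<in> carrier R" "s \<in> M" unfolding carrier_Loc by blast
    then have c: "s \<in> carrier R" by auto
    show "\<zero>\<^bsub>Loc\<^esub> \<oplus>\<^bsub>Loc\<^esub> X = X" unfolding zero_Loc *(1) using *(2,3) c by (simp add: add_Loc M_one)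
    have "frac (\<ominus> r) s \<oplus>\<^bsub>Loc\<^esub> X = frac (\<ominus> r \<otimes> s \<oplus> r \<otimes> s) (s \<otimes> s)"
      unfolding *(1) using *(2,3) by (simp add: add_Loc)
    also have "\<dots> = frac \<zero> \<one>"
      using *(2,3) c by (intro frac_eqI) (simp_all add: M_mult M_one l_minus l_neg)
    finally show "\<exists>Y\<in>carrier Loc. Y \<oplus>\<^bsub>Loc\<^esub> X = \<zero>\<^bsub>Loc\<^esub>"
      unfolding zero_Loc using *(2,3) by (auto intro!: bexI[of _ "frac (\<ominus> r) s"] frac_closed)
  qed
  show "Group.comm_monoid Loc"
  proof (rule comm_monoidI)
    fix X Y assume "X \<in> carrier Loc" "Y \<in> carrier Loc"
    then obtain r s r' s' where *: "X = frac r s" "Y = frac r' s'" "r \<in> carrier R" "s \<in> M" "r' \<in> carrier R" "s' \<in> M"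
      unfolding carrier_Loc by blast
    then have c: "s \<in> carrier R" "s' \<in> carrier R" by auto
    show "X \<otimes>\<^bsub>Loc\<^esub> Y \<in> carrier Loc" unfolding *(1,2) using * by (simp add: mult_Loc frac_closed M_mult)
    show "X \<otimes>\<^bsub>Loc\<^esub> Y = Y \<otimes>\<^bsub>Loc\<^esub> X"
      unfolding *(1,2) mult_Loc[OF *(3-6)] mult_Loc[OF *(5,6,3,4)] using *(3,5) c by (simp add: m_comm)
    fix Z assume "Z \<in> carrier Loc"
    then obtain r'' s'' where **: "Z = frac r'' s''" "r'' \<in> carrier R" "s'' \<in> M"
      unfolding carrier_Loc by blast
    then show "X \<otimes>\<^bsub>Loc\<^esub> Y \<otimes>\<^bsub>Loc\<^esub> Z = X \<otimes>\<^bsub>Loc\<^esub> (Y \<otimes>\<^bsub>Loc\<^esub> Z)"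
      unfolding *(1,2) **(1) using *(3-6) **(2,3) c by (simp add: mult_Loc M_mult m_assoc)
  next
    show "\<one>\<^bsub>Loc\<^esub> \<in> carrier Loc" unfolding one_Loc by (simp add: frac_closed M_one)
    fix X assume "X \<in> carrier Loc"
    then obtain r s where *: "X = frac r s" "r \<in> carrier R" "s \<in> M" unfolding carrier_Loc by blast
    then show "\<one>\<^bsub>Loc\<^esub> \<otimes>\<^bsub>Loc\<^esub> X = X" unfolding one_Loc *(1) by (simp add: mult_Loc M_one)
  qed
  fix X Y Z assume "X \<in> carrier Loc" "Y \<in> carrier Loc" "Z \<in> carrier Loc"
  then obtain r s r' s' r'' s'' where *: "X = frac r s" "Y = frac r' s'" "Z = frac r'' s''"
    and r: "r \<in> carrier R" "r' \<in> carrier R" "r'' \<in> carrier R" and s: "s \<in> M" "s' \<in> M" "s'' \<in> M"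
    unfolding carrier_Loc by blast
  then have c: "s \<in> carrier R" "s' \<in> carrier R" "s'' \<in> carrier R" by auto
  have "(X \<oplus>\<^bsub>Loc\<^esub> Y) \<otimes>\<^bsub>Loc\<^esub> Z = frac ((r \<otimes> s' \<oplus> r' \<otimes> s) \<otimes> r'') (s \<otimes> s' \<otimes> s'')"
    unfolding * using r s c by (simp add: add_Loc mult_Loc M_mult)
  also have "\<dots> = frac (r \<otimes> r'' \<otimes> (s' \<otimes> s'') \<oplus> r' \<otimes> r'' \<otimes> (s \<otimes> s'')) (s \<otimes> s'' \<otimes> (s' \<otimes> s''))"
  proof (rule frac_eqI)
    show "(r \<otimes> s' \<oplus> r' \<otimes> s) \<otimes> r'' \<otimes> (s \<otimes> s'' \<otimes> (s' \<otimes> s''))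
      = (r \<otimes> r'' \<otimes> (s' \<otimes> s'') \<oplus> r' \<otimes> r'' \<otimes> (s \<otimes> s'')) \<otimes> (s \<otimes> s' \<otimes> s'')"
      using r c by algebra
  qed (use r s c M_mult in auto)
  also have "\<dots> = X \<otimes>\<^bsub>Loc\<^esub> Z \<oplus>\<^bsub>Loc\<^esub> Y \<otimes>\<^bsub>Loc\<^esub> Z"
    unfolding * using r s c by (simp add: add_Loc mult_Loc M_mult)
  finally show "(X \<oplus>\<^bsub>Loc\<^esub> Y) \<otimes>\<^bsub>Loc\<^esub> Z = X \<otimes>\<^bsub>Loc\<^esub> Z \<oplus>\<^bsub>Loc\<^esub> Y \<otimes>\<^bsub>Loc\<^esub> Z" .
qed

lemma frac_one_hom: "(\<lambda>r. frac r \<one>) \<in> Ring.ring_hom R Loc"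
  by (rule ring_hom_memI) (simp_all add: mult_Loc add_Loc one_Loc frac_closed M_one)

lemma frac_one_zero_iff: "r \<in> carrier R \<Longrightarrow> frac r \<one> = \<zero>\<^bsub>Loc\<^esub> \<longleftrightarrow> (\<exists>u\<in>M. u \<otimes> r = \<zero>)"
  unfolding zero_Loc by (subst frac_eq_iff) (simp_all add: M_one minus_eq)

text \<open>Clearing the denominator reduces questions about a fraction to questions about its
  numerator, because the factor used is a unit.\<close>

lemma frac_numerator:
  assumes "b \<in> carrier Loc"
  shows "\<exists>r\<in>carrier R. \<exists>s\<in>M. frac s \<one> \<otimes>\<^bsub>Loc\<^esub> b = frac r \<one>"
proof -
  obtain r s where *: "b = frac r s" "r \<in> carrier R" "s \<in> M" using assms unfolding carrier_Loc by blast
  have "frac s \<one> \<otimes>\<^bsub>Loc\<^esub> b = frac r \<one>"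
    unfolding *(1) using *(2,3) by (simp add: mult_Loc M_one) (rule frac_eqI, auto simp: M_one M_mult m_comm)
  then show ?thesis using * by blast
qed

lemma frac_one_Unit:
  assumes "s \<in> M"
  shows "frac s \<one> \<in> Units Loc"
proof -
  interpret L: cring Loc by (rule cring_Loc)
  have "frac \<one> s \<otimes>\<^bsub>Loc\<^esub> frac s \<one> = \<one>\<^bsub>Loc\<^esub>"
    using assms unfolding one_Loc by (simp add: mult_Loc M_one) (rule frac_eqI, auto simp: M_one M_mult)
  moreover have "frac \<one> s \<in> carrier Loc" "frac s \<one> \<in> carrier Loc" using assms by (auto intro: frac_closed M_one)
  ultimately show ?thesis unfolding Units_def using L.m_comm[of "frac \<one> s" "frac s \<one>"] by auto
qed

end

section \<open>Localized quotients described through the original ring\<close>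

lemma class_ring_homD:
  fixes h :: "'s::comm_ring_1 \<Rightarrow> 'b"
  assumes h: "h \<in> Ring.ring_hom class_ring A" and A: "ring A"
  shows "h (a + b) = h a \<oplus>\<^bsub>A\<^esub> h b" "h (a * b) = h a \<otimes>\<^bsub>A\<^esub> h b" "h 1 = \<one>\<^bsub>A\<^esub>" "h a \<in> carrier A"
    "h 0 = \<zero>\<^bsub>A\<^esub>" "h (a - b) = h a \<ominus>\<^bsub>A\<^esub> h b" "h (a ^ n) = h a [^]\<^bsub>A\<^esub> n"
proof -
  interpret A: ring A by (rule A)
  show add: "h (a + b) = h a \<oplus>\<^bsub>A\<^esub> h b" for a b using ring_hom_add[OF h, of a b] by simp
  show mult: "h (a * b) = h a \<otimes>\<^bsub>A\<^esub> h b" for a b using ring_hom_mult[OF h, of a b] by simp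
  show one: "h 1 = \<one>\<^bsub>A\<^esub>" using ring_hom_one[OF h] by simp
  show c: "h a \<in> carrier A" for a using ring_hom_closed[OF h, of a] by simp
  have "h 0 \<oplus>\<^bsub>A\<^esub> h 0 = h 0 \<oplus>\<^bsub>A\<^esub> \<zero>\<^bsub>A\<^esub>" using add[of 0 0] c by simp
  then show "h 0 = \<zero>\<^bsub>A\<^esub>" using c A.add.l_cancel[of "h 0" "h 0" "\<zero>\<^bsub>A\<^esub>"] by simp
  have "h (a - b) \<oplus>\<^bsub>A\<^esub> h b = h a" using add[of "a - b" b] by simp
  then have "h a \<ominus>\<^bsub>A\<^esub> h b = (h (a - b) \<oplus>\<^bsub>A\<^esub> h b) \<ominus>\<^bsub>A\<^esub> h b" by simp
  also have "\<dots> = h (a - b)" using c[of "a - b"] c[of b] by algebra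
  finally show "h (a - b) = h a \<ominus>\<^bsub>A\<^esub> h b" by simp
  show "h (a ^ n) = h a [^]\<^bsub>A\<^esub> n"
    by (induction n) (simp_all add: one mult power_Suc2 del: power_Suc)
qed

lemma class_ring_hom_image_ideal:
  fixes K :: "'s::comm_ring_1 set"
  assumes A: "cring A" and h: "h \<in> Ring.ring_hom class_ring A" and surj: "carrier A = range h"
    and K: "ideal K class_ring"
  shows "ideal (h ` K) A"
proof -
  interpret A: cring A by (rule A)
  note h = class_ring_homD[OF h A.ring_axioms]
  have K': "0 \<in> K" "\<And>a b. a \<in> K \<Longrightarrow> b \<in> K \<Longrightarrow> a + b \<in> K" "\<And>a r. a \<in> K \<Longrightarrow> r * a \<in> K"
    using K unfolding class_ideal_iff by blast+
  have cl: "x \<otimes>\<^bsub>A\<^esub> a \<in> h ` K" if x: "a \<in> h ` K" "x \<in> carrier A" for a x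
  proof -
    obtain k r where "k \<in> K" "a = h k" "x = h r" using x surj by blast
    then show ?thesis using K'(3)[of k r] by (auto simp: h(2)[symmetric])
  qed
  show ?thesis
  proof (rule idealI[OF A.ring_axioms])
    show "subgroup (h ` K) (add_monoid A)"
    proof (rule A.add.subgroupI)
      show "h ` K \<subseteq> carrier A" "h ` K \<noteq> {}" using h(4) K'(1) by blast+
      show "\<ominus>\<^bsub>A\<^esub> a \<in> h ` K" if "a \<in> h ` K" for a
      proof -
        obtain k where k: "k \<in> K" "a = h k" using \<open>a \<in> h ` K\<close> by blast
        have "h (0 - k) = \<ominus>\<^bsub>A\<^esub> a" unfolding h(6) h(5) k(2) using h(4)[of k] by (simp add: A.minus_eq)
        moreover have "0 - k \<in> K" using K'(3)[OF k(1), of "-1"] by simp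
        ultimately show ?thesis by (metis imageI)
      qed
      show "a \<oplus>\<^bsub>A\<^esub> b \<in> h ` K" if "a \<in> h ` K" "b \<in> h ` K" for a b
      proof -
        obtain k l where "k \<in> K" "a = h k" "l \<in> K" "b = h l" using \<open>a \<in> h ` K\<close> \<open>b \<in> h ` K\<close> by blast
        then show ?thesis using K'(2)[of k l] by (auto simp: h(1)[symmetric])
      qed
    qed
    show "x \<otimes>\<^bsub>A\<^esub> a \<in> h ` K" if "a \<in> h ` K" "x \<in> carrier A" for a x using cl that by blast
    show "a \<otimes>\<^bsub>A\<^esub> x \<in> h ` K" if x: "a \<in> h ` K" "x \<in> carrier A" for a x
    proof -
      have "a \<in> carrier A" using x(1) h(4) by blast
      then show ?thesis using cl[OF x] A.m_comm[of a x] x(2) by simp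
    qed
  qed
qed

text \<open>B stands for the localization of S/J at M/J, known only through the canonical map
  \<open>\<beta>\<close> from S. Numerators, units and the vanishing criterion express every later
  question about B by elements of S, so that neither cosets nor fractions occur again.\<close>

locale quotient_localization = B: cring B for B :: "('b, 'm) ring_scheme" (structure) +
  fixes J M :: "'s::comm_ring_1 set" and \<beta> :: "'s \<Rightarrow> 'b"
  assumes J: "ideal J class_ring" and M: "primeideal M class_ring" and JM: "J \<subseteq> M"
    and hom: "\<beta> \<in> Ring.ring_hom class_ring B"
    and numerator: "b \<in> carrier B \<Longrightarrow> \<exists>r s. s \<notin> M \<and> \<beta> s \<otimes> b = \<beta> r"
    and unit: "s \<notin> M \<Longrightarrow> \<beta> s \<in> Units B"
    and zero_iff: "\<beta> r = \<zero> \<longleftrightarrow> (\<exists>u. u \<notin> M \<and> u * r \<in> J)"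
begin

lemmas \<beta> = class_ring_homD[OF hom B.ring_axioms]

lemma one_notin_M: "1 \<notin> M" and M_prime: "a * b \<in> M \<Longrightarrow> a \<in> M \<or> b \<in> M"
  and M_add: "a \<in> M \<Longrightarrow> b \<in> M \<Longrightarrow> a + b \<in> M" and M_mult: "a \<in> M \<Longrightarrow> r * a \<in> M"
  using M unfolding class_prime_iff class_ideal_iff by blast+

lemma mult_in_M_iff: "a * b \<in> M \<longleftrightarrow> a \<in> M \<or> b \<in> M"
  using M_prime M_mult by (metis mult.commute)

lemma unit_cancel:
  assumes "s \<notin> M" "b \<in> carrier B" "c \<in> carrier B" "\<beta> s \<otimes> b = \<beta> s \<otimes> c"
  shows "b = c"
  by (rule iffD1[OF B.Units_l_cancel[OF unit[OF assms(1)] assms(2,3)] assms(4)])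

text \<open>If an inverse of \<open>\<beta> h\<close> has numerator r and denominator s, then h r -
  s is sent into J by a factor outside M, hence lies in M. With h in M this forces s into M.\<close>

lemma nonunit:
  assumes "h \<in> M" shows "\<beta> h \<notin> Units B"
proof
  assume "\<beta> h \<in> Units B"
  then obtain b where b: "b \<in> carrier B" "\<beta> h \<otimes> b = \<one>" unfolding Units_def by blast
  obtain r s where rs: "s \<notin> M" "\<beta> s \<otimes> b = \<beta> r" using numerator[OF b(1)] by blast
  have "\<beta> (h * r) = \<beta> h \<otimes> (\<beta> s \<otimes> b)" by (simp add: \<beta> rs)
  also have "\<dots> = \<beta> s" using b \<beta>(4) by (metis B.m_lcomm B.r_one)
  finally have "\<beta> (h * r - s) = \<zero>" using \<beta>(4) by (simp add: \<beta>(6) B.r_right_minus_eq)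
  then obtain u where "u \<notin> M" "u * (h * r - s) \<in> M" unfolding zero_iff using JM by blast
  then have "h * r - s \<in> M" using M_prime by blast
  moreover have "h * r \<in> M" using M_mult[OF assms, of r] by (simp add: mult.commute)
  ultimately have "s \<in> M" using class_ideal_minus[of M "h * r" "h * r - s"] M unfolding class_prime_iff by simp
  then show False using rs by simp
qed

lemma Idl_single: "x \<in> carrier B \<Longrightarrow> Idl {x} = {b \<otimes> x | b. b \<in> carrier B}"
  using B.cgenideal_eq_genideal[of x] unfolding cgenideal_def by simp

text \<open>An element regular modulo J stays regular in B. If it kills a fraction with numerator r,
  then h u r lies in J for some u outside M, so u r lies in J and the fraction is zero.\<close>

lemma local_depth_ge_1:
  assumes h: "h \<in> M" and nzd: "\<And>g. h * g \<in> J \<Longrightarrow> g \<in> J"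
  shows "local_depth B \<ge> 1"
proof -
  have "regular_sequence B [\<beta> h]"
    unfolding regular_sequence_def
  proof (intro conjI allI impI ballI)
    show "set [\<beta> h] \<subseteq> carrier B" by (simp add: \<beta>)
    show "Idl (set [\<beta> h]) \<noteq> carrier B"
    proof
      assume "Idl (set [\<beta> h]) = carrier B"
      then have "\<one> \<in> {b \<otimes> \<beta> h | b. b \<in> carrier B}" using Idl_single[OF \<beta>(4)] by simp
      then obtain b where b: "b \<in> carrier B" "b \<otimes> \<beta> h = \<one>" by auto
      then have "\<beta> h \<in> Units B" unfolding Units_def using b B.m_comm[OF b(1) \<beta>(4)[of h]] \<beta>(4)[of h] by auto
      then show False using nonunit h by blast
    qed
    fix i b assume i: "i < length [\<beta> h]" and b: "b \<in> carrier B" and hb: "[\<beta> h] ! i \<otimes> b \<in> Idl (set (take i [\<beta> h]))"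
    have "Idl {} = {\<zero>}"
      using B.genideal_minimal[OF B.zeroideal, of "{}"]
        additive_subgroup.zero_closed[OF ideal.axioms(1)[OF B.genideal_ideal[of "{}"]]] by auto
    then have z: "\<beta> h \<otimes> b = \<zero>" and I: "Idl (set (take i [\<beta> h])) = {\<zero>}" using hb i by auto
    obtain r s where rs: "s \<notin> M" "\<beta> s \<otimes> b = \<beta> r" using numerator[OF b] by blast
    have "\<beta> (h * r) = \<beta> s \<otimes> (\<beta> h \<otimes> b)" using b \<beta>(4) by (simp add: \<beta>(2) rs(2)[symmetric] B.m_lcomm)
    also have "\<dots> = \<zero>" using z \<beta>(4) by simp
    finally obtain u where u: "u \<notin> M" "u * (h * r) \<in> J" unfolding zero_iff by blast
    then have "h * (u * r) \<in> J" by (simp add: mult.left_commute)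
    then have "u * r \<in> J" by (rule nzd)
    then have "\<beta> r = \<zero>" unfolding zero_iff using u by blast
    then have "\<beta> s \<otimes> b = \<beta> s \<otimes> \<zero>" using rs \<beta>(4) by simp
    then have "b = \<zero>" using unit_cancel[OF rs(1) b] by simp
    then show "b \<in> Idl (set (take i [\<beta> h]))" unfolding I by simp
  qed
  moreover have "set [\<beta> h] \<subseteq> carrier B - Units B" using nonunit[OF h] \<beta>(4) by simp
  ultimately have "enat (length [\<beta> h]) \<le> local_depth B"
    unfolding local_depth_def by (intro Sup_upper CollectI exI[of _ "[\<beta> h]"]) blast
  then show ?thesis by (simp add: one_enat_def)
qed

text \<open>The class of g is nonzero in B but is annihilated by all of M. The numerator of a
  nonunit lies in M, so every nonunit kills this class and cannot begin a regular sequence.\<close>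

lemma local_depth_eq_0:
  assumes soc: "\<And>s. s \<in> M \<Longrightarrow> s * g \<in> J" and g: "\<And>u. u \<notin> M \<Longrightarrow> u * g \<notin> J"
  shows "local_depth B = 0"
proof -
  have "length xs = 0" if xs: "set xs \<subseteq> carrier B - Units B" "regular_sequence B xs" for xs
  proof (rule ccontr)
    assume "length xs \<noteq> 0"
    then obtain x ys where x: "xs = x # ys" by (cases xs) auto
    then have xc: "x \<in> carrier B" "x \<notin> Units B" using xs by auto
    obtain r s where rs: "s \<notin> M" "\<beta> s \<otimes> x = \<beta> r" using numerator[OF xc(1)] by blast
    have "r \<in> M"
    proof (rule ccontr)
      assume "r \<notin> M"
      then have "\<beta> s \<otimes> x \<in> Units B" using rs unit by simp
      then have "x \<in> Units B" using B.prod_unit_l[OF _ unit[OF rs(1)] \<beta>(4) xc(1)] by simp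
      then show False using xc by simp
    qed
    then have "\<beta> (r * g) = \<zero>" unfolding zero_iff using soc one_notin_M by (metis mult_1)
    then have "\<beta> s \<otimes> (x \<otimes> \<beta> g) = \<beta> s \<otimes> \<zero>" using xc \<beta>(4) by (simp add: \<beta>(2) rs(2)[symmetric] B.m_assoc)
    then have z: "x \<otimes> \<beta> g = \<zero>" using unit_cancel[OF rs(1)] xc \<beta>(4) by simp
    have I: "Idl {} = {\<zero>}"
      using B.genideal_minimal[OF B.zeroideal, of "{}"]
        additive_subgroup.zero_closed[OF ideal.axioms(1)[OF B.genideal_ideal[of "{}"]]] by auto
    have "\<forall>i<length xs. \<forall>r\<in>carrier B. xs ! i \<otimes> r \<in> Idl (set (take i xs)) \<longrightarrow> r \<in> Idl (set (take i xs))"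
      using xs(2) unfolding regular_sequence_def by blast
    from this[rule_format, of 0 "\<beta> g"] have "\<beta> g = \<zero>" using z \<beta>(4) by (simp add: x I)
    then show False unfolding zero_iff using g by blast
  qed
  then have "local_depth B \<le> 0"
    unfolding local_depth_def by (intro Sup_least) (auto simp: zero_enat_def)
  then show ?thesis by simp
qed

text \<open>The image of w is not nilpotent, and 1 - w b is a unit for every fraction b = r / s
  because its numerator s - w r lies outside M.\<close>

lemma krull_dim_ge_1:
  assumes w: "w \<in> M" and nil: "\<And>u n. u \<notin> M \<Longrightarrow> u * w ^ n \<notin> J"
  shows "krull_dim B \<ge> 1"
proof (rule B.krull_dim_ge_1)
  show "\<beta> w \<in> carrier B" by (rule \<beta>)
  show "\<beta> w [^] n \<noteq> \<zero>" for n :: nat unfolding \<beta>(7)[symmetric] zero_iff using nil by blast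
  fix b assume b: "b \<in> carrier B"
  obtain r s where rs: "s \<notin> M" "\<beta> s \<otimes> b = \<beta> r" using numerator[OF b] by blast
  have "s - w * r \<notin> M"
  proof
    assume "s - w * r \<in> M"
    moreover have "w * r \<in> M" using mult_in_M_iff w by blast
    ultimately have "s \<in> M" using M_add by fastforce
    then show False using rs by simp
  qed
  then have "\<beta> (s - w * r) \<in> Units B" by (rule unit)
  also have "\<beta> (s - w * r) = \<beta> s \<otimes> (\<one> \<ominus> \<beta> w \<otimes> b)"
    unfolding \<beta>(6) \<beta>(2) rs(2)[symmetric] using b \<beta>(4)[of s] \<beta>(4)[of w] by algebra
  finally have u: "\<beta> s \<otimes> (\<one> \<ominus> \<beta> w \<otimes> b) \<in> Units B" .
  show "\<one> \<ominus> \<beta> w \<otimes> b \<in> Units B"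
    by (rule B.prod_unit_l[OF u unit[OF rs(1)] \<beta>(4) B.minus_closed[OF B.one_closed B.m_closed[OF \<beta>(4) b]]])
qed

lemma preimage_prime:
  assumes P: "primeideal P B"
  shows "primeideal (\<beta> -` P) class_ring" "J \<subseteq> \<beta> -` P"
proof -
  interpret P: primeideal P B by (rule P)
  have "\<one> \<notin> P" using P.one_imp_carrier P.I_notcarr by blast
  then show "primeideal (\<beta> -` P) class_ring"
    unfolding class_prime_iff class_ideal_iff
    using P.zero_closed P.a_closed P.I_l_closed P.I_prime by (auto simp: \<beta>)
  show "J \<subseteq> \<beta> -` P"
  proof
    fix j assume "j \<in> J"
    then have "\<beta> j = \<zero>" unfolding zero_iff using one_notin_M by (metis mult_1)
    then show "j \<in> \<beta> -` P" using P.zero_closed by simp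
  qed
qed

text \<open>Chains of primes of B thus pull back to chains of the same length over J, and the
  dimension of B can be bounded in S. Strictness holds because an element of B and its numerator
  differ by a unit.\<close>

lemma preimage_strict:
  assumes P: "primeideal P B" and Q: "primeideal Q B" and PQ: "P \<subset> Q"
  shows "\<beta> -` P \<subset> \<beta> -` Q"
proof -
  interpret P: primeideal P B by (rule P)
  interpret Q: primeideal Q B by (rule Q)
  obtain b where b: "b \<in> Q" "b \<notin> P" using PQ by blast
  then have bc: "b \<in> carrier B" using Q.Icarr by blast
  obtain r s where rs: "s \<notin> M" "\<beta> s \<otimes> b = \<beta> r" using numerator[OF bc] by blast
  have "\<beta> r \<in> Q" using Q.I_l_closed[OF b(1) \<beta>(4)] rs(2) by metis
  moreover have "\<beta> r \<notin> P"
  proof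
    assume "\<beta> r \<in> P"
    then have "\<beta> s \<in> P" using P.I_prime[OF \<beta>(4) bc] rs(2) b(2) by metis
    moreover obtain c where "c \<in> carrier B" "c \<otimes> \<beta> s = \<one>" using unit[OF rs(1)] unfolding Units_def by blast
    ultimately have "\<one> \<in> P" using P.I_l_closed by metis
    then show False using P.one_imp_carrier P.I_notcarr by blast
  qed
  ultimately show ?thesis using PQ by auto
qed

lemma krull_dim_le_1:
  assumes "\<And>P Q N. primeideal P class_ring \<Longrightarrow> primeideal Q class_ring \<Longrightarrow> primeideal N class_ring \<Longrightarrow>
    J \<subseteq> P \<Longrightarrow> P \<subset> Q \<Longrightarrow> Q \<subset> N \<Longrightarrow> False"
  shows "krull_dim B \<le> 1"
  unfolding krull_dim_def
proof (rule Sup_least, clarify)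
  fix n and P :: "nat \<Rightarrow> 'b set"
  assume P: "\<forall>i\<le>n. primeideal (P i) B" "\<forall>i<n. P i \<subset> P (Suc i)"
  have "n \<le> 1"
  proof (rule ccontr)
    assume "\<not> n \<le> 1"
    then have p: "primeideal (P 0) B" "primeideal (P (Suc 0)) B" "primeideal (P (Suc (Suc 0))) B"
      and s: "P 0 \<subset> P (Suc 0)" "P (Suc 0) \<subset> P (Suc (Suc 0))" using P by auto
    show False
      using assms[OF preimage_prime(1)[OF p(1)] preimage_prime(1)[OF p(2)] preimage_prime(1)[OF p(3)]
          preimage_prime(2)[OF p(1)] preimage_strict[OF p(1,2) s(1)] preimage_strict[OF p(2,3) s(2)]] .
  qed
  then show "enat n \<le> 1" by (simp add: one_enat_def)
qed

end

section \<open>Criteria for a quotient to be Cohen-Macaulay or not\<close>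

lemma class_quot:
  fixes J :: "'s::comm_ring_1 set"
  assumes J: "ideal J class_ring"
  defines "A \<equiv> class_ring Quot J" and "\<pi> \<equiv> \<lambda>s. J +>\<^bsub>class_ring\<^esub> s"
  shows "cring A" "\<pi> \<in> Ring.ring_hom class_ring A" "carrier A = range \<pi>" "\<pi> s = \<zero>\<^bsub>A\<^esub> \<longleftrightarrow> s \<in> J"
proof -
  interpret J: ideal J class_ring by (rule J)
  show "cring A" unfolding A_def by (rule J.quotient_is_cring[OF class_cring.is_cring])
  show "\<pi> \<in> Ring.ring_hom class_ring A" unfolding A_def \<pi>_def by (rule J.rcos_ring_hom)
  show "carrier A = range \<pi>" unfolding A_def \<pi>_def FactRing_def A_RCOSETS_def' by auto
  have "\<zero>\<^bsub>A\<^esub> = J" unfolding A_def FactRing_def by simp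
  then show "\<pi> s = \<zero>\<^bsub>A\<^esub> \<longleftrightarrow> s \<in> J"
    unfolding \<pi>_def using ring.a_rcos_zero[OF class_ring.ring_axioms J, of s] J.rcos_const_imp_mem[of s] by auto
qed

text \<open>The map is the composite of the residue map S to S/J and the localization at m, and M is
  the preimage of m in S.\<close>

lemma quotient_localization:
  fixes J :: "'s::comm_ring_1 set"
  assumes J: "ideal J class_ring"
  defines "A \<equiv> class_ring Quot J"
  assumes m: "primeideal m A"
  defines "M \<equiv> {s. J +>\<^bsub>class_ring\<^esub> s \<in> m}"
  obtains \<beta> where "quotient_localization (localization A (carrier A - m)) J M \<beta>"
proof -
  define \<pi> where "\<pi> = (\<lambda>s. J +>\<^bsub>class_ring\<^esub> s)"
  have q: "cring A" "\<pi> \<in> Ring.ring_hom class_ring A" "carrier A = range \<pi>" "\<pi> s = \<zero>\<^bsub>A\<^esub> \<longleftrightarrow> s \<in> J" for s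
    unfolding A_def \<pi>_def by (rule class_quot[OF J])+
  interpret A: cring A by (rule q(1))
  interpret m: primeideal m A by (rule m)
  note \<pi> = class_ring_homD[OF q(2) A.ring_axioms]
  have M_eq: "M = {s. \<pi> s \<in> m}" unfolding M_def \<pi>_def by simp
  then have M: "s \<in> M \<longleftrightarrow> \<pi> s \<in> m" for s by simp
  have m1: "\<one>\<^bsub>A\<^esub> \<notin> m" using m.one_imp_carrier m.I_notcarr by blast
  interpret L: mult_submonoid A "carrier A - m"
  proof
    show "s \<otimes>\<^bsub>A\<^esub> t \<in> carrier A - m" if "s \<in> carrier A - m" "t \<in> carrier A - m" for s t
      using m.I_prime[of s t] that by blast
  qed (use m1 in auto)
  define \<beta> where "\<beta> = (\<lambda>s. loc_rel A (carrier A - m) `` {(\<pi> s, \<one>\<^bsub>A\<^esub>)})"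
  have comp: "\<beta> = (\<lambda>r. loc_rel A (carrier A - m) `` {(r, \<one>\<^bsub>A\<^esub>)}) \<circ> \<pi>" unfolding \<beta>_def by auto
  have "quotient_localization (localization A (carrier A - m)) J M \<beta>"
  proof (intro quotient_localization.intro[OF L.cring_Loc] quotient_localization_axioms.intro)
    show "\<beta> \<in> Ring.ring_hom class_ring (localization A (carrier A - m))"
      unfolding comp by (rule ring_hom_trans[OF q(2) L.frac_one_hom])
    show "J \<subseteq> M" unfolding M subset_iff using q(4) m.zero_closed by metis
    show "ideal J class_ring" by (rule J)
    show "primeideal M class_ring"
      unfolding class_prime_iff class_ideal_iff M_eq
      using m.zero_closed m.a_closed m.I_l_closed m.I_prime m1 by (auto simp: \<pi>)
    fix b assume "b \<in> carrier (localization A (carrier A - m))"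
    then obtain r s where *: "r \<in> carrier A" "s \<in> carrier A - m"
      "loc_rel A (carrier A - m) `` {(s, \<one>\<^bsub>A\<^esub>)} \<otimes>\<^bsub>localization A (carrier A - m)\<^esub> b = loc_rel A (carrier A - m) `` {(r, \<one>\<^bsub>A\<^esub>)}"
      using L.frac_numerator by blast
    have "r \<in> range \<pi>" "s \<in> range \<pi>" using *(1,2) q(3) by simp_all
    then obtain r' s' where "r = \<pi> r'" "s = \<pi> s'" by (elim rangeE)
    then show "\<exists>r s. s \<notin> M \<and> \<beta> s \<otimes>\<^bsub>localization A (carrier A - m)\<^esub> b = \<beta> r"
      unfolding M \<beta>_def using * by (intro exI[of _ r'] exI[of _ s']) auto
  next
    show "\<beta> s \<in> Units (localization A (carrier A - m))" if "s \<notin> M" for s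
      unfolding \<beta>_def using that L.frac_one_Unit[of "\<pi> s"] \<pi>(4) unfolding M by simp
    show "(\<beta> r = \<zero>\<^bsub>localization A (carrier A - m)\<^esub>) = (\<exists>u. u \<notin> M \<and> u * r \<in> J)" for r
    proof -
      have "(\<beta> r = \<zero>\<^bsub>localization A (carrier A - m)\<^esub>) \<longleftrightarrow> (\<exists>u\<in>carrier A - m. u \<otimes>\<^bsub>A\<^esub> \<pi> r = \<zero>\<^bsub>A\<^esub>)"
        unfolding \<beta>_def by (rule L.frac_one_zero_iff[OF \<pi>(4)])
      also have "\<dots> \<longleftrightarrow> (\<exists>u. u \<notin> M \<and> \<pi> u \<otimes>\<^bsub>A\<^esub> \<pi> r = \<zero>\<^bsub>A\<^esub>)" unfolding q(3) M by blast
      also have "\<dots> \<longleftrightarrow> (\<exists>u. u \<notin> M \<and> u * r \<in> J)" unfolding \<pi>(2)[symmetric] q(4) ..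
      finally show ?thesis .
    qed
  qed
  then show ?thesis by (rule that)
qed

text \<open>Finitely many generators of the preimage of an ideal map to generators of the
  ideal.\<close>

lemma noetherian_quot:
  fixes J :: "'s::comm_ring_1 set"
  assumes J: "ideal J class_ring" and N: "noetherian_ring (class_ring :: 's ring)"
  shows "noetherian_ring (class_ring Quot J)"
proof -
  define A where "A = class_ring Quot J"
  define \<pi> where "\<pi> = (\<lambda>s. J +>\<^bsub>class_ring\<^esub> s)"
  have q: "cring A" "\<pi> \<in> Ring.ring_hom class_ring A" "carrier A = range \<pi>"
    unfolding A_def \<pi>_def by (rule class_quot[OF J])+
  interpret A: cring A by (rule q(1))
  note \<pi> = class_ring_homD[OF q(2) A.ring_axioms]
  have preim: "ideal (\<pi> -` I) class_ring" if "ideal I A" for I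
  proof -
    interpret I: ideal I A by (rule that)
    show ?thesis unfolding class_ideal_iff using I.zero_closed I.a_closed I.I_l_closed by (auto simp: \<pi>)
  qed
  have "noetherian_ring A"
  proof (rule A.noetherian_ringI)
    fix I assume I: "ideal I A"
    obtain X where X: "finite X" "\<pi> -` I = Idl\<^bsub>class_ring\<^esub> X"
      using noetherian_ring.finetely_gen[OF N preim[OF I]] by auto
    have sub: "\<pi> ` X \<subseteq> carrier A" using \<pi>(4) by blast
    have "X \<subseteq> \<pi> -` I" unfolding X(2) by (rule ring.genideal_self[OF class_ring.ring_axioms]) simp
    then have "\<pi> ` X \<subseteq> I" by blast
    then have 1: "Idl\<^bsub>A\<^esub> (\<pi> ` X) \<subseteq> I" by (rule A.genideal_minimal[OF I])
    have "X \<subseteq> \<pi> -` (Idl\<^bsub>A\<^esub> (\<pi> ` X))" using A.genideal_self[OF sub] by blast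
    then have "\<pi> -` I \<subseteq> \<pi> -` (Idl\<^bsub>A\<^esub> (\<pi> ` X))" unfolding X(2)
      by (rule ring.genideal_minimal[OF class_ring.ring_axioms preim[OF A.genideal_ideal[OF sub]]])
    moreover have "I \<subseteq> range \<pi>" unfolding q(3)[symmetric] using ideal.Icarr[OF I] by (rule subsetI)
    ultimately have "I \<subseteq> Idl\<^bsub>A\<^esub> (\<pi> ` X)" by blast
    then show "\<exists>Y\<subseteq>carrier A. finite Y \<and> I = Idl\<^bsub>A\<^esub> Y" using 1 X(1) sub by blast
  qed
  then show ?thesis unfolding A_def .
qed

text \<open>At each maximal ideal the local ring has depth at least 1 by \<open>nzd\<close> and
  dimension at most 1 by \<open>chain\<close>. As depth never exceeds dimension, both are 1.\<close>

lemma perfect_idealI: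
  fixes J :: "'s::comm_ring_1 set"
  assumes J: "ideal J class_ring" and N: "noetherian_ring (class_ring :: 's ring)"
    and nzd: "\<And>M. maximalideal M class_ring \<Longrightarrow> J \<subseteq> M \<Longrightarrow> \<exists>h\<in>M. \<forall>g. h * g \<in> J \<longrightarrow> g \<in> J"
    and chain: "\<And>P Q N. primeideal P class_ring \<Longrightarrow> primeideal Q class_ring \<Longrightarrow> primeideal N class_ring \<Longrightarrow>
      J \<subseteq> P \<Longrightarrow> P \<subset> Q \<Longrightarrow> Q \<subset> N \<Longrightarrow> False"
  shows "perfect_ideal J"
proof -
  define A where "A = class_ring Quot J"
  define \<pi> where "\<pi> = (\<lambda>s. J +>\<^bsub>class_ring\<^esub> s)"
  have q: "cring A" "\<pi> \<in> Ring.ring_hom class_ring A" "carrier A = range \<pi>"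
    unfolding A_def \<pi>_def by (rule class_quot[OF J])+
  interpret A: cring A by (rule q(1))
  note \<pi> = class_ring_homD[OF q(2) A.ring_axioms]
  have "local_depth (localization A (carrier A - m)) = krull_dim (localization A (carrier A - m))"
    if m: "maximalideal m A" for m
  proof -
    have mp: "primeideal m A" by (rule A.maximalideal_prime[OF m])
    define M where "M = {s. \<pi> s \<in> m}"
    obtain \<beta> where "quotient_localization (localization A (carrier A - m)) J M \<beta>"
      using quotient_localization[OF J mp[unfolded A_def]] unfolding A_def M_def \<pi>_def by blast
    then interpret L: quotient_localization "localization A (carrier A - m)" J M \<beta> .
    interpret m: maximalideal m A by (rule m)
    have "maximalideal M class_ring"
    proof (rule maximalidealI)
      show "ideal M class_ring" using L.M unfolding class_prime_iff by blast
      show "carrier class_ring \<noteq> M" using L.one_notin_M by auto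
      fix K :: "'s set" assume K: "ideal K class_ring" "M \<subseteq> K"
      have "ideal (\<pi> ` K) A" by (rule class_ring_hom_image_ideal[OF q K(1)])
      moreover have "m \<subseteq> \<pi> ` K"
      proof
        fix a assume a: "a \<in> m"
        have "a \<in> range \<pi>" unfolding q(3)[symmetric] using m.Icarr[OF a] .
        then obtain r where "a = \<pi> r" by (rule rangeE)
        then show "a \<in> \<pi> ` K" using a K(2) unfolding M_def by blast
      qed
      moreover have "\<pi> ` K \<subseteq> carrier A" using \<pi>(4) by blast
      ultimately consider "\<pi> ` K = m" | "\<pi> ` K = carrier A" using m.I_maximal by blast
      then show "K = M \<or> K = carrier class_ring"
      proof cases
        case 1
        then have "K = M" using K(2) unfolding M_def by blast
        then show ?thesis ..
      next
        case 2
        have "1 \<in> K"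
        proof -
          have "\<pi> 1 \<in> \<pi> ` K" unfolding 2 by (rule \<pi>(4))
          then obtain k where k: "k \<in> K" "\<pi> k = \<pi> 1" by (metis imageE)
          then have "\<pi> (1 - k) = \<zero>\<^bsub>A\<^esub>" unfolding \<pi>(6) using \<pi>(4) by (simp add: A.r_right_minus_eq)
          then have "1 - k \<in> M" unfolding M_def using m.zero_closed by simp
          then have "1 - k + k \<in> K" using K k(1) unfolding class_ideal_iff by blast
          then show ?thesis by simp
        qed
        then have "r \<in> K" for r using K(1) unfolding class_ideal_iff by (metis mult.right_neutral)
        then show ?thesis by auto
      qed
    qed
    then obtain h where h: "h \<in> M" "\<forall>g. h * g \<in> J \<longrightarrow> g \<in> J" using nzd[OF _ L.JM] by auto
    have "1 \<le> local_depth (localization A (carrier A - m))"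
      by (rule L.local_depth_ge_1[OF h(1)]) (rule h(2)[rule_format])
    moreover have "krull_dim (localization A (carrier A - m)) \<le> 1" by (rule L.krull_dim_le_1) (rule chain)
    moreover have "local_depth (localization A (carrier A - m)) \<le> krull_dim (localization A (carrier A - m))"
      by (rule local_depth_le_krull_dim) (rule L.B.is_cring)
    ultimately show ?thesis by order
  qed
  moreover have "noetherian_ring A" unfolding A_def by (rule noetherian_quot[OF J N])
  ultimately show ?thesis
    unfolding perfect_ideal_def cohen_macaulay_def A_def[symmetric] using q(1) by simp
qed

text \<open>The residue class of \<open>g\<close> makes the depth at \<open>M\<close> zero, and \<open>w\<close> makes the dimension positive.\<close>

lemma not_perfect_idealI:
  fixes J :: "'s::comm_ring_1 set"
  assumes J: "ideal J class_ring" and M: "maximalideal M class_ring" "J \<subseteq> M"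
    and soc: "\<And>s. s \<in> M \<Longrightarrow> s * g \<in> J" "\<And>u. u \<notin> M \<Longrightarrow> u * g \<notin> J"
    and w: "w \<in> M" "\<And>u n. u \<notin> M \<Longrightarrow> u * w ^ n \<notin> J"
  shows "\<not> perfect_ideal J"
proof
  define A where "A = class_ring Quot J"
  define \<pi> where "\<pi> = (\<lambda>s. J +>\<^bsub>class_ring\<^esub> s)"
  assume "perfect_ideal J"
  then have cm: "\<And>m. maximalideal m A \<Longrightarrow>
      local_depth (localization A (carrier A - m)) = krull_dim (localization A (carrier A - m))"
    unfolding perfect_ideal_def cohen_macaulay_def A_def by blast
  have q: "cring A" "\<pi> \<in> Ring.ring_hom class_ring A" "carrier A = range \<pi>" "\<pi> s = \<zero>\<^bsub>A\<^esub> \<longleftrightarrow> s \<in> J" for s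
    unfolding A_def \<pi>_def by (rule class_quot[OF J])+
  interpret A: cring A by (rule q(1))
  note \<pi> = class_ring_homD[OF q(2) A.ring_axioms]
  have Mi: "0 \<in> M" "\<And>a b. a \<in> M \<Longrightarrow> b \<in> M \<Longrightarrow> a + b \<in> M" "\<And>a r. a \<in> M \<Longrightarrow> r * a \<in> M"
    using maximalideal.axioms(1)[OF M(1)] unfolding class_ideal_iff by blast+
  define m where "m = \<pi> ` M"
  have mem: "\<pi> s \<in> m \<longleftrightarrow> s \<in> M" for s
  proof
    assume "\<pi> s \<in> m"
    then obtain k where k: "k \<in> M" "\<pi> s = \<pi> k" unfolding m_def by blast
    then have "\<pi> (s - k) = \<zero>\<^bsub>A\<^esub>" unfolding \<pi>(6) using \<pi>(4) by (simp add: A.r_right_minus_eq)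
    then have "s - k \<in> M" unfolding q(4) using M(2) by blast
    then have "s - k + k \<in> M" using k(1) by (rule Mi(2))
    then show "s \<in> M" by simp
  qed (simp add: m_def)
  have 1: "1 \<notin> M"
  proof
    assume "1 \<in> M"
    then have "r \<in> M" for r using Mi(3)[of 1 r] by simp
    then have "carrier class_ring = M" by auto
    then show False using maximalideal.I_notcarr[OF M(1)] by blast
  qed
  have mi: "ideal m A" unfolding m_def by (rule class_ring_hom_image_ideal[OF q(1-3) maximalideal.axioms(1)[OF M(1)]])
  have m: "maximalideal m A"
  proof (rule maximalidealI[OF mi])
    have "\<one>\<^bsub>A\<^esub> \<notin> m" using mem[of 1] 1 by (simp add: \<pi>(3))
    then show "carrier A \<noteq> m" using A.one_closed by metis
    fix K assume K: "ideal K A" "m \<subseteq> K" "K \<subseteq> carrier A"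
    interpret K: ideal K A by (rule K(1))
    have "ideal (\<pi> -` K) class_ring"
      unfolding class_ideal_iff using K.zero_closed K.a_closed K.I_l_closed by (auto simp: \<pi>)
    moreover have "M \<subseteq> \<pi> -` K" using K(2) mem by blast
    ultimately consider "\<pi> -` K = M" | "\<pi> -` K = carrier class_ring"
      using maximalideal.I_maximal[OF M(1), of "\<pi> -` K"] by auto
    then show "K = m \<or> K = carrier A"
    proof cases
      case 1
      have "K \<subseteq> m"
      proof
        fix a assume a: "a \<in> K"
        have "a \<in> range \<pi>" unfolding q(3)[symmetric] using K(3) a by (rule subsetD)
        then obtain s where s: "a = \<pi> s" by (rule rangeE)
        then have "s \<in> M" using a unfolding 1[symmetric] by simp
        then show "a \<in> m" unfolding s m_def by (rule imageI)
      qed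
      then show ?thesis using K(2) by simp
    next
      case 2
      then have "1 \<in> \<pi> -` K" by (simp only: partial_object.simps UNIV_I)
      then have "\<pi> 1 \<in> K" by simp
      then show ?thesis using K.one_imp_carrier by (simp add: \<pi>(3))
    qed
  qed
  have mp: "primeideal m A" by (rule A.maximalideal_prime[OF m])
  have Meq: "{s. J +>\<^bsub>class_ring\<^esub> s \<in> m} = M" using mem unfolding \<pi>_def by simp
  obtain \<beta> where "quotient_localization (localization A (carrier A - m)) J {s. J +>\<^bsub>class_ring\<^esub> s \<in> m} \<beta>"
    using quotient_localization[OF J mp[unfolded A_def]] unfolding A_def by blast
  then have "quotient_localization (localization A (carrier A - m)) J M \<beta>" unfolding Meq .
  then interpret L: quotient_localization "localization A (carrier A - m)" J M \<beta> .
  have "local_depth (localization A (carrier A - m)) = 0" by (rule L.local_depth_eq_0[OF soc])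
  moreover have "1 \<le> krull_dim (localization A (carrier A - m))" by (rule L.krull_dim_ge_1[OF w])
  ultimately show False using cm[OF m] by simp
qed

section \<open>Hilbert's basis theorem\<close>

text \<open>The ring is named by its type, so that the basis theorem becomes an implication from a
  type to its polynomial type and can be iterated three times.\<close>

definition fg_ideals :: "'a::comm_ring_1 itself \<Rightarrow> bool" where
  "fg_ideals _ \<longleftrightarrow> (\<forall>I::'a set. ideal I class_ring \<longrightarrow> (\<exists>X. finite X \<and> I = Idl\<^bsub>class_ring\<^esub> X))"

lemma class_Idl_ideal: "ideal (Idl\<^bsub>class_ring\<^esub> X) (class_ring :: 'a::comm_ring_1 ring)"
  by (rule ring.genideal_ideal[OF class_ring.ring_axioms]) simp

lemma class_Idl_self: "X \<subseteq> Idl\<^bsub>class_ring\<^esub> (X :: 'a::comm_ring_1 set)"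
  by (rule ring.genideal_self[OF class_ring.ring_axioms]) simp

lemma class_Idl_minimal: "ideal I class_ring \<Longrightarrow> X \<subseteq> I \<Longrightarrow> Idl\<^bsub>class_ring\<^esub> (X :: 'a::comm_ring_1 set) \<subseteq> I"
  by (rule ring.genideal_minimal[OF class_ring.ring_axioms])

lemma fg_idealsD:
  assumes "fg_ideals TYPE('a::comm_ring_1)" "ideal (I :: 'a set) class_ring"
  obtains X where "finite X" "X \<subseteq> I" "I = Idl\<^bsub>class_ring\<^esub> X"
proof -
  obtain X where X: "finite X" "I = Idl\<^bsub>class_ring\<^esub> X" using assms unfolding fg_ideals_def by blast
  then show ?thesis using that class_Idl_self by blast
qed

text \<open>The union of the chain is an ideal, and its finitely many generators already occur at
  one stage.\<close>

lemma fg_ideals_chain: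
  assumes fg: "fg_ideals TYPE('a::comm_ring_1)"
    and I: "\<And>n. ideal (I n :: 'a set) class_ring" and mono: "\<And>n. I n \<subseteq> I (Suc n)"
  obtains N where "\<And>n. n \<ge> N \<Longrightarrow> I n = I N"
proof -
  have m: "I n \<subseteq> I k" if "n \<le> k" for n k using lift_Suc_mono_le[of I n k] mono that by simp
  have U: "ideal (\<Union>n. I n) class_ring"
    unfolding class_ideal_iff
  proof (intro conjI ballI allI)
    show "0 \<in> (\<Union>n. I n)" using I[of 0] unfolding class_ideal_iff by blast
    fix a b assume "a \<in> (\<Union>n. I n)" "b \<in> (\<Union>n. I n)"
    then obtain n k where "a \<in> I n" "b \<in> I k" by blast
    then have "a \<in> I (max n k)" "b \<in> I (max n k)" using m[of n "max n k"] m[of k "max n k"] by auto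
    then show "a + b \<in> (\<Union>n. I n)" using I[of "max n k"] unfolding class_ideal_iff by blast
  next
    fix a r assume "a \<in> (\<Union>n. I n)"
    then obtain n where "a \<in> I n" by blast
    then have "r * a \<in> I n" using I[of n] unfolding class_ideal_iff by blast
    then show "r * a \<in> (\<Union>n. I n)" by blast
  qed
  obtain X where X: "finite X" "X \<subseteq> (\<Union>n. I n)" "(\<Union>n. I n) = Idl\<^bsub>class_ring\<^esub> X"
    by (rule fg_idealsD[OF fg U])
  have "\<exists>N. X \<subseteq> I N" using X(1,2)
  proof (induction X)
    case (insert x X)
    then obtain N k where "X \<subseteq> I N" "x \<in> I k" by blast
    then have "insert x X \<subseteq> I (max N k)" using m[of N "max N k"] m[of k "max N k"] by auto
    then show ?case by blast
  qed simp
  then obtain N where "X \<subseteq> I N" by blast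
  then have "(\<Union>n. I n) \<subseteq> I N" unfolding X(3) by (rule class_Idl_minimal[OF I])
  then have "I n = I N" if "n \<ge> N" for n using m[OF that] by blast
  then show ?thesis by (rule that)
qed

text \<open>Hilbert's argument with the ideals L n of the n-th coefficients of members of I of
  degree at most n. They increase and become stationary at some N; polynomials in I whose
  coefficients generate L n, for all n up to N, generate I, because leading coefficients can be
  cancelled one after the other.\<close>

theorem fg_ideals_poly:
  assumes fg: "fg_ideals TYPE('a::comm_ring_1)"
  shows "fg_ideals TYPE('a poly)"
  unfolding fg_ideals_def
proof (intro allI impI)
  fix I :: "'a poly set" assume "ideal I class_ring"
  then have I: "0 \<in> I" "\<And>p q. p \<in> I \<Longrightarrow> q \<in> I \<Longrightarrow> p + q \<in> I" "\<And>p r. p \<in> I \<Longrightarrow> r * p \<in> I"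
    unfolding class_ideal_iff by blast+
  define L where "L n = {coeff p n | p. p \<in> I \<and> degree p \<le> n}" for n
  have L_ideal: "ideal (L n) class_ring" for n
    unfolding class_ideal_iff
  proof (intro conjI ballI allI)
    show "0 \<in> L n" unfolding L_def using I(1) by (intro CollectI exI[of _ 0]) simp
    fix a assume "a \<in> L n"
    then obtain p where p: "p \<in> I" "degree p \<le> n" "a = coeff p n" unfolding L_def by blast
    { fix r
      have "[:r:] * p \<in> I" by (rule I(3)[OF p(1)])
      moreover have "degree ([:r:] * p) \<le> n" using degree_mult_le[of "[:r:]" p] p(2) by simp
      ultimately show "r * a \<in> L n" unfolding L_def p(3)
        by (intro CollectI exI[of _ "[:r:] * p"]) simp }
    fix b assume "b \<in> L n"
    then obtain q where q: "q \<in> I" "degree q \<le> n" "b = coeff q n" unfolding L_def by blast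
    show "a + b \<in> L n" unfolding L_def p(3) q(3)
      using I(2)[OF p(1) q(1)] degree_add_le[OF p(2) q(2)] by (intro CollectI exI[of _ "p + q"]) simp
  qed
  have L_mono: "L n \<subseteq> L (Suc n)" for n
  proof
    fix a assume "a \<in> L n"
    then obtain p where p: "p \<in> I" "degree p \<le> n" "a = coeff p n" unfolding L_def by blast
    have "degree (pCons 0 p) \<le> Suc n" using p(2) by (auto simp: degree_pCons_le intro: order_trans)
    moreover have "pCons 0 p \<in> I" using I(3)[OF p(1), of "[:0, 1:]"] by simp
    ultimately show "a \<in> L (Suc n)" unfolding L_def p(3)
      by (intro CollectI exI[of _ "pCons 0 p"]) simp
  qed
  obtain N where N: "\<And>n. n \<ge> N \<Longrightarrow> L n = L N" using fg_ideals_chain[of L, OF fg L_ideal L_mono] by blast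
  have "\<exists>G. finite G \<and> G \<subseteq> I \<and> (\<forall>g\<in>G. degree g \<le> n) \<and> L n \<subseteq> Idl\<^bsub>class_ring\<^esub> ((\<lambda>g. coeff g n) ` G)" for n
  proof -
    obtain X where X: "finite X" "X \<subseteq> L n" "L n = Idl\<^bsub>class_ring\<^esub> X"
      by (rule fg_idealsD[OF fg L_ideal])
    have "\<forall>x\<in>X. \<exists>p. p \<in> I \<and> degree p \<le> n \<and> x = coeff p n" using X(2) unfolding L_def by blast
    then obtain P where P: "\<forall>x\<in>X. P x \<in> I \<and> degree (P x) \<le> n \<and> x = coeff (P x) n" by metis
    then have "(\<lambda>g. coeff g n) ` (P ` X) = X" by force
    then show ?thesis using X P by (intro exI[of _ "P ` X"]) auto
  qed
  then obtain G where G: "\<And>n. finite (G n)" "\<And>n. G n \<subseteq> I" "\<And>n g. g \<in> G n \<Longrightarrow> degree g \<le> n"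
    "\<And>n. L n \<subseteq> Idl\<^bsub>class_ring\<^esub> ((\<lambda>g. coeff g n) ` G n)" by metis
  define X where "X = (\<Union>n\<le>N. G n)"
  have Xf: "finite X" "X \<subseteq> I" unfolding X_def using G by auto
  let ?K = "Idl\<^bsub>class_ring\<^esub> X"
  have K: "0 \<in> ?K" "\<And>p q. p \<in> ?K \<Longrightarrow> q \<in> ?K \<Longrightarrow> p + q \<in> ?K" "\<And>p r. p \<in> ?K \<Longrightarrow> r * p \<in> ?K"
    using class_Idl_ideal[of X] unfolding class_ideal_iff by blast+
  have lead: "\<exists>q\<in>?K. degree q \<le> n \<and> coeff q n = a" if a: "a \<in> L n" for a n
  proof -
    \<comment> \<open>Beyond N the ideal L n is already L N, so a generator of degree at most N has
      the required coefficient; the factor t^(n - k) moves it to position n.\<close>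
    define k where "k = min n N"
    have k: "k \<le> n" "k \<le> N" "L n = L k" using N[of n] unfolding k_def by (auto simp: min_def)
    let ?T = "{coeff q k | q. q \<in> ?K \<and> degree q \<le> k}"
    have "ideal ?T class_ring"
      unfolding class_ideal_iff
    proof (intro conjI ballI allI)
      show "0 \<in> ?T" using K(1) by (intro CollectI exI[of _ 0]) simp
      fix a assume "a \<in> ?T"
      then obtain p where p: "p \<in> ?K" "degree p \<le> k" "a = coeff p k" by blast
      { fix r
        have "[:r:] * p \<in> ?K" by (rule K(3)[OF p(1)])
        moreover have "degree ([:r:] * p) \<le> k" using degree_mult_le[of "[:r:]" p] p(2) by simp
        ultimately show "r * a \<in> ?T" unfolding p(3)
          by (intro CollectI exI[of _ "[:r:] * p"]) simp }
      fix b assume "b \<in> ?T"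
      then obtain q where q: "q \<in> ?K" "degree q \<le> k" "b = coeff q k" by blast
      show "a + b \<in> ?T" unfolding p(3) q(3)
        using K(2)[OF p(1) q(1)] degree_add_le[OF p(2) q(2)] by (intro CollectI exI[of _ "p + q"]) simp
    qed
    moreover have "(\<lambda>g. coeff g k) ` G k \<subseteq> ?T"
    proof
      fix c assume "c \<in> (\<lambda>g. coeff g k) ` G k"
      then obtain g where g: "g \<in> G k" "c = coeff g k" by blast
      then have "g \<in> ?K" using class_Idl_self[of X] k(2) unfolding X_def by blast
      then show "c \<in> ?T" using g G(3)[OF g(1)] by blast
    qed
    ultimately have "Idl\<^bsub>class_ring\<^esub> ((\<lambda>g. coeff g k) ` G k) \<subseteq> ?T" by (rule class_Idl_minimal)
    then have "a \<in> ?T" using a G(4)[of k] unfolding k(3) by blast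
    then obtain q where q: "q \<in> ?K" "degree q \<le> k" "a = coeff q k" by blast
    have "Polynomial.monom 1 (n - k) * q \<in> ?K" by (rule K(3)[OF q(1)])
    moreover have "degree (Polynomial.monom 1 (n - k) * q) \<le> n"
      using degree_mult_le[of "Polynomial.monom 1 (n - k)" q] degree_monom_le[of "1::'a" "n - k"] q(2) k(1) by linarith
    moreover have "coeff (Polynomial.monom 1 (n - k) * q) n = a"
      using k(1) q(3) by (simp add: coeff_monom_mult)
    ultimately show ?thesis by blast
  qed
  have "p \<in> ?K" if "p \<in> I" "degree p < m" for p m
    using that
  proof (induction m arbitrary: p)
    case (Suc m)
    have "coeff p m \<in> L m" unfolding L_def using Suc.prems by (intro CollectI exI[of _ p]) simp
    then obtain q where q: "q \<in> ?K" "degree q \<le> m" "coeff q m = coeff p m" using lead by blast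
    have "q \<in> I" using q(1) class_Idl_minimal[OF \<open>ideal I class_ring\<close> Xf(2)] by blast
    then have pq: "p - q \<in> I" using class_ideal_minus[OF \<open>ideal I class_ring\<close> Suc.prems(1)] by blast
    have "p - q \<in> ?K"
    proof (cases "p - q = 0")
      case False
      have "degree (p - q) \<le> m" using Suc.prems(2) q(2) by (intro degree_diff_le) auto
      moreover have "degree (p - q) \<noteq> m" using q(3) False leading_coeff_neq_0[of "p - q"] by auto
      ultimately show ?thesis using Suc.IH[OF pq] by simp
    qed (use K(1) in simp)
    then have "p - q + q \<in> ?K" using q(1) by (rule K(2))
    then show ?case by simp
  qed simp
  then have "I \<subseteq> ?K" by blast
  moreover have "?K \<subseteq> I" by (rule class_Idl_minimal[OF \<open>ideal I class_ring\<close> Xf(2)])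
  ultimately show "\<exists>X. finite X \<and> I = Idl\<^bsub>class_ring\<^esub> X" using Xf(1) by blast
qed

lemma fg_ideals_field: "fg_ideals TYPE('k::field)"
  unfolding fg_ideals_def
proof (intro allI impI)
  fix I :: "'k set" assume I: "ideal I class_ring"
  show "\<exists>X. finite X \<and> I = Idl\<^bsub>class_ring\<^esub> X"
  proof (cases "I \<subseteq> {0}")
    case True
    then have "I = Idl\<^bsub>class_ring\<^esub> {}"
      using class_Idl_minimal[OF I, of "{}"] class_Idl_ideal[of "{}::'k set"] unfolding class_ideal_iff by blast
    then show ?thesis by blast
  next
    case False
    then obtain a where a: "a \<in> I" "a \<noteq> 0" by blast
    have "c \<in> Idl\<^bsub>class_ring\<^esub> {a}" for c
    proof -
      have "(c / a) * a \<in> Idl\<^bsub>class_ring\<^esub> {a}"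
        using class_Idl_ideal[of "{a}"] class_Idl_self[of "{a}"] unfolding class_ideal_iff by blast
      then show ?thesis using a by simp
    qed
    then have "I = Idl\<^bsub>class_ring\<^esub> {a}" using class_Idl_minimal[OF I, of "{a}"] a by blast
    then show ?thesis by blast
  qed
qed

lemma noetherian_poly3: "noetherian_ring (class_ring :: 'k::field poly poly poly ring)"
proof (rule ring.noetherian_ringI[OF class_ring.ring_axioms])
  fix I :: "'k poly poly poly set" assume "ideal I class_ring"
  then show "\<exists>A\<subseteq>carrier class_ring. finite A \<and> I = Idl\<^bsub>class_ring\<^esub> A"
    using fg_ideals_poly[OF fg_ideals_poly[OF fg_ideals_poly[OF fg_ideals_field]]]
    unfolding fg_ideals_def by auto
qed

section \<open>Symmetric and Rees algebras\<close>

definition evp :: "('a::comm_ring_1 \<Rightarrow> 'r::comm_ring_1) \<Rightarrow> 'r \<Rightarrow> 'a poly \<Rightarrow> 'r" where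
  "evp \<phi> t p = poly (map_poly \<phi> p) t"

lemma evp_hom:
  assumes "comm_ring_hom \<phi>"
  shows "comm_ring_hom (evp \<phi> t)"
proof -
  interpret comm_ring_hom \<phi> by (rule assms)
  interpret m: map_poly_comm_ring_hom \<phi> ..
  show ?thesis
    by unfold_locales (simp_all add: evp_def m.hom_add m.hom_mult)
qed

lemma evp_pCons:
  assumes "comm_ring_hom \<phi>"
  shows "evp \<phi> t (pCons c p) = \<phi> c + t * evp \<phi> t p"
proof -
  interpret comm_ring_hom \<phi> by (rule assms)
  interpret m: map_poly_comm_ring_hom \<phi> ..
  show ?thesis by (simp add: evp_def map_poly_pCons_hom)
qed

lemma evp_0: "evp \<phi> t 0 = 0"
  by (simp add: evp_def)

text \<open>The threefold polynomial type occurs at two levels. Over the field it is S; over S it is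
  S[T1, T2, T3], which presents the symmetric and the Rees algebra of an ideal with three
  generators, and there \<open>X3\<close>, \<open>Y3\<close>, \<open>Z3\<close> are T1, T2, T3 while
  \<open>C3\<close> embeds S.\<close>

definition C3 :: "'a::comm_ring_1 \<Rightarrow> 'a poly poly poly" where
  "C3 c = [:[:[:c:]:]:]"

definition ev3 :: "('a::comm_ring_1 \<Rightarrow> 'r::comm_ring_1) \<Rightarrow> 'r \<Rightarrow> 'r \<Rightarrow> 'r \<Rightarrow> 'a poly poly poly \<Rightarrow> 'r" where
  "ev3 \<phi> t1 t2 t3 = evp (evp (evp \<phi> t1) t2) t3"

lemma ev3_hom: "comm_ring_hom \<phi> \<Longrightarrow> comm_ring_hom (ev3 \<phi> t1 t2 t3)"
  unfolding ev3_def by (intro evp_hom)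

lemma C3_hom: "comm_ring_hom (C3 :: 'a::comm_ring_1 \<Rightarrow> _)"
  by unfold_locales (simp_all add: C3_def one_pCons)

lemma ev3_simps:
  assumes \<phi>: "comm_ring_hom \<phi>"
  shows "ev3 \<phi> t1 t2 t3 (C3 c) = \<phi> c" "ev3 \<phi> t1 t2 t3 X3 = t1" "ev3 \<phi> t1 t2 t3 Y3 = t2" "ev3 \<phi> t1 t2 t3 Z3 = t3"
proof -
  interpret comm_ring_hom \<phi> by (rule \<phi>)
  interpret e1: comm_ring_hom "evp \<phi> t1" by (rule evp_hom[OF \<phi>])
  interpret e2: comm_ring_hom "evp (evp \<phi> t1) t2" by (intro evp_hom \<phi>)
  note [simp] = evp_pCons[OF \<phi>] evp_pCons[OF e1.comm_ring_hom_axioms] evp_pCons[OF e2.comm_ring_hom_axioms] evp_0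
  show "ev3 \<phi> t1 t2 t3 (C3 c) = \<phi> c" by (simp add: ev3_def C3_def)
  show "ev3 \<phi> t1 t2 t3 X3 = t1" by (simp add: ev3_def X3_def one_pCons)
  show "ev3 \<phi> t1 t2 t3 Y3 = t2" by (simp add: ev3_def Y3_def one_pCons)
  show "ev3 \<phi> t1 t2 t3 Z3 = t3" by (simp add: ev3_def Z3_def one_pCons)
qed

lemma poly3_induct [case_names const add X Y Z]:
  fixes p :: "'a::comm_ring_1 poly poly poly"
  assumes C: "\<And>c. Q (C3 c)" and add: "\<And>p q. Q p \<Longrightarrow> Q q \<Longrightarrow> Q (p + q)"
    and X: "\<And>p. Q p \<Longrightarrow> Q (X3 * p)" and Y: "\<And>p. Q p \<Longrightarrow> Q (Y3 * p)" and Z: "\<And>p. Q p \<Longrightarrow> Q (Z3 * p)"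
  shows "Q p"
proof -
  have 0: "Q 0" using C[of 0] by (simp add: C3_def)
  have 1: "Q [:[:r:]:]" for r
  proof (induction r)
    case (pCons c r)
    have "[:[:pCons c r:]:] = C3 c + X3 * [:[:r:]:]" by (simp add: C3_def X3_def)
    then show ?case using add[OF C X[OF pCons.IH]] by simp
  qed (simp add: 0)
  have 2: "Q [:q:]" for q
  proof (induction q)
    case (pCons r q)
    have "[:pCons r q:] = [:[:r:]:] + Y3 * [:q:]" by (simp add: Y3_def)
    then show ?case using add[OF 1 Y[OF pCons.IH]] by simp
  qed (simp add: 0)
  show ?thesis
  proof (induction p)
    case (pCons q p)
    have "pCons q p = [:q:] + Z3 * p" by (simp add: Z3_def)
    then show ?case using add[OF 2 Z[OF pCons.IH]] by simp
  qed (simp add: 0)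
qed

lemma poly_mapping_sum_single: "p = (\<Sum>m\<in>Poly_Mapping.keys p. Poly_Mapping.single m (Poly_Mapping.lookup p m))"
proof (rule poly_mapping_eqI)
  fix k
  have "Poly_Mapping.lookup (\<Sum>m\<in>Poly_Mapping.keys p. Poly_Mapping.single m (Poly_Mapping.lookup p m)) k
      = (\<Sum>m\<in>Poly_Mapping.keys p. if m = k then Poly_Mapping.lookup p k else 0)"
    by (simp add: lookup_sum lookup_single when_def if_distrib cong: if_cong)
  then show "Poly_Mapping.lookup p k = Poly_Mapping.lookup (\<Sum>m\<in>Poly_Mapping.keys p. Poly_Mapping.single m (Poly_Mapping.lookup p m)) k"
    by (simp add: in_keys_iff)
qed

lemma poly_mapping_add_induct [case_names single add]:
  assumes s: "\<And>m c. Q (Poly_Mapping.single m c)" and a: "\<And>p q. Q p \<Longrightarrow> Q q \<Longrightarrow> Q (p + q)"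
  shows "Q (p :: 'g \<Rightarrow>\<^sub>0 'c::comm_monoid_add)"
proof -
  have "Q (\<Sum>m\<in>A. Poly_Mapping.single m (Poly_Mapping.lookup p m))" if "finite A" for A
    using that
  proof (induction A)
    case empty
    show ?case using s[of undefined 0] by simp
  qed (simp add: s a)
  from this[of "Poly_Mapping.keys p"] show ?thesis using poly_mapping_sum_single[of p] by simp
qed

definition pm_monom :: "('g \<Rightarrow> 'r::comm_ring_1) \<Rightarrow> ('g \<Rightarrow>\<^sub>0 nat) \<Rightarrow> 'r" where
  "pm_monom v m = (\<Prod>g\<in>Poly_Mapping.keys m. v g ^ Poly_Mapping.lookup m g)"

text \<open>The substitution homomorphism given by \<open>v\<close> on the variables and by
  \<open>\<phi>\<close> on the coefficients. Both \<open>rees_eval\<close> and the passage from one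
  variable per element of J to three variables are instances.\<close>

definition pm_eval :: "('s::comm_ring_1 \<Rightarrow> 'r::comm_ring_1) \<Rightarrow> ('g \<Rightarrow> 'r) \<Rightarrow> (('g \<Rightarrow>\<^sub>0 nat) \<Rightarrow>\<^sub>0 's) \<Rightarrow> 'r" where
  "pm_eval \<phi> v p = (\<Sum>m\<in>Poly_Mapping.keys p. \<phi> (Poly_Mapping.lookup p m) * pm_monom v m)"

lemma pm_monom_superset:
  assumes "finite A" "Poly_Mapping.keys m \<subseteq> A"
  shows "pm_monom v m = (\<Prod>g\<in>A. v g ^ Poly_Mapping.lookup m g)"
  unfolding pm_monom_def using assms by (intro prod.mono_neutral_left) (auto simp: in_keys_iff)

lemma pm_monom_add: "pm_monom v (m + n) = pm_monom v m * pm_monom v n"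
proof -
  let ?A = "Poly_Mapping.keys m \<union> Poly_Mapping.keys n"
  have "pm_monom v (m + n) = (\<Prod>g\<in>?A. v g ^ Poly_Mapping.lookup (m + n) g)"
    by (rule pm_monom_superset) (use Poly_Mapping.keys_add[of m n] in auto)
  also have "\<dots> = pm_monom v m * pm_monom v n"
    using pm_monom_superset[of ?A m v] pm_monom_superset[of ?A n v]
    by (simp add: lookup_add power_add prod.distrib)
  finally show ?thesis .
qed

lemma pm_monom_0 [simp]: "pm_monom v 0 = 1"
  by (simp add: pm_monom_def)

context
  fixes \<phi> :: "'s::comm_ring_1 \<Rightarrow> 'r::comm_ring_1" and v :: "'g \<Rightarrow> 'r"
  assumes \<phi>: "comm_ring_hom \<phi>"
begin

interpretation \<phi>: comm_ring_hom \<phi> by (rule \<phi>)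

lemma pm_eval_superset:
  assumes "finite A" "Poly_Mapping.keys p \<subseteq> A"
  shows "pm_eval \<phi> v p = (\<Sum>m\<in>A. \<phi> (Poly_Mapping.lookup p m) * pm_monom v m)"
  unfolding pm_eval_def using assms by (intro sum.mono_neutral_left) (auto simp: in_keys_iff)

lemma pm_eval_add: "pm_eval \<phi> v (p + q) = pm_eval \<phi> v p + pm_eval \<phi> v q"
proof -
  let ?A = "Poly_Mapping.keys p \<union> Poly_Mapping.keys q"
  have "pm_eval \<phi> v (p + q) = (\<Sum>m\<in>?A. \<phi> (Poly_Mapping.lookup (p + q) m) * pm_monom v m)"
    by (rule pm_eval_superset) (use Poly_Mapping.keys_add[of p q] in auto)
  also have "\<dots> = pm_eval \<phi> v p + pm_eval \<phi> v q"
    using pm_eval_superset[of ?A p] pm_eval_superset[of ?A q]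
    by (simp add: lookup_add \<phi>.hom_add distrib_right sum.distrib)
  finally show ?thesis .
qed

lemma pm_eval_single: "pm_eval \<phi> v (Poly_Mapping.single m c) = \<phi> c * pm_monom v m"
  by (subst pm_eval_superset[of "{m}"]) auto

lemma pm_eval_mult: "pm_eval \<phi> v (p * q) = pm_eval \<phi> v p * pm_eval \<phi> v q"
proof (induction p rule: poly_mapping_add_induct)
  case (single m c)
  show ?case
  proof (induction q rule: poly_mapping_add_induct)
    case (single n d)
    show ?case by (simp add: mult_single pm_eval_single pm_monom_add \<phi>.hom_mult algebra_simps)
  qed (simp add: distrib_left pm_eval_add)
qed (simp add: distrib_right pm_eval_add)

lemma pm_eval_hom: "comm_ring_hom (pm_eval \<phi> v)"
proof
  show "pm_eval \<phi> v 0 = 0" by (simp add: pm_eval_def)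
  show "pm_eval \<phi> v 1 = 1" using pm_eval_single[of 0 1] by simp
qed (simp_all add: pm_eval_add pm_eval_mult)

lemma pm_eval_hom_comp:
  assumes h: "comm_ring_hom h"
  shows "h (pm_eval \<phi> v p) = pm_eval (h \<circ> \<phi>) (h \<circ> v) p"
proof -
  interpret h: comm_ring_hom h by (rule h)
  show ?thesis unfolding pm_eval_def pm_monom_def by (simp add: h.hom_sum h.hom_mult h.hom_prod h.hom_power)
qed

end

lemma pm_eval_gvar:
  assumes "comm_ring_hom \<phi>"
  shows "pm_eval \<phi> v (gvar g) = v g"
proof -
  interpret comm_ring_hom \<phi> by (rule assms)
  show ?thesis unfolding gvar_def pm_eval_single[OF assms] by (simp add: pm_monom_def)
qed

lemma pm_eval_cong:
  assumes "\<And>c. \<phi> c = \<phi>' c" "\<And>m g. m \<in> Poly_Mapping.keys p \<Longrightarrow> g \<in> Poly_Mapping.keys m \<Longrightarrow> v g = v' g"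
  shows "pm_eval \<phi> v p = pm_eval \<phi>' v' p"
  unfolding pm_eval_def pm_monom_def using assms by (auto intro!: sum.cong prod.cong arg_cong2[where f="(*)"])

lemma single0_hom: "comm_ring_hom (Poly_Mapping.single (0::'m::comm_monoid_add) :: 'a::comm_ring_1 \<Rightarrow> _)"
  by unfold_locales (simp_all add: single_add mult_single)

lemma pm_monom_gvar: "pm_monom gvar m = Poly_Mapping.single m (1::'s::comm_ring_1)"
proof -
  have "pm_monom gvar m = (Poly_Mapping.single (\<Sum>g\<in>Poly_Mapping.keys m. Poly_Mapping.single g (Poly_Mapping.lookup m g)) (1::'s))"
  proof -
    have pw: "gvar g ^ n = Poly_Mapping.single (Poly_Mapping.single g n) (1::'s)" for g :: 's and n
      by (induction n) (simp_all add: gvar_def mult_single flip: single_add)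
    have "(\<Prod>g\<in>A. Poly_Mapping.single (f g) (1::'s)) = Poly_Mapping.single (\<Sum>g\<in>A. f g) 1" if "finite A" for A and f :: "'s \<Rightarrow> 's \<Rightarrow>\<^sub>0 nat"
      using that by induction (simp_all add: mult_single)
    then show ?thesis unfolding pm_monom_def pw by simp
  qed
  then show ?thesis by (simp add: poly_mapping_sum_single[symmetric])
qed

lemma pm_eval_id: "pm_eval (Poly_Mapping.single 0) gvar p = (p :: ('s::comm_ring_1 \<Rightarrow>\<^sub>0 nat) \<Rightarrow>\<^sub>0 's)"
proof -
  have "pm_eval (Poly_Mapping.single 0) gvar p = (\<Sum>m\<in>Poly_Mapping.keys p. Poly_Mapping.single m (Poly_Mapping.lookup p m))"
    unfolding pm_eval_def pm_monom_gvar by (simp add: mult_single)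
  then show ?thesis by (simp add: poly_mapping_sum_single[symmetric])
qed

lemma rees_eval_eq: "rees_eval = pm_eval (\<lambda>c. [:c:]) (\<lambda>g. Polynomial.monom g 1)"
  by (simp add: rees_eval_def pm_eval_def pm_monom_def fun_eq_iff)


section \<open>Congruences modulo the relations of the symmetric algebra\<close>

lemma class_cring_carrier_update:
  fixes C :: "'a::comm_ring_1 set"
  assumes "1 \<in> C" "\<And>p q. p \<in> C \<Longrightarrow> q \<in> C \<Longrightarrow> p + q \<in> C" "\<And>p q. p \<in> C \<Longrightarrow> q \<in> C \<Longrightarrow> p * q \<in> C"
    "\<And>p. p \<in> C \<Longrightarrow> - p \<in> C"
  shows "cring (class_ring\<lparr>carrier := C\<rparr>)"
proof (rule cringI)
  have 0: "0 \<in> C" using assms(2)[OF assms(1) assms(4)[OF assms(1)]] by simp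
  show "abelian_group (class_ring\<lparr>carrier := C\<rparr>)"
  proof (rule abelian_groupI)
    fix x assume "x \<in> carrier (class_ring\<lparr>carrier := C\<rparr>)"
    then show "\<exists>y\<in>carrier (class_ring\<lparr>carrier := C\<rparr>). y \<oplus>\<^bsub>class_ring\<lparr>carrier := C\<rparr>\<^esub> x = \<zero>\<^bsub>class_ring\<lparr>carrier := C\<rparr>\<^esub>"
      using assms(4)[of x] by (intro bexI[of _ "- x"]) simp_all
  qed (use assms 0 in \<open>simp_all add: algebra_simps\<close>)
  show "Group.comm_monoid (class_ring\<lparr>carrier := C\<rparr>)"
    by (rule comm_monoidI) (use assms in \<open>simp_all add: algebra_simps\<close>)
qed (simp add: algebra_simps)

context
  fixes J :: "'s::comm_ring_1 set"
  assumes J: "ideal J class_ring"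
begin

definition FA where "FA = {p :: ('s \<Rightarrow>\<^sub>0 nat) \<Rightarrow>\<^sub>0 's. \<forall>m\<in>Poly_Mapping.keys p. Poly_Mapping.keys m \<subseteq> J}"

lemma FA_iff: "p \<in> FA \<longleftrightarrow> (\<forall>m\<in>Poly_Mapping.keys p. Poly_Mapping.keys m \<subseteq> J)"
  by (simp add: FA_def)

lemma FA_closed:
  shows "p \<in> FA \<Longrightarrow> q \<in> FA \<Longrightarrow> p + q \<in> FA" "p \<in> FA \<Longrightarrow> q \<in> FA \<Longrightarrow> p * q \<in> FA" "p \<in> FA \<Longrightarrow> - p \<in> FA"
    "Poly_Mapping.single 0 c \<in> FA" "1 \<in> FA" "0 \<in> FA" "g \<in> J \<Longrightarrow> gvar g \<in> FA"
    "p \<in> FA \<Longrightarrow> q \<in> FA \<Longrightarrow> p - q \<in> FA"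
proof -
  show add: "p + q \<in> FA" if "p \<in> FA" "q \<in> FA" for p q
    using that Poly_Mapping.keys_add[of p q] unfolding FA_iff by blast
  show neg: "- p \<in> FA" if "p \<in> FA" for p using that by (simp add: FA_iff)
  show "p \<in> FA \<Longrightarrow> q \<in> FA \<Longrightarrow> p - q \<in> FA" using add[of p "- q"] neg[of q] by simp
  show "p * q \<in> FA" if "p \<in> FA" "q \<in> FA" for p q
    unfolding FA_iff
  proof
    fix m assume "m \<in> Poly_Mapping.keys (p * q)"
    then obtain a b where ab: "m = a + b" "a \<in> Poly_Mapping.keys p" "b \<in> Poly_Mapping.keys q"
      using Poly_Mapping.keys_mult[of p q] by blast
    then show "Poly_Mapping.keys m \<subseteq> J" using that Poly_Mapping.keys_add[of a b] unfolding FA_iff by blast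
  qed
  show "Poly_Mapping.single 0 c \<in> FA" "1 \<in> FA" "0 \<in> FA" by (simp_all add: FA_iff)
  show "gvar g \<in> FA" if "g \<in> J" using that by (simp add: gvar_def FA_iff)
qed

lemma free_algebra_eq: "free_algebra J = class_ring\<lparr>carrier := FA\<rparr>"
  by (simp add: free_algebra_def FA_def)

lemma free_algebra_cring: "cring (free_algebra J)"
  unfolding free_algebra_eq by (rule class_cring_carrier_update) (intro FA_closed; assumption)+

definition SI where "SI = Idl\<^bsub>free_algebra J\<^esub> (sym_relations J)"

lemma J_closed: "0 \<in> J" "g \<in> J \<Longrightarrow> h \<in> J \<Longrightarrow> g + h \<in> J" "g \<in> J \<Longrightarrow> c * g \<in> J"
  using J unfolding class_ideal_iff by blast+

lemma sym_relations_FA: "sym_relations J \<subseteq> FA"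
  unfolding sym_relations_def by (auto intro!: FA_closed(8) FA_closed(2,4,7) J_closed)

lemma SI_ideal: "ideal SI (free_algebra J)"
  unfolding SI_def by (rule ring.genideal_ideal[OF cring.axioms(1)[OF free_algebra_cring]])
    (use sym_relations_FA in \<open>simp add: free_algebra_eq\<close>)

lemma SI_closed:
  shows "0 \<in> SI" "p \<in> SI \<Longrightarrow> q \<in> SI \<Longrightarrow> p + q \<in> SI" "p \<in> SI \<Longrightarrow> r \<in> FA \<Longrightarrow> r * p \<in> SI" "p \<in> SI \<Longrightarrow> p \<in> FA"
    "p \<in> SI \<Longrightarrow> q \<in> SI \<Longrightarrow> p - q \<in> SI"
proof -
  interpret I: ideal SI "free_algebra J" by (rule SI_ideal)
  show "0 \<in> SI" using additive_subgroup.zero_closed[OF ideal.axioms(1)[OF SI_ideal]] by (simp add: free_algebra_eq)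
  show add: "p + q \<in> SI" if "p \<in> SI" "q \<in> SI" for p q using additive_subgroup.a_closed[OF ideal.axioms(1)[OF SI_ideal] that] by (simp add: free_algebra_eq)
  show mult: "r * p \<in> SI" if "p \<in> SI" "r \<in> FA" for p r using I.I_l_closed[OF that(1), of r] that(2) by (simp add: free_algebra_eq)
  show "p \<in> FA" if "p \<in> SI" for p using I.Icarr[OF that] by (simp add: free_algebra_eq)
  show "p - q \<in> SI" if "p \<in> SI" "q \<in> SI" for p q
    using add[OF that(1) mult[OF that(2) FA_closed(3)[OF FA_closed(5)]]] by simp
qed

lemma SI_relations:
  shows "g \<in> J \<Longrightarrow> h \<in> J \<Longrightarrow> gvar (g + h) - (gvar g + gvar h) \<in> SI"
    "g \<in> J \<Longrightarrow> gvar (c * g) - Poly_Mapping.single 0 c * gvar g \<in> SI"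
proof -
  have "sym_relations J \<subseteq> SI"
    unfolding SI_def by (rule ring.genideal_self[OF cring.axioms(1)[OF free_algebra_cring]])
      (use sym_relations_FA in \<open>simp add: free_algebra_eq\<close>)
  then show "g \<in> J \<Longrightarrow> h \<in> J \<Longrightarrow> gvar (g + h) - (gvar g + gvar h) \<in> SI"
    "g \<in> J \<Longrightarrow> gvar (c * g) - Poly_Mapping.single 0 c * gvar g \<in> SI"
    unfolding sym_relations_def diff_diff_eq[symmetric] by blast+
qed

lemma SI_trans: "p - q \<in> SI \<Longrightarrow> q - r \<in> SI \<Longrightarrow> p - r \<in> SI"
  using SI_closed(2)[of "p - q" "q - r"] by simp

lemma SI_sym: "p - q \<in> SI \<Longrightarrow> q - p \<in> SI"
  using SI_closed(5)[OF SI_closed(1), of "p - q"] by simp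

lemma SI_add: "p - p' \<in> SI \<Longrightarrow> q - q' \<in> SI \<Longrightarrow> (p + q) - (p' + q') \<in> SI"
  using SI_closed(2)[of "p - p'" "q - q'"] by (simp add: algebra_simps)

lemma SI_mult:
  assumes "p - p' \<in> SI" "q - q' \<in> SI" "p' \<in> FA" "q \<in> FA"
  shows "p * q - p' * q' \<in> SI"
proof -
  have "q * (p - p') + p' * (q - q') \<in> SI" using assms by (intro SI_closed(2,3))
  then show ?thesis by (simp add: algebra_simps)
qed

lemma SI_gvar_0: "gvar 0 \<in> SI"
  using SI_relations(2)[OF J_closed(1), of 0] by simp

lemma SI_linear:
  assumes "g1 \<in> J" "g2 \<in> J" "g3 \<in> J"
  shows "gvar (c1 * g1 + c2 * g2 + c3 * g3)
    - (Poly_Mapping.single 0 c1 * gvar g1 + Poly_Mapping.single 0 c2 * gvar g2 + Poly_Mapping.single 0 c3 * gvar g3) \<in> SI"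
proof -
  note c = J_closed(3)[OF assms(1), of c1] J_closed(3)[OF assms(2), of c2] J_closed(3)[OF assms(3), of c3]
  note r = SI_relations(2)[OF assms(1), of c1] SI_relations(2)[OF assms(2), of c2] SI_relations(2)[OF assms(3), of c3]
  show ?thesis
    by (rule SI_trans[OF SI_relations(1)[OF J_closed(2)[OF c(1,2)] c(3)]
          SI_add[OF SI_trans[OF SI_relations(1)[OF c(1,2)] SI_add[OF r(1,2)]] r(3)]])
qed

text \<open>Substituting each variable for itself returns p, so replacing the variables by elements
  congruent to them changes p only by an element of \<open>SI\<close>.\<close>

lemma SI_pm_eval:
  assumes w: "\<And>g. g \<in> J \<Longrightarrow> w g - gvar g \<in> SI" and wF: "\<And>g. g \<in> J \<Longrightarrow> w g \<in> FA" and p: "p \<in> FA"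
  shows "pm_eval (Poly_Mapping.single 0) w p - p \<in> SI"
proof -
  have pow: "w g ^ n - gvar g ^ n \<in> SI \<and> w g ^ n \<in> FA \<and> gvar g ^ n \<in> FA" if "g \<in> J" for g n
  proof (induction n)
    case 0
    show ?case using SI_closed(1) FA_closed(5) by simp
  next
    case (Suc n)
    then show ?case using that by (auto intro!: SI_mult FA_closed(2) w wF FA_closed(7))
  qed
  have prod: "(\<Prod>g\<in>A. w g ^ f g) - (\<Prod>g\<in>A. gvar g ^ f g) \<in> SI \<and> (\<Prod>g\<in>A. w g ^ f g) \<in> FA \<and> (\<Prod>g\<in>A. gvar g ^ f g) \<in> FA"
    if "finite A" "A \<subseteq> J" for A f
    using that
  proof (induction A)
    case empty
    show ?case using SI_closed(1) FA_closed(5) by simp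
  next
    case (insert g A)
    have "g \<in> J" using insert.prems by simp
    note g = pow[OF this, of "f g"]
    have IH: "(\<Prod>g\<in>A. w g ^ f g) - (\<Prod>g\<in>A. gvar g ^ f g) \<in> SI" "(\<Prod>g\<in>A. w g ^ f g) \<in> FA" "(\<Prod>g\<in>A. gvar g ^ f g) \<in> FA"
      using insert by auto
    show ?case unfolding prod.insert[OF insert.hyps(1,2)]
      using g IH by (intro conjI SI_mult FA_closed(2)) auto
  qed
  have "(\<Sum>m\<in>A. Poly_Mapping.single 0 (Poly_Mapping.lookup p m) * pm_monom w m)
      - (\<Sum>m\<in>A. Poly_Mapping.single 0 (Poly_Mapping.lookup p m) * pm_monom gvar m) \<in> SI"
    if "finite A" "A \<subseteq> Poly_Mapping.keys p" for A
    using that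
  proof (induction A)
    case empty
    show ?case using SI_closed(1) by simp
  next
    case (insert m A)
    have "Poly_Mapping.keys m \<subseteq> J" using insert.prems p by (auto simp: FA_iff)
    then have m: "pm_monom w m - pm_monom gvar m \<in> SI"
      unfolding pm_monom_def using prod[of "Poly_Mapping.keys m"] by simp
    have "Poly_Mapping.single 0 (Poly_Mapping.lookup p m) * (pm_monom w m - pm_monom gvar m) \<in> SI"
      by (rule SI_closed(3)[OF m FA_closed(4)])
    then show ?case unfolding sum.insert[OF insert.hyps(1,2)]
      using insert by (intro SI_add) (simp_all add: right_diff_distrib)
  qed
  from this[of "Poly_Mapping.keys p"] have "pm_eval (Poly_Mapping.single 0) w p - pm_eval (Poly_Mapping.single 0) gvar p \<in> SI"
    unfolding pm_eval_def by simp
  then show ?thesis unfolding pm_eval_id .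
qed

section \<open>The Rees algebra as an image, and the reduction to three variables\<close>

definition Jpow where "Jpow i = J [^]\<^bsub>ideals_set (class_ring :: 's ring)\<^esub> (i::nat)"

definition RA where "RA = {p :: 's poly. \<forall>i. coeff p i \<in> Jpow i}"

lemma RA_iff: "p \<in> RA \<longleftrightarrow> (\<forall>i. coeff p i \<in> Jpow i)"
  by (simp add: RA_def)

lemma const_hom: "comm_ring_hom (\<lambda>c::'s. [:c:])"
  by unfold_locales (simp_all add: one_pCons)

lemma Jpow_0: "Jpow 0 = UNIV" and Jpow_Suc: "Jpow (Suc i) = Jpow i \<cdot>\<^bsub>class_ring\<^esub> J"
  by (simp_all add: Jpow_def nat_pow_def ideals_set_def)

lemma Jpow_ideal: "ideal (Jpow i) class_ring"
proof (induction i)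
  case 0
  show ?case unfolding Jpow_0 class_ideal_iff by simp
next
  case (Suc i)
  show ?case unfolding Jpow_Suc by (rule ring.ideal_prod_is_ideal[OF class_ring.ring_axioms Suc J])
qed

lemma Jpow_mult: "a \<in> Jpow i \<Longrightarrow> b \<in> Jpow j \<Longrightarrow> a * b \<in> Jpow (i + j)"
proof -
  assume ab: "a \<in> Jpow i" "b \<in> Jpow j"
  interpret M: Group.comm_monoid "ideals_set (class_ring :: 's ring)"
    by (rule cring.ideals_set_is_comm_monoid[OF class_cring.is_cring])
  have "J \<in> carrier (ideals_set class_ring)" using J by (simp add: ideals_set_def)
  then have "Jpow (i + j) = Jpow i \<otimes>\<^bsub>ideals_set class_ring\<^esub> Jpow j" by (simp only: Jpow_def M.nat_pow_mult)
  also have "\<dots> = Jpow i \<cdot>\<^bsub>class_ring\<^esub> Jpow j" by (simp add: ideals_set_def)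
  finally show ?thesis using ideal_prod.prod[OF ab, of class_ring] by simp
qed

lemma Jpow_closed: "0 \<in> Jpow i" "a \<in> Jpow i \<Longrightarrow> b \<in> Jpow i \<Longrightarrow> a + b \<in> Jpow i" "a \<in> Jpow i \<Longrightarrow> r * a \<in> Jpow i"
  using Jpow_ideal[of i] unfolding class_ideal_iff by blast+

lemma RA_closed:
  shows "p \<in> RA \<Longrightarrow> q \<in> RA \<Longrightarrow> p + q \<in> RA" "p \<in> RA \<Longrightarrow> q \<in> RA \<Longrightarrow> p * q \<in> RA" "[:c:] \<in> RA" "0 \<in> RA"
    "g \<in> J \<Longrightarrow> Polynomial.monom g 1 \<in> RA"
proof -
  show "p \<in> RA \<Longrightarrow> q \<in> RA \<Longrightarrow> p + q \<in> RA" by (auto simp: RA_iff intro: Jpow_closed)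
  show "[:c:] \<in> RA" "0 \<in> RA" using Jpow_closed(1) by (auto simp: RA_iff coeff_pCons Jpow_0 split: nat.splits)
  show "p * q \<in> RA" if "p \<in> RA" "q \<in> RA"
    unfolding RA_iff
  proof
    fix n
    have sums: "sum f A \<in> Jpow n" if "finite A" "\<And>i. i \<in> A \<Longrightarrow> f i \<in> Jpow n" for f and A :: "nat set"
      using that by induction (auto intro: Jpow_closed)
    show "coeff (p * q) n \<in> Jpow n"
      unfolding coeff_mult
    proof (rule sums)
      fix i assume "i \<in> {..n}"
      then show "coeff p i * coeff q (n - i) \<in> Jpow n" using Jpow_mult[of "coeff p i" i "coeff q (n - i)" "n - i"] that by (simp add: RA_iff)
    qed simp
  qed
  show "Polynomial.monom g 1 \<in> RA" if "g \<in> J"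
  proof -
    have "1 * g \<in> Jpow 1"
      using ideal_prod.prod[of 1 "Jpow 0" g J class_ring] that Jpow_Suc[of 0] by (simp add: Jpow_0)
    then show ?thesis using Jpow_closed(1) by (auto simp: RA_iff coeff_monom)
  qed
qed

lemma rees_eval_hom: "comm_ring_hom (rees_eval :: _ \<Rightarrow> 's poly)"
  unfolding rees_eval_eq by (rule pm_eval_hom[OF const_hom])

text \<open>For the harder inclusion each monomial c t^i with c in J^i is reached by induction on i,
  following the way elements of J^i are built from products of an element of J^(i-1) with one of
  J.\<close>

lemma rees_eval_image: "rees_eval ` FA = RA"
proof
  interpret h: comm_ring_hom "rees_eval :: _ \<Rightarrow> 's poly" by (rule rees_eval_hom)
  show "rees_eval ` FA \<subseteq> RA"
  proof clarify
    fix p :: "('s \<Rightarrow>\<^sub>0 nat) \<Rightarrow>\<^sub>0 's" assume p: "p \<in> FA"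
    have pow: "Polynomial.monom g 1 ^ n \<in> RA" if "g \<in> J" for g n
      by (induction n) (use that RA_closed in \<open>auto simp: one_pCons simp del: One_nat_def\<close>)
    have prod: "(\<Prod>g\<in>A. Polynomial.monom g 1 ^ f g) \<in> RA" if "finite A" "A \<subseteq> J" for A and f :: "'s \<Rightarrow> nat"
      using that by induction (auto intro!: RA_closed(2) pow simp: one_pCons RA_closed(3) simp del: One_nat_def)
    have "(\<Sum>m\<in>A. [:Poly_Mapping.lookup p m:] * pm_monom (\<lambda>g. Polynomial.monom g 1) m) \<in> RA"
      if "finite A" "A \<subseteq> Poly_Mapping.keys p" for A
      using that
    proof induction
      case (insert m A)
      have "pm_monom (\<lambda>g. Polynomial.monom g 1) m \<in> RA"
        unfolding pm_monom_def using insert.prems p by (intro prod) (auto simp: FA_iff)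
      then have "[:Poly_Mapping.lookup p m:] * pm_monom (\<lambda>g. Polynomial.monom g 1) m \<in> RA" by (rule RA_closed(2)[OF RA_closed(3)])
      then show ?case unfolding sum.insert[OF insert.hyps(1,2)] using insert by (intro RA_closed(1)) auto
    qed (simp add: RA_closed(4))
    from this[of "Poly_Mapping.keys p"] show "rees_eval p \<in> RA" unfolding rees_eval_eq pm_eval_def by simp
  qed
  show "RA \<subseteq> rees_eval ` FA"
  proof
    fix q assume q: "q \<in> RA"
    have im: "p + q \<in> rees_eval ` FA" "p * q \<in> rees_eval ` FA" if pq: "p \<in> rees_eval ` FA" "q \<in> rees_eval ` FA" for p q
    proof -
      obtain p' q' where *: "p = rees_eval p'" "q = rees_eval q'" "p' \<in> FA" "q' \<in> FA" using pq by blast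
      show "p + q \<in> rees_eval ` FA" "p * q \<in> rees_eval ` FA"
        unfolding *(1,2) h.hom_add[symmetric] h.hom_mult[symmetric] by (intro imageI FA_closed *)+
    qed
    have zero: "0 \<in> rees_eval ` FA" using FA_closed(6) h.hom_zero by (metis imageI)
    have mon: "Polynomial.monom c i \<in> rees_eval ` FA" if "c \<in> Jpow i" for c i
      using that
    proof (induction i arbitrary: c)
      case 0
      have "rees_eval (Poly_Mapping.single 0 c) = Polynomial.monom c 0"
        unfolding rees_eval_eq pm_eval_single[OF const_hom] by (simp add: monom_0)
      then show ?case using FA_closed(4)[of c] by (metis imageI)
    next
      case (Suc i)
      show ?case using Suc.prems unfolding Jpow_Suc
      proof (induction c rule: ideal_prod.induct)
        case (prod a b)
        have "rees_eval (gvar b) = Polynomial.monom b 1" unfolding rees_eval_eq by (rule pm_eval_gvar[OF const_hom])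
        then have "Polynomial.monom b 1 \<in> rees_eval ` FA" using FA_closed(7)[OF prod(2)] by (metis imageI)
        then have "Polynomial.monom a i * Polynomial.monom b 1 \<in> rees_eval ` FA" by (rule im(2)[OF Suc.IH[OF prod(1)]])
        then show ?case by (simp add: mult_monom)
      next
        case (sum a b)
        then show ?case using im(1) by (simp add: add_monom[symmetric])
      qed
    qed
    have "(\<Sum>i\<in>A. Polynomial.monom (coeff q i) i) \<in> rees_eval ` FA" if "finite A" for A
      using that by induction (use zero mon q in \<open>auto intro!: im(1) simp: RA_iff\<close>)
    then show "q \<in> rees_eval ` FA" by (metis poly_as_sum_of_monoms finite_atMost)
  qed
qed

text \<open>This passes from one variable per element of J to one per generator. Write each g in J
  as a combination of the generators and replace its variable by the corresponding linear form
  \<open>lf g\<close>. A polynomial p in the kernel of the Rees map becomes a q in the kernel for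
  three variables, which \<open>ker\<close> places in the ideal of linear relations. The map
  \<open>\<psi>\<close> sends these relations into \<open>SI\<close> and sends q back to p modulo
  \<open>SI\<close>.\<close>

theorem linear_typeI:
  fixes g1 g2 g3 :: 's
  assumes Jg: "J = Idl\<^bsub>class_ring\<^esub> {g1, g2, g3}"
    and ker: "\<And>p :: 's poly poly poly.
      ev3 (\<lambda>c. [:c:]) (Polynomial.monom g1 1) (Polynomial.monom g2 1) (Polynomial.monom g3 1) p = 0 \<Longrightarrow>
      p \<in> Idl\<^bsub>class_ring\<^esub> {C3 u1 * X3 + C3 u2 * Y3 + C3 u3 * Z3 | u1 u2 u3. u1 * g1 + u2 * g2 + u3 * g3 = 0}"
  shows "linear_type J"
proof -
  interpret h: comm_ring_hom "rees_eval :: _ \<Rightarrow> 's poly" by (rule rees_eval_hom)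
  interpret F: cring "free_algebra J" by (rule free_algebra_cring)
  have gJ: "g1 \<in> J" "g2 \<in> J" "g3 \<in> J"
    using ring.genideal_self[OF class_ring.ring_axioms, of "{g1, g2, g3}"] unfolding Jg by auto
  have hom: "ring_hom_ring (free_algebra J) (class_ring :: 's poly ring) rees_eval"
    by (rule ring_hom_ringI[OF F.ring_axioms class_ring.ring_axioms])
      (simp_all add: free_algebra_eq h.hom_add h.hom_mult)
  interpret H: ring_hom_ring "free_algebra J" "class_ring :: 's poly ring" rees_eval by (rule hom)
  have kerdef: "a_kernel (free_algebra J) (class_ring :: 's poly ring) rees_eval = {p \<in> FA. rees_eval p = 0}"
    unfolding a_kernel_def' by (simp add: free_algebra_eq)
  have "a_kernel (free_algebra J) (class_ring :: 's poly ring) rees_eval = SI"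
  proof
    have "sym_relations J \<subseteq> {p \<in> FA. rees_eval p = 0}"
    proof
      fix p assume p: "p \<in> sym_relations J"
      have "rees_eval (gvar g) = Polynomial.monom g 1" for g :: 's
        unfolding rees_eval_eq by (rule pm_eval_gvar[OF const_hom])
      moreover have "rees_eval (Poly_Mapping.single 0 c) = [:c:]" for c :: 's
        unfolding rees_eval_eq pm_eval_single[OF const_hom] by simp
      ultimately have "rees_eval p = 0"
        using p unfolding sym_relations_def
        by (auto simp: h.hom_minus h.hom_mult add_monom[symmetric] smult_monom)
      then show "p \<in> {p \<in> FA. rees_eval p = 0}" using p sym_relations_FA by blast
    qed
    then show "SI \<subseteq> a_kernel (free_algebra J) (class_ring :: 's poly ring) rees_eval"
      unfolding SI_def kerdef[symmetric] by (rule F.genideal_minimal[OF H.kernel_is_ideal])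
    show "a_kernel (free_algebra J) (class_ring :: 's poly ring) rees_eval \<subseteq> SI"
    proof
      fix p assume "p \<in> a_kernel (free_algebra J) (class_ring :: 's poly ring) rees_eval"
      then have p: "p \<in> FA" "rees_eval p = 0" unfolding kerdef by auto
      have "\<forall>g\<in>J. \<exists>c1 c2 c3. g = c1 * g1 + c2 * g2 + c3 * g3" unfolding Jg class_Idl_triple by blast
      then obtain c1 c2 c3 where c: "\<And>g. g \<in> J \<Longrightarrow> g = c1 g * g1 + c2 g * g2 + c3 g * g3" by metis
      define lf where "lf g = C3 (c1 g) * X3 + C3 (c2 g) * Y3 + C3 (c3 g) * Z3" for g
      define e where "e = ev3 (\<lambda>c::'s. [:c:]) (Polynomial.monom g1 1) (Polynomial.monom g2 1) (Polynomial.monom g3 1)"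
      define \<psi> where "\<psi> = ev3 (Poly_Mapping.single 0) (gvar g1) (gvar g2) (gvar g3)"
      interpret e: comm_ring_hom e unfolding e_def by (rule ev3_hom[OF const_hom])
      interpret \<psi>: comm_ring_hom \<psi> unfolding \<psi>_def by (rule ev3_hom[OF single0_hom])
      note e_simps = ev3_simps[OF const_hom, of "Polynomial.monom g1 1" "Polynomial.monom g2 1" "Polynomial.monom g3 1", folded e_def]
      note \<psi>_simps = ev3_simps[OF single0_hom, of "gvar g1" "gvar g2" "gvar g3", folded \<psi>_def]
      define q where "q = pm_eval C3 lf p"
      have "e q = pm_eval (e \<circ> C3) (e \<circ> lf) p" unfolding q_def by (rule pm_eval_hom_comp[OF C3_hom e.comm_ring_hom_axioms])
      also have "\<dots> = pm_eval (\<lambda>c. [:c:]) (\<lambda>g. Polynomial.monom g 1) p"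
      proof (rule pm_eval_cong)
        fix m g assume "m \<in> Poly_Mapping.keys p" "g \<in> Poly_Mapping.keys m"
        then have "g \<in> J" using p(1) unfolding FA_iff by blast
        have "e (lf g) = Polynomial.monom (c1 g * g1 + c2 g * g2 + c3 g * g3) 1"
          unfolding lf_def by (simp add: e.hom_add e.hom_mult e_simps smult_monom add_monom)
        then show "(e \<circ> lf) g = Polynomial.monom g 1" using c[OF \<open>g \<in> J\<close>] by simp
      qed (simp add: e_simps)
      also have "\<dots> = 0" using p(2) unfolding rees_eval_eq .
      finally have "q \<in> Idl\<^bsub>class_ring\<^esub> {C3 u1 * X3 + C3 u2 * Y3 + C3 u3 * Z3 | u1 u2 u3. u1 * g1 + u2 * g2 + u3 * g3 = 0}"
        unfolding e_def by (rule ker)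
      moreover have \<psi>F: "\<psi> r \<in> FA" for r
        by (induction r rule: poly3_induct)
          (auto simp: \<psi>.hom_add \<psi>.hom_mult \<psi>_simps intro!: FA_closed(1,2,4,7) gJ)
      have "ideal {r. \<psi> r \<in> SI} class_ring"
        unfolding class_ideal_iff using SI_closed(1,2) SI_closed(3)[OF _ \<psi>F] by (simp add: \<psi>.hom_add \<psi>.hom_mult)
      moreover have "{C3 u1 * X3 + C3 u2 * Y3 + C3 u3 * Z3 | u1 u2 u3. u1 * g1 + u2 * g2 + u3 * g3 = 0} \<subseteq> {r. \<psi> r \<in> SI}"
      proof clarify
        fix u1 u2 u3 assume u: "u1 * g1 + u2 * g2 + u3 * g3 = 0"
        have "\<psi> (C3 u1 * X3 + C3 u2 * Y3 + C3 u3 * Z3) = Poly_Mapping.single 0 u1 * gvar g1 + Poly_Mapping.single 0 u2 * gvar g2 + Poly_Mapping.single 0 u3 * gvar g3"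
          by (simp add: \<psi>.hom_add \<psi>.hom_mult \<psi>_simps)
        moreover have "gvar 0 - (Poly_Mapping.single 0 u1 * gvar g1 + Poly_Mapping.single 0 u2 * gvar g2 + Poly_Mapping.single 0 u3 * gvar g3) \<in> SI"
          using SI_linear[OF gJ, of u1 u2 u3] unfolding u .
        ultimately show "\<psi> (C3 u1 * X3 + C3 u2 * Y3 + C3 u3 * Z3) \<in> SI"
          using SI_closed(5)[OF SI_gvar_0, of "gvar 0 - \<psi> (C3 u1 * X3 + C3 u2 * Y3 + C3 u3 * Z3)"] by (simp add: add.assoc)
      qed
      ultimately have "\<psi> q \<in> SI" using ring.genideal_minimal[OF class_ring.ring_axioms] by blast
      moreover have "\<psi> q - p \<in> SI"
      proof -
        have "\<psi> q = pm_eval (\<psi> \<circ> C3) (\<psi> \<circ> lf) p" unfolding q_def by (rule pm_eval_hom_comp[OF C3_hom \<psi>.comm_ring_hom_axioms])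
        also have "\<psi> \<circ> C3 = Poly_Mapping.single 0" by (auto simp: \<psi>_simps)
        finally have "\<psi> q = pm_eval (Poly_Mapping.single 0) (\<psi> \<circ> lf) p" .
        moreover have "(\<psi> \<circ> lf) g - gvar g \<in> SI" if "g \<in> J" for g
        proof (rule SI_sym)
          have "\<psi> (lf g) = Poly_Mapping.single 0 (c1 g) * gvar g1 + Poly_Mapping.single 0 (c2 g) * gvar g2 + Poly_Mapping.single 0 (c3 g) * gvar g3"
            unfolding lf_def by (simp add: \<psi>.hom_add \<psi>.hom_mult \<psi>_simps)
          then show "gvar g - (\<psi> \<circ> lf) g \<in> SI" using SI_linear[OF gJ, of "c1 g" "c2 g" "c3 g"] c[OF that] by simp
        qed
        ultimately show ?thesis using SI_pm_eval[OF _ _ p(1), of "\<psi> \<circ> lf"] \<psi>F by simp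
      qed
      ultimately have "\<psi> q - (\<psi> q - p) \<in> SI" by (rule SI_closed(5))
      then show "p \<in> SI" by simp
    qed
  qed
  moreover have "class_ring\<lparr>carrier := rees_eval ` carrier (free_algebra J)\<rparr> = rees_algebra J"
    using rees_eval_image by (simp add: rees_algebra_def free_algebra_eq RA_def Jpow_def)
  \<comment> \<open>With kernel \<open>SI\<close> and image the Rees algebra, the isomorphism
    theorem applies, and the isomorphism it supplies is by construction
    \<open>sym_to_rees\<close>.\<close>
  ultimately show ?thesis
    using H.FactRing_iso_set_aux unfolding linear_type_def sym_algebra_def SI_def[symmetric] sym_to_rees_def by simp
qed

end

section \<open>Minors of matrices with two columns\<close>

text \<open>Cramer's rule expresses \<open>w u\<close> and \<open>w' u\<close> through the columns; the regularity of \<open>w\<close>, \<open>w'\<close> removes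
  the factors.\<close>

lemma syzygies_of_minors:
  fixes A1 :: "'a::idom"
  assumes m: "m1 = A2 * B3 - A3 * B2" "m2 = A3 * B1 - A1 * B3" "m3 = A1 * B2 - A2 * B1"
    and w: "w = s1 * m1 + s2 * m2 + s3 * m3" "w' = s1' * m1 + s2' * m2 + s3' * m3"
    and w0: "w \<noteq> 0" and reg: "\<And>p. w dvd w' * p \<Longrightarrow> w dvd p"
    and u: "u1 * m1 + u2 * m2 + u3 * m3 = 0"
  shows "\<exists>s t. u1 = s * A1 + t * B1 \<and> u2 = s * A2 + t * B2 \<and> u3 = s * A3 + t * B3"
proof -
  have ex: "\<exists>\<alpha> \<beta>. v * u1 = \<alpha> * A1 + \<beta> * B1 \<and> v * u2 = \<alpha> * A2 + \<beta> * B2 \<and> v * u3 = \<alpha> * A3 + \<beta> * B3"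
    if v: "v = r1 * m1 + r2 * m2 + r3 * m3" for v r1 r2 r3
  proof -
    \<comment> \<open>In vector notation m = A \<times> B and t = u \<times> r. The double cross
      product gives (r m) u = (u m) r + m \<times> t, and m \<times> t = (A t) B - (B t) A explains
      \<open>\<alpha>\<close> and \<open>\<beta>\<close>.\<close>
    define t1 t2 t3 where t: "t1 = u2 * r3 - u3 * r2" "t2 = u3 * r1 - u1 * r3" "t3 = u1 * r2 - u2 * r1"
    define \<alpha> \<beta> where ab: "\<alpha> = - (B1 * t1 + B2 * t2 + B3 * t3)" "\<beta> = A1 * t1 + A2 * t2 + A3 * t3"
    have "v * u1 = r1 * (u1 * m1 + u2 * m2 + u3 * m3) + (\<alpha> * A1 + \<beta> * B1)"
      "v * u2 = r2 * (u1 * m1 + u2 * m2 + u3 * m3) + (\<alpha> * A2 + \<beta> * B2)"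
      "v * u3 = r3 * (u1 * m1 + u2 * m2 + u3 * m3) + (\<alpha> * A3 + \<beta> * B3)"
      unfolding v m ab t by (simp_all add: algebra_simps)
    then show ?thesis unfolding u by auto
  qed
  obtain a b where 1: "w * u1 = a * A1 + b * B1" "w * u2 = a * A2 + b * B2" "w * u3 = a * A3 + b * B3"
    using ex[OF w(1)] by blast
  obtain a' b' where 2: "w' * u1 = a' * A1 + b' * B1" "w' * u2 = a' * A2 + b' * B2" "w' * u3 = a' * A3 + b' * B3"
    using ex[OF w(2)] by blast
  \<comment> \<open>The columns are independent: a relation between them makes p and q annihilate
    all minors, hence also w, a nonzero combination of minors.\<close>
  have indep: "p = 0 \<and> q = 0" if "p * A1 + q * B1 = 0" "p * A2 + q * B2 = 0" "p * A3 + q * B3 = 0" for p q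
  proof -
    have e: "p * A1 = - (q * B1)" "p * A2 = - (q * B2)" "p * A3 = - (q * B3)" using that by (simp_all add: eq_neg_iff_add_eq_0)
    have "p * m1 = (p * A2) * B3 - (p * A3) * B2" "p * m2 = (p * A3) * B1 - (p * A1) * B3" "p * m3 = (p * A1) * B2 - (p * A2) * B1"
      unfolding m by (simp_all add: algebra_simps)
    then have pm: "p * m1 = 0" "p * m2 = 0" "p * m3 = 0" unfolding e by simp_all
    have f: "q * B1 = - (p * A1)" "q * B2 = - (p * A2)" "q * B3 = - (p * A3)" unfolding e by simp_all
    have "q * m1 = A2 * (q * B3) - A3 * (q * B2)" "q * m2 = A3 * (q * B1) - A1 * (q * B3)" "q * m3 = A1 * (q * B2) - A2 * (q * B1)"
      unfolding m by (simp_all add: algebra_simps)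
    then have qm: "q * m1 = 0" "q * m2 = 0" "q * m3 = 0" unfolding f by (simp_all add: algebra_simps)
    have "p * w = s1 * (p * m1) + s2 * (p * m2) + s3 * (p * m3)" "q * w = s1 * (q * m1) + s2 * (q * m2) + s3 * (q * m3)"
      unfolding w by (simp_all add: algebra_simps)
    then show ?thesis unfolding pm qm using w0 by simp
  qed
  have "w' * a - w * a' = 0 \<and> w' * b - w * b' = 0"
  proof (rule indep)
    have "(w' * a - w * a') * A1 + (w' * b - w * b') * B1 = w' * (w * u1) - w * (w' * u1)" unfolding 1 2 by (simp add: algebra_simps)
    then show "(w' * a - w * a') * A1 + (w' * b - w * b') * B1 = 0" by simp
    have "(w' * a - w * a') * A2 + (w' * b - w * b') * B2 = w' * (w * u2) - w * (w' * u2)" unfolding 1 2 by (simp add: algebra_simps)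
    then show "(w' * a - w * a') * A2 + (w' * b - w * b') * B2 = 0" by simp
    have "(w' * a - w * a') * A3 + (w' * b - w * b') * B3 = w' * (w * u3) - w * (w' * u3)" unfolding 1 2 by (simp add: algebra_simps)
    then show "(w' * a - w * a') * A3 + (w' * b - w * b') * B3 = 0" by simp
  qed
  then have "w dvd a" "w dvd b" using reg[of a] reg[of b] by (metis dvd_triv_left right_minus_eq)+
  then obtain s t where st: "a = w * s" "b = w * t" by (elim dvdE)
  have "w * u1 = w * (s * A1 + t * B1)" "w * u2 = w * (s * A2 + t * B2)" "w * u3 = w * (s * A3 + t * B3)"
    unfolding 1 st by (simp_all add: algebra_simps)
  then show ?thesis using w0 by auto
qed

text \<open>The coefficients of a multiple h g become, modulo h, a syzygy of the reduced minors.
  These still contain a regular pair, so the syzygy is a combination of the reduced columns. Lifting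
  this combination and subtracting it leaves h g unchanged, since the columns are syzygies before
  reduction too, and makes every coefficient divisible by h.\<close>

lemma nonzerodivisor_mod_minors:
  fixes A1 :: "'a::idom" and \<tau> :: "'a \<Rightarrow> 'd::idom"
  assumes m: "m1 = A2 * B3 - A3 * B2" "m2 = A3 * B1 - A1 * B3" "m3 = A1 * B2 - A2 * B1"
    and hom: "comm_ring_hom \<tau>" and surj: "surj \<tau>" and ker: "\<And>p. \<tau> p = 0 \<Longrightarrow> h dvd p" and h: "\<tau> h = 0" "h \<noteq> 0"
    and w: "w = s1 * \<tau> m1 + s2 * \<tau> m2 + s3 * \<tau> m3" "w' = s1' * \<tau> m1 + s2' * \<tau> m2 + s3' * \<tau> m3"
    and w0: "w \<noteq> 0" and reg: "\<And>p. w dvd w' * p \<Longrightarrow> w dvd p"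
    and g: "h * g = u1 * m1 + u2 * m2 + u3 * m3"
  shows "\<exists>v1 v2 v3. g = v1 * m1 + v2 * m2 + v3 * m3"
proof -
  interpret \<tau>: comm_ring_hom \<tau> by (rule hom)
  have "\<tau> u1 * \<tau> m1 + \<tau> u2 * \<tau> m2 + \<tau> u3 * \<tau> m3 = \<tau> (h * g)" unfolding g by (simp add: \<tau>.hom_add \<tau>.hom_mult)
  also have "\<dots> = 0" by (simp add: \<tau>.hom_mult h)
  finally have u: "\<tau> u1 * \<tau> m1 + \<tau> u2 * \<tau> m2 + \<tau> u3 * \<tau> m3 = 0" .
  have \<tau>m: "\<tau> m1 = \<tau> A2 * \<tau> B3 - \<tau> A3 * \<tau> B2" "\<tau> m2 = \<tau> A3 * \<tau> B1 - \<tau> A1 * \<tau> B3" "\<tau> m3 = \<tau> A1 * \<tau> B2 - \<tau> A2 * \<tau> B1"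
    unfolding m by (simp_all add: \<tau>.hom_minus \<tau>.hom_mult)
  obtain s t where st: "\<tau> u1 = s * \<tau> A1 + t * \<tau> B1" "\<tau> u2 = s * \<tau> A2 + t * \<tau> B2" "\<tau> u3 = s * \<tau> A3 + t * \<tau> B3"
    using syzygies_of_minors[OF \<tau>m w w0 reg u] by blast
  obtain s' t' where st': "s = \<tau> s'" "t = \<tau> t'" using surj by (metis surjD)
  have "\<tau> (u1 - (s' * A1 + t' * B1)) = 0" "\<tau> (u2 - (s' * A2 + t' * B2)) = 0" "\<tau> (u3 - (s' * A3 + t' * B3)) = 0"
    using st unfolding st' by (simp_all add: \<tau>.hom_minus \<tau>.hom_add \<tau>.hom_mult)
  then obtain v1 v2 v3 where v: "u1 - (s' * A1 + t' * B1) = h * v1" "u2 - (s' * A2 + t' * B2) = h * v2" "u3 - (s' * A3 + t' * B3) = h * v3"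
    using ker by (meson dvdE)
  have "h * g = (u1 - (s' * A1 + t' * B1)) * m1 + (u2 - (s' * A2 + t' * B2)) * m2 + (u3 - (s' * A3 + t' * B3)) * m3"
    unfolding g m by (simp add: algebra_simps)
  also have "\<dots> = h * (v1 * m1 + v2 * m2 + v3 * m3)" unfolding v by (simp add: algebra_simps)
  finally show ?thesis using h(2) by auto
qed

text \<open>The same lifting argument for two generators. As the image of L1 is prime and does not
  divide that of L2, every syzygy modulo h is a multiple of the Koszul syzygy, which lifts.\<close>

lemma nonzerodivisor_mod_regular_pair:
  fixes L1 :: "'a::idom" and \<tau> :: "'a \<Rightarrow> 'd::idom"
  assumes hom: "comm_ring_hom \<tau>" and surj: "surj \<tau>" and ker: "\<And>p. \<tau> p = 0 \<Longrightarrow> h dvd p" and h: "\<tau> h = 0" "h \<noteq> 0"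
    and L: "prime_elem (\<tau> L1)" "\<not> \<tau> L1 dvd \<tau> L2"
    and g: "h * g = u * L1 + v * L2"
  shows "\<exists>u' v'. g = u' * L1 + v' * L2"
proof -
  interpret \<tau>: comm_ring_hom \<tau> by (rule hom)
  have "\<tau> u * \<tau> L1 + \<tau> v * \<tau> L2 = \<tau> (h * g)" unfolding g by (simp add: \<tau>.hom_add \<tau>.hom_mult)
  then have e: "\<tau> u * \<tau> L1 + \<tau> v * \<tau> L2 = 0" by (simp add: \<tau>.hom_mult h)
  then have "\<tau> v * \<tau> L2 = \<tau> L1 * (- \<tau> u)" by (simp add: eq_neg_iff_add_eq_0 mult.commute add.commute)
  then have "\<tau> L1 dvd \<tau> v * \<tau> L2" by (rule dvdI)
  then have "\<tau> L1 dvd \<tau> v" using prime_elem_dvd_multD[OF L(1)] L(2) by blast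
  then obtain r where r: "\<tau> v = \<tau> L1 * \<tau> r" using surj by (metis dvdE surjD)
  have "\<tau> L1 * (\<tau> u + \<tau> r * \<tau> L2) = 0" using e unfolding r by (simp add: algebra_simps)
  then have "\<tau> u + \<tau> r * \<tau> L2 = 0" using prime_elem_not_zeroI[OF L(1)] by simp
  then have "\<tau> (u + r * L2) = 0" "\<tau> (v - r * L1) = 0" using r by (simp_all add: \<tau>.hom_add \<tau>.hom_minus \<tau>.hom_mult)
  then obtain u' v' where uv: "u + r * L2 = h * u'" "v - r * L1 = h * v'" using ker by (meson dvdE)
  have "h * g = (u + r * L2) * L1 + (v - r * L1) * L2" unfolding g by (simp add: algebra_simps)
  also have "\<dots> = h * (u' * L1 + v' * L2)" unfolding uv by (simp add: algebra_simps)
  finally show ?thesis using h(2) by auto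
qed

text \<open>Over a domain, a T + b is prime if a is nonzero and b is regular modulo a.
  Pseudo-division replaces factors of a multiple by constants at the price of powers of a; a nonzero
  constant is no multiple of a T + b, and powers of a can be cancelled by the regularity of
  b.\<close>

lemma prime_elem_linear:
  fixes a b :: "'d::idom"
  assumes a: "a \<noteq> 0" and reg: "\<And>r. a dvd b * r \<Longrightarrow> a dvd r"
  shows "prime_elem [:b, a:]"
proof -
  define L A T where "L = [:b, a:]" and "A = [:a:]" and "T = ([:0, 1:] :: 'd poly)"
  have LA: "L = [:b:] + T * A" unfolding L_def A_def T_def by simp
  have A0: "A \<noteq> 0" unfolding A_def using a by simp
  have div: "\<exists>n s r. A ^ n * v = L * s + [:r:]" for v
  proof (induction v)
    case 0
    show ?case by (intro exI[of _ 0] exI[of _ "0::'d poly"]) simp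
  next
    case (pCons c v)
    then obtain n s r where IH: "A ^ n * v = L * s + [:r:]" by blast
    have "A ^ k = [:a ^ k:]" for k by (induction k) (simp_all add: A_def one_pCons)
    then have An: "A ^ k * [:e:] = [:a ^ k * e:]" for k e by simp
    have "pCons c v = [:c:] + T * v" unfolding T_def by simp
    then have "A ^ Suc n * pCons c v = A ^ Suc n * [:c:] + T * A * (A ^ n * v)" by (simp add: algebra_simps)
    also have "\<dots> = A ^ Suc n * [:c:] + T * A * L * s + (L - [:b:]) * [:r:]" unfolding IH LA by (simp only: algebra_simps add_diff_cancel_left')
    also have "\<dots> = L * (T * A * s + [:r:]) + (A ^ Suc n * [:c:] - [:b:] * [:r:])" by (simp only: algebra_simps)
    also have "A ^ Suc n * [:c:] - [:b:] * [:r:] = [:a ^ Suc n * c - b * r:]" unfolding An by simp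
    finally show ?case by blast
  qed
  \<comment> \<open>If a w = L s, then modulo a the equation reads b s = 0; regularity of b is
    applied to each coefficient of s.\<close>
  have cancel: "L dvd w" if Aw: "L dvd A * w" for w
  proof -
    obtain s where s: "A * w = L * s" using Aw by (rule dvdE)
    have "a dvd coeff s k" for k
    proof (rule reg)
      have "[:b:] * s = A * (w - T * s)" using s unfolding LA by (simp add: algebra_simps)
      then have "coeff ([:b:] * s) k = coeff (A * (w - T * s)) k" by simp
      then have "b * coeff s k = a * coeff (w - T * s) k" unfolding A_def by simp
      then show "a dvd b * coeff s k" by simp
    qed
    then have "A dvd s" unfolding A_def by (simp add: const_poly_dvd_iff)
    then obtain s' where "s = A * s'" by (rule dvdE)
    then have "A * w = A * (L * s')" using s by (simp only: mult.left_commute)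
    then have "w = L * s'" using A0 by simp
    then show ?thesis by (rule dvdI)
  qed
  have cancel_pow: "L dvd w" if "L dvd A ^ n * w" for w n
    using that
  proof (induction n)
    case (Suc n)
    have "A ^ Suc n * w = A * (A ^ n * w)" by (simp add: mult.assoc)
    then show ?case using Suc cancel by metis
  qed simp
  have const: "r = 0" if Lr: "L dvd [:r:]" for r
  proof (rule ccontr)
    assume r: "r \<noteq> 0"
    obtain s where s: "[:r:] = L * s" using Lr by (rule dvdE)
    then have "s \<noteq> 0" using r by auto
    then have "degree (L * s) = degree L + degree s" using a by (intro degree_mult_eq) (simp_all add: L_def)
    moreover have "degree L = 1" using a by (simp add: L_def)
    ultimately show False using s by (metis Zero_not_Suc degree_pCons_0 One_nat_def plus_nat.simps(2))
  qed
  have "prime_elem L"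
    unfolding prime_elem_def
  proof (intro conjI allI impI)
    show "L \<noteq> 0" using a by (simp add: L_def)
    show "\<not> L dvd 1" using const[of 1] by (auto simp: one_pCons)
    fix v w assume vw: "L dvd v * w"
    obtain n s r where 1: "A ^ n * v = L * s + [:r:]" using div by blast
    obtain n' s' r' where 2: "A ^ n' * w = L * s' + [:r':]" using div by blast
    have "L dvd A ^ n * A ^ n' * (v * w)" using vw by (rule dvd_mult)
    also have "A ^ n * A ^ n' * (v * w) = (A ^ n * v) * (A ^ n' * w)" by (simp only: ac_simps)
    also have "\<dots> = L * (s * (L * s' + [:r':]) + [:r:] * s') + [:r:] * [:r':]" unfolding 1 2 by (simp only: algebra_simps)
    also have "[:r:] * [:r':] = [:r * r':]" by simp
    finally have "L dvd [:r * r':]" by (metis dvd_add_right_iff dvd_triv_left)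
    then have "r = 0 \<or> r' = 0" using const by fastforce
    then have "A ^ n * v = L * s \<or> A ^ n' * w = L * s'" using 1 2 by auto
    then have "L dvd A ^ n * v \<or> L dvd A ^ n' * w" by (metis dvdI)
    then show "L dvd v \<or> L dvd w" using cancel_pow by blast
  qed
  then show ?thesis unfolding L_def .
qed

section \<open>Base change of polynomial rings along a homomorphism\<close>

lemma map_poly_surj:
  assumes "comm_ring_hom \<sigma>" "surj \<sigma>"
  shows "surj (map_poly \<sigma>)"
proof -
  interpret comm_ring_hom \<sigma> by (rule assms)
  have "\<exists>q. p = map_poly \<sigma> q" for p
  proof (induction p)
    case 0
    show ?case by (rule exI[of _ 0]) simp
  next
    case (pCons c p)
    then obtain q where "p = map_poly \<sigma> q" by blast
    moreover obtain d where "c = \<sigma> d" using assms(2) by (metis surjD)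
    ultimately have "pCons c p = map_poly \<sigma> (pCons d q)" by (simp add: map_poly_pCons_hom)
    then show ?case by blast
  qed
  then show ?thesis by (metis surjI)
qed

lemma map_poly_kernel:
  fixes h :: "'a::idom"
  assumes "comm_ring_hom \<sigma>" "\<And>p. \<sigma> p = 0 \<Longrightarrow> h dvd p" "map_poly \<sigma> q = 0"
  shows "[:h:] dvd q"
proof -
  interpret comm_ring_hom \<sigma> by (rule assms)
  have "\<sigma> (coeff q n) = 0" for n using assms(3) by (metis coeff_0 coeff_map_poly_hom)
  then show ?thesis using assms(2) by (simp add: const_poly_dvd_iff)
qed

lemma map_poly_hom: "comm_ring_hom \<sigma> \<Longrightarrow> comm_ring_hom (map_poly \<sigma>)"
proof -
  assume "comm_ring_hom \<sigma>"
  then interpret comm_ring_hom \<sigma> .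
  interpret m: map_poly_comm_ring_hom \<sigma> ..
  show ?thesis by (rule m.comm_ring_hom_axioms)
qed

definition map3 :: "('a::comm_ring_1 \<Rightarrow> 'd::comm_ring_1) \<Rightarrow> 'a poly poly poly \<Rightarrow> 'd poly poly poly" where
  "map3 \<sigma> = map_poly (map_poly (map_poly \<sigma>))"

lemma map3_facts:
  assumes \<sigma>: "comm_ring_hom \<sigma>"
  shows "comm_ring_hom (map3 \<sigma>)" "map3 \<sigma> (C3 c) = C3 (\<sigma> c)" "map3 \<sigma> X3 = X3" "map3 \<sigma> Y3 = Y3" "map3 \<sigma> Z3 = Z3"
    "surj \<sigma> \<Longrightarrow> surj (map3 \<sigma>)"
proof -
  note m1 = map_poly_hom[OF \<sigma>] note m2 = map_poly_hom[OF m1] note m3 = map_poly_hom[OF m2]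
  interpret comm_ring_hom \<sigma> by (rule \<sigma>)
  interpret m1: comm_ring_hom "map_poly \<sigma>" by (rule m1)
  interpret m2: comm_ring_hom "map_poly (map_poly \<sigma>)" by (rule m2)
  show "comm_ring_hom (map3 \<sigma>)" unfolding map3_def by (rule m3)
  note [simp] = map_poly_pCons_hom m1.map_poly_pCons_hom m2.map_poly_pCons_hom
  show "map3 \<sigma> (C3 c) = C3 (\<sigma> c)" "map3 \<sigma> X3 = X3" "map3 \<sigma> Y3 = Y3" "map3 \<sigma> Z3 = Z3"
    by (simp_all add: map3_def C3_def X3_def Y3_def Z3_def one_pCons)
  show "surj \<sigma> \<Longrightarrow> surj (map3 \<sigma>)" unfolding map3_def by (intro map_poly_surj m1 m2 \<sigma>)
qed

lemma map3_kernel: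
  fixes h :: "'a::idom"
  assumes \<sigma>: "comm_ring_hom \<sigma>" and "\<And>p. \<sigma> p = 0 \<Longrightarrow> h dvd p" "map3 \<sigma> q = 0"
  shows "C3 h dvd q"
proof -
  note m1 = map_poly_hom[OF \<sigma>] note m2 = map_poly_hom[OF m1]
  show ?thesis using assms(3) unfolding map3_def C3_def
    by (intro map_poly_kernel[OF m2] map_poly_kernel[OF m1] map_poly_kernel[OF \<sigma>] assms(2))
qed

text \<open>Modulo the Koszul relations, a power of each generator kills the kernel of the Rees map.\<close>

lemma symmetric_kernel_power:
  fixes g1 g2 g3 :: "'s::comm_ring_1"
  assumes L: "ideal L class_ring"
    and K: "C3 g1 * Y3 - C3 g2 * X3 \<in> L" "C3 g1 * Z3 - C3 g3 * X3 \<in> L" "C3 g2 * Z3 - C3 g3 * Y3 \<in> L"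
    and w: "w = c1 * g1 + c2 * g2 + c3 * g3"
    and p: "ev3 (\<lambda>c. [:c:]) (Polynomial.monom g1 1) (Polynomial.monom g2 1) (Polynomial.monom g3 1) p = 0"
  shows "\<exists>n. C3 w ^ n * p \<in> L"
proof -
  interpret C: comm_ring_hom "C3 :: 's \<Rightarrow> _" by (rule C3_hom)
  have const: "comm_ring_hom (\<lambda>c::'s. [:c:])" by unfold_locales (simp_all add: one_pCons)
  define e where "e = ev3 (\<lambda>c::'s. [:c:]) (Polynomial.monom g1 1) (Polynomial.monom g2 1) (Polynomial.monom g3 1)"
  interpret e: comm_ring_hom e unfolding e_def by (rule ev3_hom[OF const])
  note e_simps = ev3_simps[OF const, of "Polynomial.monom g1 1" "Polynomial.monom g2 1" "Polynomial.monom g3 1", folded e_def]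
  have Lc: "0 \<in> L" "\<And>a b. a \<in> L \<Longrightarrow> b \<in> L \<Longrightarrow> a + b \<in> L" "\<And>a r. a \<in> L \<Longrightarrow> r * a \<in> L"
    using L unfolding class_ideal_iff by blast+
  have Lm: "a - b \<in> L" if "a \<in> L" "b \<in> L" for a b using class_ideal_minus[OF L that] .
  \<comment> \<open>The linear form that represents w. Modulo the Koszul relations w T_i is
    congruent to g_i \<open>\<tau>\<close>, so that inverting w makes every T_i a multiple of
    \<open>\<tau>\<close>.\<close>
  define \<tau> where "\<tau> = C3 c1 * X3 + C3 c2 * Y3 + C3 c3 * Z3"
  \<comment> \<open>For n at least the degree of q this is w^n q(\<open>\<tau>\<close> / w). For
    large n it is congruent to w^n r when q is the image of r under the Rees map, and it is 0 for r
    in the kernel.\<close>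
  define hg where "hg n q = (\<Sum>k\<le>n. C3 (coeff q k) * \<tau> ^ k * C3 w ^ (n - k))" for n and q :: "'s poly"
  have var: "C3 w * X3 - C3 g1 * \<tau> \<in> L" "C3 w * Y3 - C3 g2 * \<tau> \<in> L" "C3 w * Z3 - C3 g3 * \<tau> \<in> L"
  proof -
    have "C3 w * X3 - C3 g1 * \<tau> = 0 - (C3 c2 * (C3 g1 * Y3 - C3 g2 * X3) + C3 c3 * (C3 g1 * Z3 - C3 g3 * X3))"
      unfolding w \<tau>_def C.hom_add C.hom_mult by (simp add: algebra_simps)
    then show "C3 w * X3 - C3 g1 * \<tau> \<in> L" using Lm[OF Lc(1) Lc(2)[OF Lc(3)[OF K(1)] Lc(3)[OF K(2)]]] by metis
    have "C3 w * Y3 - C3 g2 * \<tau> = C3 c1 * (C3 g1 * Y3 - C3 g2 * X3) - C3 c3 * (C3 g2 * Z3 - C3 g3 * Y3)"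
      unfolding w \<tau>_def C.hom_add C.hom_mult by (simp add: algebra_simps)
    then show "C3 w * Y3 - C3 g2 * \<tau> \<in> L" using Lm[OF Lc(3)[OF K(1)] Lc(3)[OF K(3)]] by metis
    have "C3 w * Z3 - C3 g3 * \<tau> = C3 c1 * (C3 g1 * Z3 - C3 g3 * X3) + C3 c2 * (C3 g2 * Z3 - C3 g3 * Y3)"
      unfolding w \<tau>_def C.hom_add C.hom_mult by (simp add: algebra_simps)
    then show "C3 w * Z3 - C3 g3 * \<tau> \<in> L" using Lc(2)[OF Lc(3)[OF K(2)] Lc(3)[OF K(3)]] by metis
  qed
  have shift: "hg (Suc n) (Polynomial.monom g 1 * q) = C3 g * \<tau> * hg n q" for n g q
  proof -
    have c: "coeff (Polynomial.monom g 1 * q) (Suc k) = g * coeff q k" "coeff (Polynomial.monom g 1 * q) 0 = 0" for k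
      by (simp_all add: coeff_monom_mult)
    show ?thesis
      unfolding hg_def sum.atMost_Suc_shift c
      by (simp add: sum_distrib_left C.hom_mult mult_ac)
  qed
  have step: "\<exists>n0. \<forall>n\<ge>n0. C3 w ^ n * (T * r) - hg n (e (T * r)) \<in> L"
    if IH: "\<exists>n0. \<forall>n\<ge>n0. C3 w ^ n * r - hg n (e r) \<in> L" and T: "C3 w * T - C3 g * \<tau> \<in> L" "e T = Polynomial.monom g 1" for T g r
  proof -
    obtain n0 where n0: "\<And>n. n \<ge> n0 \<Longrightarrow> C3 w ^ n * r - hg n (e r) \<in> L" using IH by blast
    have "C3 w ^ n * (T * r) - hg n (e (T * r)) \<in> L" if "n \<ge> Suc n0" for n
    proof -
      obtain k where k: "n = Suc k" "k \<ge> n0" using \<open>n \<ge> Suc n0\<close> by (metis Suc_le_D Suc_le_mono)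
      have "C3 w ^ n * (T * r) - hg n (e (T * r)) = C3 w ^ k * r * (C3 w * T - C3 g * \<tau>) + C3 g * \<tau> * (C3 w ^ k * r - hg k (e r))"
        unfolding k(1) e.hom_mult T(2) shift by (simp add: algebra_simps)
      then show ?thesis using Lc(2)[OF Lc(3)[OF T(1)] Lc(3)[OF n0[OF k(2)]]] by metis
    qed
    then show ?thesis by blast
  qed
  have "\<exists>n0. \<forall>n\<ge>n0. C3 w ^ n * r - hg n (e r) \<in> L" for r
  proof (induction r rule: poly3_induct)
    case (const c)
    have "hg n [:c:] = C3 w ^ n * C3 c" for n
    proof -
      have "hg n [:c:] = (\<Sum>k\<le>n. if k = 0 then C3 c * C3 w ^ n else 0)"
        unfolding hg_def by (intro sum.cong) (auto simp: coeff_pCons split: nat.splits)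
      then show ?thesis by (simp add: mult.commute)
    qed
    then show ?case using Lc(1) by (simp add: e_simps)
  next
    case (add r s)
    then obtain n0 n1 where n: "\<And>n. n \<ge> n0 \<Longrightarrow> C3 w ^ n * r - hg n (e r) \<in> L" "\<And>n. n \<ge> n1 \<Longrightarrow> C3 w ^ n * s - hg n (e s) \<in> L" by blast
    have hg_add: "hg n (a + b) = hg n a + hg n b" for n a b
      unfolding hg_def by (simp add: C.hom_add distrib_right sum.distrib)
    have "C3 w ^ n * (r + s) - hg n (e (r + s)) \<in> L" if "n \<ge> max n0 n1" for n
      using Lc(2)[OF n(1)[of n] n(2)[of n]] that by (simp add: e.hom_add hg_add algebra_simps)
    then show ?case by blast
  next
    case (X r)
    then show ?case by (rule step[OF _ var(1) e_simps(2)])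
  next
    case (Y r)
    then show ?case by (rule step[OF _ var(2) e_simps(3)])
  next
    case (Z r)
    then show ?case by (rule step[OF _ var(3) e_simps(4)])
  qed
  then obtain n where "C3 w ^ n * p - hg n (e p) \<in> L" by blast
  moreover have "hg n (e p) = 0" unfolding hg_def using p[folded e_def] by simp
  ultimately show ?thesis by auto
qed

text \<open>L is an ideal of known linear relations that includes the Koszul ones. A power of y
  kills the kernel of the Rees map modulo L because y^N lies in the ideal of the generators, and the
  regularity of y modulo L removes that power.\<close>

lemma linear_type_from_nonzerodivisor:
  fixes g1 g2 g3 :: "'s::comm_ring_1"
  assumes L: "ideal L class_ring"
    and K: "C3 g1 * Y3 - C3 g2 * X3 \<in> L" "C3 g1 * Z3 - C3 g3 * X3 \<in> L" "C3 g2 * Z3 - C3 g3 * Y3 \<in> L"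
    and y: "y ^ N = c1 * g1 + c2 * g2 + c3 * g3" and nzd: "\<And>q. C3 y * q \<in> L \<Longrightarrow> q \<in> L"
    and sub: "L \<subseteq> Idl\<^bsub>class_ring\<^esub> {C3 u1 * X3 + C3 u2 * Y3 + C3 u3 * Z3 | u1 u2 u3. u1 * g1 + u2 * g2 + u3 * g3 = 0}"
  shows "linear_type (Idl\<^bsub>class_ring\<^esub> {g1, g2, g3})"
proof (rule linear_typeI[OF _ refl])
  show "ideal (Idl\<^bsub>class_ring\<^esub> {g1, g2, g3}) class_ring"
    by (rule ring.genideal_ideal[OF class_ring.ring_axioms]) simp
  interpret C: comm_ring_hom "C3 :: 's \<Rightarrow> _" by (rule C3_hom)
  fix p :: "'s poly poly poly"
  assume "ev3 (\<lambda>c. [:c:]) (Polynomial.monom g1 1) (Polynomial.monom g2 1) (Polynomial.monom g3 1) p = 0"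
  then obtain n where "C3 (y ^ N) ^ n * p \<in> L" using symmetric_kernel_power[OF L K y] by blast
  then have "C3 y ^ (N * n) * p \<in> L" by (simp add: C.hom_power power_mult)
  moreover have "q \<in> L" if "C3 y ^ k * q \<in> L" for k q
    using that by (induction k) (auto simp: mult.assoc intro: nzd)
  ultimately have "p \<in> L" by blast
  then show "p \<in> Idl\<^bsub>class_ring\<^esub> {C3 u1 * X3 + C3 u2 * Y3 + C3 u3 * Z3 | u1 u2 u3. u1 * g1 + u2 * g2 + u3 * g3 = 0}"
    using sub by blast
qed

text \<open>\<open>L1\<close> and \<open>L2\<close> are the relations given by the columns (x, -y,
  -z) and (0, Q, -P). Putting y = 0 turns \<open>L1\<close> into x T1 - z T3, which is prime since x
  is not divisible by the prime z, and which does not divide the image of \<open>L2\<close>. So y is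
  regular modulo the two relations.\<close>

lemma linear_type_perfect_case:
  fixes x y z P Q :: "'s::idom" and \<sigma> :: "'s \<Rightarrow> 'd::idom"
  assumes \<sigma>: "comm_ring_hom \<sigma>" "surj \<sigma>" "\<And>p. \<sigma> p = 0 \<Longrightarrow> y dvd p" "\<sigma> y = 0" "y \<noteq> 0"
    and z: "prime_elem (\<sigma> z)" "\<not> \<sigma> z dvd \<sigma> x"
    and PQ: "\<sigma> P \<noteq> 0 \<or> \<sigma> Q \<noteq> 0"
    and y: "y ^ N = c1 * (y * P + z * Q) + c2 * (x * P) + c3 * (x * Q)"
  shows "linear_type (Idl\<^bsub>class_ring\<^esub> {y * P + z * Q, x * P, x * Q})"
proof -
  define L1 where "L1 = C3 x * X3 - C3 y * Y3 - C3 z * Z3"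
  define L2 where "L2 = C3 Q * Y3 - C3 P * Z3"
  let ?L = "{u * L1 + v * L2 + w * 0 | u v w. True}"
  interpret C: comm_ring_hom "C3 :: 's \<Rightarrow> _" by (rule C3_hom)
  note m = map3_facts[OF \<sigma>(1)]
  interpret m: comm_ring_hom "map3 \<sigma>" by (rule m(1))
  have mem: "q \<in> ?L \<longleftrightarrow> (\<exists>u v. q = u * L1 + v * L2)" for q by auto
  have x0: "\<sigma> x \<noteq> 0" using z(2) by auto
  have L: "ideal ?L class_ring" unfolding class_Idl_triple[symmetric] by (rule ring.genideal_ideal[OF class_ring.ring_axioms]) simp
  have t1: "map3 \<sigma> L1 = C3 (\<sigma> x) * X3 - C3 (\<sigma> z) * Z3" and t2: "map3 \<sigma> L2 = C3 (\<sigma> Q) * Y3 - C3 (\<sigma> P) * Z3"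
    unfolding L1_def L2_def by (simp_all add: m.hom_minus m.hom_mult m(2-5) \<sigma>(4)) (simp add: C3_def)
  have "map3 \<sigma> L1 = [:[:[:0, \<sigma> x:]:], [:[:- \<sigma> z:]:]:]" unfolding t1 by (simp add: C3_def X3_def Z3_def)
  moreover have "prime_elem [:[:[:0, \<sigma> x:]:], [:[:- \<sigma> z:]:]:]"
  proof (rule prime_elem_linear)
    show "[:[:- \<sigma> z:]:] \<noteq> 0" using z(1) by auto
    have pr: "prime_elem [:[:\<sigma> z:]:]" using z(1) by (simp add: prime_elem_const_poly_iff)
    fix r assume "[:[:- \<sigma> z:]:] dvd [:[:0, \<sigma> x:]:] * r"
    then have "[:[:\<sigma> z:]:] dvd [:[:0, \<sigma> x:]:] * r" by (metis minus_dvd_iff minus_pCons minus_zero)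
    moreover have "\<not> [:[:\<sigma> z:]:] dvd [:[:0, \<sigma> x:]:]"
      using z(2) by (auto simp: const_poly_dvd_iff coeff_pCons split: nat.splits)
    ultimately have "[:[:\<sigma> z:]:] dvd r" using prime_elem_dvd_multD[OF pr] by blast
    then show "[:[:- \<sigma> z:]:] dvd r" by (metis minus_dvd_iff minus_pCons minus_zero)
  qed
  ultimately have prime: "prime_elem (map3 \<sigma> L1)" by simp
  have ndvd: "\<not> map3 \<sigma> L1 dvd map3 \<sigma> L2"
  proof
    assume d: "map3 \<sigma> L1 dvd map3 \<sigma> L2"
    have id: "comm_ring_hom (\<lambda>a::'d. a)" by unfold_locales simp_all
    have "\<sigma> Q * t - \<sigma> P * \<sigma> x = 0" for t
    proof -
      \<comment> \<open>The point T1 = z, T3 = x is a zero of the reduced \<open>L1\<close> for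
        every value t of T2. If the reduced \<open>L2\<close> vanished there too, t = 0 and t = 1
        would give P = Q = 0 modulo y.\<close>
      define E where "E = ev3 (\<lambda>a::'d. a) (\<sigma> z) t (\<sigma> x)"
      interpret E: comm_ring_hom E unfolding E_def by (rule ev3_hom[OF id])
      note E = ev3_simps[OF id, of "\<sigma> z" t "\<sigma> x", folded E_def]
      have "E (map3 \<sigma> L1) = 0" unfolding t1 by (simp add: E.hom_minus E.hom_mult E)
      moreover have "E (map3 \<sigma> L2) = \<sigma> Q * t - \<sigma> P * \<sigma> x" unfolding t2 by (simp add: E.hom_minus E.hom_mult E)
      ultimately show ?thesis using E.hom_dvd[OF d] by simp
    qed
    from this[of 0] this[of 1] have "\<sigma> P = 0" "\<sigma> Q = 0" using x0 by auto
    then show False using PQ by simp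
  qed
  show ?thesis
  proof (rule linear_type_from_nonzerodivisor[OF L _ _ _ y])
    have "C3 (y * P + z * Q) * Y3 - C3 (x * P) * X3 = - C3 P * L1 + C3 z * L2"
      "C3 (y * P + z * Q) * Z3 - C3 (x * Q) * X3 = - C3 Q * L1 + - C3 y * L2"
      "C3 (x * P) * Z3 - C3 (x * Q) * Y3 = 0 * L1 + - C3 x * L2"
      unfolding L1_def L2_def C.hom_add C.hom_mult by (simp_all add: algebra_simps)
    then show "C3 (y * P + z * Q) * Y3 - C3 (x * P) * X3 \<in> ?L" "C3 (y * P + z * Q) * Z3 - C3 (x * Q) * X3 \<in> ?L"
      "C3 (x * P) * Z3 - C3 (x * Q) * Y3 \<in> ?L" unfolding mem by blast+
    have C3y: "map3 \<sigma> (C3 y) = 0" "C3 y \<noteq> 0" using \<sigma>(4,5) by (simp_all add: m(2)) (simp_all add: C3_def)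
    show "q \<in> ?L" if "C3 y * q \<in> ?L" for q
      using that nonzerodivisor_mod_regular_pair[OF m(1) m(6)[OF \<sigma>(2)] map3_kernel[OF \<sigma>(1,3)] C3y prime ndvd, of q]
      unfolding mem by blast
    let ?G = "{C3 u1 * X3 + C3 u2 * Y3 + C3 u3 * Z3 | u1 u2 u3. u1 * (y * P + z * Q) + u2 * (x * P) + u3 * (x * Q) = 0}"
    have "L1 = C3 x * X3 + C3 (- y) * Y3 + C3 (- z) * Z3" unfolding L1_def C.hom_uminus by simp
    moreover have "x * (y * P + z * Q) + - y * (x * P) + - z * (x * Q) = 0" by (simp add: algebra_simps)
    ultimately have 1: "L1 \<in> ?G" by blast
    have "L2 = C3 0 * X3 + C3 Q * Y3 + C3 (- P) * Z3" unfolding L2_def C.hom_uminus by simp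
    moreover have "0 * (y * P + z * Q) + Q * (x * P) + - P * (x * Q) = 0" by (simp add: algebra_simps)
    ultimately have 2: "L2 \<in> ?G" by blast
    have i: "ideal (Idl\<^bsub>class_ring\<^esub> ?G) class_ring" by (rule ring.genideal_ideal[OF class_ring.ring_axioms]) simp
    have "?G \<subseteq> Idl\<^bsub>class_ring\<^esub> ?G" by (rule ring.genideal_self[OF class_ring.ring_axioms]) simp
    then have "L1 \<in> Idl\<^bsub>class_ring\<^esub> ?G" "L2 \<in> Idl\<^bsub>class_ring\<^esub> ?G" using 1 2 by blast+
    then show "?L \<subseteq> Idl\<^bsub>class_ring\<^esub> ?G" unfolding subset_iff mem using i unfolding class_ideal_iff by blast
  qed
qed

text \<open>The three relations are the minors of the matrix with columns (x, z, H) and (T1, T2, G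
  T3). After putting y = 0, \<open>M3\<close> = x T2 - z T1 is prime and does not divide
  \<open>M2\<close>; this regular pair makes y regular modulo the minors.\<close>

lemma linear_type_imperfect_case:
  fixes x y z G H :: "'s::idom" and \<sigma> :: "'s \<Rightarrow> 'd::idom"
  assumes \<sigma>: "comm_ring_hom \<sigma>" "surj \<sigma>" "\<And>p. \<sigma> p = 0 \<Longrightarrow> y dvd p" "\<sigma> y = 0" "y \<noteq> 0"
    and x: "prime_elem (\<sigma> x)" "\<not> \<sigma> x dvd \<sigma> z"
    and GH: "\<sigma> G \<noteq> 0 \<or> \<sigma> H \<noteq> 0"
    and y: "y ^ N = c1 * (x * G) + c2 * (z * G) + c3 * H"
  shows "linear_type (Idl\<^bsub>class_ring\<^esub> {x * G, z * G, H})"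
proof -
  define M1 where "M1 = C3 z * (C3 G * Z3) - C3 H * Y3"
  define M2 where "M2 = C3 H * X3 - C3 x * (C3 G * Z3)"
  define M3 where "M3 = C3 x * Y3 - C3 z * X3"
  let ?L = "{u * M1 + v * M2 + w * M3 | u v w. True}"
  interpret C: comm_ring_hom "C3 :: 's \<Rightarrow> _" by (rule C3_hom)
  note m = map3_facts[OF \<sigma>(1)]
  interpret m: comm_ring_hom "map3 \<sigma>" by (rule m(1))
  have mem: "q \<in> ?L \<longleftrightarrow> (\<exists>u v w. q = u * M1 + v * M2 + w * M3)" for q by auto
  have x0: "\<sigma> x \<noteq> 0" using x(1) by auto
  have L: "ideal ?L class_ring" unfolding class_Idl_triple[symmetric] by (rule ring.genideal_ideal[OF class_ring.ring_axioms]) simp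
  have t3: "map3 \<sigma> M3 = C3 (\<sigma> x) * Y3 - C3 (\<sigma> z) * X3" and t2: "map3 \<sigma> M2 = C3 (\<sigma> H) * X3 - C3 (\<sigma> x) * (C3 (\<sigma> G) * Z3)"
    unfolding M3_def M2_def by (simp_all add: m.hom_minus m.hom_mult m(2-5))
  have "map3 \<sigma> M3 = [:[:[:0, - \<sigma> z:], [:\<sigma> x:]:]:]" unfolding t3 by (simp add: C3_def X3_def Y3_def)
  moreover have "prime_elem [:[:0, - \<sigma> z:], [:\<sigma> x:]:]"
  proof (rule prime_elem_linear)
    show "[:\<sigma> x:] \<noteq> 0" using x0 by auto
    have pr: "prime_elem [:\<sigma> x:]" using x(1) by (simp add: prime_elem_const_poly_iff)
    fix r assume "[:\<sigma> x:] dvd [:0, - \<sigma> z:] * r"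
    moreover have "\<not> [:\<sigma> x:] dvd [:0, - \<sigma> z:]"
      using x(2) by (auto simp: const_poly_dvd_iff coeff_pCons split: nat.splits)
    ultimately show "[:\<sigma> x:] dvd r" using prime_elem_dvd_multD[OF pr] by blast
  qed
  ultimately have prime: "prime_elem (map3 \<sigma> M3)" by (simp add: prime_elem_const_poly_iff)
  have ndvd: "\<not> map3 \<sigma> M3 dvd map3 \<sigma> M2"
  proof
    assume d: "map3 \<sigma> M3 dvd map3 \<sigma> M2"
    have id: "comm_ring_hom (\<lambda>a::'d. a)" by unfold_locales simp_all
    have "\<sigma> x * (\<sigma> H - \<sigma> G * t) = 0" for t
    proof -
      \<comment> \<open>The point T1 = x, T2 = z is a zero of the reduced \<open>M3\<close>, with T3
        = t still free to separate H from G.\<close>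
      define E where "E = ev3 (\<lambda>a::'d. a) (\<sigma> x) (\<sigma> z) t"
      interpret E: comm_ring_hom E unfolding E_def by (rule ev3_hom[OF id])
      note E = ev3_simps[OF id, of "\<sigma> x" "\<sigma> z" t, folded E_def]
      have "E (map3 \<sigma> M3) = 0" unfolding t3 by (simp add: E.hom_minus E.hom_mult E)
      moreover have "E (map3 \<sigma> M2) = \<sigma> x * (\<sigma> H - \<sigma> G * t)" unfolding t2 by (simp add: E.hom_minus E.hom_mult E algebra_simps)
      ultimately show ?thesis using E.hom_dvd[OF d] by simp
    qed
    from this[of 0] this[of 1] have "\<sigma> H = 0" "\<sigma> G = 0" using x0 by auto
    then show False using GH by simp
  qed
  have w: "map3 \<sigma> M3 = 0 * map3 \<sigma> M1 + 0 * map3 \<sigma> M2 + 1 * map3 \<sigma> M3"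
    "map3 \<sigma> M2 = 0 * map3 \<sigma> M1 + 1 * map3 \<sigma> M2 + 0 * map3 \<sigma> M3" by simp_all
  have reg: "map3 \<sigma> M3 dvd p" if "map3 \<sigma> M3 dvd map3 \<sigma> M2 * p" for p
    using prime_elem_dvd_multD[OF prime that] ndvd by blast
  show ?thesis
  proof (rule linear_type_from_nonzerodivisor[OF L _ _ _ y])
    have "C3 (x * G) * Y3 - C3 (z * G) * X3 = 0 * M1 + 0 * M2 + C3 G * M3"
      "C3 (x * G) * Z3 - C3 H * X3 = 0 * M1 + (- 1) * M2 + 0 * M3"
      "C3 (z * G) * Z3 - C3 H * Y3 = 1 * M1 + 0 * M2 + 0 * M3"
      unfolding M1_def M2_def M3_def C.hom_mult by (simp_all add: algebra_simps)
    then show "C3 (x * G) * Y3 - C3 (z * G) * X3 \<in> ?L" "C3 (x * G) * Z3 - C3 H * X3 \<in> ?L"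
      "C3 (z * G) * Z3 - C3 H * Y3 \<in> ?L" unfolding mem by blast+
    have C3y: "map3 \<sigma> (C3 y) = 0" "C3 y \<noteq> 0" using \<sigma>(4,5) by (simp_all add: m(2)) (simp_all add: C3_def)
    show "q \<in> ?L" if "C3 y * q \<in> ?L" for q
      using that nonzerodivisor_mod_minors[OF M1_def M2_def M3_def m(1) m(6)[OF \<sigma>(2)] map3_kernel[OF \<sigma>(1,3)] C3y w
          prime_elem_not_zeroI[OF prime] reg, of q]
      unfolding mem by blast
    let ?G = "{C3 u1 * X3 + C3 u2 * Y3 + C3 u3 * Z3 | u1 u2 u3. u1 * (x * G) + u2 * (z * G) + u3 * H = 0}"
    have "M1 = C3 0 * X3 + C3 (- H) * Y3 + C3 (z * G) * Z3" unfolding M1_def C.hom_uminus C.hom_mult by (simp add: algebra_simps)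
    moreover have "0 * (x * G) + - H * (z * G) + z * G * H = 0" by (simp add: algebra_simps)
    ultimately have 1: "M1 \<in> ?G" by blast
    have "M2 = C3 H * X3 + C3 0 * Y3 + C3 (- (x * G)) * Z3" unfolding M2_def C.hom_uminus C.hom_mult by (simp add: algebra_simps)
    moreover have "H * (x * G) + 0 * (z * G) + - (x * G) * H = 0" by (simp add: algebra_simps)
    ultimately have 2: "M2 \<in> ?G" by blast
    have "M3 = C3 (- z) * X3 + C3 x * Y3 + C3 0 * Z3" unfolding M3_def C.hom_uminus by simp
    moreover have "- z * (x * G) + x * (z * G) + 0 * H = 0" by (simp add: algebra_simps)
    ultimately have 3: "M3 \<in> ?G" by blast
    have i: "ideal (Idl\<^bsub>class_ring\<^esub> ?G) class_ring" by (rule ring.genideal_ideal[OF class_ring.ring_axioms]) simp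
    have "?G \<subseteq> Idl\<^bsub>class_ring\<^esub> ?G" by (rule ring.genideal_self[OF class_ring.ring_axioms]) simp
    then have "M1 \<in> Idl\<^bsub>class_ring\<^esub> ?G" "M2 \<in> Idl\<^bsub>class_ring\<^esub> ?G" "M3 \<in> Idl\<^bsub>class_ring\<^esub> ?G" using 1 2 3 by blast+
    then show "?L \<subseteq> Idl\<^bsub>class_ring\<^esub> ?G" unfolding subset_iff mem using i unfolding class_ideal_iff by blast
  qed
qed

section \<open>Prime ideals of the polynomial ring in three variables\<close>

lemma ker_prime:
  fixes \<theta> :: "'s::comm_ring_1 \<Rightarrow> 'd::idom"
  assumes "comm_ring_hom \<theta>"
  shows "primeideal {s. \<theta> s = 0} class_ring"
proof -
  interpret comm_ring_hom \<theta> by (rule assms)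
  show ?thesis unfolding class_prime_iff class_ideal_iff by (simp add: hom_add hom_mult)
qed

text \<open>Otherwise some prime over J avoids all powers of t. This converts the knowledge about
  primes over an ideal into explicit powers of y and x z inside it.\<close>

lemma radical_member:
  fixes J :: "'s::comm_ring_1 set"
  assumes J: "ideal J class_ring" and all: "\<And>Q. primeideal Q class_ring \<Longrightarrow> J \<subseteq> Q \<Longrightarrow> t \<in> Q"
  obtains N where "t ^ N \<in> J"
proof (rule ccontr)
  assume "\<not> thesis"
  then have disj: "J \<inter> range (\<lambda>n. t ^ n) = {}" using that by blast
  have 1: "1 \<in> range (\<lambda>n. t ^ n)" by (metis power_0 rangeI)
  have mult: "s * s' \<in> range (\<lambda>n. t ^ n)" if "s \<in> range (\<lambda>n. t ^ n)" "s' \<in> range (\<lambda>n. t ^ n)" for s s'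
    using that by (auto simp: power_add[symmetric])
  obtain Q where Q: "primeideal Q class_ring" "J \<subseteq> Q" "Q \<inter> range (\<lambda>n. t ^ n) = {}"
    by (rule cring.prime_ideal_avoiding[OF class_cring.is_cring J, of "range (\<lambda>n. t ^ n)"])
      (use 1 mult disj in simp_all)
  have "t \<in> range (\<lambda>n. t ^ n)" by (metis power_one_right rangeI)
  then show False using all[OF Q(1,2)] Q(3) by blast
qed

lemma prime_power_mem:
  fixes Q :: "'s::comm_ring_1 set"
  assumes "primeideal Q class_ring" "t ^ n \<in> Q"
  shows "t \<in> Q"
  using assms(2)
proof (induction n)
  case 0
  then show ?case using assms(1) unfolding class_prime_iff by simp
next
  case (Suc n)
  then show ?case using assms(1) unfolding class_prime_iff by auto
qed

text \<open>The regularity of the pair p^N, a^N, in the form in which the syzygy lemmas require it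
  of w and w'.\<close>

lemma prime_power_dvd_cancel:
  fixes p :: "'a::algebraic_semidom"
  assumes "prime_elem p" "\<not> p dvd a" "p ^ N dvd a ^ N * r"
  shows "p ^ N dvd r"
proof (cases "N = 0")
  case False
  have "\<not> p dvd a ^ N" using assms(1,2) prime_elem_dvd_power by blast
  then show ?thesis using prime_power_dvd_multD[OF assms(1,3)] False by blast
qed simp

lemma prime_X: "prime_elem [:0, 1 :: 'd::idom:]"
  by (rule prime_elem_linear) simp_all

lemma ideal_cong_add:
  fixes Q :: "'s::comm_ring_1 set"
  assumes "ideal Q class_ring" "a - a' \<in> Q" "b - b' \<in> Q"
  shows "(a + b) - (a' + b') \<in> Q"
proof -
  have "(a - a') + (b - b') \<in> Q" using assms unfolding class_ideal_iff by blast
  then show ?thesis by (simp add: algebra_simps)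
qed

lemma C3_const_hom: "comm_ring_hom (\<lambda>c::'a::comm_ring_1. [:c:])"
  by unfold_locales (simp_all add: one_pCons)

lemma id_hom: "comm_ring_hom (\<lambda>a::'a::comm_ring_1. a)"
  by unfold_locales simp_all

lemma hom_ext3:
  assumes "comm_ring_hom f" "comm_ring_hom g" "\<And>c. f (C3 c) = g (C3 c)" "f X3 = g X3" "f Y3 = g Y3" "f Z3 = g Z3"
  shows "f p = g p"
proof -
  interpret f: comm_ring_hom f by (rule assms)
  interpret g: comm_ring_hom g by (rule assms)
  show ?thesis by (induction p rule: poly3_induct) (simp_all add: assms(3-6) f.hom_add g.hom_add f.hom_mult g.hom_mult)
qed

text \<open>All variables other than w lie in Q, so the residue ring is generated over the constants
  by w alone.\<close>

lemma reduce_mod_two_variables: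
  fixes Q :: "'a::comm_ring_1 poly poly poly set"
  assumes Q: "ideal Q class_ring" and v: "X3 \<in> Q \<or> X3 = w" "Y3 \<in> Q \<or> Y3 = w" "Z3 \<in> Q \<or> Z3 = w"
  shows "\<exists>e. s - evp C3 w e \<in> Q"
proof -
  interpret E: comm_ring_hom "evp C3 w" by (rule evp_hom[OF C3_hom])
  have Qc: "0 \<in> Q" "\<And>a b. a \<in> Q \<Longrightarrow> b \<in> Q \<Longrightarrow> a + b \<in> Q" "\<And>a r. a \<in> Q \<Longrightarrow> r * a \<in> Q"
    using Q unfolding class_ideal_iff by blast+
  have evp_const: "evp C3 w [:c:] = C3 c" for c by (simp add: evp_pCons[OF C3_hom] evp_0)
  have var: "evp C3 w (pCons 0 e) = w * evp C3 w e" for e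
    by (simp add: evp_pCons[OF C3_hom]) (simp add: C3_def)
  have step: "\<exists>e. t * r - evp C3 w e \<in> Q" if t: "t \<in> Q \<or> t = w" and IH: "\<exists>e. r - evp C3 w e \<in> Q" for t r
    using t
  proof
    assume "t \<in> Q"
    then have "t * r - evp C3 w 0 \<in> Q" using Qc(3)[of t r] by (simp add: evp_0 mult.commute)
    then show ?thesis by blast
  next
    assume tw: "t = w"
    obtain e where "r - evp C3 w e \<in> Q" using IH by blast
    then have "w * (r - evp C3 w e) \<in> Q" by (rule Qc(3))
    then have "t * r - evp C3 w (pCons 0 e) \<in> Q" unfolding var tw by (simp add: algebra_simps)
    then show ?thesis by blast
  qed
  show ?thesis
  proof (induction s rule: poly3_induct)
    case (const c)
    show ?case using Qc(1) by (intro exI[of _ "[:c:]"]) (simp add: evp_const)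
  next
    case (add p q)
    then obtain e e' where "p - evp C3 w e \<in> Q" "q - evp C3 w e' \<in> Q" by blast
    then have "p + q - evp C3 w (e + e') \<in> Q" unfolding E.hom_add by (rule ideal_cong_add[OF Q])
    then show ?case by blast
  qed (use step v in blast)+
qed

lemma coeff3_0_hom: "comm_ring_hom (\<lambda>s::'a::comm_ring_1 poly poly poly. coeff3 s 0 0 0)"
proof -
  have "(\<lambda>s. coeff3 s 0 0 0) = ev3 (\<lambda>a::'a. a) 0 0 0"
    unfolding ev3_def evp_def coeff3_def by (rule ext) (simp add: poly_0_coeff_0 coeff_map_poly)
  then show ?thesis using ev3_hom[OF id_hom] by metis
qed

lemma coeff3_0_simps [simp]:
  "coeff3 (C3 c) 0 0 0 = c" "coeff3 X3 0 0 0 = 0" "coeff3 Y3 0 0 0 = 0" "coeff3 Z3 0 0 0 = 0"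
  by (simp_all add: coeff3_def C3_def X3_def Y3_def Z3_def)

lemma coeff3_0_mem:
  fixes Q :: "'a::comm_ring_1 poly poly poly set"
  assumes Q: "ideal Q class_ring" and v: "X3 \<in> Q" "Y3 \<in> Q" "Z3 \<in> Q"
  shows "s - C3 (coeff3 s 0 0 0) \<in> Q"
proof -
  interpret c: comm_ring_hom "\<lambda>s::'a poly poly poly. coeff3 s 0 0 0" by (rule coeff3_0_hom)
  interpret C: comm_ring_hom "C3 :: 'a \<Rightarrow> _" by (rule C3_hom)
  have Qc: "0 \<in> Q" "\<And>a b. a \<in> Q \<Longrightarrow> b \<in> Q \<Longrightarrow> a + b \<in> Q" "\<And>a r. a \<in> Q \<Longrightarrow> r * a \<in> Q"
    using Q unfolding class_ideal_iff by blast+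
  show ?thesis
  proof (induction s rule: poly3_induct)
    case (add p q)
    then show ?case unfolding c.hom_add C.hom_add by (rule ideal_cong_add[OF Q])
  qed (use Qc v in \<open>simp_all add: c.hom_mult C.hom_zero mult.commute[of X3] mult.commute[of Y3] mult.commute[of Z3]\<close>)
qed

lemma irrelevant_ideal_mem:
  assumes "coeff3 s 0 0 0 = 0"
  shows "s \<in> irrelevant_ideal"
proof -
  interpret C: comm_ring_hom C3 by (rule C3_hom)
  have "ideal irrelevant_ideal class_ring" "{X3, Y3, Z3} \<subseteq> irrelevant_ideal"
    unfolding irrelevant_ideal_def
    by (rule ring.genideal_ideal[OF class_ring.ring_axioms] ring.genideal_self[OF class_ring.ring_axioms]; simp)+
  then have "s - C3 (coeff3 s 0 0 0) \<in> irrelevant_ideal" by (intro coeff3_0_mem) auto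
  then show ?thesis using assms by (simp add: C.hom_zero)
qed

lemma homogeneous3_simps:
  fixes p q :: "'a::comm_ring_1 poly poly poly"
  shows "homogeneous3 n p \<Longrightarrow> homogeneous3 (n + 1) (X3 * p)" "homogeneous3 n p \<Longrightarrow> homogeneous3 (n + 1) (Y3 * p)"
  "homogeneous3 n p \<Longrightarrow> homogeneous3 (n + 1) (Z3 * p)"
  "homogeneous3 n p \<Longrightarrow> homogeneous3 n q \<Longrightarrow> homogeneous3 n (p + q)"
  "homogeneous3 n p \<Longrightarrow> homogeneous3 n (- p)" "homogeneous3 0 (1 :: 'a poly poly poly)" "homogeneous3 n (0 :: 'a poly poly poly)"
proof -
  have X: "coeff3 (X3 * p) i j k = (if i = 0 then 0 else coeff3 p (i - 1) j k)" for i j k and p :: "'a poly poly poly"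
    by (simp add: coeff3_def X3_def coeff_pCons split: nat.splits)
  have Y: "coeff3 (Y3 * p) i j k = (if j = 0 then 0 else coeff3 p i (j - 1) k)" for i j k and p :: "'a poly poly poly"
    by (simp add: coeff3_def Y3_def coeff_pCons split: nat.splits)
  have Z: "coeff3 (Z3 * p) i j k = (if k = 0 then 0 else coeff3 p i j (k - 1))" for i j k and p :: "'a poly poly poly"
    by (simp add: coeff3_def Z3_def coeff_pCons split: nat.splits)
  show "homogeneous3 n p \<Longrightarrow> homogeneous3 (n + 1) (X3 * p)" unfolding homogeneous3_def X by (auto split: if_splits) force
  show "homogeneous3 n p \<Longrightarrow> homogeneous3 (n + 1) (Y3 * p)" unfolding homogeneous3_def Y by (auto split: if_splits) force
  show "homogeneous3 n p \<Longrightarrow> homogeneous3 (n + 1) (Z3 * p)" unfolding homogeneous3_def Z by (auto split: if_splits) force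
  show "homogeneous3 n (p + q)" if pq: "homogeneous3 n p" "homogeneous3 n q"
    unfolding homogeneous3_def
  proof (intro allI impI)
    fix i j k assume "coeff3 (p + q) i j k \<noteq> 0"
    then have "coeff3 p i j k \<noteq> 0 \<or> coeff3 q i j k \<noteq> 0" by (auto simp: coeff3_def)
    then show "int (i + j + k) = n" using pq unfolding homogeneous3_def by metis
  qed
  show "homogeneous3 n p \<Longrightarrow> homogeneous3 n (- p)" unfolding homogeneous3_def by (simp add: coeff3_def)
  show "homogeneous3 0 (1 :: 'a poly poly poly)" "homogeneous3 n (0 :: 'a poly poly poly)" unfolding homogeneous3_def
    by (auto simp: coeff3_def one_pCons coeff_pCons split: nat.splits)
qed

lemma homogeneous3_irrelevant: "homogeneous3 n s \<Longrightarrow> n > 0 \<Longrightarrow> s \<in> irrelevant_ideal"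
  by (rule irrelevant_ideal_mem) (force simp: homogeneous3_def)

text \<open>The two orders of the variables are treated at once: \<open>x\<close> will be the variable of larger weight.\<close>

locale roles =
  fixes xb yb :: "'k::{alg_closed_field, field_char_0} poly poly"
  assumes roles: "xb = X2 \<and> yb = Y2 \<or> xb = Y2 \<and> yb = X2"
begin

definition x where "x = [:xb:]"
definition y where "y = [:yb:]"
abbreviation z where "z \<equiv> (Z3 :: 'k poly poly poly)"

lemma xy: "x = X3 \<and> y = Y3 \<or> x = Y3 \<and> y = X3"
  using roles by (auto simp: x_def y_def X2_def Y2_def X3_def Y3_def)

lemma prime_yb: "prime_elem yb" and prime_xb: "prime_elem xb"
proof -
  have "prime_elem (X2 :: 'k poly poly)" "prime_elem (Y2 :: 'k poly poly)"
    unfolding X2_def Y2_def by (simp_all add: prime_elem_const_poly_iff prime_X)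
  then show "prime_elem yb" "prime_elem xb" using roles by auto
qed

text \<open>The map puts \<open>yb\<close> equal to 0: for the outer variable this is evaluation,
  for the inner one it is evaluation of the coefficients. The remaining variable generates the image
  ring.\<close>

lemma quotient_by_yb:
  obtains \<rho> :: "'k poly poly \<Rightarrow> 'k poly" where "comm_ring_hom \<rho>" "surj \<rho>" "\<forall>p. \<rho> p = 0 \<longrightarrow> yb dvd p" "\<rho> yb = 0"
    "\<rho> xb = [:0, 1:]" "\<forall>c. \<rho> [:[:c:]:] = [:c:]"
  using roles
proof
  assume r: "xb = X2 \<and> yb = Y2"
  show ?thesis
  proof (rule that[of "\<lambda>p. poly p 0"])
    show "comm_ring_hom (\<lambda>p::'k poly poly. poly p 0)" by unfold_locales simp_all
    show "surj (\<lambda>p::'k poly poly. poly p 0)" by (rule surjI[of _ "\<lambda>q. [:q:]"]) simp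
    show "\<forall>p. poly p 0 = 0 \<longrightarrow> yb dvd p" using r poly_eq_0_iff_dvd[where c = "0 :: 'k poly"] by (simp add: Y2_def)
  qed (use r in \<open>simp_all add: X2_def Y2_def\<close>)
next
  assume r: "xb = Y2 \<and> yb = X2"
  have h: "comm_ring_hom (\<lambda>p::'k poly. poly p 0)" by unfold_locales simp_all
  interpret h: comm_ring_hom "\<lambda>p::'k poly. poly p 0" by (rule h)
  have s: "surj (\<lambda>p::'k poly. poly p 0)" by (rule surjI[of _ "\<lambda>q. [:q:]"]) simp
  show ?thesis
  proof (rule that[of "map_poly (\<lambda>p. poly p 0)"])
    show "comm_ring_hom (map_poly (\<lambda>p::'k poly. poly p 0))" by (rule map_poly_hom[OF h])
    show "surj (map_poly (\<lambda>p::'k poly. poly p 0))" by (rule map_poly_surj[OF h s])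
    have "poly p 0 = 0 \<Longrightarrow> [:0, 1:] dvd p" for p :: "'k poly" using poly_eq_0_iff_dvd[of p 0] by simp
    then show "\<forall>q. map_poly (\<lambda>p. poly p 0) q = 0 \<longrightarrow> yb dvd q"
      using r map_poly_kernel[OF h, of "[:0, 1:]"] by (simp add: X2_def)
  qed (use r in \<open>simp_all add: X2_def Y2_def poly_hom.map_poly_pCons_hom\<close>)
qed

lemma quotient_by_y:
  obtains \<sigma> :: "'k poly poly poly \<Rightarrow> 'k poly poly" where "comm_ring_hom \<sigma>" "surj \<sigma>" "\<forall>p. \<sigma> p = 0 \<longrightarrow> y dvd p" "\<sigma> y = 0"
    "prime_elem (\<sigma> x)" "prime_elem (\<sigma> z)" "\<not> \<sigma> z dvd \<sigma> x" "\<not> \<sigma> x dvd \<sigma> z" "\<sigma> x \<noteq> 0" "\<sigma> z \<noteq> 0"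
proof -
  obtain \<rho> :: "'k poly poly \<Rightarrow> 'k poly" where \<rho>: "comm_ring_hom \<rho>" "surj \<rho>" "\<forall>p. \<rho> p = 0 \<longrightarrow> yb dvd p" "\<rho> yb = 0"
    "\<rho> xb = [:0, 1:]" "\<forall>c. \<rho> [:[:c:]:] = [:c:]" by (rule quotient_by_yb)
  interpret \<rho>: comm_ring_hom \<rho> by (rule \<rho>)
  have v: "map_poly \<rho> x = [:[:0, 1:]:]" "map_poly \<rho> z = [:0, 1:]" "map_poly \<rho> y = 0"
    by (simp_all add: x_def y_def \<rho>.map_poly_pCons_hom \<rho> Z3_def)
  show ?thesis
  proof (rule that[of "map_poly \<rho>"])
    show "\<not> map_poly \<rho> z dvd map_poly \<rho> x" unfolding v
      using poly_eq_0_iff_dvd[of "[:[:0, 1::'k:]:]" 0] by simp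
    show "\<not> map_poly \<rho> x dvd map_poly \<rho> z" unfolding v
      by (auto simp: const_poly_dvd_iff coeff_pCons split: nat.splits dest!: spec[of _ 1])
    show "prime_elem (map_poly \<rho> x)" "prime_elem (map_poly \<rho> z)" unfolding v
      by (simp_all add: prime_elem_const_poly_iff prime_X)
  qed (use \<rho> v in \<open>simp_all add: map_poly_hom map_poly_surj y_def map_poly_kernel[OF \<rho>(1) \<rho>(3)[rule_format]]\<close>)
qed

lemma prime_xyz: "prime_elem x" "prime_elem y" "prime_elem z"
  using prime_xb prime_yb by (simp_all add: x_def y_def prime_elem_const_poly_iff Z3_def prime_X)

lemma y_ndvd: "\<not> y dvd x" "\<not> y dvd z" "\<not> y dvd x * z"
proof -
  obtain \<sigma> :: "'k poly poly poly \<Rightarrow> 'k poly poly" where \<sigma>: "comm_ring_hom \<sigma>" "surj \<sigma>" "\<forall>p. \<sigma> p = 0 \<longrightarrow> y dvd p" "\<sigma> y = 0"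
    "prime_elem (\<sigma> x)" "prime_elem (\<sigma> z)" "\<not> \<sigma> z dvd \<sigma> x" "\<not> \<sigma> x dvd \<sigma> z" "\<sigma> x \<noteq> 0" "\<sigma> z \<noteq> 0" by (rule quotient_by_y)
  interpret \<sigma>: comm_ring_hom \<sigma> by (rule \<sigma>)
  show "\<not> y dvd x" "\<not> y dvd z" using \<sigma>.hom_dvd[of y] \<sigma> by force+
  then show "\<not> y dvd x * z" using prime_elem_dvd_multD[OF prime_xyz(2)] by blast
qed

lemma y_power_regular: "y ^ N dvd (x * z) ^ N * p \<Longrightarrow> y ^ N dvd p"
  by (rule prime_power_dvd_cancel[OF prime_xyz(2) y_ndvd(3)])

text \<open>Otherwise the kernel of \<open>\<sigma>\<close> would be a prime over J that contains
  neither x nor z.\<close>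

lemma y_ideal_prime:
  assumes "\<And>Q. primeideal Q class_ring \<Longrightarrow> J \<subseteq> Q \<Longrightarrow> y \<in> Q \<and> (x \<in> Q \<or> z \<in> Q)" and "comm_ring_hom \<sigma>" "\<sigma> x \<noteq> 0" "\<sigma> z \<noteq> (0::'k poly poly)"
  shows "\<exists>s\<in>J. \<sigma> s \<noteq> 0"
  using assms(1)[OF ker_prime[OF assms(2)]] assms(3,4) by blast

text \<open>Over an algebraically closed field e splits into linear factors; after substitution of w
  the prime contains one of them, since it contains no nonzero constant.\<close>

lemma root_in_prime:
  assumes Q: "primeideal Q class_ring" and e: "e \<noteq> 0" "evp C3 w e \<in> Q"
  shows "\<exists>r. w - C3 (r :: 'k) \<in> Q"
  using e
proof (induction "degree e" arbitrary: e)
  case 0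
  interpret C: comm_ring_hom "C3 :: 'k \<Rightarrow> _" by (rule C3_hom)
  obtain c where c: "e = [:c:]" "c \<noteq> 0" using 0 by (metis degree_eq_zeroE pCons_0_0)
  then have "C3 c \<in> Q" using 0 by (simp add: evp_pCons[OF C3_hom] evp_0)
  then have "C3 (inverse c) * C3 c \<in> Q" using Q unfolding class_prime_iff class_ideal_iff by blast
  then have "C3 (inverse c * c) \<in> Q" by (simp only: C.hom_mult)
  then show ?case using Q c(2) unfolding class_prime_iff by (simp add: C.hom_one)
next
  case (Suc n)
  interpret C: comm_ring_hom "C3 :: 'k \<Rightarrow> _" by (rule C3_hom)
  interpret E: comm_ring_hom "evp C3 w" by (rule evp_hom[OF C3_hom])
  obtain r where "poly e r = 0" using alg_closed_imp_poly_has_root[of e] Suc.hyps(2) by auto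
  then obtain e' where e': "e = [:- r, 1:] * e'" using poly_eq_0_iff_dvd by blast
  then have "e' \<noteq> 0" using Suc.prems by auto
  then have "degree e = Suc (degree e')" unfolding e' by (subst degree_mult_eq) auto
  have "evp C3 w [:- r, 1:] = w - C3 r" by (simp add: evp_pCons[OF C3_hom] evp_0 C.hom_uminus C.hom_one)
  then have "(w - C3 r) * evp C3 w e' \<in> Q" using Suc.prems(2) unfolding e' E.hom_mult by simp
  then have "w - C3 r \<in> Q \<or> evp C3 w e' \<in> Q" using Q unfolding class_prime_iff by blast
  then show ?case using Suc.hyps(1)[of e'] Suc.hyps(2) \<open>degree e = Suc (degree e')\<close> \<open>e' \<noteq> 0\<close> by auto
qed

text \<open>Of x and z one lies in Q, and w is the other. Since x + z and w agree modulo Q, a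
  congruence w = c carries over to x + z; this is why one linear form serves both components of the
  zero set.\<close>

lemma remaining_variable:
  assumes "y \<in> Q" "x \<in> Q \<or> z \<in> Q"
  obtains w where "w \<in> {x, z}" "X3 \<in> Q \<or> X3 = w" "Y3 \<in> Q \<or> Y3 = w" "Z3 \<in> Q \<or> Z3 = w" "\<forall>c. w - c \<in> Q \<longrightarrow> ideal Q class_ring \<longrightarrow> x + z - c \<in> Q"
proof (cases "x \<in> Q")
  case True
  have "x + (z - c) \<in> Q" if "z - c \<in> Q" "ideal Q class_ring" for c using that True unfolding class_ideal_iff by blast
  then show ?thesis using that[of z] xy assms True by (auto simp: add_diff_eq)
next
  case False
  then have "z \<in> Q" using assms by blast
  moreover have "z + (x - c) \<in> Q" if "x - c \<in> Q" "ideal Q class_ring" for c using that \<open>z \<in> Q\<close> unfolding class_ideal_iff by blast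
  ultimately show ?thesis using that[of x] xy assms by (auto simp: add_diff_eq add.commute)
qed

text \<open>Modulo P everything is a polynomial in w. A prime Q strictly above P contains such a
  nonzero polynomial, hence some w - r, so that S/Q consists of constants and nothing proper lies
  strictly above Q.\<close>

lemma no_long_chain:
  assumes P: "primeideal P class_ring" "y \<in> P" "x \<in> P \<or> z \<in> P" and Q: "primeideal Q class_ring" "P \<subset> Q"
    and N: "primeideal N class_ring" "Q \<subset> N"
  shows False
proof -
  interpret C: comm_ring_hom "C3 :: 'k \<Rightarrow> _" by (rule C3_hom)
  obtain w where "w \<in> {x, z}" and w: "X3 \<in> P \<or> X3 = w" "Y3 \<in> P \<or> Y3 = w" "Z3 \<in> P \<or> Z3 = w"
    and "\<forall>c. w - c \<in> P \<longrightarrow> ideal P class_ring \<longrightarrow> x + z - c \<in> P" by (rule remaining_variable[OF P(2,3)])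
  interpret E: comm_ring_hom "evp C3 w" by (rule evp_hom[OF C3_hom])
  have id: "ideal P class_ring" "ideal Q class_ring" "ideal N class_ring" using P(1) Q(1) N(1) by (simp_all add: primeideal.axioms(1))
  have red: "\<exists>e. s - evp C3 w e \<in> P" for s :: "'k poly poly poly" by (rule reduce_mod_two_variables[OF id(1) w])
  obtain g where g: "g \<in> Q" "g \<notin> P" using Q by blast
  obtain e where e: "g - evp C3 w e \<in> P" using red by blast
  have "e \<noteq> 0" using e g(2) by (auto simp: evp_0)
  moreover have "g - (g - evp C3 w e) \<in> Q" using class_ideal_minus[OF id(2) g(1)] e Q(2) by blast
  ultimately obtain r where r: "w - C3 r \<in> Q" using root_in_prime[OF Q(1), of e w] by auto
  obtain g' where g': "g' \<in> N" "g' \<notin> Q" using N by blast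
  obtain e' where e': "g' - evp C3 w e' \<in> P" using red by blast
  have "[:- r, 1:] dvd e' - [:poly e' r:]" by (subst poly_eq_0_iff_dvd[symmetric]) simp
  then obtain q where "e' - [:poly e' r:] = [:- r, 1:] * q" by (rule dvdE)
  then have "evp C3 w e' - evp C3 w [:poly e' r:] = evp C3 w [:- r, 1:] * evp C3 w q" by (metis E.hom_minus E.hom_mult)
  moreover have "evp C3 w [:- r, 1:] = w - C3 r" by (simp add: evp_pCons[OF C3_hom] evp_0 C.hom_uminus C.hom_one)
  moreover have "evp C3 w [:poly e' r:] = C3 (poly e' r)" by (simp add: evp_pCons[OF C3_hom] evp_0)
  ultimately have "evp C3 w e' - C3 (poly e' r) = evp C3 w q * (w - C3 r)" by (simp add: mult.commute)
  also have "\<dots> \<in> Q" using r id(2) unfolding class_ideal_iff by blast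
  finally have "evp C3 w e' - C3 (poly e' r) \<in> Q" .
  moreover have "g' - evp C3 w e' \<in> Q" using e' Q(2) by blast
  ultimately have "(g' - evp C3 w e') + (evp C3 w e' - C3 (poly e' r)) \<in> Q" using id(2) unfolding class_ideal_iff by blast
  then have *: "g' - C3 (poly e' r) \<in> Q" by simp
  then have ne: "poly e' r \<noteq> 0" using g'(2) by (auto simp: C.hom_zero)
  have "g' - (g' - C3 (poly e' r)) \<in> N" using class_ideal_minus[OF id(3) g'(1)] * N(2) by blast
  then have "C3 (inverse (poly e' r)) * C3 (poly e' r) \<in> N" using id(3) unfolding class_ideal_iff by simp
  then have "C3 (inverse (poly e' r) * poly e' r) \<in> N" by (simp only: C.hom_mult)
  then show False using N(1) ne unfolding class_prime_iff by (simp add: C.hom_one)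
qed

text \<open>The Nullstellensatz in one variable. If w is not in M, it is invertible modulo M and its
  inverse is a polynomial e in w; so M contains w e(w) - 1, a nonzero polynomial in w, and thereby
  some w - r.\<close>

lemma maximal_contains_linear_form:
  assumes M: "maximalideal M class_ring" and y: "y \<in> M" "x \<in> M \<or> z \<in> M"
  shows "\<exists>c. x + z - C3 c \<in> M"
proof -
  interpret C: comm_ring_hom "C3 :: 'k \<Rightarrow> _" by (rule C3_hom)
  have Mp: "primeideal M class_ring" by (rule cring.maximalideal_prime[OF class_cring.is_cring M])
  then have Mi: "ideal M class_ring" unfolding class_prime_iff by blast
  obtain w where "w \<in> {x, z}" and w: "X3 \<in> M \<or> X3 = w" "Y3 \<in> M \<or> Y3 = w" "Z3 \<in> M \<or> Z3 = w"
    "\<forall>c. w - c \<in> M \<longrightarrow> ideal M class_ring \<longrightarrow> x + z - c \<in> M" by (rule remaining_variable[OF y])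
  interpret E: comm_ring_hom "evp C3 w" by (rule evp_hom[OF C3_hom])
  have "\<exists>r. w - C3 r \<in> M"
  proof (cases "w \<in> M")
    case True
    then show ?thesis by (intro exI[of _ 0]) (simp add: C.hom_zero)
  next
    case False
    define K where "K = {m + s * w | m s. m \<in> M}"
    have Mc: "0 \<in> M" "\<And>a b. a \<in> M \<Longrightarrow> b \<in> M \<Longrightarrow> a + b \<in> M" "\<And>a r. a \<in> M \<Longrightarrow> r * a \<in> M"
      using Mi unfolding class_ideal_iff by blast+
    have "ideal K class_ring"
      unfolding class_ideal_iff
    proof (intro conjI ballI allI)
      show "0 \<in> K" unfolding K_def using Mc(1) by (intro CollectI exI[of _ 0]) simp
      fix a assume "a \<in> K"
      then obtain m s where a: "m \<in> M" "a = m + s * w" unfolding K_def by blast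
      { fix r show "r * a \<in> K" using Mc(3)[OF a(1), of r] unfolding a(2) K_def
          by (intro CollectI exI[of _ "r * m"] exI[of _ "r * s"]) (simp add: algebra_simps) }
      fix b assume "b \<in> K"
      then obtain m' s' where b: "m' \<in> M" "b = m' + s' * w" unfolding K_def by blast
      show "a + b \<in> K" using Mc(2)[OF a(1) b(1)] unfolding a(2) b(2) K_def
          by (intro CollectI exI[of _ "m + m'"] exI[of _ "s + s'"]) (simp add: algebra_simps)
    qed
    moreover have "M \<subseteq> K" unfolding K_def by (force intro: exI[of _ 0])
    ultimately have "K = M \<or> K = carrier class_ring" using maximalideal.I_maximal[OF M, of K] by simp
    moreover have "w \<in> K" unfolding K_def using Mc(1) by (intro CollectI exI[of _ 0] exI[of _ 1]) simp
    ultimately have "1 \<in> K" using False by (metis UNIV_I partial_object.select_convs(1))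
    then obtain m s where ms: "m \<in> M" "1 = m + s * w" unfolding K_def by blast
    obtain e where e: "s - evp C3 w e \<in> M" using reduce_mod_two_variables[OF Mi w(1-3)] by blast
    have "evp C3 w (pCons 0 e - 1) = - m - (s - evp C3 w e) * w"
      unfolding E.hom_minus E.hom_one evp_pCons[OF C3_hom] ms(2) C.hom_zero by (simp add: algebra_simps)
    moreover have "- m \<in> M" using Mc(3)[OF ms(1), of "-1"] by simp
    moreover have "(s - evp C3 w e) * w \<in> M" using Mc(3)[OF e, of w] by (simp add: mult.commute)
    ultimately have "evp C3 w (pCons 0 e - 1) \<in> M" using class_ideal_minus[OF Mi] by metis
    moreover have "pCons 0 e - 1 \<noteq> 0"
    proof
      assume "pCons 0 e - 1 = 0"
      then have "poly (pCons 0 e - 1) 0 = 0" by simp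
      then show False by simp
    qed
    ultimately show ?thesis using root_in_prime[OF Mp] by blast
  qed
  then show ?thesis using w(4) Mi by blast
qed

text \<open>The form is monic in z, so the quotient map is evaluation at z = c - x. The image x (c -
  x) of x z is not divisible by y, whence powers of y and of x z stay a regular pair.\<close>

lemma quotient_by_linear_form:
  obtains \<tau> :: "'k poly poly poly \<Rightarrow> 'k poly poly" where "comm_ring_hom \<tau>" "surj \<tau>" "\<forall>p. \<tau> p = 0 \<longrightarrow> x + z - C3 c dvd p"
    "\<tau> (x + z - C3 c) = 0" "\<tau> y = yb" "\<not> yb dvd \<tau> (x * z)"
proof -
  define t where "t = [:[:c:]:] - xb"
  show ?thesis
  proof (rule that[of "\<lambda>p. poly p t"])
    have eq: "x + z - C3 c = [:- t, 1:]" by (simp add: x_def t_def Z3_def C3_def)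
    show "comm_ring_hom (\<lambda>p. poly p t)" by unfold_locales simp_all
    show "surj (\<lambda>p. poly p t)" by (rule surjI[of _ "\<lambda>q. [:q:]"]) simp
    show "\<forall>p. poly p t = 0 \<longrightarrow> x + z - C3 c dvd p" unfolding eq by (simp add: poly_eq_0_iff_dvd)
    show "poly (x + z - C3 c) t = 0" unfolding eq by simp
    obtain \<rho> :: "'k poly poly \<Rightarrow> 'k poly" where \<rho>: "comm_ring_hom \<rho>" "surj \<rho>" "\<forall>p. \<rho> p = 0 \<longrightarrow> yb dvd p" "\<rho> yb = 0"
      "\<rho> xb = [:0, 1:]" "\<forall>c. \<rho> [:[:c:]:] = [:c:]" by (rule quotient_by_yb)
    interpret \<rho>: comm_ring_hom \<rho> by (rule \<rho>)
    have "\<rho> t = [:c, -1:]" unfolding t_def by (simp add: \<rho>.hom_minus \<rho>)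
    then have "\<rho> (xb * t) \<noteq> 0" by (simp add: \<rho>.hom_mult \<rho>)
    then have "\<not> yb dvd xb * t" using \<rho>.hom_dvd[of yb "xb * t"] \<rho>(4) by auto
    then show "\<not> yb dvd poly (x * z) t" by (simp add: x_def Z3_def mult.commute)
  qed (simp add: y_def)
qed

end

section \<open>Resolutions given by matrices\<close>

lemma mult_mat_vec_eq:
  assumes "v \<in> carrier_vec m"
  shows "mat n m f *\<^sub>v v = vec n (\<lambda>i. \<Sum>j<m. f (i, j) * v $ j)"
  using assms by (intro eq_vecI) (auto simp: scalar_prod_def lessThan_atLeast0 intro!: sum.cong)

lemma mat_kernel_mat:
  "mat_kernel (mat n m f) = {v \<in> carrier_vec m. \<forall>i<n. (\<Sum>j<m. f (i, j) * v $ j) = 0}"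
proof -
  have "vec n g = 0\<^sub>v n \<longleftrightarrow> (\<forall>i<n. g i = 0)" for g :: "nat \<Rightarrow> 'a"
    by (auto simp: vec_eq_iff)
  then show ?thesis unfolding mat_kernel_def by (auto simp: mult_mat_vec_eq)
qed

lemma mat_image_mat:
  "mat_image (mat n m f) = {vec n (\<lambda>i. \<Sum>j<m. f (i, j) * v $ j) | v. v \<in> carrier_vec m}"
  unfolding mat_image_def Setcompr_eq_image by (intro image_cong) (simp_all add: mult_mat_vec_eq)

lemma elements_mat_mat: "elements_mat (mat n m f) = {f (i, j) | i j. i < n \<and> j < m}"
  unfolding elements_mat_def by (auto, blast)

lemma obtain_vec2:
  obtains v where "v \<in> carrier_vec 2" "v $ 0 = a" "v $ 1 = b"
  by (rule that[of "vec 2 (\<lambda>i. if i = 0 then a else b)"]) simp_all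

lemma obtain_vec3:
  obtains v where "v \<in> carrier_vec 3" "v $ 0 = a" "v $ 1 = b" "v $ 2 = c"
  by (rule that[of "vec 3 (\<lambda>i. if i = 0 then a else if i = 1 then b else c)"]) simp_all

lemma less3: "(i::nat) < 3 \<longleftrightarrow> i = 0 \<or> i = 1 \<or> i = 2" and less2: "(i::nat) < 2 \<longleftrightarrow> i = 0 \<or> i = 1"
  by auto

lemma vec3_eq: "v \<in> carrier_vec 3 \<Longrightarrow> w \<in> carrier_vec 3 \<Longrightarrow> v = w \<longleftrightarrow> v $ 0 = w $ 0 \<and> v $ 1 = w $ 1 \<and> v $ 2 = w $ 2"
  by (auto simp: vec_eq_iff less3)

lemma vec2_eq: "v \<in> carrier_vec 2 \<Longrightarrow> w \<in> carrier_vec 2 \<Longrightarrow> v = w \<longleftrightarrow> v $ 0 = w $ 0 \<and> v $ 1 = w $ 1"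
  by (auto simp: vec_eq_iff less2)

lemma sum_less2: "(\<Sum>j<2::nat. f j) = f 0 + (f 1 :: 'a::comm_monoid_add)"
  and sum_less3: "(\<Sum>j<3::nat. f j) = f 0 + f 1 + f 2"
  by (simp_all add: numeral_3_eq_3 numeral_2_eq_2)

lemma sum_less1: "(\<Sum>j<1::nat. f j) = (f 0 :: 'a::comm_monoid_add)"
  by simp

text \<open>Both dimensions are explicit because a map from the zero module has no entries, but its
  number of rows still matters.\<close>

definition rows_mat :: "nat \<Rightarrow> nat \<Rightarrow> 's list list \<Rightarrow> 's mat" where
  "rows_mat n m rs = mat n m (\<lambda>(i, j). rs ! i ! j)"

lemma mat_image_0_cols: "mat_image (rows_mat n 0 rs) = {0\<^sub>v n}"
  unfolding rows_mat_def mat_image_mat lessThan_0 sum.empty zero_vec_def[symmetric]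
  by (auto intro: exI[of _ "0\<^sub>v 0"])

lemma rows_mat_trivial:
  "mat_kernel (rows_mat n 0 rs) = mat_image (rows_mat 0 0 rs')" "elements_mat (rows_mat n 0 rs) = {}"
proof -
  have "v = 0\<^sub>v 0" if "v \<in> carrier_vec 0" for v :: "'a vec" using that by (intro eq_vecI) auto
  then have "carrier_vec 0 = {0\<^sub>v 0 :: 'a vec}" by auto
  then show "mat_kernel (rows_mat n 0 rs) = mat_image (rows_mat 0 0 rs')"
    unfolding mat_image_0_cols unfolding rows_mat_def mat_kernel_mat by simp
  show "elements_mat (rows_mat n 0 rs) = {}" unfolding rows_mat_def elements_mat_mat by simp
qed

lemma augmentation_image:
  fixes g1 g2 g3 :: "'s::comm_ring_1"
  shows "(\<lambda>v. v $ 0) ` mat_image (rows_mat 1 3 [[g1, g2, g3]]) = Idl\<^bsub>class_ring\<^esub> {g1, g2, g3}"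
proof -
  have "(\<lambda>v. v $ 0) ` mat_image (rows_mat 1 3 [[g1, g2, g3]]) = {g1 * v $ 0 + g2 * v $ 1 + g3 * v $ 2 | v. v \<in> carrier_vec 3}"
    unfolding rows_mat_def mat_image_mat sum_less3 by (simp add: Setcompr_eq_image image_image)
  also have "\<dots> = {u * g1 + v * g2 + w * g3 | u v w. True}"
  proof (intro equalityI subsetI; elim CollectE exE conjE)
    fix a v assume "a = g1 * v $ 0 + g2 * v $ 1 + g3 * v $ 2"
    then have "a = v $ 0 * g1 + v $ 1 * g2 + v $ 2 * g3" by (simp add: mult.commute)
    then show "a \<in> {u * g1 + v * g2 + w * g3 | u v w. True}" by blast
  next
    fix a u v w assume a: "a = u * g1 + v * g2 + w * g3"
    obtain t where "t \<in> carrier_vec 3" "t $ 0 = u" "t $ 1 = v" "t $ 2 = w" by (rule obtain_vec3)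
    then show "a \<in> {g1 * v $ 0 + g2 * v $ 1 + g3 * v $ 2 | v. v \<in> carrier_vec 3}"
      unfolding a by (intro CollectI exI[of _ t]) (simp add: mult.commute)
  qed
  finally show ?thesis unfolding class_Idl_triple .
qed

text \<open>Exactness at the first module is \<open>ex\<close>, which says that the columns generate
  the syzygies; exactness at the second is \<open>inj\<close>. All positive-degree entries lie in
  the irrelevant ideal, which gives minimality.\<close>

lemma resolution_of_length_1:
  fixes g1 g2 g3 :: "'k::comm_ring_1 poly poly poly"
  assumes g: "homogeneous3 e g1" "homogeneous3 e g2" "homogeneous3 e g3"
    and B: "homogeneous3 (b - e) B1" "homogeneous3 (b - e) B2" "homogeneous3 (b - e) B3"
    and A: "homogeneous3 (a - e) A1" "homogeneous3 (a - e) A2" "homogeneous3 (a - e) A3"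
    and deg: "b > e" "a > e"
    and ex: "\<And>u1 u2 u3. u1 * g1 + u2 * g2 + u3 * g3 = 0 \<longleftrightarrow>
      (\<exists>s t. u1 = B1 * s + A1 * t \<and> u2 = B2 * s + A2 * t \<and> u3 = B3 * s + A3 * t)"
    and inj: "\<And>s t. B1 * s + A1 * t = 0 \<Longrightarrow> B2 * s + A2 * t = 0 \<Longrightarrow> B3 * s + A3 * t = 0 \<Longrightarrow> s = 0 \<and> t = 0"
  shows "min_graded_free_resolution (Idl\<^bsub>class_ring\<^esub> {g1, g2, g3}) [[e, e, e], [b, a]]"
proof -
  \<comment> \<open>The matrix with two rows and no columns has image 0, so exactness there is
    injectivity of the map before it. All later matrices are empty.\<close>
  define M where "M i = (if i = 0 then rows_mat 1 3 [[g1, g2, g3]]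
    else if i = 1 then rows_mat 3 2 [[B1, A1], [B2, A2], [B3, A3]]
    else if i = 2 then rows_mat 2 0 [] else rows_mat 0 0 [])" for i :: nat
  define F where "F i = (if i < length [[e, e, e], [b, a]] then [[e, e, e], [b, a]] ! i else [])" for i
  have F: "F 0 = [e, e, e]" "F (Suc 0) = [b, a]" "F (Suc (Suc i)) = []" for i by (simp_all add: F_def)
  have M: "M 0 = rows_mat 1 3 [[g1, g2, g3]]" "M (Suc 0) = rows_mat 3 2 [[B1, A1], [B2, A2], [B3, A3]]"
    "M (Suc (Suc 0)) = rows_mat 2 0 []" "M (Suc (Suc (Suc i))) = rows_mat 0 0 []" for i
    by (simp_all add: M_def)
  have step0: "graded_map (F (Suc 0)) (F 0) (M (Suc 0)) \<and> mat_kernel (M 0) = mat_image (M (Suc 0)) \<and>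
      elements_mat (M (Suc 0)) \<subseteq> irrelevant_ideal"
  proof (intro conjI)
    show "graded_map (F (Suc 0)) (F 0) (M (Suc 0))"
      unfolding F M graded_map_def rows_mat_def using A B by (auto simp: less3 less2 numeral_3_eq_3 less_Suc_eq)
    show "elements_mat (M (Suc 0)) \<subseteq> irrelevant_ideal"
      unfolding M rows_mat_def elements_mat_mat using A[THEN homogeneous3_irrelevant] B[THEN homogeneous3_irrelevant] deg
      by (auto simp: less3 less2)
    show "mat_kernel (M 0) = mat_image (M (Suc 0))"
    proof (intro equalityI subsetI)
      fix v assume "v \<in> mat_kernel (M 0)"
      then have v: "v \<in> carrier_vec 3" "v $ 0 * g1 + v $ 1 * g2 + v $ 2 * g3 = 0"
        unfolding M rows_mat_def mat_kernel_mat sum_less3 by (auto simp: mult.commute)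
      obtain s t where st: "v $ 0 = B1 * s + A1 * t" "v $ 1 = B2 * s + A2 * t" "v $ 2 = B3 * s + A3 * t"
        using v(2) unfolding ex by blast
      obtain u where u: "u \<in> carrier_vec 2" "u $ 0 = s" "u $ 1 = t" by (rule obtain_vec2)
      show "v \<in> mat_image (M (Suc 0))"
        unfolding M rows_mat_def mat_image_mat sum_less2
        by (rule CollectI, rule exI[of _ u]) (simp add: u v(1) vec3_eq st del: One_nat_def)
    next
      fix v assume "v \<in> mat_image (M (Suc 0))"
      then obtain u where u: "u \<in> carrier_vec 2" and v: "v \<in> carrier_vec 3" "v $ 0 = B1 * u $ 0 + A1 * u $ 1" "v $ 1 = B2 * u $ 0 + A2 * u $ 1"
        "v $ 2 = B3 * u $ 0 + A3 * u $ 1"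
        unfolding M rows_mat_def mat_image_mat sum_less2 by auto
      have "v $ 0 * g1 + v $ 1 * g2 + v $ 2 * g3 = 0" unfolding ex using v(2-4) by blast
      then show "v \<in> mat_kernel (M 0)"
        using v(1) unfolding M rows_mat_def mat_kernel_mat sum_less3 by (auto simp: mult.commute)
    qed
  qed
  have step1: "graded_map (F (Suc (Suc 0))) (F (Suc 0)) (M (Suc (Suc 0))) \<and> mat_kernel (M (Suc 0)) = mat_image (M (Suc (Suc 0))) \<and>
      elements_mat (M (Suc (Suc 0))) \<subseteq> irrelevant_ideal"
  proof (intro conjI)
    show "graded_map (F (Suc (Suc 0))) (F (Suc 0)) (M (Suc (Suc 0)))"
      unfolding F M graded_map_def rows_mat_def by (simp add: numeral_2_eq_2)
    show "elements_mat (M (Suc (Suc 0))) \<subseteq> irrelevant_ideal" unfolding M rows_mat_trivial by simp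
    show "mat_kernel (M (Suc 0)) = mat_image (M (Suc (Suc 0)))"
      unfolding M mat_image_0_cols
    proof (intro equalityI subsetI)
      fix v assume "v \<in> mat_kernel (rows_mat 3 2 [[B1, A1], [B2, A2], [B3, A3]])"
      then have v: "v \<in> carrier_vec 2" "B1 * v $ 0 + A1 * v $ 1 = 0" "B2 * v $ 0 + A2 * v $ 1 = 0" "B3 * v $ 0 + A3 * v $ 1 = 0"
        unfolding rows_mat_def mat_kernel_mat sum_less2 by (auto simp: less3)
      then show "v \<in> {0\<^sub>v 2}" using inj[OF v(2-4)] vec2_eq[OF v(1), of "0\<^sub>v 2"] by simp
    next
      fix v :: "'k poly poly poly vec" assume "v \<in> {0\<^sub>v 2}"
      then show "v \<in> mat_kernel (rows_mat 3 2 [[B1, A1], [B2, A2], [B3, A3]])"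
        unfolding rows_mat_def mat_kernel_mat by (simp add: less3 sum_less2)
    qed
  qed
  have step2: "graded_map (F (Suc i)) (F i) (M (Suc i)) \<and> mat_kernel (M i) = mat_image (M (Suc i)) \<and>
      elements_mat (M (Suc i)) \<subseteq> irrelevant_ideal" if "i \<ge> 2" for i
  proof -
    obtain j where j: "i = Suc (Suc j)" using \<open>i \<ge> 2\<close> by (metis add_2_eq_Suc le_Suc_ex)
    have "mat_kernel (M i) = mat_image (M (Suc i))"
      unfolding j by (cases j) (simp_all only: M rows_mat_trivial(1)[where rs' = "[]"])
    then show ?thesis unfolding j F M rows_mat_trivial(2) by (simp add: graded_map_def rows_mat_def)
  qed
  have "graded_map (F (Suc i)) (F i) (M (Suc i)) \<and> mat_kernel (M i) = mat_image (M (Suc i)) \<and>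
      elements_mat (M (Suc i)) \<subseteq> irrelevant_ideal" for i
  proof -
    consider "i = 0" | "i = Suc 0" | "i \<ge> 2" by linarith
    then show ?thesis using step0 step1 step2 by cases simp_all
  qed
  moreover have "graded_map (F 0) [0] (M 0)"
    unfolding F M graded_map_def rows_mat_def using g by (auto simp: less_Suc_eq numeral_3_eq_3)
  moreover have "(\<lambda>v. v $ 0) ` mat_image (M 0) = Idl\<^bsub>class_ring\<^esub> {g1, g2, g3}" unfolding M by (rule augmentation_image)
  ultimately show ?thesis
    unfolding min_graded_free_resolution_def Let_def F_def by blast
qed

lemma resolution_of_length_2:
  fixes g1 g2 g3 :: "'k::comm_ring_1 poly poly poly"
  assumes g: "homogeneous3 e g1" "homogeneous3 e g2" "homogeneous3 e g3"
    and A: "homogeneous3 (a - e) A1" "homogeneous3 (a - e) A2" "homogeneous3 (a - e) A3"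
    and B: "homogeneous3 (b - e) B1" "homogeneous3 (b - e) B2" "homogeneous3 (b - e) B3"
    and E: "homogeneous3 (b - e) E1" "homogeneous3 (b - e) E2" "homogeneous3 (b - e) E3"
    and D: "homogeneous3 (c - a) D1" "homogeneous3 (c - b) D2" "homogeneous3 (c - b) D3"
    and deg: "a > e" "b > e" "c > a" "c > b"
    and ex0: "\<And>u1 u2 u3. u1 * g1 + u2 * g2 + u3 * g3 = 0 \<longleftrightarrow>
      (\<exists>s t r. u1 = A1 * s + B1 * t + E1 * r \<and> u2 = A2 * s + B2 * t + E2 * r \<and> u3 = A3 * s + B3 * t + E3 * r)"
    and ex1: "\<And>s t r. (A1 * s + B1 * t + E1 * r = 0 \<and> A2 * s + B2 * t + E2 * r = 0 \<and> A3 * s + B3 * t + E3 * r = 0) \<longleftrightarrow>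
      (\<exists>h. s = D1 * h \<and> t = D2 * h \<and> r = D3 * h)"
    and inj: "\<And>h. D1 * h = 0 \<Longrightarrow> D2 * h = 0 \<Longrightarrow> D3 * h = 0 \<Longrightarrow> h = 0"
  shows "min_graded_free_resolution (Idl\<^bsub>class_ring\<^esub> {g1, g2, g3}) [[e, e, e], [a, b, b], [c]]"
proof -
  define M where "M i = (if i = 0 then rows_mat 1 3 [[g1, g2, g3]]
    else if i = 1 then rows_mat 3 3 [[A1, B1, E1], [A2, B2, E2], [A3, B3, E3]]
    else if i = 2 then rows_mat 3 1 [[D1], [D2], [D3]]
    else if i = 3 then rows_mat 1 0 [] else rows_mat 0 0 [])" for i :: nat
  define F where "F i = (if i < length [[e, e, e], [a, b, b], [c]] then [[e, e, e], [a, b, b], [c]] ! i else [])" for i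
  have F: "F 0 = [e, e, e]" "F (Suc 0) = [a, b, b]" "F (Suc (Suc 0)) = [c]" "F (Suc (Suc (Suc i))) = []" for i by (simp_all add: F_def)
  have M: "M 0 = rows_mat 1 3 [[g1, g2, g3]]" "M (Suc 0) = rows_mat 3 3 [[A1, B1, E1], [A2, B2, E2], [A3, B3, E3]]"
    "M (Suc (Suc 0)) = rows_mat 3 1 [[D1], [D2], [D3]]" "M (Suc (Suc (Suc 0))) = rows_mat 1 0 []"
    "M (Suc (Suc (Suc (Suc i)))) = rows_mat 0 0 []" for i
    by (simp_all add: M_def)
  have step0: "graded_map (F (Suc 0)) (F 0) (M (Suc 0)) \<and> mat_kernel (M 0) = mat_image (M (Suc 0)) \<and>
      elements_mat (M (Suc 0)) \<subseteq> irrelevant_ideal"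
  proof (intro conjI)
    show "graded_map (F (Suc 0)) (F 0) (M (Suc 0))"
      unfolding F M graded_map_def rows_mat_def using A B E by (auto simp: less3 numeral_3_eq_3 less_Suc_eq)
    show "elements_mat (M (Suc 0)) \<subseteq> irrelevant_ideal"
      unfolding M rows_mat_def elements_mat_mat
      using A[THEN homogeneous3_irrelevant] B[THEN homogeneous3_irrelevant] E[THEN homogeneous3_irrelevant] deg
      by (auto simp: less3)
    show "mat_kernel (M 0) = mat_image (M (Suc 0))"
    proof (intro equalityI subsetI)
      fix v assume "v \<in> mat_kernel (M 0)"
      then have v: "v \<in> carrier_vec 3" "v $ 0 * g1 + v $ 1 * g2 + v $ 2 * g3 = 0"
        unfolding M rows_mat_def mat_kernel_mat sum_less3 by (auto simp: mult.commute)
      obtain s t r where st: "v $ 0 = A1 * s + B1 * t + E1 * r" "v $ 1 = A2 * s + B2 * t + E2 * r" "v $ 2 = A3 * s + B3 * t + E3 * r"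
        using v(2) unfolding ex0 by blast
      obtain u where u: "u \<in> carrier_vec 3" "u $ 0 = s" "u $ 1 = t" "u $ 2 = r" by (rule obtain_vec3)
      show "v \<in> mat_image (M (Suc 0))"
        unfolding M rows_mat_def mat_image_mat sum_less3
        by (rule CollectI, rule exI[of _ u]) (simp add: u v(1) vec3_eq st del: One_nat_def)
    next
      fix v assume "v \<in> mat_image (M (Suc 0))"
      then obtain u where u: "u \<in> carrier_vec 3" and v: "v \<in> carrier_vec 3" "v $ 0 = A1 * u $ 0 + B1 * u $ 1 + E1 * u $ 2"
        "v $ 1 = A2 * u $ 0 + B2 * u $ 1 + E2 * u $ 2" "v $ 2 = A3 * u $ 0 + B3 * u $ 1 + E3 * u $ 2"
        unfolding M rows_mat_def mat_image_mat sum_less3 by auto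
      have "v $ 0 * g1 + v $ 1 * g2 + v $ 2 * g3 = 0" unfolding ex0 using v(2-4) by blast
      then show "v \<in> mat_kernel (M 0)"
        using v(1) unfolding M rows_mat_def mat_kernel_mat sum_less3 by (auto simp: mult.commute)
    qed
  qed
  have step1: "graded_map (F (Suc (Suc 0))) (F (Suc 0)) (M (Suc (Suc 0))) \<and> mat_kernel (M (Suc 0)) = mat_image (M (Suc (Suc 0))) \<and>
      elements_mat (M (Suc (Suc 0))) \<subseteq> irrelevant_ideal"
  proof (intro conjI)
    show "graded_map (F (Suc (Suc 0))) (F (Suc 0)) (M (Suc (Suc 0)))"
      unfolding F M graded_map_def rows_mat_def using D by (auto simp: less3 numeral_3_eq_3 less_Suc_eq)
    show "elements_mat (M (Suc (Suc 0))) \<subseteq> irrelevant_ideal"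
      unfolding M rows_mat_def elements_mat_mat using D[THEN homogeneous3_irrelevant] deg
      by (auto simp: less3)
    show "mat_kernel (M (Suc 0)) = mat_image (M (Suc (Suc 0)))"
    proof (intro equalityI subsetI)
      fix v assume "v \<in> mat_kernel (M (Suc 0))"
      then have v: "v \<in> carrier_vec 3" "A1 * v $ 0 + B1 * v $ 1 + E1 * v $ 2 = 0 \<and> A2 * v $ 0 + B2 * v $ 1 + E2 * v $ 2 = 0 \<and>
          A3 * v $ 0 + B3 * v $ 1 + E3 * v $ 2 = 0"
        unfolding M rows_mat_def mat_kernel_mat sum_less3 by (auto simp: less3)
      obtain h where h: "v $ 0 = D1 * h" "v $ 1 = D2 * h" "v $ 2 = D3 * h" using v(2) unfolding ex1 by blast
      have "vec 1 (\<lambda>_. h) \<in> carrier_vec 1" "vec 1 (\<lambda>_. h) $ 0 = h" by simp_all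
      then show "v \<in> mat_image (M (Suc (Suc 0)))"
        unfolding M rows_mat_def mat_image_mat sum_less1
        by (intro CollectI exI[of _ "vec 1 (\<lambda>_. h)"]) (simp add: v(1) vec3_eq h del: One_nat_def)
    next
      fix v assume "v \<in> mat_image (M (Suc (Suc 0)))"
      then obtain u :: "'k poly poly poly vec" where v: "v \<in> carrier_vec 3" "v $ 0 = D1 * u $ 0" "v $ 1 = D2 * u $ 0" "v $ 2 = D3 * u $ 0"
        unfolding M rows_mat_def mat_image_mat sum_less1 by auto
      have "A1 * v $ 0 + B1 * v $ 1 + E1 * v $ 2 = 0 \<and> A2 * v $ 0 + B2 * v $ 1 + E2 * v $ 2 = 0 \<and>
          A3 * v $ 0 + B3 * v $ 1 + E3 * v $ 2 = 0" unfolding ex1 using v(2-4) by blast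
      then show "v \<in> mat_kernel (M (Suc 0))"
        using v(1) unfolding M rows_mat_def mat_kernel_mat sum_less3 by (auto simp: less3)
    qed
  qed
  have step2: "graded_map (F (Suc (Suc (Suc 0)))) (F (Suc (Suc 0))) (M (Suc (Suc (Suc 0)))) \<and> mat_kernel (M (Suc (Suc 0))) = mat_image (M (Suc (Suc (Suc 0)))) \<and>
      elements_mat (M (Suc (Suc (Suc 0)))) \<subseteq> irrelevant_ideal"
  proof (intro conjI)
    show "graded_map (F (Suc (Suc (Suc 0)))) (F (Suc (Suc 0))) (M (Suc (Suc (Suc 0))))"
      unfolding F M graded_map_def rows_mat_def by (simp add: numeral_2_eq_2)
    show "elements_mat (M (Suc (Suc (Suc 0)))) \<subseteq> irrelevant_ideal" unfolding M rows_mat_trivial by simp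
    show "mat_kernel (M (Suc (Suc 0))) = mat_image (M (Suc (Suc (Suc 0))))"
      unfolding M mat_image_0_cols
    proof (intro equalityI subsetI)
      fix v assume "v \<in> mat_kernel (rows_mat 3 1 [[D1], [D2], [D3]])"
      then have v: "v \<in> carrier_vec 1" "D1 * v $ 0 = 0" "D2 * v $ 0 = 0" "D3 * v $ 0 = 0"
        unfolding rows_mat_def mat_kernel_mat sum_less1 by (auto simp: less3)
      have "v = 0\<^sub>v 1" using inj[OF v(2-4)] v(1) by (intro eq_vecI) auto
      then show "v \<in> {0\<^sub>v 1}" by simp
    next
      fix v :: "'k poly poly poly vec" assume "v \<in> {0\<^sub>v 1}"
      then show "v \<in> mat_kernel (rows_mat 3 1 [[D1], [D2], [D3]])"
        unfolding rows_mat_def mat_kernel_mat by (simp add: less3)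
    qed
  qed
  have step3: "graded_map (F (Suc i)) (F i) (M (Suc i)) \<and> mat_kernel (M i) = mat_image (M (Suc i)) \<and>
      elements_mat (M (Suc i)) \<subseteq> irrelevant_ideal" if "i \<ge> 3" for i
  proof -
    obtain j where j: "i = Suc (Suc (Suc j))" using \<open>i \<ge> 3\<close> by (metis add_2_eq_Suc add_Suc le_Suc_ex numeral_3_eq_3 numeral_2_eq_2)
    have "mat_kernel (M i) = mat_image (M (Suc i))"
      unfolding j by (cases j) (simp_all only: M rows_mat_trivial(1)[where rs' = "[]"])
    then show ?thesis unfolding j F M rows_mat_trivial(2) by (simp add: graded_map_def rows_mat_def)
  qed
  have "graded_map (F (Suc i)) (F i) (M (Suc i)) \<and> mat_kernel (M i) = mat_image (M (Suc i)) \<and>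
      elements_mat (M (Suc i)) \<subseteq> irrelevant_ideal" for i
  proof -
    consider "i = 0" | "i = Suc 0" | "i = Suc (Suc 0)" | "i \<ge> 3" by linarith
    then show ?thesis using step0 step1 step2 step3 by cases simp_all
  qed
  moreover have "graded_map (F 0) [0] (M 0)"
    unfolding F M graded_map_def rows_mat_def using g by (auto simp: less_Suc_eq numeral_3_eq_3)
  moreover have "(\<lambda>v. v $ 0) ` mat_image (M 0) = Idl\<^bsub>class_ring\<^esub> {g1, g2, g3}" unfolding M by (rule augmentation_image)
  ultimately show ?thesis
    unfolding min_graded_free_resolution_def Let_def F_def by blast
qed

section \<open>The two shapes of the Jacobian ideal\<close>

context roles
begin

lemma homogeneous3_var:
  assumes "homogeneous3 n p"
  shows "homogeneous3 (n + 1) (x * p)" "homogeneous3 (n + 1) (y * p)" "homogeneous3 (n + 1) (z * p)"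
proof -
  note X = homogeneous3_simps(1)[OF assms] and Y = homogeneous3_simps(2)[OF assms]
  show "homogeneous3 (n + 1) (x * p)" using xy X Y by (elim disjE conjE) simp_all
  show "homogeneous3 (n + 1) (y * p)" using xy X Y by (elim disjE conjE) simp_all
  show "homogeneous3 (n + 1) (z * p)" by (rule homogeneous3_simps(3)[OF assms])
qed

lemma homogeneous3_xyz: "homogeneous3 1 x" "homogeneous3 1 y" "homogeneous3 1 z"
  using homogeneous3_var[OF homogeneous3_simps(6)] by simp_all

text \<open>The generators are the minors of the matrix with columns \<open>(0, Q, -P)\<close> and \<open>(x, -y, -z)\<close>.\<close>

theorem perfect_case:
  fixes P Q :: "'k poly poly poly" and d :: nat
  defines "J \<equiv> Idl\<^bsub>class_ring\<^esub> {y * P + z * Q, x * P, x * Q}"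
  assumes d: "d \<ge> 3" and hom: "homogeneous3 (int d - 2) P" "homogeneous3 (int d - 2) Q"
    and primes: "\<And>M. primeideal M class_ring \<Longrightarrow> J \<subseteq> M \<Longrightarrow> y \<in> M \<and> (x \<in> M \<or> z \<in> M)"
  shows "perfect_ideal J \<and> linear_type J \<and>
    min_graded_free_resolution J [[int d - 1, int d - 1, int d - 1], [2 * int d - 3, int d]]"
proof -
  have J: "ideal J class_ring" unfolding J_def by (rule class_Idl_ideal)
  have mem: "s \<in> J \<longleftrightarrow> (\<exists>u v w. s = u * (y * P + z * Q) + v * (x * P) + w * (x * Q))" for s
    unfolding J_def class_Idl_triple by simp
  obtain N where "y ^ N \<in> J" using radical_member[OF J, of y] primes by metis
  then obtain c1 c2 c3 where yN: "y ^ N = c1 * (y * P + z * Q) + c2 * (x * P) + c3 * (x * Q)" unfolding mem by blast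
  have xz: "x * z \<in> M" if "primeideal M class_ring" "J \<subseteq> M" for M
    using primes[OF that] primeideal.axioms(1)[OF that(1)] unfolding class_ideal_iff by (metis mult.commute)
  obtain N' where "(x * z) ^ N' \<in> J" using radical_member[OF J xz] by metis
  moreover have Jc: "r * t \<in> J" if "t \<in> J" for r t using that J unfolding class_ideal_iff by blast
  ultimately have "(x * z) ^ (N' + N) \<in> J" using Jc[of "(x * z) ^ N'" "(x * z) ^ N"] by (simp only: power_add mult.commute)
  have "y ^ (N' + N) \<in> J" using Jc[OF \<open>y ^ N \<in> J\<close>, of "y ^ N'"] by (simp only: power_add)
  \<comment> \<open>A common exponent, since the regular pair consists of equal powers of y and of x
    z.\<close>
  define K where "K = N' + N"
  obtain a1 a2 a3 where yK: "y ^ K = a1 * (y * P + z * Q) + a2 * (x * P) + a3 * (x * Q)"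
    using \<open>y ^ (N' + N) \<in> J\<close> unfolding mem K_def by blast
  obtain b1 b2 b3 where xzK: "(x * z) ^ K = b1 * (y * P + z * Q) + b2 * (x * P) + b3 * (x * Q)"
    using \<open>(x * z) ^ (N' + N) \<in> J\<close> unfolding mem K_def by blast
  obtain \<sigma> :: "'k poly poly poly \<Rightarrow> 'k poly poly" where \<sigma>: "comm_ring_hom \<sigma>" "surj \<sigma>" "\<forall>p. \<sigma> p = 0 \<longrightarrow> y dvd p" "\<sigma> y = 0"
    "prime_elem (\<sigma> x)" "prime_elem (\<sigma> z)" "\<not> \<sigma> z dvd \<sigma> x" "\<not> \<sigma> x dvd \<sigma> z" "\<sigma> x \<noteq> 0" "\<sigma> z \<noteq> 0"
    by (rule quotient_by_y)
  interpret \<sigma>: comm_ring_hom \<sigma> by (rule \<sigma>(1))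
  have y0: "y \<noteq> 0" using prime_xyz(2) by auto
  have PQ: "\<sigma> P \<noteq> 0 \<or> \<sigma> Q \<noteq> 0"
  proof (rule ccontr)
    assume "\<not> ?thesis"
    then have "\<sigma> s = 0" if "s \<in> J" for s using that unfolding mem by (auto simp: \<sigma>.hom_add \<sigma>.hom_mult)
    then show False using y_ideal_prime[of J \<sigma>, OF primes \<sigma>(1,9,10)] by blast
  qed
  have lt: "linear_type J"
    unfolding J_def by (rule linear_type_perfect_case[OF \<sigma>(1,2) \<sigma>(3)[rule_format] \<sigma>(4) y0 \<sigma>(6,7) PQ yN])
  \<comment> \<open>The zero entry of the column (0, Q, -P) is kept, so that the generators have the
    exact form of minors with the other column (x, -y, -z).\<close>
  have m: "y * P + z * Q = - y * (- P) - (- z) * Q" "x * P = - z * 0 - x * (- P)" "x * Q = x * Q - (- y) * 0"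
    by simp_all
  have pj: "perfect_ideal J"
  proof (rule perfect_idealI[OF J noetherian_poly3])
    fix M :: "'k poly poly poly set" assume M: "maximalideal M class_ring" "J \<subseteq> M"
    have Mp: "primeideal M class_ring" by (rule cring.maximalideal_prime[OF class_cring.is_cring M(1)])
    obtain c where c: "x + z - C3 c \<in> M" using maximal_contains_linear_form[OF M(1)] primes[OF Mp M(2)] by blast
    obtain \<tau> :: "'k poly poly poly \<Rightarrow> 'k poly poly" where \<tau>: "comm_ring_hom \<tau>" "surj \<tau>" "\<forall>p. \<tau> p = 0 \<longrightarrow> x + z - C3 c dvd p"
      "\<tau> (x + z - C3 c) = 0" "\<tau> y = yb" "\<not> yb dvd \<tau> (x * z)" by (rule quotient_by_linear_form)
    interpret \<tau>: comm_ring_hom \<tau> by (rule \<tau>(1))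
    have "x + z - C3 c \<noteq> 0"
    proof
      assume "x + z - C3 c = 0"
      then have "coeff (x + z - C3 c) 1 = 0" by simp
      then show False by (simp add: x_def Z3_def C3_def)
    qed
    note h = \<tau>(4) this
    \<comment> \<open>The memberships of y^K and (x z)^K in J are carried to the quotient by x + z -
      c, where they supply the regular pair.\<close>
    have w: "yb ^ K = \<tau> a1 * \<tau> (y * P + z * Q) + \<tau> a2 * \<tau> (x * P) + \<tau> a3 * \<tau> (x * Q)"
      unfolding \<tau>.hom_mult[symmetric] \<tau>.hom_add[symmetric] yK[symmetric] \<tau>.hom_power \<tau>(5) ..
    have w': "\<tau> (x * z) ^ K = \<tau> b1 * \<tau> (y * P + z * Q) + \<tau> b2 * \<tau> (x * P) + \<tau> b3 * \<tau> (x * Q)"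
      unfolding \<tau>.hom_power[symmetric] xzK by (simp only: \<tau>.hom_add \<tau>.hom_mult)
    have w0: "yb ^ K \<noteq> 0" using prime_yb by auto
    have "g \<in> J" if g: "(x + z - C3 c) * g \<in> J" for g
    proof -
      obtain u1 u2 u3 where "(x + z - C3 c) * g = u1 * (y * P + z * Q) + u2 * (x * P) + u3 * (x * Q)" using g unfolding mem by blast
      from nonzerodivisor_mod_minors[OF m \<tau>(1,2) \<tau>(3)[rule_format] h w w' w0 prime_power_dvd_cancel[OF prime_yb \<tau>(6)] this]
      show ?thesis unfolding mem .
    qed
    then show "\<exists>h\<in>M. \<forall>g. h * g \<in> J \<longrightarrow> g \<in> J" using c by blast
  next
    fix A B C :: "'k poly poly poly set"
    assume *: "primeideal A class_ring" "primeideal B class_ring" "primeideal C class_ring" "J \<subseteq> A" "A \<subset> B" "B \<subset> C"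
    show False using no_long_chain[OF *(1) _ _ *(2,5,3,6)] primes[OF *(1,4)] by blast
  qed
  have yK0: "y ^ K \<noteq> 0" using y0 by simp
  have PQ0: "P \<noteq> 0 \<or> Q \<noteq> 0" using PQ by auto
  have x0: "x \<noteq> 0" using prime_xyz(1) by auto
  have e: "int d - 2 + 1 = int d - 1" by simp
  have "min_graded_free_resolution J [[int d - 1, int d - 1, int d - 1], [2 * int d - 3, int d]]"
    unfolding J_def
  proof (rule resolution_of_length_1[where ?A1.0 = x and ?A2.0 = "- y" and ?A3.0 = "- z" and ?B1.0 = 0 and ?B2.0 = Q and ?B3.0 = "- P"])
    show "homogeneous3 (int d - 1) (y * P + z * Q)" "homogeneous3 (int d - 1) (x * P)" "homogeneous3 (int d - 1) (x * Q)"
      using homogeneous3_var[OF hom(1)] homogeneous3_var[OF hom(2)] unfolding e by (auto intro: homogeneous3_simps)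
    show "homogeneous3 (2 * int d - 3 - (int d - 1)) (0 :: 'k poly poly poly)" by (rule homogeneous3_simps(7))
    have e2: "2 * int d - 3 - (int d - 1) = int d - 2" by simp
    show "homogeneous3 (2 * int d - 3 - (int d - 1)) Q" "homogeneous3 (2 * int d - 3 - (int d - 1)) (- P)"
      unfolding e2 using hom by (auto intro: homogeneous3_simps)
    have e3: "int d - (int d - 1) = 1" by simp
    show "homogeneous3 (int d - (int d - 1)) x" "homogeneous3 (int d - (int d - 1)) (- y)" "homogeneous3 (int d - (int d - 1)) (- z)"
      unfolding e3 using homogeneous3_xyz by (auto intro: homogeneous3_simps)
    show "int d - 1 < 2 * int d - 3" "int d - 1 < int d" using d by simp_all
    fix u1 u2 u3
    show "(u1 * (y * P + z * Q) + u2 * (x * P) + u3 * (x * Q) = 0) \<longleftrightarrow>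
       (\<exists>s t. u1 = 0 * s + x * t \<and> u2 = Q * s + - y * t \<and> u3 = - P * s + - z * t)"
    proof
      assume "u1 * (y * P + z * Q) + u2 * (x * P) + u3 * (x * Q) = 0"
      from syzygies_of_minors[OF m yK xzK yK0 y_power_regular this]
      show "\<exists>s t. u1 = 0 * s + x * t \<and> u2 = Q * s + - y * t \<and> u3 = - P * s + - z * t"
        by (metis add.commute mult.commute)
    next
      assume "\<exists>s t. u1 = 0 * s + x * t \<and> u2 = Q * s + - y * t \<and> u3 = - P * s + - z * t"
      then obtain s t where u: "u1 = 0 * s + x * t" "u2 = Q * s + - y * t" "u3 = - P * s + - z * t" by blast
      show "u1 * (y * P + z * Q) + u2 * (x * P) + u3 * (x * Q) = 0" unfolding u by (simp add: algebra_simps)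
    qed
  next
    fix s t assume *: "0 * s + x * t = 0" "Q * s + - y * t = 0" "- P * s + - z * t = 0"
    have t: "t = 0" using *(1) x0 by simp
    then show "s = 0 \<and> t = 0" using *(2,3) PQ0 by auto
  qed
  then show ?thesis using lt pj by blast
qed

text \<open>\<open>H\<close> says that H is a pure power of y on the y-axis and vanishes on the
  other two axes; \<open>G\<close> says that G vanishes on the x-axis or on the z-axis. For the
  resolution, a syzygy (u1, u2, u3) has u3 = G q by coprimality of G and H; restricting to the
  y-axis shows that q lies in the ideal of x and z, and what remains is a multiple of the Koszul
  syzygy (z, -x).\<close>

theorem imperfect_case:
  fixes G H E E' :: "'k poly poly poly" and d :: nat
  defines "J \<equiv> Idl\<^bsub>class_ring\<^esub> {x * G, z * G, H}"
  assumes d: "d \<ge> 3" and hom: "homogeneous3 (int d - 2) G" "homogeneous3 (int d - 1) H"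
    and H: "H = C3 c * y ^ (d - 1) + x * z * E" "c \<noteq> 0"
    and G: "G = C3 c' * x ^ r * z ^ s + y * E'" "r + s > 0"
    and primes: "\<And>M. primeideal M class_ring \<Longrightarrow> G \<in> M \<Longrightarrow> H \<in> M \<Longrightarrow> y \<in> M \<and> (x \<in> M \<or> z \<in> M)"
  shows "linear_type J \<and> \<not> perfect_ideal J \<and>
    min_graded_free_resolution J [[int d - 1, int d - 1, int d - 1], [int d, 2 * (int d - 1), 2 * (int d - 1)], [2 * int d - 1]]"
proof -
  interpret C: comm_ring_hom "C3 :: 'k \<Rightarrow> _" by (rule C3_hom)
  have J: "ideal J class_ring" unfolding J_def by (rule class_Idl_ideal)
  have Jc: "0 \<in> J" "\<And>a b. a \<in> J \<Longrightarrow> b \<in> J \<Longrightarrow> a + b \<in> J" "\<And>a r. a \<in> J \<Longrightarrow> r * a \<in> J"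
    using J unfolding class_ideal_iff by blast+
  have mem: "t \<in> J \<longleftrightarrow> (\<exists>u v w. t = u * (x * G) + v * (z * G) + w * H)" for t
    unfolding J_def class_Idl_triple by simp
  have gens: "x * G \<in> J" "z * G \<in> J" "H \<in> J"
    unfolding mem by (metis mult_1 mult_zero_left add.right_neutral add.left_neutral)+
  have cinv: "C3 (inverse c) * C3 c = 1" using H(2) by (simp flip: C.hom_mult)
  have x0: "x \<noteq> 0" and y0: "y \<noteq> 0" and z0: "z \<noteq> 0" using prime_xyz by auto
  let ?I = "Idl\<^bsub>class_ring\<^esub> {G, H, 0}"
  have I: "ideal ?I class_ring" by (rule class_Idl_ideal)
  have memI: "t \<in> ?I \<longleftrightarrow> (\<exists>u v. t = u * G + v * H)" for t unfolding class_Idl_triple by auto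
  have GH: "G \<in> ?I" "H \<in> ?I" unfolding memI by (metis mult_1 mult_zero_left add.right_neutral add.left_neutral)+
  have primesI: "y \<in> M" "x * z \<in> M" if M: "primeideal M class_ring" "?I \<subseteq> M" for M
  proof -
    have p: "y \<in> M \<and> (x \<in> M \<or> z \<in> M)" using primes[OF M(1)] M(2) GH by blast
    then show "y \<in> M" by blast
    show "x * z \<in> M" using p primeideal.axioms(1)[OF M(1)] unfolding class_ideal_iff by (metis mult.commute)
  qed
  obtain N1 where N1: "y ^ N1 \<in> ?I" using radical_member[OF I primesI(1)] by metis
  obtain N2 where N2: "(x * z) ^ N2 \<in> ?I" using radical_member[OF I primesI(2)] by metis
  define K where "K = N1 + N2"
  have Ic: "r * t \<in> ?I" if "t \<in> ?I" for r t using that I unfolding class_ideal_iff by blast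
  have "y ^ K \<in> ?I" using Ic[OF N1, of "y ^ N2"] by (simp only: K_def power_add mult.commute)
  moreover have "(x * z) ^ K \<in> ?I" using Ic[OF N2, of "(x * z) ^ N1"] by (simp only: K_def power_add)
  ultimately obtain a1 a2 b1 b2 where K: "y ^ K = a1 * G + a2 * H" "(x * z) ^ K = b1 * G + b2 * H" unfolding memI by blast
  have yK0: "y ^ K \<noteq> 0" using y0 by simp
  \<comment> \<open>Both y^K w and (x z)^K w are multiples of G. Comparing the cofactors, y^K
    divides the first one because the pair is regular, and it can be cancelled.\<close>
  have coprime: "G dvd w" if w: "G * u + w * H = 0" for u w
  proof -
    have e: "w * H = - (G * u)" using w by (simp add: eq_neg_iff_add_eq_0 add.commute)
    have "y ^ K * w = a1 * G * w + a2 * (w * H)" "(x * z) ^ K * w = b1 * G * w + b2 * (w * H)"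
      unfolding K by (simp_all add: algebra_simps)
    then have f: "y ^ K * w = G * (a1 * w - a2 * u)" "(x * z) ^ K * w = G * (b1 * w - b2 * u)"
      unfolding e by (simp_all add: algebra_simps)
    show ?thesis
    proof (cases "G = 0")
      case True
      then show ?thesis using f(1) y0 by simp
    next
      case False
      have "G * ((x * z) ^ K * (a1 * w - a2 * u)) = (x * z) ^ K * (y ^ K * w)" unfolding f(1) by (simp only: ac_simps)
      also have "\<dots> = G * (y ^ K * (b1 * w - b2 * u))" using f(2) by (metis mult.left_commute)
      finally have "(x * z) ^ K * (a1 * w - a2 * u) = y ^ K * (b1 * w - b2 * u)" using False by simp
      then have "y ^ K dvd (x * z) ^ K * (a1 * w - a2 * u)" by simp
      then have "y ^ K dvd a1 * w - a2 * u" by (rule y_power_regular)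
      then obtain q where "a1 * w - a2 * u = y ^ K * q" by (rule dvdE)
      then have "y ^ K * w = y ^ K * (G * q)" using f(1) by (simp only: mult.left_commute)
      then have "w = G * q" using yK0 by (metis mult_cancel_left)
      then show ?thesis by (rule dvdI)
    qed
  qed
  have primesJ: "y \<in> M" if M: "primeideal M class_ring" "J \<subseteq> M" for M
  proof -
    have Mi: "ideal M class_ring" by (rule primeideal.axioms(1)[OF M(1)])
    have "x * G \<in> M" "z * G \<in> M" and HM: "H \<in> M" using gens M(2) by blast+
    then consider "G \<in> M" | "x \<in> M" using M(1) unfolding class_prime_iff by blast
    then show ?thesis
    proof cases
      case 1
      then show ?thesis using primes[OF M(1) _ HM] by blast
    next
      case 2
      have "x * z * E \<in> M" using 2 Mi unfolding class_ideal_iff by (metis mult.commute mult.left_commute)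
      then have "H - x * z * E \<in> M" using class_ideal_minus[OF Mi HM] by blast
      then have "C3 (inverse c) * (C3 c * y ^ (d - 1)) \<in> M" using Mi H(1) unfolding class_ideal_iff by simp
      then have "y ^ (d - 1) \<in> M" by (simp add: mult.assoc[symmetric] cinv)
      then show ?thesis by (rule prime_power_mem[OF M(1)])
    qed
  qed
  obtain N where "y ^ N \<in> J" using radical_member[OF J primesJ] by metis
  then obtain c1 c2 c3 where yN: "y ^ N = c1 * (x * G) + c2 * (z * G) + c3 * H" unfolding mem by blast
  obtain \<sigma> :: "'k poly poly poly \<Rightarrow> 'k poly poly" where \<sigma>: "comm_ring_hom \<sigma>" "surj \<sigma>" "\<forall>p. \<sigma> p = 0 \<longrightarrow> y dvd p" "\<sigma> y = 0"
    "prime_elem (\<sigma> x)" "prime_elem (\<sigma> z)" "\<not> \<sigma> z dvd \<sigma> x" "\<not> \<sigma> x dvd \<sigma> z" "\<sigma> x \<noteq> 0" "\<sigma> z \<noteq> 0"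
    by (rule quotient_by_y)
  interpret \<sigma>: comm_ring_hom \<sigma> by (rule \<sigma>(1))
  have sGH: "\<sigma> G \<noteq> 0 \<or> \<sigma> H \<noteq> 0"
    using primes[OF ker_prime[OF \<sigma>(1)]] \<sigma>(9,10) by blast
  have lt: "linear_type J"
    unfolding J_def by (rule linear_type_imperfect_case[OF \<sigma>(1,2) \<sigma>(3)[rule_format] \<sigma>(4) y0 \<sigma>(5,8) sGH yN])
  (* the restrictions to the coordinate axes *)
  define hy where "hy = (if y = X3 then ev3 (\<lambda>c::'k. [:c:]) [:0, 1:] 0 0 else ev3 (\<lambda>c::'k. [:c:]) 0 [:0, 1:] 0)"
  define hx where "hx = (if x = X3 then ev3 (\<lambda>c::'k. [:c:]) [:0, 1:] 0 0 else ev3 (\<lambda>c::'k. [:c:]) 0 [:0, 1:] 0)"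
  define hz where "hz = ev3 (\<lambda>c::'k. [:c:]) 0 0 [:0, 1:]"
  have XY: "X3 \<noteq> (Y3 :: 'k poly poly poly)" by (simp add: X3_def Y3_def)
  note evs = ev3_simps[OF C3_const_hom]
  have h_hom: "comm_ring_hom hy" "comm_ring_hom hx" "comm_ring_hom hz"
    unfolding hy_def hx_def hz_def by (auto intro: ev3_hom[OF C3_const_hom])
  have h_val: "hy y = [:0, 1:]" "hy x = 0" "hy z = 0" "hx x = [:0, 1:]" "hx y = 0" "hx z = 0" "hz z = [:0, 1:]" "hz x = 0" "hz y = 0"
    using xy XY unfolding hy_def hx_def hz_def by (auto simp: evs)
  have h_const: "hy (C3 a) = [:a:]" "hx (C3 a) = [:a:]" "hz (C3 a) = [:a:]" for a
    unfolding hy_def hx_def hz_def by (simp_all add: evs)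
  interpret hy: comm_ring_hom hy by (rule h_hom)
  interpret hx: comm_ring_hom hx by (rule h_hom)
  interpret hz: comm_ring_hom hz by (rule h_hom)
  interpret c0: comm_ring_hom "\<lambda>s::'k poly poly poly. coeff3 s 0 0 0" by (rule coeff3_0_hom)
  have at0: "poly (hy t) 0 = coeff3 t 0 0 0" "poly (hx t) 0 = coeff3 t 0 0 0" "poly (hz t) 0 = coeff3 t 0 0 0" for t
  proof -
    have p0: "comm_ring_hom (\<lambda>t. poly (h t) 0)" if "comm_ring_hom h" for h :: "'k poly poly poly \<Rightarrow> 'k poly"
    proof -
      interpret h: comm_ring_hom h by (rule that)
      show ?thesis by unfold_locales (simp_all add: h.hom_add h.hom_mult)
    qed
    have v: "poly (h v) 0 = 0" if "h \<in> {hx, hy, hz}" "v \<in> {x, y, z}" for h v using that h_val by auto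
    have "X3 \<in> {x, y, z}" "Y3 \<in> {x, y, z}" "Z3 \<in> {x, y, z}" using xy by auto
    note v' = v[OF _ this(1)] v[OF _ this(2)] v[OF _ this(3)]
    show "poly (hy t) 0 = coeff3 t 0 0 0"
      by (rule hom_ext3[OF p0[OF h_hom(1)] coeff3_0_hom]) (simp_all add: h_const v')
    show "poly (hx t) 0 = coeff3 t 0 0 0"
      by (rule hom_ext3[OF p0[OF h_hom(2)] coeff3_0_hom]) (simp_all add: h_const v')
    show "poly (hz t) 0 = coeff3 t 0 0 0"
      by (rule hom_ext3[OF p0[OF h_hom(3)] coeff3_0_hom]) (simp_all add: h_const v')
  qed
  have hyH: "hy H = [:c:] * [:0, 1:] ^ (d - 1)"
    unfolding H(1) by (simp add: hy.hom_add hy.hom_mult hy.hom_power h_val h_const)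
  \<comment> \<open>The kernel of the restriction to the y-axis is generated by x and z: modulo them
    t is a polynomial in y alone, which the restriction reproduces.\<close>
  have xz_mem: "\<exists>a b. t = x * a + z * b" if "hy t = 0" for t
  proof -
    let ?X = "Idl\<^bsub>class_ring\<^esub> {x, z, 0}"
    have Xi: "ideal ?X class_ring" by (rule class_Idl_ideal)
    have memX: "t \<in> ?X \<longleftrightarrow> (\<exists>u v. t = u * x + v * z)" for t unfolding class_Idl_triple by auto
    have "x \<in> ?X" "z \<in> ?X" unfolding memX by (metis mult_1 mult_zero_left add.right_neutral add.left_neutral)+
    then have v: "X3 \<in> ?X \<or> X3 = y" "Y3 \<in> ?X \<or> Y3 = y" "Z3 \<in> ?X \<or> Z3 = y" using xy by (elim disjE conjE; simp)+
    obtain e where e: "t - evp C3 y e \<in> ?X" using reduce_mod_two_variables[OF Xi v] by blast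
    then obtain u w where uw: "t - evp C3 y e = u * x + w * z" unfolding memX by blast
    have "hy (evp C3 y e) = e"
    proof (induction e)
      case 0
      show ?case by (simp add: evp_0)
    next
      case (pCons a e)
      show ?case by (simp add: evp_pCons[OF C3_hom] hy.hom_add hy.hom_mult h_const h_val pCons.IH)
    qed
    moreover have "hy (t - evp C3 y e) = 0" unfolding uw by (simp add: hy.hom_add hy.hom_mult h_val)
    ultimately have "e = 0" using that by (simp add: hy.hom_minus)
    then have "t = x * u + z * w" using uw by (simp add: evp_0 mult.commute)
    then show ?thesis by blast
  qed
  \<comment> \<open>If G were 0, both y^K and (x z)^K would be multiples of H. The regular pair then
    makes H a unit, although H vanishes at the origin.\<close>
  have G0: "G \<noteq> 0"
  proof
    assume "G = 0"
    have "H \<noteq> 0" using K(1) yK0 \<open>G = 0\<close> by auto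
    have "H * ((x * z) ^ K * a2) = H * (y ^ K * b2)" using K unfolding \<open>G = 0\<close> by (simp add: ac_simps)
    then have "(x * z) ^ K * a2 = y ^ K * b2" using \<open>H \<noteq> 0\<close> by simp
    then have "y ^ K dvd (x * z) ^ K * a2" by simp
    then have "y ^ K dvd a2" by (rule y_power_regular)
    then obtain q where "a2 = y ^ K * q" by (rule dvdE)
    then have "y ^ K * 1 = y ^ K * (q * H)" using K(1) unfolding \<open>G = 0\<close> by (metis add.left_neutral mult.assoc mult.right_neutral mult_zero_right)
    then have "1 = q * H" using yK0 by (metis mult_cancel_left)
    then have "hy 1 = hy q * hy H" by (metis hy.hom_mult)
    then have "poly (hy 1) 0 = poly (hy q * hy H) 0" by simp
    then show False using d unfolding hyH by (auto simp: power_0_left)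
  qed
  have np: "\<not> perfect_ideal J"
  proof (rule not_perfect_idealI[OF J])
    let ?M = "{t :: 'k poly poly poly. coeff3 t 0 0 0 = 0}"
    have Mp: "primeideal ?M class_ring" by (rule ker_prime[OF coeff3_0_hom])
    have Mi: "ideal ?M class_ring" by (rule primeideal.axioms(1)[OF Mp])
    show "maximalideal ?M class_ring"
    proof (rule maximalidealI[OF Mi])
      have "1 \<notin> ?M" using c0.hom_one by simp
      then show "carrier class_ring \<noteq> ?M" by (metis UNIV_I partial_object.select_convs(1))
      fix L :: "'k poly poly poly set" assume L: "ideal L class_ring" "?M \<subseteq> L"
      show "L = ?M \<or> L = carrier class_ring"
      proof (cases "L \<subseteq> ?M")
        case True
        then show ?thesis using L(2) by blast
      next
        case False
        then obtain t where t: "t \<in> L" "coeff3 t 0 0 0 \<noteq> 0" by blast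
        have vM: "X3 \<in> L" "Y3 \<in> L" "Z3 \<in> L" using L(2) by auto
        have "t - (t - C3 (coeff3 t 0 0 0)) \<in> L" using class_ideal_minus[OF L(1) t(1) coeff3_0_mem[OF L(1) vM]] .
        then have "C3 (inverse (coeff3 t 0 0 0)) * C3 (coeff3 t 0 0 0) \<in> L" using L(1) unfolding class_ideal_iff by simp
        then have "1 \<in> L" using t(2) by (simp flip: C.hom_mult)
        then have "q \<in> L" for q using L(1) unfolding class_ideal_iff by (metis mult.right_neutral)
        then show ?thesis by auto
      qed
    qed
    have var0: "coeff3 x 0 0 0 = 0" "coeff3 y 0 0 0 = 0" "coeff3 z 0 0 0 = 0" using xy by auto
    have H0: "coeff3 H 0 0 0 = 0" using d unfolding H(1) by (simp add: c0.hom_add c0.hom_mult c0.hom_power var0 del: coeff3_0_simps)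
    show "J \<subseteq> ?M"
      unfolding subset_iff mem by (auto simp: c0.hom_add c0.hom_mult var0 H0 simp del: coeff3_0_simps)
    let ?g = "y ^ (d - 2) * G"
    have yg: "y * ?g \<in> J"
    proof -
      have "d - 1 = Suc (d - 2)" using d by simp
      then have "C3 c * (y * ?g) = C3 c * y ^ (d - 1) * G" by simp
      also have "\<dots> = G * H - z * E * (x * G)" unfolding H(1) by (simp add: algebra_simps)
      also have "\<dots> \<in> J" by (rule class_ideal_minus[OF J Jc(3)[OF gens(3)] Jc(3)[OF gens(1)]])
      finally have "C3 (inverse c) * (C3 c * (y * ?g)) \<in> J" by (rule Jc(3))
      then show ?thesis by (simp only: mult.assoc[symmetric] cinv mult_1)
    qed
    show "t * ?g \<in> J" if "t \<in> ?M" for t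
    proof -
      let ?V = "Idl\<^bsub>class_ring\<^esub> {x, y, z}"
      have Vi: "ideal ?V class_ring" by (rule class_Idl_ideal)
      have "{x, y, z} \<subseteq> ?V" by (rule ring.genideal_self[OF class_ring.ring_axioms]) simp
      then have "X3 \<in> ?V" "Y3 \<in> ?V" "Z3 \<in> ?V" using xy by auto
      then have "t - C3 (coeff3 t 0 0 0) \<in> ?V" by (rule coeff3_0_mem[OF Vi])
      then have "t \<in> ?V" using that by (simp add: C.hom_zero)
      then obtain u v w where t: "t = u * x + v * y + w * z" unfolding class_Idl_triple by blast
      have "t * ?g = (u * y ^ (d - 2)) * (x * G) + v * (y * ?g) + (w * y ^ (d - 2)) * (z * G)"
        unfolding t by (simp add: algebra_simps)
      then show ?thesis using Jc(2)[OF Jc(2)[OF Jc(3)[OF gens(1)] Jc(3)[OF yg]] Jc(3)[OF gens(2)]] by metis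
    qed
    \<comment> \<open>Coprimality allows G to be cancelled, leaving t y^(d-2) in the ideal of x, z
      and H. On the y-axis it becomes a multiple of y^(d-1), so t would vanish at the
      origin.\<close>
    show "t * ?g \<notin> J" if "t \<notin> ?M" for t
    proof
      assume "t * ?g \<in> J"
      then obtain u v w where uvw: "t * ?g = u * (x * G) + v * (z * G) + w * H" unfolding mem by blast
      then have "G * (u * x + v * z - t * y ^ (d - 2)) + w * H = 0" by (simp add: algebra_simps)
      then have "G dvd w" by (rule coprime)
      then obtain q where q: "w = G * q" by (rule dvdE)
      have "G * (t * y ^ (d - 2)) = G * (u * x + v * z + q * H)" using uvw unfolding q by (simp add: algebra_simps)
      then have "t * y ^ (d - 2) = u * x + v * z + q * H" using G0 by simp
      then have "hy (t * y ^ (d - 2)) = hy (u * x + v * z + q * H)" by simp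
      then have e: "hy t * [:0, 1:] ^ (d - 2) = hy q * ([:c:] * [:0, 1:] ^ (d - 1))"
        by (simp add: hy.hom_add hy.hom_mult hy.hom_power h_val hyH)
      have "d - 1 = Suc (d - 2)" using d by simp
      then have "hy t * [:0, 1:] ^ (d - 2) = (hy q * [:c:] * [:0, 1:]) * [:0, 1:] ^ (d - 2)"
        unfolding e by (simp only: power_Suc ac_simps)
      moreover have "[:0, 1 :: 'k:] ^ (d - 2) \<noteq> 0" by simp
      ultimately have "hy t = hy q * [:c:] * [:0, 1:]" using mult_right_cancel by blast
      then have "poly (hy t) 0 = 0" by simp
      then show False using that at0 by simp
    qed
    \<comment> \<open>The axis on which G vanishes: its monomial x^r z^s vanishes on the x-axis if s
      > 0, and otherwise r > 0 and it vanishes on the z-axis. As H vanishes there too, no multiple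
      of a power of w by a factor nonzero at the origin lies in J.\<close>
    define w where "w = (if s > 0 then x else z)"
    define \<theta> where "\<theta> = (if s > 0 then hx else hz)"
    have th: "comm_ring_hom \<theta>" unfolding \<theta>_def using h_hom by simp
    interpret th: comm_ring_hom \<theta> by (rule th)
    have "\<theta> G = 0" using G(2) unfolding G(1) \<theta>_def
      by (auto simp: hx.hom_add hx.hom_mult hx.hom_power hz.hom_add hz.hom_mult hz.hom_power h_val)
    moreover have "\<theta> H = 0" using d unfolding H(1) \<theta>_def
      by (auto simp: hx.hom_add hx.hom_mult hx.hom_power hz.hom_add hz.hom_mult hz.hom_power h_val)
    ultimately have thJ: "\<theta> t = 0" if "t \<in> J" for t using that unfolding mem by (auto simp: th.hom_add th.hom_mult)
    show "w \<in> ?M" unfolding w_def using var0 by simp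
    show "u * w ^ n \<notin> J" if "u \<notin> ?M" for u n
    proof
      assume "u * w ^ n \<in> J"
      then have "\<theta> (u * w ^ n) = 0" by (rule thJ)
      then have "\<theta> u * \<theta> w ^ n = 0" by (simp only: th.hom_mult th.hom_power)
      moreover have "\<theta> w = [:0, 1:]" unfolding \<theta>_def w_def by (simp add: h_val)
      ultimately have "\<theta> u = 0" by simp
      then have "coeff3 u 0 0 0 = 0" using at0[of u] unfolding \<theta>_def by (auto split: if_splits)
      then show False using that by simp
    qed
  qed
  have H0: "H \<noteq> 0"
  proof
    assume "H = 0"
    then have "hy H = 0" by (simp add: hy.hom_zero)
    then show False using hyH H(2) by simp
  qed
  have xz_syz: "\<exists>h. a = z * h \<and> b = - x * h" if "x * a + z * b = 0" for a b
  proof -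
    have e: "z * b = x * (- a)" using that by (simp add: eq_neg_iff_add_eq_0 add.commute)
    then have "x dvd z * b" by (rule dvdI)
    moreover have "\<not> x dvd z" using \<sigma>.hom_dvd \<sigma>(8) by blast
    ultimately have "x dvd b" using prime_elem_dvd_multD[OF prime_xyz(1)] by blast
    then obtain q where q: "b = x * q" by (rule dvdE)
    then have "x * (- a) = x * (z * q)" using e by (simp only: mult.left_commute)
    then have "- a = z * q" using x0 by (metis mult_cancel_left)
    then have "a = z * (- q)" by (metis minus_minus mult_minus_right)
    moreover have "b = - x * (- q)" using q by simp
    ultimately show ?thesis by blast
  qed
  have e1: "int d - 2 + 1 = int d - 1" by simp
  have res: "min_graded_free_resolution J [[int d - 1, int d - 1, int d - 1], [int d, 2 * (int d - 1), 2 * (int d - 1)], [2 * int d - 1]]"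
    unfolding J_def
  proof (rule resolution_of_length_2[where ?A1.0 = z and ?A2.0 = "- x" and ?A3.0 = 0 and ?B1.0 = H and ?B2.0 = 0 and ?B3.0 = "- (x * G)"
        and ?E1.0 = 0 and ?E2.0 = H and ?E3.0 = "- (z * G)" and ?D1.0 = H and ?D2.0 = "- z" and ?D3.0 = x])
    show "homogeneous3 (int d - 1) (x * G)" "homogeneous3 (int d - 1) (z * G)" "homogeneous3 (int d - 1) H"
      using homogeneous3_var[OF hom(1)] hom(2) unfolding e1 by auto
    have e2: "int d - (int d - 1) = 1" "2 * (int d - 1) - (int d - 1) = int d - 1" "2 * int d - 1 - int d = int d - 1"
      "2 * int d - 1 - 2 * (int d - 1) = 1" by simp_all
    show "homogeneous3 (int d - (int d - 1)) z" "homogeneous3 (int d - (int d - 1)) (- x)" "homogeneous3 (int d - (int d - 1)) (0 :: 'k poly poly poly)"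
      unfolding e2 using homogeneous3_xyz by (auto intro: homogeneous3_simps)
    show "homogeneous3 (2 * (int d - 1) - (int d - 1)) H" "homogeneous3 (2 * (int d - 1) - (int d - 1)) (0 :: 'k poly poly poly)"
      "homogeneous3 (2 * (int d - 1) - (int d - 1)) (- (x * G))" "homogeneous3 (2 * (int d - 1) - (int d - 1)) (0 :: 'k poly poly poly)"
      "homogeneous3 (2 * (int d - 1) - (int d - 1)) H" "homogeneous3 (2 * (int d - 1) - (int d - 1)) (- (z * G))"
      unfolding e2 using homogeneous3_var[OF hom(1)] hom(2) unfolding e1 by (auto intro: homogeneous3_simps)
    show "homogeneous3 (2 * int d - 1 - int d) H" "homogeneous3 (2 * int d - 1 - 2 * (int d - 1)) (- z)"
      "homogeneous3 (2 * int d - 1 - 2 * (int d - 1)) x"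
      unfolding e2 using hom(2) homogeneous3_xyz by (auto intro: homogeneous3_simps)
    show "int d - 1 < int d" "int d - 1 < 2 * (int d - 1)" "int d < 2 * int d - 1" "2 * (int d - 1) < 2 * int d - 1" using d by simp_all
    fix u1 u2 u3
    show "(u1 * (x * G) + u2 * (z * G) + u3 * H = 0) \<longleftrightarrow>
       (\<exists>s t r. u1 = z * s + H * t + 0 * r \<and> u2 = - x * s + 0 * t + H * r \<and> u3 = 0 * s + - (x * G) * t + - (z * G) * r)"
    proof
      assume u: "u1 * (x * G) + u2 * (z * G) + u3 * H = 0"
      then have "G * (u1 * x + u2 * z) + u3 * H = 0" by (simp add: algebra_simps)
      then have "G dvd u3" by (rule coprime)
      then obtain q where q: "u3 = G * q" by (rule dvdE)
      have "G * (x * u1 + z * u2 + q * H) = 0" using u unfolding q by (simp add: algebra_simps)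
      then have *: "x * u1 + z * u2 + q * H = 0" using G0 by simp
      \<comment> \<open>On the y-axis only q H survives, and H is a nonzero power of y there; so q
        restricts to 0.\<close>
      then have "hy (x * u1 + z * u2 + q * H) = 0" by (simp add: hy.hom_zero)
      then have "hy q * hy H = 0" by (simp add: hy.hom_add hy.hom_mult h_val)
      then have "hy q = 0" unfolding hyH using H(2) by simp
      then obtain a b where ab: "q = x * a + z * b" using xz_mem by blast
      have "x * (u1 + a * H) + z * (u2 + b * H) = 0" using * unfolding ab by (simp add: algebra_simps)
      then obtain h where h: "u1 + a * H = z * h" "u2 + b * H = - x * h" using xz_syz by blast
      have "u2 = - x * h - b * H" using h(2) by (simp only: eq_diff_eq)
      moreover have "- x * h - b * H = - x * h + 0 * (- a) + H * (- b)" by (simp add: algebra_simps)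
      ultimately have "u2 = - x * h + 0 * (- a) + H * (- b)" by (rule trans)
      moreover have "u1 = z * h + H * (- a) + 0 * (- b)" using h(1) by (simp add: algebra_simps)
      moreover have "u3 = 0 * h + - (x * G) * (- a) + - (z * G) * (- b)" unfolding q ab by (simp add: algebra_simps)
      ultimately show "\<exists>s t r. u1 = z * s + H * t + 0 * r \<and> u2 = - x * s + 0 * t + H * r \<and> u3 = 0 * s + - (x * G) * t + - (z * G) * r" by blast
    next
      assume "\<exists>s t r. u1 = z * s + H * t + 0 * r \<and> u2 = - x * s + 0 * t + H * r \<and> u3 = 0 * s + - (x * G) * t + - (z * G) * r"
      then obtain s t r where u: "u1 = z * s + H * t + 0 * r" "u2 = - x * s + 0 * t + H * r" "u3 = 0 * s + - (x * G) * t + - (z * G) * r" by blast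
      show "u1 * (x * G) + u2 * (z * G) + u3 * H = 0" unfolding u by (simp add: algebra_simps)
    qed
  next
    show "(z * s + H * t + 0 * r = 0 \<and> - x * s + 0 * t + H * r = 0 \<and> 0 * s + - (x * G) * t + - (z * G) * r = 0) \<longleftrightarrow>
       (\<exists>h. s = H * h \<and> t = - z * h \<and> r = x * h)" for s t r
    proof
      assume *: "z * s + H * t + 0 * r = 0 \<and> - x * s + 0 * t + H * r = 0 \<and> 0 * s + - (x * G) * t + - (z * G) * r = 0"
      have "G * (x * t + z * r) = - (0 * s + - (x * G) * t + - (z * G) * r)" by (simp add: algebra_simps)
      moreover have "0 * s + - (x * G) * t + - (z * G) * r = 0" using * by blast
      ultimately have "G * (x * t + z * r) = 0" by (simp only: minus_zero)
      then have "x * t + z * r = 0" using G0 by simp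
      then obtain h where h: "t = z * h" "r = - x * h" using xz_syz by blast
      have "z * (s + H * h) = 0" using * unfolding h by (simp add: algebra_simps)
      then have "s + H * h = 0" using z0 by simp
      then have "s = H * (- h)" by (simp add: eq_neg_iff_add_eq_0)
      then have "s = H * (- h) \<and> t = - z * (- h) \<and> r = x * (- h)" using h by simp
      then show "\<exists>h. s = H * h \<and> t = - z * h \<and> r = x * h" by blast
    next
      assume "\<exists>h. s = H * h \<and> t = - z * h \<and> r = x * h"
      then show "z * s + H * t + 0 * r = 0 \<and> - x * s + 0 * t + H * r = 0 \<and> 0 * s + - (x * G) * t + - (z * G) * r = 0"
        by (auto simp: algebra_simps)
    qed
    show "r = 0" if "H * r = 0" "- z * r = 0" "x * r = 0" for r using that(1) H0 by simp
  qed
  show ?thesis using lt np res by blast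
qed

end

section \<open>Binary forms\<close>

text \<open>The binary form v^n \<open>\<phi>\<close>(u / v), with \<open>C\<close> embedding the
  coefficients. The degree n is separate because it may exceed that of
  \<open>\<phi>\<close>.\<close>

definition bihom :: "('a \<Rightarrow> 's) \<Rightarrow> nat \<Rightarrow> 'a::comm_ring_1 poly \<Rightarrow> 's \<Rightarrow> 's \<Rightarrow> 's::comm_ring_1" where
  "bihom C n \<phi> u v = (\<Sum>k\<le>n. C (coeff \<phi> k) * u ^ k * v ^ (n - k))"

lemma bihom_const:
  assumes "comm_ring_hom C"
  shows "bihom C n [:c:] u v = C c * v ^ n"
proof -
  interpret C: comm_ring_hom C by (rule assms)
  have "bihom C n [:c:] u v = (\<Sum>k\<le>n. if k = 0 then C c * v ^ n else 0)"
    unfolding bihom_def by (intro sum.cong) (auto simp: coeff_pCons C.hom_zero split: nat.splits)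
  then show ?thesis by simp
qed

text \<open>The homogenization of \<open>\<phi>\<close> = (t - r) \<open>\<psi>\<close> +
  \<open>\<phi>\<close>(r), where \<open>\<psi>\<close> is the quotient.\<close>

lemma bihom_synthetic_div:
  assumes "comm_ring_hom C" and "degree \<phi> \<le> Suc n"
  shows "bihom C (Suc n) \<phi> u v = (u - C r * v) * bihom C n (synthetic_div \<phi> r) u v + C (poly \<phi> r) * v ^ Suc n"
proof -
  interpret C: comm_ring_hom C by (rule assms(1))
  define \<psi> where "\<psi> = synthetic_div \<phi> r"
  have "degree \<psi> \<le> n" unfolding \<psi>_def degree_synthetic_div using assms(2) by simp
  then have top: "coeff \<psi> (Suc n) = 0" by (simp add: coeff_eq_0)
  have u: "bihom C (Suc n) (pCons 0 \<psi>) u v = u * bihom C n \<psi> u v"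
    unfolding bihom_def sum.atMost_Suc_shift by (simp add: C.hom_zero sum_distrib_left ac_simps)
  have v: "bihom C (Suc n) \<psi> u v = v * bihom C n \<psi> u v"
    unfolding bihom_def by (simp add: top C.hom_zero sum_distrib_left Suc_diff_le ac_simps)
  have \<phi>: "\<phi> = pCons 0 \<psi> - Polynomial.smult r \<psi> + [:poly \<phi> r:]"
    using synthetic_div_correct'[of r \<phi>] by (simp add: \<psi>_def)
  have "coeff \<phi> k = coeff (pCons 0 \<psi>) k - r * coeff \<psi> k + coeff [:poly \<phi> r:] k" for k
    by (subst \<phi>) simp
  then have c: "C (coeff \<phi> k) = C (coeff (pCons 0 \<psi>) k) - C r * C (coeff \<psi> k) + C (coeff [:poly \<phi> r:] k)" for k
    by (simp only: C.hom_add C.hom_minus C.hom_mult)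
  have "bihom C (Suc n) \<phi> u v = bihom C (Suc n) (pCons 0 \<psi>) u v - C r * bihom C (Suc n) \<psi> u v
      + bihom C (Suc n) [:poly \<phi> r:] u v"
    unfolding bihom_def c sum_distrib_left sum_subtractf[symmetric] sum.distrib[symmetric]
    by (intro sum.cong refl) (simp add: algebra_simps)
  then show ?thesis unfolding u v bihom_const[OF assms(1)] \<psi>_def[symmetric] by (simp add: algebra_simps)
qed

lemma bihom_divide:
  assumes "comm_ring_hom C" and "degree \<phi> \<le> n"
  shows "\<exists>w. bihom C n \<phi> u v = (u - C r * v) * w + C (poly \<phi> r) * v ^ n"
proof (cases n)
  case 0
  then obtain c where "\<phi> = [:c:]" using assms(2) by (metis degree_eq_zeroE le_zero_eq)
  then show ?thesis using bihom_const[OF assms(1), of n c u v] by (intro exI[of _ 0]) simp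
next
  case (Suc k)
  then show ?thesis using bihom_synthetic_div[OF assms(1)] assms(2) by blast
qed

lemma poly_synthetic_div_self:
  "poly (synthetic_div \<phi> r) r = poly (pderiv \<phi>) (r :: 'a::idom)"
proof -
  have "poly (pderiv \<phi>) r = poly (pderiv ([:- r, 1:] * synthetic_div \<phi> r + [:poly \<phi> r:])) r" by (simp only: synthetic_div_correct')
  also have "\<dots> = poly (synthetic_div \<phi> r) r"
    by (simp only: pderiv_add pderiv_mult pderiv_pCons poly_add poly_mult poly_pCons poly_0) simp
  finally show ?thesis by (rule sym)
qed

lemma prime_unit_cancel:
  fixes C :: "'k::field \<Rightarrow> 's::comm_ring_1"
  assumes "comm_ring_hom C" "ideal Q class_ring" "C c * t \<in> Q" "c \<noteq> 0"
  shows "t \<in> Q"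
proof -
  interpret C: comm_ring_hom C by (rule assms(1))
  have "C (inverse c) * (C c * t) \<in> Q" using assms(2,3) unfolding class_ideal_iff by blast
  moreover have "C (inverse c) * (C c * t) = C (inverse c * c) * t" by (simp only: C.hom_mult mult.assoc)
  ultimately show ?thesis using assms(4) by (simp add: C.hom_one)
qed

text \<open>The form splits into factors u - r v, a power of v and a nonzero constant. As v is
  outside Q, one of the linear factors lies in Q.\<close>

lemma bihom_root_in_prime:
  fixes C :: "'k::alg_closed_field \<Rightarrow> 's::comm_ring_1"
  assumes C: "comm_ring_hom C" and Q: "primeideal Q class_ring" and v: "v \<notin> Q"
  shows "\<phi> \<noteq> 0 \<Longrightarrow> degree \<phi> \<le> n \<Longrightarrow> bihom C n \<phi> u v \<in> Q \<Longrightarrow> \<exists>r. poly \<phi> r = 0 \<and> u - C r * v \<in> Q"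
proof (induction n arbitrary: \<phi>)
  have const: False if "bihom C n [:c:] u v \<in> Q" "c \<noteq> 0" for n c
    using prime_unit_cancel[OF C primeideal.axioms(1)[OF Q]] that prime_power_mem[OF Q] v
    unfolding bihom_const[OF C] by blast
  {
    case 0
    then show ?case using const by (metis degree_eq_zeroE le_zero_eq pCons_0_0)
  next
    case (Suc n)
    show ?case
    proof (cases "degree \<phi> = 0")
      case True
      then show ?thesis using const Suc.prems by (metis degree_eq_zeroE pCons_0_0)
    next
      case False
      then obtain r where r: "poly \<phi> r = 0" using alg_closed_imp_poly_has_root[of \<phi>] by auto
      let ?\<psi> = "synthetic_div \<phi> r"
      interpret C: comm_ring_hom C by (rule C)
      have \<phi>: "\<phi> = [:- r, 1:] * ?\<psi>" using synthetic_div_correct'[of r \<phi>] r by simp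
      have "(u - C r * v) * bihom C n ?\<psi> u v \<in> Q"
        using bihom_synthetic_div[OF C Suc.prems(2), of u v r] Suc.prems(3) r by (simp add: C.hom_zero)
      then consider "u - C r * v \<in> Q" | "bihom C n ?\<psi> u v \<in> Q" using Q unfolding class_prime_iff by blast
      then show ?thesis
      proof cases
        case 1
        then show ?thesis using r by blast
      next
        case 2
        have "?\<psi> \<noteq> 0" using \<phi> Suc.prems(1) by (metis mult_zero_right)
        moreover have "degree ?\<psi> \<le> n" using Suc.prems(2) by (simp add: degree_synthetic_div)
        ultimately obtain r' where r': "poly ?\<psi> r' = 0" "u - C r' * v \<in> Q" using Suc.IH 2 by blast
        have "poly \<phi> r' = 0" by (subst \<phi>) (simp add: r'(1))
        then show ?thesis using r'(2) by blast
      qed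
    qed
  }
qed

text \<open>The polynomials \<open>\<phi>\<close> and \<open>t \<phi>'\<close> have no common root when \<open>\<phi>\<close> has simple nonzero roots.\<close>

lemma bihom_pderiv_prime:
  fixes C :: "'k::alg_closed_field \<Rightarrow> 's::comm_ring_1"
  assumes C: "comm_ring_hom C" and Q: "primeideal Q class_ring"
    and \<phi>: "degree \<phi> \<le> n" "poly \<phi> 0 \<noteq> 0" "\<forall>r. poly \<phi> r = 0 \<longrightarrow> poly (pderiv \<phi>) r \<noteq> 0"
    and "bihom C n \<phi> u v \<in> Q" "bihom C n (pCons 0 (pderiv \<phi>)) u v \<in> Q"
  shows "v \<in> Q"
proof (rule ccontr)
  assume v: "v \<notin> Q"
  have Qi: "ideal Q class_ring" by (rule primeideal.axioms(1)[OF Q])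
  have "\<phi> \<noteq> 0" using \<phi>(2) by auto
  then obtain r where r: "poly \<phi> r = 0" "u - C r * v \<in> Q" using bihom_root_in_prime[OF C Q v _ \<phi>(1) assms(6)] by blast
  have "degree (pCons 0 (pderiv \<phi>)) \<le> n"
  proof (cases "degree \<phi> = 0")
    case True
    then have "pderiv \<phi> = 0" by (metis degree_eq_zeroE pderiv_singleton)
    then show ?thesis by simp
  next
    case False
    have "degree (pderiv \<phi>) \<le> degree \<phi> - 1" by (rule degree_pderiv_le)
    then have "Suc (degree (pderiv \<phi>)) \<le> n" using False \<phi>(1) by linarith
    then show ?thesis by (simp add: degree_pCons_eq_if)
  qed
  then obtain w where w: "bihom C n (pCons 0 (pderiv \<phi>)) u v = (u - C r * v) * w + C (poly (pCons 0 (pderiv \<phi>)) r) * v ^ n"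
    using bihom_divide[OF C] by blast
  have "w * (u - C r * v) \<in> Q" using r(2) Qi unfolding class_ideal_iff by blast
  then have "bihom C n (pCons 0 (pderiv \<phi>)) u v - w * (u - C r * v) \<in> Q" by (rule class_ideal_minus[OF Qi assms(7)])
  \<comment> \<open>Modulo u - r v the second form becomes its value at r times v^n. That value, r
    \<open>\<phi>\<close>'(r), is nonzero because the root r is nonzero and simple.\<close>
  then have "C (r * poly (pderiv \<phi>) r) * v ^ n \<in> Q" unfolding w by (simp add: mult.commute)
  moreover have "r * poly (pderiv \<phi>) r \<noteq> 0" using r(1) \<phi>(2,3) by auto
  ultimately have "v ^ n \<in> Q" by (rule prime_unit_cancel[OF C Qi])
  then show False using prime_power_mem[OF Q] v by blast
qed

lemma class_Idl_triple_units:
  fixes C :: "'k::field \<Rightarrow> 's::comm_ring_1"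
  assumes "comm_ring_hom C" "u \<noteq> 0" "v \<noteq> 0"
  shows "Idl\<^bsub>class_ring\<^esub> {C u * g, C v * h, k} = Idl\<^bsub>class_ring\<^esub> {g, h, k}"
proof -
  interpret C: comm_ring_hom C by (rule assms(1))
  have i: "C u * C (inverse u) = 1" "C v * C (inverse v) = 1" using assms by (simp_all flip: C.hom_mult)
  have "(\<exists>a b c. t = a * (C u * g) + b * (C v * h) + c * k) \<longleftrightarrow> (\<exists>a b c. t = a * g + b * h + c * k)" for t
  proof
    assume "\<exists>a b c. t = a * (C u * g) + b * (C v * h) + c * k"
    then show "\<exists>a b c. t = a * g + b * h + c * k" by (metis mult.assoc)
  next
    assume "\<exists>a b c. t = a * g + b * h + c * k"
    then obtain a b c where t: "t = a * g + b * h + c * k" by blast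
    have "a * g = a * (C u * C (inverse u)) * g" "b * h = b * (C v * C (inverse v)) * h" unfolding i by simp_all
    then have "t = (a * C (inverse u)) * (C u * g) + (b * C (inverse v)) * (C v * h) + c * k" unfolding t by (simp add: ac_simps)
    then show "\<exists>a b c. t = a * (C u * g) + b * (C v * h) + c * k" by blast
  qed
  then show ?thesis unfolding class_Idl_triple by simp
qed

section \<open>Sums of monomials and their partial derivatives\<close>

context roles
begin

text \<open>Exponents are functions of the index, so that differentiation and multiplication by a
  variable only change these functions and the coefficients.\<close>

definition tsum :: "nat \<Rightarrow> (nat \<Rightarrow> 'k) \<Rightarrow> (nat \<Rightarrow> nat) \<Rightarrow> (nat \<Rightarrow> nat) \<Rightarrow> (nat \<Rightarrow> nat) \<Rightarrow> 'k poly poly poly" where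
  "tsum m g \<alpha> \<beta> \<gamma> = (\<Sum>k\<le>m. C3 (g k) * x ^ \<alpha> k * y ^ \<beta> k * z ^ \<gamma> k)"

text \<open>Exponents need to agree only where the coefficient is nonzero. This makes truncated
  subtraction harmless: where an exponent is 0, the derivative has coefficient 0.\<close>

lemma tsum_cong:
  assumes "\<And>k. k \<le> m \<Longrightarrow> g k = g' k" "\<And>k. k \<le> m \<Longrightarrow> g k \<noteq> 0 \<Longrightarrow> \<alpha> k = \<alpha>' k \<and> \<beta> k = \<beta>' k \<and> \<gamma> k = \<gamma>' k"
  shows "tsum m g \<alpha> \<beta> \<gamma> = tsum m g' \<alpha>' \<beta>' \<gamma>'"
proof -
  interpret C: comm_ring_hom "C3 :: 'k \<Rightarrow> _" by (rule C3_hom)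
  have "C3 (g k) * x ^ \<alpha> k * y ^ \<beta> k * z ^ \<gamma> k = C3 (g' k) * x ^ \<alpha>' k * y ^ \<beta>' k * z ^ \<gamma>' k" if "k \<le> m" for k
    using assms[OF that] by (cases "g k = 0") (simp_all add: C.hom_zero)
  then show ?thesis unfolding tsum_def by (intro sum.cong) simp_all
qed

lemma tsum_mult:
  "x * tsum m g \<alpha> \<beta> \<gamma> = tsum m g (\<lambda>k. Suc (\<alpha> k)) \<beta> \<gamma>"
  "y * tsum m g \<alpha> \<beta> \<gamma> = tsum m g \<alpha> (\<lambda>k. Suc (\<beta> k)) \<gamma>"
  "z * tsum m g \<alpha> \<beta> \<gamma> = tsum m g \<alpha> \<beta> (\<lambda>k. Suc (\<gamma> k))"
  "C3 a * tsum m g \<alpha> \<beta> \<gamma> = tsum m (\<lambda>k. a * g k) \<alpha> \<beta> \<gamma>"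
  "tsum m g \<alpha> \<beta> \<gamma> + tsum m h \<alpha> \<beta> \<gamma> = tsum m (\<lambda>k. g k + h k) \<alpha> \<beta> \<gamma>"
proof -
  interpret C: comm_ring_hom "C3 :: 'k \<Rightarrow> _" by (rule C3_hom)
  show "x * tsum m g \<alpha> \<beta> \<gamma> = tsum m g (\<lambda>k. Suc (\<alpha> k)) \<beta> \<gamma>"
  "y * tsum m g \<alpha> \<beta> \<gamma> = tsum m g \<alpha> (\<lambda>k. Suc (\<beta> k)) \<gamma>"
  "z * tsum m g \<alpha> \<beta> \<gamma> = tsum m g \<alpha> \<beta> (\<lambda>k. Suc (\<gamma> k))"
  "C3 a * tsum m g \<alpha> \<beta> \<gamma> = tsum m (\<lambda>k. a * g k) \<alpha> \<beta> \<gamma>"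
    unfolding tsum_def sum_distrib_left by (intro sum.cong refl; simp only: C.hom_mult power_Suc ac_simps)+
  show "tsum m g \<alpha> \<beta> \<gamma> + tsum m h \<alpha> \<beta> \<gamma> = tsum m (\<lambda>k. g k + h k) \<alpha> \<beta> \<gamma>"
    unfolding tsum_def sum.distrib[symmetric] by (intro sum.cong refl) (simp only: C.hom_add distrib_right)
qed

lemma tsum_homogeneous:
  assumes "\<And>k. k \<le> m \<Longrightarrow> g k \<noteq> 0 \<Longrightarrow> \<alpha> k + \<beta> k + \<gamma> k = n"
  shows "homogeneous3 (int n) (tsum m g \<alpha> \<beta> \<gamma>)"
proof -
  interpret C: comm_ring_hom "C3 :: 'k \<Rightarrow> _" by (rule C3_hom)
  have c: "homogeneous3 0 (C3 c :: 'k poly poly poly)" for c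
    unfolding homogeneous3_def coeff3_def C3_def by (auto simp: coeff_pCons split: nat.splits)
  have p: "homogeneous3 (int n') (v ^ i * t) \<Longrightarrow> homogeneous3 (int (n' + 1)) (v ^ Suc i * t)"
    if "v \<in> {x, y, z}" for v i n' and t :: "'k poly poly poly"
    using that homogeneous3_var[of "int n'" "v ^ i * t"] by (auto simp: mult.assoc add.commute)
  have pw: "homogeneous3 (int n') t \<Longrightarrow> homogeneous3 (int (n' + i)) (v ^ i * t)"
    if "v \<in> {x, y, z}" for v i n' and t :: "'k poly poly poly"
  proof (induction i)
    case (Suc i)
    show ?case using p[OF that Suc.IH[OF Suc.prems]] by simp
  qed simp
  have t: "homogeneous3 (int n) (C3 (g k) * x ^ \<alpha> k * y ^ \<beta> k * z ^ \<gamma> k)" if "k \<le> m" for k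
  proof (cases "g k = 0")
    case True
    then show ?thesis by (simp add: C.hom_zero homogeneous3_simps(7))
  next
    case False
    have "homogeneous3 (int (0 + \<alpha> k + \<beta> k + \<gamma> k)) (z ^ \<gamma> k * (y ^ \<beta> k * (x ^ \<alpha> k * C3 (g k))))"
      by (intro pw) (use c in simp_all)
    then show ?thesis using assms[OF that False] by (simp only: add_0 mult.commute mult.left_commute)
  qed
  have "homogeneous3 (int n) (\<Sum>k\<in>A. C3 (g k) * x ^ \<alpha> k * y ^ \<beta> k * z ^ \<gamma> k)" if "finite A" "A \<subseteq> {..m}" for A
    using that by (induction A rule: finite_induct) (use t homogeneous3_simps(4,7) in auto)
  then show ?thesis unfolding tsum_def by blast
qed

text \<open>With a variable as the common factor of the other terms, this shows what is left of the
  sum where that variable vanishes.\<close>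

lemma tsum_split:
  assumes "k0 \<le> m" and "\<And>k. k \<le> m \<Longrightarrow> k \<noteq> k0 \<Longrightarrow> g k \<noteq> 0 \<Longrightarrow> i \<le> \<alpha> k \<and> j \<le> \<beta> k \<and> l \<le> \<gamma> k"
  shows "\<exists>E. tsum m g \<alpha> \<beta> \<gamma> = C3 (g k0) * x ^ \<alpha> k0 * y ^ \<beta> k0 * z ^ \<gamma> k0 + x ^ i * y ^ j * z ^ l * E"
proof -
  interpret C: comm_ring_hom "C3 :: 'k \<Rightarrow> _" by (rule C3_hom)
  have "x ^ i * y ^ j * z ^ l dvd C3 (g k) * x ^ \<alpha> k * y ^ \<beta> k * z ^ \<gamma> k" if "k \<in> {..m} - {k0}" for k
  proof (cases "g k = 0")
    case False
    then have "i \<le> \<alpha> k" "j \<le> \<beta> k" "l \<le> \<gamma> k" using assms(2)[of k] that by auto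
    then have "x ^ i * y ^ j * z ^ l dvd x ^ \<alpha> k * y ^ \<beta> k * z ^ \<gamma> k" by (intro mult_dvd_mono le_imp_power_dvd)
    then show ?thesis by (simp add: mult.assoc)
  qed (simp add: C.hom_zero)
  then have "x ^ i * y ^ j * z ^ l dvd (\<Sum>k\<in>{..m} - {k0}. C3 (g k) * x ^ \<alpha> k * y ^ \<beta> k * z ^ \<gamma> k)" by (rule dvd_sum)
  then obtain E where "(\<Sum>k\<in>{..m} - {k0}. C3 (g k) * x ^ \<alpha> k * y ^ \<beta> k * z ^ \<gamma> k) = x ^ i * y ^ j * z ^ l * E" by (rule dvdE)
  then show ?thesis unfolding tsum_def using assms(1) by (subst sum.remove[of _ k0]) auto
qed

lemma tsum_bihom:
  "tsum m (coeff \<phi>) (\<lambda>k. \<epsilon> + p * k) (\<lambda>k. \<delta> + q * (m - k)) (\<lambda>k. e * k)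
    = x ^ \<epsilon> * y ^ \<delta> * bihom C3 m \<phi> (x ^ p * z ^ e) (y ^ q)"
  unfolding tsum_def bihom_def sum_distrib_left
  by (intro sum.cong refl) (simp only: power_add power_mult_distrib ac_simps flip: power_mult)


text \<open>The two sums are a monomial in x and y times the binary forms of \<open>\<phi>\<close>
  and of t \<open>\<phi>\<close>' in x^p z^e and y^q. If no variable lies in M, the monomial can be
  cancelled, and the absence of common roots puts y^q into M.\<close>

lemma tsum_prime:
  fixes e m p q \<delta> \<epsilon> :: nat and \<phi> :: "'k poly"
  defines "T \<equiv> \<lambda>c. tsum m c (\<lambda>k. \<epsilon> + p * k) (\<lambda>k. \<delta> + q * (m - k)) (\<lambda>k. e * k)"
  assumes M: "primeideal M class_ring"
    and \<phi>: "degree \<phi> \<le> m" "poly \<phi> 0 \<noteq> 0" "\<forall>r. poly \<phi> r = 0 \<longrightarrow> poly (pderiv \<phi>) r \<noteq> 0"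
    and mem: "T (coeff \<phi>) \<in> M" "T (\<lambda>k. of_nat k * coeff \<phi> k) \<in> M"
  shows "y \<in> M \<or> x \<in> M \<or> z \<in> M"
proof (rule ccontr)
  assume n: "\<not> ?thesis"
  then have pw: "x ^ \<epsilon> \<notin> M" "y ^ \<delta> \<notin> M" "y ^ q \<notin> M" using prime_power_mem[OF M] by blast+
  have "(\<lambda>k. of_nat k * coeff \<phi> k) = coeff (pCons 0 (pderiv \<phi>))"
    by (rule ext) (auto simp: coeff_pCons coeff_pderiv split: nat.splits)
  then have "x ^ \<epsilon> * y ^ \<delta> * bihom C3 m \<phi> (x ^ p * z ^ e) (y ^ q) \<in> M"
    "x ^ \<epsilon> * y ^ \<delta> * bihom C3 m (pCons 0 (pderiv \<phi>)) (x ^ p * z ^ e) (y ^ q) \<in> M"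
    using mem unfolding T_def by (simp_all add: tsum_bihom)
  then have "bihom C3 m \<phi> (x ^ p * z ^ e) (y ^ q) \<in> M" "bihom C3 m (pCons 0 (pderiv \<phi>)) (x ^ p * z ^ e) (y ^ q) \<in> M"
    using pw M unfolding class_prime_iff by metis+
  then have "y ^ q \<in> M" by (rule bihom_pderiv_prime[OF C3_hom M \<phi>])
  then show False using pw by blast
qed

text \<open>The positive exponents in the conclusion matter: they exclude the variables that are
  missing from the monomial.\<close>

lemma monomial_prime:
  assumes M: "primeideal M class_ring" and t: "t \<in> M" "t = C3 c * x ^ i * y ^ j * z ^ l + s" "s \<in> M" "c \<noteq> 0"
  shows "(i > 0 \<and> x \<in> M) \<or> (j > 0 \<and> y \<in> M) \<or> (l > 0 \<and> z \<in> M)"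
proof -
  have Mi: "ideal M class_ring" by (rule primeideal.axioms(1)[OF M])
  have "t - s \<in> M" by (rule class_ideal_minus[OF Mi t(1,3)])
  then have "C3 c * (x ^ i * y ^ j * z ^ l) \<in> M" unfolding t(2) by (simp add: mult.assoc)
  then have "x ^ i * y ^ j * z ^ l \<in> M" by (rule prime_unit_cancel[OF C3_hom Mi _ t(4)])
  then consider "x ^ i \<in> M" | "y ^ j \<in> M" | "z ^ l \<in> M" using M unfolding class_prime_iff by metis
  moreover have "n > 0 \<and> v \<in> M" if "v ^ n \<in> M" for v n
  proof
    show "v \<in> M" by (rule prime_power_mem[OF M that])
    show "n > 0" using that M unfolding class_prime_iff by (metis gr0I power_0)
  qed
  ultimately show ?thesis by cases blast+
qed

definition partials :: "(nat \<Rightarrow> 'k) \<Rightarrow> nat \<Rightarrow> (nat \<Rightarrow> nat) \<Rightarrow> (nat \<Rightarrow> nat) \<Rightarrow> (nat \<Rightarrow> nat) \<Rightarrow> 'k poly poly poly set" where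
  "partials c m \<alpha> \<beta> \<gamma> = {tsum m (\<lambda>k. of_nat (\<alpha> k) * c k) (\<lambda>k. \<alpha> k - 1) \<beta> \<gamma>,
     tsum m (\<lambda>k. of_nat (\<beta> k) * c k) \<alpha> (\<lambda>k. \<beta> k - 1) \<gamma>, tsum m (\<lambda>k. of_nat (\<gamma> k) * c k) \<alpha> \<beta> (\<lambda>k. \<gamma> k - 1)}"

lemma times_partials:
  "x * tsum m (\<lambda>k. of_nat (\<alpha> k) * c k) (\<lambda>k. \<alpha> k - 1) \<beta> \<gamma> = tsum m (\<lambda>k. of_nat (\<alpha> k) * c k) \<alpha> \<beta> \<gamma>"
  "y * tsum m (\<lambda>k. of_nat (\<beta> k) * c k) \<alpha> (\<lambda>k. \<beta> k - 1) \<gamma> = tsum m (\<lambda>k. of_nat (\<beta> k) * c k) \<alpha> \<beta> \<gamma>"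
  "z * tsum m (\<lambda>k. of_nat (\<gamma> k) * c k) \<alpha> \<beta> (\<lambda>k. \<gamma> k - 1) = tsum m (\<lambda>k. of_nat (\<gamma> k) * c k) \<alpha> \<beta> \<gamma>"
  unfolding tsum_mult(1-3) by (rule tsum_cong; auto)+

lemma C3_unit_mult:
  assumes "(a :: 'k) \<noteq> 0"
  shows "C3 (inverse a) * C3 a = 1"
proof -
  interpret C: comm_ring_hom "C3 :: 'k \<Rightarrow> _" by (rule C3_hom)
  show ?thesis using assms by (simp flip: C.hom_mult)
qed

text \<open>By Euler's identity, \<open>F\<close> is a combination of its partial derivatives.\<close>

lemma tsum_mem_of_partials:
  assumes M: "ideal M class_ring" and mem: "partials c m \<alpha> \<beta> \<gamma> \<subseteq> M"
    and deg: "d > 0" "\<forall>k\<le>m. \<alpha> k + \<beta> k + \<gamma> k = d"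
  shows "tsum m c \<alpha> \<beta> \<gamma> \<in> M" "tsum m (\<lambda>k. of_nat (\<gamma> k) * c k) \<alpha> \<beta> \<gamma> \<in> M"
proof -
  have Mc: "\<And>a b. a \<in> M \<Longrightarrow> b \<in> M \<Longrightarrow> a + b \<in> M" "\<And>a r. a \<in> M \<Longrightarrow> r * a \<in> M"
    using M unfolding class_ideal_iff by blast+
  have t: "tsum m (\<lambda>k. of_nat (\<alpha> k) * c k) \<alpha> \<beta> \<gamma> \<in> M" "tsum m (\<lambda>k. of_nat (\<beta> k) * c k) \<alpha> \<beta> \<gamma> \<in> M"
    and z: "tsum m (\<lambda>k. of_nat (\<gamma> k) * c k) \<alpha> \<beta> \<gamma> \<in> M"
    unfolding times_partials[symmetric] using mem by (auto simp: partials_def intro!: Mc(2))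
  show "tsum m (\<lambda>k. of_nat (\<gamma> k) * c k) \<alpha> \<beta> \<gamma> \<in> M" by (rule z)
  have "tsum m (\<lambda>k. of_nat (\<alpha> k) * c k + of_nat (\<beta> k) * c k + of_nat (\<gamma> k) * c k) \<alpha> \<beta> \<gamma> \<in> M"
    using Mc(1)[OF Mc(1)[OF t] z] by (simp only: tsum_mult(5))
  moreover have "tsum m (\<lambda>k. of_nat (\<alpha> k) * c k + of_nat (\<beta> k) * c k + of_nat (\<gamma> k) * c k) \<alpha> \<beta> \<gamma>
      = C3 (of_nat d) * tsum m c \<alpha> \<beta> \<gamma>"
    unfolding tsum_mult(4) using deg(2) by (intro tsum_cong) (simp_all flip: of_nat_add distrib_right)
  ultimately show "tsum m c \<alpha> \<beta> \<gamma> \<in> M" using prime_unit_cancel[OF C3_hom M, of "of_nat d"] deg(1) by simp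
qed

text \<open>M contains F by Euler's identity, and it contains z F_z, whose coefficients are e k c_k.
  Up to the unit e these are the forms of \<open>\<phi>\<close> and t \<open>\<phi>\<close>'. The
  equation q = p + e makes all terms have the same degree d.\<close>

lemma partials_prime:
  fixes e m p q \<delta> \<epsilon> :: nat and \<phi> :: "'k poly"
  defines "S \<equiv> partials (coeff \<phi>) m (\<lambda>k. \<epsilon> + p * k) (\<lambda>k. \<delta> + q * (m - k)) (\<lambda>k. e * k)"
  assumes M: "primeideal M class_ring" and S: "S \<subseteq> M"
    and e: "e > 0" "q = p + e" and d: "d = \<epsilon> + \<delta> + q * m" "d > 0"
    and \<phi>: "degree \<phi> \<le> m" "poly \<phi> 0 \<noteq> 0" "\<forall>r. poly \<phi> r = 0 \<longrightarrow> poly (pderiv \<phi>) r \<noteq> 0"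
  shows "y \<in> M \<or> x \<in> M \<or> z \<in> M"
proof -
  have Mi: "ideal M class_ring" by (rule primeideal.axioms(1)[OF M])
  have deg: "\<forall>k\<le>m. \<epsilon> + p * k + (\<delta> + q * (m - k)) + e * k = d"
  proof (intro allI impI)
    fix k assume that: "k \<le> m"
    have "q * (m - k) + (p * k + e * k) = q * (m - k) + q * k" unfolding e(2) by (simp add: distrib_right)
    also have "\<dots> = q * m" using that by (simp flip: distrib_left)
    finally show "\<epsilon> + p * k + (\<delta> + q * (m - k)) + e * k = d" unfolding d(1) by simp
  qed
  note tm = tsum_mem_of_partials[OF Mi S[unfolded S_def] d(2) deg]
  have "tsum m (\<lambda>k. of_nat (e * k) * coeff \<phi> k) (\<lambda>k. \<epsilon> + p * k) (\<lambda>k. \<delta> + q * (m - k)) (\<lambda>k. e * k)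
      = C3 (of_nat e) * tsum m (\<lambda>k. of_nat k * coeff \<phi> k) (\<lambda>k. \<epsilon> + p * k) (\<lambda>k. \<delta> + q * (m - k)) (\<lambda>k. e * k)"
    unfolding tsum_mult(4) by (intro tsum_cong) (simp_all add: mult.assoc)
  then have "tsum m (\<lambda>k. of_nat k * coeff \<phi> k) (\<lambda>k. \<epsilon> + p * k) (\<lambda>k. \<delta> + q * (m - k)) (\<lambda>k. e * k) \<in> M"
    using tm(2) prime_unit_cancel[OF C3_hom Mi, of "of_nat e"] e(1) by simp
  then show ?thesis by (rule tsum_prime[OF M \<phi> tm(1)])
qed


text \<open>Every term contains x, so F_y = x P0 and F_z = x Q0. In the relation between the partial
  derivatives x can then be cancelled, and F_x becomes a combination of y P0 and z Q0.\<close>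

theorem partials_perfect:
  fixes e m p q \<delta> :: nat and \<phi> :: "'k poly"
  defines "S \<equiv> partials (coeff \<phi>) m (\<lambda>k. 1 + p * k) (\<lambda>k. \<delta> + q * (m - k)) (\<lambda>k. e * k)"
  defines "J \<equiv> Idl\<^bsub>class_ring\<^esub> S"
  assumes e: "e > 0" "p > 0" "q = p + e" and m: "m > 0" and \<delta>: "\<delta> \<le> 1" and d: "d = 1 + \<delta> + q * m" "d \<ge> 3"
    and \<phi>: "degree \<phi> \<le> m" "poly \<phi> 0 \<noteq> 0" "\<forall>r. poly \<phi> r = 0 \<longrightarrow> poly (pderiv \<phi>) r \<noteq> 0" "coeff \<phi> m \<noteq> 0"
  shows "perfect_ideal J \<and> linear_type J \<and>
    min_graded_free_resolution J [[int d - 1, int d - 1, int d - 1], [2 * int d - 3, int d]]"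
proof -
  interpret C: comm_ring_hom "C3 :: 'k \<Rightarrow> _" by (rule C3_hom)
  define c where "c = coeff \<phi>"
  \<comment> \<open>The weights of x and y are q / N and p / N. Multiplied by N, the relation
    between the derivatives reads (d - 1) e x F_x = e y F_y + N z F_z; the next facts verify it
    coefficient by coefficient.\<close>
  define N where "N = (d - 1) * p + q"
  define P0 where "P0 = tsum m (\<lambda>k. of_nat (\<delta> + q * (m - k)) * c k) (\<lambda>k. p * k) (\<lambda>k. \<delta> + q * (m - k) - 1) (\<lambda>k. e * k)"
  define Q0 where "Q0 = tsum m (\<lambda>k. of_nat (e * k) * c k) (\<lambda>k. p * k) (\<lambda>k. \<delta> + q * (m - k)) (\<lambda>k. e * k - 1)"
  define Fx where "Fx = tsum m (\<lambda>k. of_nat (1 + p * k) * c k) (\<lambda>k. p * k) (\<lambda>k. \<delta> + q * (m - k)) (\<lambda>k. e * k)"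
  define Fy where "Fy = tsum m (\<lambda>k. of_nat (\<delta> + q * (m - k)) * c k) (\<lambda>k. 1 + p * k) (\<lambda>k. \<delta> + q * (m - k) - 1) (\<lambda>k. e * k)"
  have S: "S = {Fx, x * P0, x * Q0}"
    unfolding S_def partials_def Fx_def P0_def Q0_def c_def tsum_mult by simp
  have line: "q * (m - k) + q * k = q * m" if "k \<le> m" for k using that by (simp flip: distrib_left)
  have coef: "(d - 1) * e * (1 + p * k) = e * (\<delta> + q * (m - k)) + N * (e * k)" if "k \<le> m" for k
  proof -
    define D s where "D = d - 1" and "s = m - k"
    have D: "D = \<delta> + q * s + q * k" using line[OF that] d(1) unfolding D_def s_def by simp
    have "D * e * (1 + p * k) = e * D + D * p * (e * k)" by (simp add: algebra_simps)
    also have "e * D = e * (\<delta> + q * s) + q * (e * k)" unfolding D by (simp add: algebra_simps)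
    also have "e * (\<delta> + q * s) + q * (e * k) + D * p * (e * k) = e * (\<delta> + q * s) + N * (e * k)"
      unfolding N_def D_def by (simp add: algebra_simps)
    finally show ?thesis unfolding D_def s_def .
  qed
  have id: "C3 (of_nat ((d - 1) * e)) * Fx = y * (C3 (of_nat e) * P0) + z * (C3 (of_nat N) * Q0)"
  proof -
    have 1: "y * P0 = tsum m (\<lambda>k. of_nat (\<delta> + q * (m - k)) * c k) (\<lambda>k. p * k) (\<lambda>k. \<delta> + q * (m - k)) (\<lambda>k. e * k)"
      and 2: "z * Q0 = tsum m (\<lambda>k. of_nat (e * k) * c k) (\<lambda>k. p * k) (\<lambda>k. \<delta> + q * (m - k)) (\<lambda>k. e * k)"
      unfolding P0_def Q0_def by (rule times_partials)+
    have "y * (C3 (of_nat e) * P0) + z * (C3 (of_nat N) * Q0) = C3 (of_nat e) * (y * P0) + C3 (of_nat N) * (z * Q0)"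
      by (simp only: mult.left_commute)
    also have "\<dots> = C3 (of_nat ((d - 1) * e)) * Fx" unfolding 1 2 Fx_def tsum_mult
    proof (rule tsum_cong)
      fix k assume k: "k \<le> m"
      show "of_nat e * (of_nat (\<delta> + q * (m - k)) * c k) + of_nat N * (of_nat (e * k) * c k)
        = of_nat ((d - 1) * e) * (of_nat (1 + p * k) * c k)"
        unfolding mult.assoc[symmetric] of_nat_mult[symmetric] distrib_right[symmetric] of_nat_add[symmetric] coef[OF k] ..
    qed simp
    finally show ?thesis by (rule sym)
  qed
  define u where "u = (of_nat ((d - 1) * e) :: 'k)"
  have u: "u \<noteq> 0" using d(2) e(1) unfolding u_def by simp
  have N: "of_nat N \<noteq> (0 :: 'k)" "of_nat e \<noteq> (0 :: 'k)" using e by (simp_all only: of_nat_eq_0_iff) (simp_all add: N_def)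
  define P where "P = C3 (of_nat e / u) * P0"
  define Q where "Q = C3 (of_nat N / u) * Q0"
  have "y * P + z * Q = C3 (inverse u) * (C3 u * Fx)"
    unfolding id[folded u_def] P_def Q_def divide_inverse C.hom_mult by (simp add: algebra_simps)
  also have "\<dots> = Fx" using C3_unit_mult[OF u] by (simp add: mult.assoc[symmetric])
  finally have Fx: "y * P + z * Q = Fx" .
  have "{C3 (of_nat e / u) * (x * P0), C3 (of_nat N / u) * (x * Q0), Fx} = {y * P + z * Q, x * P, x * Q}"
    unfolding Fx unfolding P_def Q_def by (auto simp: mult.left_commute)
  moreover have "{x * P0, x * Q0, Fx} = S" unfolding S by auto
  ultimately have J: "J = Idl\<^bsub>class_ring\<^esub> {y * P + z * Q, x * P, x * Q}"
    unfolding J_def using class_Idl_triple_units[OF C3_hom, of "of_nat e / u" "of_nat N / u" "x * P0" "x * Q0" Fx] N u by simp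
  have hom: "homogeneous3 (int d - 2) P" "homogeneous3 (int d - 2) Q"
  proof -
    have i: "int d - 2 = int (d - 2)" using d(2) by simp
    have *: "p * k + (\<delta> + q * (m - k)) + e * k = d - 1" if "k \<le> m" for k
      using line[OF that] unfolding d(1) e(3) by (simp add: algebra_simps)
    have pos: "of_nat n * t \<noteq> 0 \<Longrightarrow> n > 0" for n and t :: 'k by (cases n) auto
    show "homogeneous3 (int d - 2) P" unfolding P_def P0_def tsum_mult i
    proof (rule tsum_homogeneous)
      fix k assume k: "k \<le> m" "of_nat e / u * (of_nat (\<delta> + q * (m - k)) * c k) \<noteq> 0"
      then have "\<delta> + q * (m - k) > 0" using pos by (metis mult_eq_0_iff)
      then show "p * k + (\<delta> + q * (m - k) - 1) + e * k = d - 2" using *[OF k(1)] by linarith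
    qed
    show "homogeneous3 (int d - 2) Q" unfolding Q_def Q0_def tsum_mult i
    proof (rule tsum_homogeneous)
      fix k assume k: "k \<le> m" "of_nat N / u * (of_nat (e * k) * c k) \<noteq> 0"
      then have "e * k > 0" using pos by (metis mult_eq_0_iff)
      then show "p * k + (\<delta> + q * (m - k)) + (e * k - 1) = d - 2" using *[OF k(1)] by linarith
    qed
  qed
  show ?thesis unfolding J
  proof (rule perfect_case[OF d(2) hom])
    fix M :: "'k poly poly poly set" assume M: "primeideal M class_ring" "Idl\<^bsub>class_ring\<^esub> {y * P + z * Q, x * P, x * Q} \<subseteq> M"
    have Mi: "ideal M class_ring" by (rule primeideal.axioms(1)[OF M(1)])
    have Mc: "r * a \<in> M" if "a \<in> M" for a r using that Mi unfolding class_ideal_iff by blast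
    have "S \<subseteq> J" unfolding J_def by (rule ring.genideal_self[OF class_ring.ring_axioms]) simp
    then have SM: "S \<subseteq> M" using M(2) unfolding J by blast
    then have FM: "Fx \<in> M" "x * P0 \<in> M" unfolding S by blast+
    have xyz: "y \<in> M \<or> x \<in> M \<or> z \<in> M"
      by (rule partials_prime[OF M(1) SM[unfolded S_def] e(1,3) d(1) _ \<phi>(1-3)]) (use d(2) in simp)
    \<comment> \<open>Every term with k > 0 contains both x and z, so modulo either of them a pure
      power of y remains.\<close>
    have "\<exists>E. Fx = C3 (of_nat (1 + p * 0) * c 0) * x ^ (p * 0) * y ^ (\<delta> + q * (m - 0)) * z ^ (e * 0) + x ^ 1 * y ^ 0 * z ^ 1 * E"
      unfolding Fx_def by (rule tsum_split) (use e in auto)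
    then obtain E where E: "Fx = C3 (c 0) * x ^ 0 * y ^ (\<delta> + q * m) * z ^ 0 + x * z * E" by auto
    have c0: "c 0 \<noteq> 0" using \<phi>(2) by (simp add: c_def poly_0_coeff_0)
    have y: "y \<in> M" if "x \<in> M \<or> z \<in> M"
    proof -
      have "x * z * E \<in> M" using that Mc by (metis mult.commute mult.left_commute)
      from monomial_prime[OF M(1) FM(1) E this c0] show ?thesis by blast
    qed
    have off: "0 < \<delta> + q * (m - k)" if "k \<le> m" "k \<noteq> m" for k using e that by simp
    \<comment> \<open>What is needed is a monomial without y, and it comes from k = m. For \<delta>
      = 0 it occurs in F_x; for \<delta> = 1 that term of F contains y exactly once, and
      differentiation in y removes it.\<close>
    have "x \<in> M \<or> z \<in> M" if yM: "y \<in> M"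
    proof (cases "\<delta> = 0")
      case True
      have "\<exists>E. Fx = C3 (of_nat (1 + p * m) * c m) * x ^ (p * m) * y ^ (\<delta> + q * (m - m)) * z ^ (e * m) + x ^ 0 * y ^ 1 * z ^ 0 * E"
        unfolding Fx_def by (rule tsum_split) (use off in \<open>simp_all add: Suc_le_eq\<close>)
      then obtain E' where E': "Fx = C3 (of_nat (1 + p * m) * c m) * x ^ (p * m) * y ^ 0 * z ^ (e * m) + y * E'" using True by auto
      have "y * E' \<in> M" using Mc[OF yM] by (metis mult.commute)
      moreover have "of_nat (1 + p * m) * c m \<noteq> 0" using \<phi>(4) unfolding c_def by (simp del: of_nat_add of_nat_Suc)
      ultimately show ?thesis using monomial_prime[OF M(1) FM(1) E'] by blast
    next
      case False
      then have \<delta>1: "\<delta> = 1" using \<delta> by simp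
      have "\<exists>E. P0 = C3 (of_nat (\<delta> + q * (m - m)) * c m) * x ^ (p * m) * y ^ (\<delta> + q * (m - m) - 1) * z ^ (e * m) + x ^ 0 * y ^ 1 * z ^ 0 * E"
        unfolding P0_def by (rule tsum_split) (use e \<delta>1 in auto)
      then obtain E' where E': "P0 = C3 (c m) * x ^ (p * m) * y ^ 0 * z ^ (e * m) + y * E'" using \<delta>1 by auto
      have yE': "y * E' \<in> M" using Mc[OF yM] by (metis mult.commute)
      have "x \<in> M \<or> P0 \<in> M" using M(1) FM(2) unfolding class_prime_iff by blast
      then show ?thesis using monomial_prime[OF M(1) _ E' yE'] \<phi>(4) unfolding c_def by blast
    qed
    then show "y \<in> M \<and> (x \<in> M \<or> z \<in> M)" using xyz y by blast
  qed
qed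


text \<open>Without the extra factor x, the exponents of x and z in the k-th term are p k and e k,
  both proportional to k. Hence F_x = p z G and F_z = e x G with the same G, whose coefficients are
  k c_k.\<close>

theorem partials_imperfect:
  fixes e m p q \<delta> :: nat and \<phi> :: "'k poly"
  defines "S \<equiv> partials (coeff \<phi>) m (\<lambda>k. 0 + p * k) (\<lambda>k. \<delta> + q * (m - k)) (\<lambda>k. e * k)"
  defines "J \<equiv> Idl\<^bsub>class_ring\<^esub> S"
  assumes e: "e > 0" "p > 0" "q = p + e" and m: "m > 0" and \<delta>: "\<delta> \<le> 1" and d: "d = 0 + \<delta> + q * m" "d \<ge> 3"
    and \<phi>: "degree \<phi> \<le> m" "poly \<phi> 0 \<noteq> 0" "\<forall>r. poly \<phi> r = 0 \<longrightarrow> poly (pderiv \<phi>) r \<noteq> 0" "coeff \<phi> m \<noteq> 0"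
  shows "linear_type J \<and> \<not> perfect_ideal J \<and>
    min_graded_free_resolution J [[int d - 1, int d - 1, int d - 1], [int d, 2 * (int d - 1), 2 * (int d - 1)], [2 * int d - 1]]"
proof -
  define c where "c = coeff \<phi>"
  define G where "G = tsum m (\<lambda>k. of_nat k * c k) (\<lambda>k. p * k - 1) (\<lambda>k. \<delta> + q * (m - k)) (\<lambda>k. e * k - 1)"
  define H where "H = tsum m (\<lambda>k. of_nat (\<delta> + q * (m - k)) * c k) (\<lambda>k. p * k) (\<lambda>k. \<delta> + q * (m - k) - 1) (\<lambda>k. e * k)"
  have pos: "k > 0" if "of_nat k * t \<noteq> 0" for k and t :: 'k using that by (cases k) auto
  have "tsum m (\<lambda>k. of_nat (p * k) * c k) (\<lambda>k. p * k - 1) (\<lambda>k. \<delta> + q * (m - k)) (\<lambda>k. e * k) = C3 (of_nat p) * (z * G)"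
    unfolding G_def tsum_mult
  proof (rule tsum_cong)
    fix k assume "of_nat (p * k) * c k \<noteq> 0"
    then have "e * k > 0" using pos e(1) by force
    then show "p * k - 1 = p * k - 1 \<and> \<delta> + q * (m - k) = \<delta> + q * (m - k) \<and> e * k = Suc (e * k - 1)" by simp
  qed (simp add: mult.assoc)
  moreover have "tsum m (\<lambda>k. of_nat (e * k) * c k) (\<lambda>k. p * k) (\<lambda>k. \<delta> + q * (m - k)) (\<lambda>k. e * k - 1) = C3 (of_nat e) * (x * G)"
    unfolding G_def tsum_mult
  proof (rule tsum_cong)
    fix k assume "of_nat (e * k) * c k \<noteq> 0"
    then have "p * k > 0" using pos e(2) by force
    then show "p * k = Suc (p * k - 1) \<and> \<delta> + q * (m - k) = \<delta> + q * (m - k) \<and> e * k - 1 = e * k - 1" by simp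
  qed (simp add: mult.assoc)
  ultimately have S: "S = {C3 (of_nat e) * (x * G), C3 (of_nat p) * (z * G), H}"
    unfolding S_def partials_def c_def[symmetric] H_def[symmetric] add_0 by auto
  have J: "J = Idl\<^bsub>class_ring\<^esub> {x * G, z * G, H}"
    unfolding J_def S by (rule class_Idl_triple_units[OF C3_hom]) (use e in simp_all)
  have line: "q * (m - k) + q * k = q * m" if "k \<le> m" for k using that by (simp flip: distrib_left)
  have off: "0 < q * (m - k)" if "k \<le> m" "k \<noteq> m" for k using e that by simp
  have deg: "p * k + (\<delta> + q * (m - k)) + e * k = d" if "k \<le> m" for k
    using line[OF that] unfolding d(1) e(3) by (simp add: algebra_simps)
  have homG: "homogeneous3 (int d - 2) G"
  proof -
    have i: "int d - 2 = int (d - 2)" using d(2) by simp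
    show ?thesis unfolding G_def i
    proof (rule tsum_homogeneous)
      fix k assume k: "k \<le> m" "of_nat k * c k \<noteq> 0"
      have "p * k > 0" "e * k > 0" using pos[OF k(2)] e by simp_all
      then show "p * k - 1 + (\<delta> + q * (m - k)) + (e * k - 1) = d - 2" using deg[OF k(1)] by linarith
    qed
  qed
  have homH: "homogeneous3 (int d - 1) H"
  proof -
    have i: "int d - 1 = int (d - 1)" using d(2) by simp
    show ?thesis unfolding H_def i
    proof (rule tsum_homogeneous)
      fix k assume k: "k \<le> m" "of_nat (\<delta> + q * (m - k)) * c k \<noteq> 0"
      show "p * k + (\<delta> + q * (m - k) - 1) + e * k = d - 1" using deg[OF k(1)] pos[OF k(2)] by linarith
    qed
  qed
  have cm: "of_nat m * c m \<noteq> 0" and c0: "of_nat d * c 0 \<noteq> 0"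
    using \<phi>(2,4) m d(2) by (simp_all add: c_def poly_0_coeff_0)
  have "\<exists>E. H = C3 (of_nat (\<delta> + q * (m - 0)) * c 0) * x ^ (p * 0) * y ^ (\<delta> + q * (m - 0) - 1) * z ^ (e * 0) + x ^ 1 * y ^ 0 * z ^ 1 * E"
    unfolding H_def by (rule tsum_split) (use e in auto)
  then obtain E where E: "H = C3 (of_nat d * c 0) * y ^ (d - 1) + x * z * E" using d(1) by auto
  have "\<exists>E. G = C3 (of_nat m * c m) * x ^ (p * m - 1) * y ^ (\<delta> + q * (m - m)) * z ^ (e * m - 1) + x ^ 0 * y ^ 1 * z ^ 0 * E"
    unfolding G_def by (rule tsum_split) (use off in \<open>simp_all add: Suc_le_eq\<close>)
  then obtain E0 where E0: "G = C3 (of_nat m * c m) * x ^ (p * m - 1) * y ^ \<delta> * z ^ (e * m - 1) + y * E0" by auto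
  have "\<exists>c' r s E'. G = C3 c' * x ^ r * z ^ s + y * E' \<and> r + s > 0"
  proof (cases "\<delta> = 0")
    case True
    have "p * m + e * m = d" using d(1) True e(3) by (simp add: distrib_right)
    then have "p * m - 1 + (e * m - 1) > 0" using d(2) by linarith
    moreover have "G = C3 (of_nat m * c m) * x ^ (p * m - 1) * z ^ (e * m - 1) + y * E0" using E0 True by simp
    ultimately show ?thesis by blast
  next
    case False
    interpret C: comm_ring_hom "C3 :: 'k \<Rightarrow> _" by (rule C3_hom)
    have "\<delta> = 1" using False \<delta> by simp
    \<comment> \<open>For \<delta> = 1 all of G is a multiple of y and vanishes on both axes; a
      monomial with coefficient 0 serves as the required one with r + s > 0.\<close>
    then have "G = C3 0 * x ^ 1 * z ^ 0 + y * (C3 (of_nat m * c m) * x ^ (p * m - 1) * z ^ (e * m - 1) + E0)"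
      unfolding E0 C.hom_zero by (simp add: algebra_simps)
    moreover have "1 + 0 > (0 :: nat)" by simp
    ultimately show ?thesis by blast
  qed
  then obtain c' r s E' where G: "G = C3 c' * x ^ r * z ^ s + y * E'" "r + s > 0" by blast
  show ?thesis unfolding J
  proof (rule imperfect_case[OF d(2) homG homH E c0 G])
    fix M :: "'k poly poly poly set" assume M: "primeideal M class_ring" and GM: "G \<in> M" and HM: "H \<in> M"
    have Mi: "ideal M class_ring" by (rule primeideal.axioms(1)[OF M(1)])
    have Mc: "r * a \<in> M" if "a \<in> M" for a r using that Mi unfolding class_ideal_iff by blast
    have SM: "S \<subseteq> M" unfolding S using GM HM Mc by blast
    have xyz: "y \<in> M \<or> x \<in> M \<or> z \<in> M"
      by (rule partials_prime[OF M SM[unfolded S_def] e(1,3) d(1) _ \<phi>(1-3)]) (use d(2) in simp)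
    have y: "y \<in> M" if "x \<in> M \<or> z \<in> M"
    proof -
      have m': "x * z * E \<in> M" using that Mc by (metis mult.commute mult.left_commute)
      have "H = C3 (of_nat d * c 0) * x ^ 0 * y ^ (d - 1) * z ^ 0 + x * z * E" using E by simp
      from monomial_prime[OF M HM this m' c0] show ?thesis by blast
    qed
    have "x \<in> M \<or> z \<in> M" if yM: "y \<in> M"
    proof (cases "\<delta> = 0")
      case True
      have "y * E0 \<in> M" using Mc[OF yM] by (metis mult.commute)
      then show ?thesis using monomial_prime[OF M GM E0 _ cm] True by blast
    next
      case False
      then have \<delta>1: "\<delta> = 1" using \<delta> by simp
      have "\<exists>E. H = C3 (of_nat (\<delta> + q * (m - m)) * c m) * x ^ (p * m) * y ^ (\<delta> + q * (m - m) - 1) * z ^ (e * m) + x ^ 0 * y ^ 1 * z ^ 0 * E"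
        unfolding H_def by (rule tsum_split) (use off \<delta>1 in \<open>simp_all add: Suc_le_eq\<close>)
      then obtain E' where E': "H = C3 (c m) * x ^ (p * m) * y ^ 0 * z ^ (e * m) + y * E'" using \<delta>1 by auto
      have yE': "y * E' \<in> M" using Mc[OF yM] by (metis mult.commute)
      show ?thesis using monomial_prime[OF M HM E' yE'] \<phi>(4) unfolding c_def by blast
    qed
    then show "y \<in> M \<and> (x \<in> M \<or> z \<in> M)" using xyz y by blast
  qed
qed

end

section \<open>The normal form of a weighted homogeneous polynomial\<close>

lemma map_poly_pderiv_sum:
  fixes g :: "'b \<Rightarrow> 'a::{comm_ring_1} poly poly"
  assumes "\<And>p q :: 'a poly. D (p + q) = D p + D q" "D 0 = 0"
  shows "map_poly D (sum g A) = (\<Sum>k\<in>A. map_poly D (g k))"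
proof -
  have a: "map_poly D (p + q) = map_poly D p + map_poly D q" for p q
    by (rule poly_eqI) (simp add: coeff_map_poly assms)
  show ?thesis by (induction A rule: infinite_finite_induct) (simp_all add: a)
qed

lemma monom3: "C3 c * X3 ^ i * Y3 ^ j * Z3 ^ l = Polynomial.monom (Polynomial.monom (Polynomial.monom c i) j) l"
proof -
  have x: "[:0, 1::'a::comm_ring_1:] ^ i = Polynomial.monom 1 i" by (simp add: monom_altdef)
  have "(X3 :: 'a poly poly poly) ^ i = [:[:[:0, 1:] ^ i:]:]" by (induction i) (simp_all add: X3_def one_pCons)
  moreover have "(Y3 :: 'a poly poly poly) ^ j = [:[:0, 1:] ^ j:]" by (induction j) (simp_all add: Y3_def one_pCons)
  moreover have "[:0, 1::'a poly:] ^ j = Polynomial.monom 1 j" "(Z3 :: 'a poly poly poly) ^ l = Polynomial.monom 1 l"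
    by (simp_all add: Z3_def monom_altdef)
  ultimately show ?thesis by (simp add: x smult_monom C3_def)
qed

lemma partial_derivatives:
  fixes g :: "nat \<Rightarrow> 'k::idom" and A :: "nat set"
  defines "F \<equiv> \<lambda>g \<alpha> \<beta> \<gamma>. \<Sum>k\<in>A. C3 (g k) * X3 ^ \<alpha> k * Y3 ^ \<beta> k * Z3 ^ \<gamma> k"
  shows "map_poly (map_poly pderiv) (F g \<alpha> \<beta> \<gamma>) = F (\<lambda>k. of_nat (\<alpha> k) * g k) (\<lambda>k. \<alpha> k - 1) \<beta> \<gamma>"
    "map_poly pderiv (F g \<alpha> \<beta> \<gamma>) = F (\<lambda>k. of_nat (\<beta> k) * g k) \<alpha> (\<lambda>k. \<beta> k - 1) \<gamma>"
    "pderiv (F g \<alpha> \<beta> \<gamma>) = F (\<lambda>k. of_nat (\<gamma> k) * g k) \<alpha> \<beta> (\<lambda>k. \<gamma> k - 1)"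
proof -
  have p1: "map_poly pderiv (p + q) = map_poly pderiv p + map_poly pderiv q" for p q :: "'k poly poly"
    by (rule poly_eqI) (simp add: coeff_map_poly pderiv_add)
  have n: "of_nat n * Polynomial.monom t i = Polynomial.monom (of_nat n * t) i" for n i and t :: "'b::comm_ring_1"
    by (simp add: of_nat_poly smult_monom)
  show "map_poly (map_poly pderiv) (F g \<alpha> \<beta> \<gamma>) = F (\<lambda>k. of_nat (\<alpha> k) * g k) (\<lambda>k. \<alpha> k - 1) \<beta> \<gamma>"
    unfolding F_def by (subst map_poly_pderiv_sum) (simp_all add: p1 monom3 map_poly_monom pderiv_monom n)
  show "map_poly pderiv (F g \<alpha> \<beta> \<gamma>) = F (\<lambda>k. of_nat (\<beta> k) * g k) \<alpha> (\<lambda>k. \<beta> k - 1) \<gamma>"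
    unfolding F_def by (subst map_poly_pderiv_sum) (simp_all add: pderiv_add monom3 map_poly_monom pderiv_monom n)
  show "pderiv (F g \<alpha> \<beta> \<gamma>) = F (\<lambda>k. of_nat (\<gamma> k) * g k) \<alpha> \<beta> (\<lambda>k. \<gamma> k - 1)"
    unfolding F_def pderiv_sum by (simp add: monom3 pderiv_monom n)
qed

text \<open>Reindexes the sum over the rectangle-like range of all coefficients by a parametrization
  of a set that covers the support; terms outside the support vanish on either side.\<close>

lemma support_sum:
  fixes f :: "'k::field poly poly" and h :: "nat \<Rightarrow> nat \<Rightarrow> 'b::comm_ring_1"
  assumes inj: "inj_on (\<lambda>k. (\<alpha> k, \<beta> k)) {..m::nat}"
    and supp: "\<And>i j. coeff2 f i j \<noteq> 0 \<Longrightarrow> \<exists>k\<le>m. i = \<alpha> k \<and> j = \<beta> k"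
    and h: "\<And>i j. coeff2 f i j = 0 \<Longrightarrow> h i j = 0"
  shows "(\<Sum>j\<le>degree f. \<Sum>i\<le>degree (coeff f j). h i j) = (\<Sum>k\<le>m. h (\<alpha> k) (\<beta> k))"
proof -
  let ?B = "SIGMA j:{..degree f}. {..degree (coeff f j)}"
  let ?A = "(\<lambda>k. (\<alpha> k, \<beta> k)) ` {..m}"
  have mem: "(j, i) \<in> ?B" if "coeff2 f i j \<noteq> 0" for i j
  proof -
    have "i \<le> degree (coeff f j)" using that by (auto simp: coeff2_def intro: le_degree)
    moreover have "coeff f j \<noteq> 0" using that by (auto simp: coeff2_def)
    then have "j \<le> degree f" by (rule le_degree)
    ultimately show ?thesis by simp
  qed
  have "(\<Sum>j\<le>degree f. \<Sum>i\<le>degree (coeff f j). h i j) = (\<Sum>(j, i)\<in>?B. h i j)"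
    by (subst sum.Sigma) simp_all
  also have "\<dots> = (\<Sum>(j, i)\<in>?B \<inter> {(j, i). coeff2 f i j \<noteq> 0}. h i j)"
    by (rule sum.mono_neutral_right) (auto simp: h)
  also have "\<dots> = (\<Sum>(j, i)\<in>(\<lambda>(i, j). (j, i)) ` ?A. h i j)"
  proof (rule sum.mono_neutral_left)
    show "?B \<inter> {(j, i). coeff2 f i j \<noteq> 0} \<subseteq> (\<lambda>(i, j). (j, i)) ` ?A" using supp by force
    show "\<forall>t\<in>(\<lambda>(i, j). (j, i)) ` ?A - ?B \<inter> {(j, i). coeff2 f i j \<noteq> 0}. (case t of (j, i) \<Rightarrow> h i j) = 0"
    proof (rule ballI)
      fix t assume t: "t \<in> (\<lambda>(i, j). (j, i)) ` ?A - ?B \<inter> {(j, i). coeff2 f i j \<noteq> 0}"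
      obtain j i where ji: "t = (j, i)" by (cases t)
      have "coeff2 f i j = 0" using t mem[of i j] unfolding ji by auto
      then show "(case t of (j, i) \<Rightarrow> h i j) = 0" unfolding ji by (simp add: h)
    qed
  qed simp
  also have "\<dots> = (\<Sum>(i, j)\<in>?A. h i j)" by (subst sum.reindex) (auto simp: inj_on_def intro!: sum.cong)
  also have "\<dots> = (\<Sum>k\<le>m. h (\<alpha> k) (\<beta> k))" by (subst sum.reindex[OF inj]) simp
  finally show ?thesis .
qed

lemma poly2_eq_sum:
  fixes f :: "'k::field poly poly"
  shows "f = (\<Sum>j\<le>degree f. \<Sum>i\<le>degree (coeff f j). [:[:coeff2 f i j:]:] * X2 ^ i * Y2 ^ j)" (is "_ = ?S")
  unfolding poly2_eq_iff
proof (intro allI)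
  fix i' j'
  have "coeff2 ?S i' j' = (\<Sum>j\<le>degree f. \<Sum>i\<le>degree (coeff f j). if i = i' \<and> j = j' then coeff2 f i j else 0)"
    by (simp only: coeff2_sum monom_term coeff2_monom)
  also have "\<dots> = (\<Sum>j\<le>degree f. if j = j' then (\<Sum>i\<le>degree (coeff f j). if i = i' then coeff2 f i j' else 0) else 0)"
    by (intro sum.cong refl) (auto intro: sum.cong)
  also have "\<dots> = coeff2 f i' j'" by (auto simp: coeff2_def coeff_eq_0 not_le)
  finally show "coeff2 f i' j' = coeff2 ?S i' j'" by simp
qed

text \<open>\<epsilon> and \<delta> are the smallest exponents that occur, bounded by 1 through
  \<open>small\<close>. The points that attain them are the ends of the segment containing A, and
  they differ because A does not lie on a line of constant degree. The primitive lattice vector (p,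
  -q) of the segment has p < q because p a = q b and b < a.\<close>

lemma weighted_line:
  fixes A :: "(nat \<times> nat) set" and a b :: rat
  assumes w: "\<And>i j. (i, j) \<in> A \<Longrightarrow> of_nat i * a + of_nat j * b = 1" and ab: "0 < b" "b < a"
    and small: "\<exists>i j. (i, j) \<in> A \<and> i \<le> 1" "\<exists>i j. (i, j) \<in> A \<and> j \<le> 1"
    and nonhom: "\<not> (\<exists>n. \<forall>(i, j)\<in>A. i + j = n)"
  obtains \<epsilon> \<delta> p q m where "\<epsilon> \<le> 1" "\<delta> \<le> 1" "0 < p" "p < q" "0 < m" "(\<epsilon>, \<delta> + q * m) \<in> A" "(\<epsilon> + p * m, \<delta>) \<in> A"
    "\<forall>(i, j)\<in>A. \<exists>k\<le>m. i = \<epsilon> + p * k \<and> j = \<delta> + q * (m - k)"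
proof -
  define \<epsilon> where "\<epsilon> = (LEAST i. \<exists>j. (i, j) \<in> A)"
  define \<delta> where "\<delta> = (LEAST j. \<exists>i. (i, j) \<in> A)"
  obtain j0 where j0: "(\<epsilon>, j0) \<in> A" using LeastI_ex[of "\<lambda>i. \<exists>j. (i, j) \<in> A"] small(1) unfolding \<epsilon>_def by blast
  obtain i1 where i1: "(i1, \<delta>) \<in> A" using LeastI_ex[of "\<lambda>j. \<exists>i. (i, j) \<in> A"] small(2) unfolding \<delta>_def by blast
  have le: "\<epsilon> \<le> i" "\<delta> \<le> j" if "(i, j) \<in> A" for i j
    using that unfolding \<epsilon>_def \<delta>_def by (blast intro: Least_le)+
  have e1: "\<epsilon> \<le> 1" "\<delta> \<le> 1" using small le by (meson le_trans)+
  have line: "rat_of_nat (i - \<epsilon>) * a = rat_of_nat (j0 - j) * b" "j \<le> j0" if "(i, j) \<in> A" for i j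
  proof -
    have *: "(rat_of_nat i - rat_of_nat \<epsilon>) * a = (rat_of_nat j0 - rat_of_nat j) * b"
      using w[OF that] w[OF j0] by (simp add: algebra_simps)
    have "0 \<le> (rat_of_nat i - rat_of_nat \<epsilon>) * a" using le(1)[OF that] ab by simp
    then have "rat_of_nat j \<le> rat_of_nat j0" using * ab(1) by (simp add: zero_le_mult_iff)
    then show "j \<le> j0" by simp
    then show "rat_of_nat (i - \<epsilon>) * a = rat_of_nat (j0 - j) * b" using * le(1)[OF that] by (simp add: of_nat_diff)
  qed
  have "i1 \<noteq> \<epsilon>"
  proof
    assume "i1 = \<epsilon>"
    then have j: "j0 = \<delta>" using line[OF i1] ab(1) by simp
    have "i = \<epsilon> \<and> j = \<delta>" if "(i, j) \<in> A" for i j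
      using line[OF that] le[OF that] ab j by auto
    then have "\<forall>(i, j)\<in>A. i + j = \<epsilon> + \<delta>" by auto
    then show False using nonhom by blast
  qed
  then have I: "i1 - \<epsilon> > 0" using le(1)[OF i1] by simp
  have J: "j0 - \<delta> > 0" using line(1)[OF i1] I ab by (cases "j0 - \<delta>") auto
  \<comment> \<open>The number of primitive lattice steps between the two end points.\<close>
  define m where "m = gcd (i1 - \<epsilon>) (j0 - \<delta>)"
  have m0: "m > 0" using I unfolding m_def by simp
  obtain p q where pq: "i1 - \<epsilon> = p * m" "j0 - \<delta> = q * m" "coprime p q"
    using gcd_coprime_exists[of "i1 - \<epsilon>" "j0 - \<delta>"] m0 unfolding m_def by auto
  have p0: "p > 0" "q > 0" using I J pq by (auto intro: gr0I)
  have ratio: "rat_of_nat p * a = rat_of_nat q * b" using line(1)[OF i1] m0 unfolding pq(1,2) by simp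
  have "rat_of_nat p * b < rat_of_nat q * b" unfolding ratio[symmetric] using ab p0 by simp
  then have plq: "p < q" using ab(1) by simp
  have j0': "j0 = \<delta> + q * m" and i1': "i1 = \<epsilon> + p * m" using pq(1,2) I J by linarith+
  have pts: "\<exists>k\<le>m. i = \<epsilon> + p * k \<and> j = \<delta> + q * (m - k)" if A: "(i, j) \<in> A" for i j
  proof -
    have "rat_of_nat ((i - \<epsilon>) * q) * b = rat_of_nat (i - \<epsilon>) * a * rat_of_nat p"
      using ratio by (simp add: ac_simps)
    also have "\<dots> = rat_of_nat ((j0 - j) * p) * b" unfolding line(1)[OF A] by simp
    finally have e: "(i - \<epsilon>) * q = (j0 - j) * p" using ab(1) by (metis mult_cancel_right of_nat_eq_iff less_irrefl)
    then have "p dvd (i - \<epsilon>) * q" by simp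
    then have "p dvd i - \<epsilon>" using pq(3) coprime_dvd_mult_left_iff by blast
    then obtain k where k: "i - \<epsilon> = p * k" by (rule dvdE)
    have jk: "j0 - j = q * k" using e p0 unfolding k by (simp add: mult.commute)
    have "q * k \<le> q * m" using jk le(2)[OF A] j0' by linarith
    then have km: "k \<le> m" using p0 by simp
    have "i = \<epsilon> + p * k" using k le(1)[OF A] by simp
    moreover have "j = \<delta> + q * (m - k)" using jk line(2)[OF A] km j0' by (simp add: diff_mult_distrib2)
    ultimately show ?thesis using km by blast
  qed
  show ?thesis by (rule that[OF e1 p0(1) plq m0]) (use j0 i1 j0' i1' pts in auto)
qed

lemma var_square_dvd:
  fixes f :: "'k::field poly poly"
  shows "(\<And>i j. coeff2 f i j \<noteq> 0 \<Longrightarrow> 2 \<le> i) \<Longrightarrow> X2 ^ 2 dvd f"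
    "(\<And>i j. coeff2 f i j \<noteq> 0 \<Longrightarrow> 2 \<le> j) \<Longrightarrow> Y2 ^ 2 dvd f"
proof -
  have t: "v ^ 2 dvd [:[:coeff2 f i j:]:] * X2 ^ i * Y2 ^ j"
    if "coeff2 f i j \<noteq> 0 \<Longrightarrow> v = X2 \<and> 2 \<le> i \<or> v = Y2 \<and> 2 \<le> j" for v i j
  proof (cases "coeff2 f i j = 0")
    case False
    then show ?thesis using that le_imp_power_dvd by (metis dvd_mult dvd_mult2)
  qed simp
  show "X2 ^ 2 dvd f" if "\<And>i j. coeff2 f i j \<noteq> 0 \<Longrightarrow> 2 \<le> i"
    by (subst poly2_eq_sum) (intro dvd_sum t, use that in simp)
  show "Y2 ^ 2 dvd f" if "\<And>i j. coeff2 f i j \<noteq> 0 \<Longrightarrow> 2 \<le> j"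
    by (subst poly2_eq_sum) (intro dvd_sum t, use that in simp)
qed

text \<open>A double root r makes the square of u - r v divide f. This factor is not a unit since u
  and v vanish at the origin.\<close>

lemma squarefree_bihom_simple_roots:
  fixes f u v t :: "'k::alg_closed_field poly poly"
  assumes f: "squarefree f" "f = t * bihom (\<lambda>c. [:[:c:]:]) m \<phi> u v"
    and m: "m > 0" "degree \<phi> \<le> m" and uv: "coeff2 u 0 0 = 0" "coeff2 v 0 0 = 0"
    and r: "poly \<phi> r = 0"
  shows "poly (pderiv \<phi>) r \<noteq> 0"
proof
  assume r': "poly (pderiv \<phi>) r = 0"
  let ?C = "\<lambda>c::'k. [:[:c:]:]"
  have C: "comm_ring_hom ?C" by unfold_locales (simp_all add: one_pCons)
  obtain n where n: "m = Suc n" using m(1) gr0_implies_Suc by blast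
  have "degree (synthetic_div \<phi> r) \<le> n" using m(2) n by (simp add: degree_synthetic_div)
  then obtain w where w: "bihom ?C n (synthetic_div \<phi> r) u v = (u - ?C r * v) * w + ?C (poly (synthetic_div \<phi> r) r) * v ^ n"
    using bihom_divide[OF C] by blast
  have "bihom ?C m \<phi> u v = (u - ?C r * v) * ((u - ?C r * v) * w)"
    using bihom_synthetic_div[OF C m(2)[unfolded n], of u v r] w r r' unfolding n by (simp add: poly_synthetic_div_self)
  then have "(u - ?C r * v) ^ 2 dvd f" unfolding f(2) power2_eq_square by (simp add: mult.assoc[symmetric])
  then have "is_unit (u - ?C r * v)" using f(1) unfolding squarefree_def by blast
  then obtain s where s: "1 = (u - ?C r * v) * s" by (rule dvdE)
  have "poly (poly 1 0) 0 = poly (poly ((u - ?C r * v) * s) 0) 0" unfolding s[symmetric] ..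
  then show False using uv by (simp add: coeff2_def flip: poly_0_coeff_0)
qed

context roles
begin

lemma jacobian_tsum:
  fixes g :: "nat \<Rightarrow> 'k"
  shows "jacobian_ideal (tsum m g \<alpha> \<beta> \<gamma>) = Idl\<^bsub>class_ring\<^esub> (partials g m \<alpha> \<beta> \<gamma>)"
  using xy
proof
  assume v: "x = X3 \<and> y = Y3"
  show ?thesis unfolding jacobian_ideal_def partials_def tsum_def v[THEN conjunct1] v[THEN conjunct2] partial_derivatives ..
next
  assume v: "x = Y3 \<and> y = X3"
  have "C3 c * x ^ i * y ^ j * z ^ l = C3 c * X3 ^ j * Y3 ^ i * Z3 ^ l" for c :: 'k and i j l
    using v by (simp only: ac_simps)
  then show ?thesis unfolding jacobian_ideal_def partials_def tsum_def by (simp only: partial_derivatives insert_commute)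
qed

text \<open>The degree d is attained at the end point (\<epsilon>, \<delta> + q m) of the support,
  so that \<epsilon> a + (d - \<epsilon>) b = 1. For \<epsilon> = 0 this is b = 1/d. For \<epsilon>
  = 1 it makes 1/d a proper weighted mean of b < a, hence different from both.\<close>

theorem jacobian_ideal_cases:
  fixes f :: "'k poly poly" and a b :: rat and d :: nat and cf :: "nat \<Rightarrow> nat \<Rightarrow> 'k"
  assumes f: "squarefree f" "\<not> (\<exists>n. homogeneous2 n f)" and d: "total_degree f = d" "d \<ge> 3"
    and cf: "xb = X2 \<and> yb = Y2 \<and> cf = coeff2 f \<or> xb = Y2 \<and> yb = X2 \<and> cf = (\<lambda>i j. coeff2 f j i)"
    and w: "\<forall>i j. cf i j \<noteq> 0 \<longrightarrow> of_nat i * a + of_nat j * b = 1" and ab: "0 < b" "b < a"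
  defines "J \<equiv> jacobian_ideal (homogenization d f)"
  shows "(a \<noteq> 1 / of_nat d \<and> b \<noteq> 1 / of_nat d \<longrightarrow>
      perfect_ideal J \<and> linear_type J \<and>
      min_graded_free_resolution J [[int d - 1, int d - 1, int d - 1], [2 * int d - 3, int d]])
    \<and> (a = 1 / of_nat d \<or> b = 1 / of_nat d \<longrightarrow>
      linear_type J \<and> \<not> perfect_ideal J \<and>
      min_graded_free_resolution J [[int d - 1, int d - 1, int d - 1], [int d, 2 * (int d - 1), 2 * (int d - 1)], [2 * int d - 1]])"
proof -
  interpret C: comm_ring_hom "C3 :: 'k \<Rightarrow> _" by (rule C3_hom)
  define A where "A = {(i, j). cf i j \<noteq> 0}"
  have xy_cf: "x = X3 \<and> y = Y3 \<and> cf = coeff2 f \<or> x = Y3 \<and> y = X3 \<and> cf = (\<lambda>i j. coeff2 f j i)"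
    using cf by (auto simp: x_def y_def X2_def Y2_def X3_def Y3_def)
  have nsq: "\<not> xb ^ 2 dvd f" "\<not> yb ^ 2 dvd f"
    using f(1) prime_xb prime_yb unfolding squarefree_def by (blast dest: prime_elem_not_unit)+
  have "\<not> (\<forall>i j. cf i j \<noteq> 0 \<longrightarrow> 2 \<le> i)" "\<not> (\<forall>i j. cf i j \<noteq> 0 \<longrightarrow> 2 \<le> j)"
    using nsq var_square_dvd[of f] cf by metis+
  then have small: "\<exists>i j. (i, j) \<in> A \<and> i \<le> 1" "\<exists>i j. (i, j) \<in> A \<and> j \<le> 1" unfolding A_def by force+
  have nonhom: "\<not> (\<exists>n. \<forall>(i, j)\<in>A. i + j = n)"
  proof
    assume "\<exists>n. \<forall>(i, j)\<in>A. i + j = n"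
    then obtain n where "\<forall>(i, j)\<in>A. i + j = n" by blast
    moreover have "(i, j) \<in> A \<or> (j, i) \<in> A" if "coeff2 f i j \<noteq> 0" for i j using that cf unfolding A_def by auto
    ultimately have "i + j = n" if "coeff2 f i j \<noteq> 0" for i j using that by fastforce
    then have "homogeneous2 (int n) f" unfolding homogeneous2_def by blast
    then show False using f(2) by blast
  qed
  have wA: "of_nat i * a + of_nat j * b = 1" if "(i, j) \<in> A" for i j using w that unfolding A_def by simp
  obtain \<epsilon> \<delta> p q m where n: "\<epsilon> \<le> 1" "\<delta> \<le> 1" "0 < p" "p < q" "0 < m" "(\<epsilon>, \<delta> + q * m) \<in> A" "(\<epsilon> + p * m, \<delta>) \<in> A"
    "\<forall>(i, j)\<in>A. \<exists>k\<le>m. i = \<epsilon> + p * k \<and> j = \<delta> + q * (m - k)"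
    by (rule weighted_line[OF wA ab small nonhom])
  define e where "e = q - p"
  have e: "e > 0" "q = p + e" using n(4) by (simp_all add: e_def)
  define \<alpha> \<beta> \<gamma> where "\<alpha> k = \<epsilon> + p * k" and "\<beta> k = \<delta> + q * (m - k)" and "\<gamma> k = e * k" for k
  define \<phi> where "\<phi> = (\<Sum>k\<le>m. Polynomial.monom (cf (\<alpha> k) (\<beta> k)) k)"
  have coeff: "coeff \<phi> k = (if k \<le> m then cf (\<alpha> k) (\<beta> k) else 0)" for k
    unfolding \<phi>_def by (simp add: coeff_sum)
  have supp: "\<exists>k\<le>m. i = \<alpha> k \<and> j = \<beta> k" if "cf i j \<noteq> 0" for i j using n(8) that unfolding A_def \<alpha>_def \<beta>_def by blast
  have supp': "\<exists>k\<le>m. i = \<beta> k \<and> j = \<alpha> k" if "cf j i \<noteq> 0" for i j using supp[OF that] by blast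
  have inj: "inj_on (\<lambda>k. (\<alpha> k, \<beta> k)) {..m}" "inj_on (\<lambda>k. (\<beta> k, \<alpha> k)) {..m}"
    unfolding inj_on_def \<alpha>_def using n(3) by simp_all
  have deg: "\<alpha> k + \<beta> k + \<gamma> k = \<epsilon> + \<delta> + q * m" if "k \<le> m" for k
  proof -
    have "q * (m - k) + q * k = q * m" using that by (simp flip: distrib_left)
    then show ?thesis unfolding \<alpha>_def \<beta>_def \<gamma>_def using e(2) by (simp add: algebra_simps)
  qed
  have deg_f: "d = \<epsilon> + \<delta> + q * m"
    unfolding d(1)[symmetric] total_degree_def
  proof (rule Max_eqI)
    have eq: "{i + j | i j. coeff2 f i j \<noteq> 0} = (\<lambda>(i, j). i + j) ` A"
      using cf unfolding A_def by (force simp: image_def add.commute)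
    have "A \<subseteq> (\<lambda>k. (\<alpha> k, \<beta> k)) ` {..m}" using supp unfolding A_def by force
    then have "finite A" by (rule finite_subset) simp
    then show "finite (insert 0 {i + j | i j. coeff2 f i j \<noteq> 0})" unfolding eq by simp
    have "\<epsilon> + (\<delta> + q * m) \<in> (\<lambda>(i, j). i + j) ` A" using n(6) by force
    then show "\<epsilon> + \<delta> + q * m \<in> insert 0 {i + j | i j. coeff2 f i j \<noteq> 0}" unfolding eq by (simp add: add.assoc)
    fix t assume "t \<in> insert 0 {i + j | i j. coeff2 f i j \<noteq> 0}"
    then have "t = 0 \<or> (\<exists>i j. cf i j \<noteq> 0 \<and> t = i + j)" unfolding eq A_def by auto
    then show "t \<le> \<epsilon> + \<delta> + q * m"
    proof
      assume "\<exists>i j. cf i j \<noteq> 0 \<and> t = i + j"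
      then obtain k where "k \<le> m" "t = \<alpha> k + \<beta> k" using supp by blast
      then show ?thesis using deg[of k] by linarith
    qed simp
  qed
  have gam: "d - \<alpha> k - \<beta> k = \<gamma> k" if "k \<le> m" for k using deg[OF that] deg_f by linarith
  have "homogenization d f = (\<Sum>k\<le>m. C3 (cf (\<alpha> k) (\<beta> k)) * x ^ \<alpha> k * y ^ \<beta> k * z ^ (d - \<alpha> k - \<beta> k))"
    using xy_cf
  proof
    assume c: "x = X3 \<and> y = Y3 \<and> cf = coeff2 f"
    show ?thesis unfolding homogenization_def
      by (subst support_sum[OF inj(1)]) (use supp c in \<open>simp_all add: C3_def\<close>)
  next
    assume c: "x = Y3 \<and> y = X3 \<and> cf = (\<lambda>i j. coeff2 f j i)"
    show ?thesis unfolding homogenization_def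
      by (subst support_sum[OF inj(2)]) (use supp' c in \<open>simp_all add: C3_def add.commute mult.commute mult.left_commute\<close>)
  qed
  also have "\<dots> = tsum m (coeff \<phi>) \<alpha> \<beta> \<gamma>" unfolding tsum_def by (intro sum.cong refl) (simp only: coeff gam atMost_iff if_True)
  finally have J: "J = Idl\<^bsub>class_ring\<^esub> (partials (coeff \<phi>) m \<alpha> \<beta> \<gamma>)" unfolding J_def by (simp only: jacobian_tsum)
  have f_sum: "f = (\<Sum>k\<le>m. [:[:cf (\<alpha> k) (\<beta> k):]:] * xb ^ \<alpha> k * yb ^ \<beta> k)"
    using cf
  proof
    assume c: "xb = X2 \<and> yb = Y2 \<and> cf = coeff2 f"
    have "(\<Sum>j\<le>degree f. \<Sum>i\<le>degree (coeff f j). [:[:coeff2 f i j:]:] * X2 ^ i * Y2 ^ j)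
      = (\<Sum>k\<le>m. [:[:cf (\<alpha> k) (\<beta> k):]:] * xb ^ \<alpha> k * yb ^ \<beta> k)"
      by (subst support_sum[OF inj(1)]) (use supp c in simp_all)
    then show ?thesis using poly2_eq_sum by (rule trans[rotated])
  next
    assume c: "xb = Y2 \<and> yb = X2 \<and> cf = (\<lambda>i j. coeff2 f j i)"
    have "(\<Sum>j\<le>degree f. \<Sum>i\<le>degree (coeff f j). [:[:coeff2 f i j:]:] * X2 ^ i * Y2 ^ j)
      = (\<Sum>k\<le>m. [:[:cf (\<alpha> k) (\<beta> k):]:] * xb ^ \<alpha> k * yb ^ \<beta> k)"
      by (subst support_sum[OF inj(2)]) (use supp' c in \<open>simp_all add: mult.commute mult.left_commute\<close>)
    then show ?thesis using poly2_eq_sum by (rule trans[rotated])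
  qed
  have f_bihom: "f = xb ^ \<epsilon> * yb ^ \<delta> * bihom (\<lambda>c. [:[:c:]:]) m \<phi> (xb ^ p) (yb ^ q)"
    unfolding bihom_def sum_distrib_left
    by (subst f_sum) (intro sum.cong refl, simp only: coeff \<alpha>_def \<beta>_def power_add power_mult_distrib ac_simps if_True atMost_iff flip: power_mult)
  have dphi: "degree \<phi> \<le> m" by (rule degree_le) (simp add: coeff)
  have c0: "poly \<phi> 0 \<noteq> 0" and cm: "coeff \<phi> m \<noteq> 0"
    using n(6,7) by (simp_all add: coeff poly_0_coeff_0 A_def \<alpha>_def \<beta>_def)
  have xb0: "coeff2 (v ^ n) 0 0 = 0" if "v \<in> {xb, yb}" "n > 0" for v n
    using that roles by (cases n) (auto simp: coeff2_def X2_def Y2_def)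
  have simple: "\<forall>r. poly \<phi> r = 0 \<longrightarrow> poly (pderiv \<phi>) r \<noteq> 0"
  proof (intro allI impI)
    fix r assume r: "poly \<phi> r = 0"
    show "poly (pderiv \<phi>) r \<noteq> 0"
      by (rule squarefree_bihom_simple_roots[OF f(1) f_bihom n(5) dphi _ _ r]) (use n in \<open>simp_all add: xb0\<close>)
  qed
  have wd: "rat_of_nat \<epsilon> * a + rat_of_nat (\<delta> + q * m) * b = 1" by (rule wA[OF n(6)])
  consider "\<epsilon> = 0" | "\<epsilon> = 1" using n(1) by linarith
  then show ?thesis
  proof cases
    case 1
    have "rat_of_nat d * b = 1" using wd 1 deg_f by simp
    then have "b = 1 / of_nat d" using d(2) by (simp add: field_simps)
    moreover have "linear_type J \<and> \<not> perfect_ideal J \<and>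
      min_graded_free_resolution J [[int d - 1, int d - 1, int d - 1], [int d, 2 * (int d - 1), 2 * (int d - 1)], [2 * int d - 1]]"
      unfolding J \<alpha>_def \<beta>_def \<gamma>_def 1
      by (rule partials_imperfect[OF e(1) n(3) e(2) n(5,2) deg_f[unfolded 1] d(2) dphi c0 simple cm])
    ultimately show ?thesis by blast
  next
    case 2
    have "rat_of_nat d * b < 1"
      using wd ab unfolding 2 deg_f by (simp add: algebra_simps)
    moreover have "rat_of_nat d * a > 1"
    proof -
      have "0 < \<delta> + q * m" using n by simp
      then have "0 < rat_of_nat (\<delta> + q * m)" by (simp only: of_nat_0_less_iff)
      then have "rat_of_nat (\<delta> + q * m) * b < rat_of_nat (\<delta> + q * m) * a" using ab by (intro mult_strict_left_mono)
      then show ?thesis using wd unfolding 2 deg_f by (simp add: algebra_simps)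
    qed
    ultimately have "\<not> (a = 1 / of_nat d \<or> b = 1 / of_nat d)" using d(2) by auto
    moreover have "perfect_ideal J \<and> linear_type J \<and>
      min_graded_free_resolution J [[int d - 1, int d - 1, int d - 1], [2 * int d - 3, int d]]"
      unfolding J \<alpha>_def \<beta>_def \<gamma>_def 2
      by (rule partials_perfect[OF e(1) n(3) e(2) n(5,2) deg_f[unfolded 2] d(2) dphi c0 simple cm])
    ultimately show ?thesis by blast
  qed
qed

end

theorem theorem2p6:
  fixes f :: "'k::{alg_closed_field, field_char_0} poly poly"
    and a b :: rat and d :: nat
  assumes "squarefree f"
    and "\<not> (\<exists>n. homogeneous2 n f)"
    and "total_degree f = d"
    and "d \<ge> 3"
    and "a > 0" and "b > 0"
    and "weighted_homogeneous a b f"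
  shows "(a \<noteq> 1 / of_nat d \<and> b \<noteq> 1 / of_nat d \<longrightarrow>
           perfect_ideal (jacobian_ideal (homogenization d f)) \<and>
           linear_type (jacobian_ideal (homogenization d f)) \<and>
           min_graded_free_resolution (jacobian_ideal (homogenization d f))
             [[int d - 1, int d - 1, int d - 1],
              [2 * int d - 3, int d]])
       \<and> (a = 1 / of_nat d \<or> b = 1 / of_nat d \<longrightarrow>
           linear_type (jacobian_ideal (homogenization d f)) \<and>
           \<not> perfect_ideal (jacobian_ideal (homogenization d f)) \<and>
           min_graded_free_resolution (jacobian_ideal (homogenization d f))
             [[int d - 1, int d - 1, int d - 1],
              [int d, 2 * (int d - 1), 2 * (int d - 1)],
              [2 * int d - 1]])"
proof -
  have w: "\<forall>i j. coeff2 f i j \<noteq> 0 \<longrightarrow> of_nat i * a + of_nat j * b = 1"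
    using assms(7) unfolding weighted_homogeneous_iff_support .
  consider "a = b" | "b < a" | "a < b" by linarith
  then show ?thesis
  proof cases
    case 1
    \<comment> \<open>Equal weights force i + j = 1 / a on the support, which makes f homogeneous.
      The floor names this degree as an integer even when the support is empty.\<close>
    have "int (i + j) = \<lfloor>1 / a\<rfloor>" if "coeff2 f i j \<noteq> 0" for i j
    proof -
      have "rat_of_nat (i + j) = 1 / a" using w that assms(5) 1 by (simp add: field_simps)
      then show ?thesis by (metis floor_of_nat)
    qed
    then show ?thesis using assms(2) unfolding homogeneous2_def by blast
  next
    case 2
    interpret roles X2 "Y2 :: 'k poly poly" by unfold_locales simp
    show ?thesis by (rule jacobian_ideal_cases[OF assms(1-4) _ w assms(6) 2]) simp_all
  next
    case 3
    interpret roles Y2 "X2 :: 'k poly poly" by unfold_locales simp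
    define cf where "cf i j = coeff2 f j i" for i j
    have "(Y2 :: 'k poly poly) = X2 \<and> (X2 :: 'k poly poly) = Y2 \<and> cf = coeff2 f
        \<or> Y2 = (Y2 :: 'k poly poly) \<and> X2 = (X2 :: 'k poly poly) \<and> cf = (\<lambda>i j. coeff2 f j i)"
      by (simp add: cf_def fun_eq_iff)
    moreover have "\<forall>i j. cf i j \<noteq> 0 \<longrightarrow> of_nat i * b + of_nat j * a = 1"
      unfolding cf_def using w by (metis add.commute)
    ultimately show ?thesis using jacobian_ideal_cases[OF assms(1-4), of cf b a] assms(5) 3 by blast
  qed
qed

end
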